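(* Let $L\in(0,\infty]$, let $(X,\mu)$ be a nonatomic, $\sigma$-finite measure space with $\mu(X)=L$, and let $p,q\in(0,\infty)$. Let $v,w$ be weights on $(0,L)$ and let $u$ be an a.e. positive weight on $(0,L)$. Write $U(t)=\int_0^t u(s)\,ds$, $V(t)=\int_0^t v(s)\,ds$, $W(t)=\int_0^t w(s)\,ds$, and set $$C=\sup\left\{\|f\|_{\Lambda^q(w)}:\ f\in\mathfrak M_\mu(X),\ \|f\|_{\Gamma^p_u(v)}\le 1\right\}.$$ (i) If $1\le q$ and $p\le q<\infty$, then $C\approx A_1$, where $$A_1=\sup_{0<t<L}\frac{W^{\frac1q}(t)}{\left(V(t)+U^p(t)\int_t^L v(s)U^{-p}(s)\,ds\right)^{\frac1p}}.$$ (ii) If $1\le q<p<\infty$, then $C\approx A_2$, where $$\begin{aligned}A_2&=\left(\int_0^L\frac{V(t)\left(\int_t^Lv(s)U^{-p}(s)\,ds\right)U^{\frac{pq}{p-q}+p-1}(t)\,u(t)\,\sup_{\tau\in[t,L)}U^{-\frac{pq}{p-q}}(\tau)W^{\frac{p}{p-q}}(\tau)}{\left(V(t)+U^p(t)\int_t^Lv(s)U^{-p}(s)\,ds\right)^{\frac{q}{p-q}+2}}\,dt\right)^{\frac{p-q}{pq}}\\ &\quad+\left(\lim_{t\to0^+}\frac{U^{p}(t)}{V(t)+U^p(t)\int_t^Lv(s)U^{-p}(s)\,ds}\right)^{\frac1p}\left(\sup_{t\in(0,L)}\frac{W(t)}{U^q(t)}\right)^{\frac1q}\\ &\quad+\left(\lim_{t\to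 L^-}\frac1{V(t)+U^p(t)\int_t^Lv(s)U^{-p}(s)\,ds}\right)^{\frac1p}W^{\frac1q}(L).\end{aligned}$$ (iii) If $p\le q<1$, then $C\approx A_3$, where $$A_3=\sup_{0<t<L}\frac{W^{\frac1q}(t)+U(t)\left(\int_t^LW^{\frac{q}{1-q}}(s)w(s)U^{-\frac{q}{1-q}}(s)\,ds\right)^{\frac{1-q}{q}}}{\left(V(t)+U^p(t)\int_t^Lv(s)U^{-p}(s)\,ds\right)^{\frac1p}}.$$ (iv) If $q<1$ and $q<p<\infty$, then $C\approx A_4$, where $$\begin{aligned}A_4&=\left(\lim_{t\to0^+}\frac{U^p(t)}{V(t)+U^p(t)\int_t^Lv(s)U^{-p}(s)\,ds}\right)^{\frac1p}\left(\int_0^LW^{\frac{q}{1-q}}(t)w(t)U^{-\frac{q}{1-q}}(t)\,dt\right)^{\frac{1-q}{q}}\\ &\quad+\left(\lim_{t\to L^-}\frac1{V(t)+U^p(t)\int_t^Lv(s)U^{-p}(s)\,ds}\right)^{\frac1p}\left(\int_0^LW^{\frac{q}{1-q}}(t)w(t)\,dt\right)^{\frac{1-q}{q}}\\ &\quad+\left(\int_0^L\frac{\left(W^{\frac{1}{1-q}}(t)+U^{\frac{q}{1-q}}(t)\int_t^LW^{\frac{q}{1-q}}(s)w(s)U^{-\frac{q}{1-q}}(s)\,ds\right)^{\frac{p(1-q)}{p-q}}}{\left(V(t)+U^p(t)\int_t^Lv(s)U^{-p}(s)\,ds\right)^{\frac{q}{p-q}+2}}\,V(t)U^{p-1}(t)u(t)\int_t^Lv(s)U^{-p}(s)\,ds\,dt\right)^{\frac{p-q}{pq}}.\end{aligned}$$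 In all cases the equivalence constants depend only on $p$ and $q$; in particular, they are independent of the weights $u,v,w$.
   Context: Notation and conventions. - $\mathfrak M_\mu(X)$ is the set of all $\mu$-measurable extended real-valued functions on $X$. For $f\in\mathfrak M_\mu(X)$, the nonincreasing rearrangement is $f^*(t)=\inf\{\lambda\in[0,\infty):\mu(\{x\in X:|f(x)|>\lambda\})\le t\}$, $t\in(0,L)$. - A weight on $(0,L)$ is a Lebesgue-measurable function $v$ on $(0,L)$ with $v\ge0$ a.e. such that $0<\int_0^tv(s)\,ds<\infty$ for every $t\in(0,L)$. Values such as $W(L)=\int_0^Lw(s)\,ds$ may be infinite. - $\|f\|_{\Lambda^q(w)}=\left(\int_0^L(f^*(t))^qw(t)\,dt\right)^{1/q}$ and $\|f\|_{\Gamma^p_u(v)}=\left(\int_0^L\left(\frac1{U(t)}\int_0^tf^*(s)u(s)\,ds\right)^pv(t)\,dt\right)^{1/p}$. - The expressions $\frac1\infty$, $\frac\infty\infty$, $\frac00$ and $0\cdot\infty$ are all interpreted as $0$; $\frac10$ is interpreted as $\infty$. - For $A,B\in[0,\infty]$, $A\approx B$ means that $c^{-1}A\le B\le cA$ for some constant $c\in(0,\infty)$ (the "equivalence constants"), whose permitted dependence is stated in the claim. *)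

theory Defs
  imports "HOL-Analysis.Analysis"
begin

text \<open>
  All quantities live in \<^typ>\<open>ennreal\<close>, whose arithmetic already obeys the conventions
  \<open>1/\<infinity> = \<infinity>/\<infinity> = 0/0 = 0 * \<infinity> = 0\<close> and \<open>1/0 = \<infinity>\<close>.
  The library has no real powers on \<^typ>\<open>ennreal\<close>.
\<close>

definition epowr :: "ennreal \<Rightarrow> real \<Rightarrow> ennreal"  (infixr \<open>epowr\<close> 80) where
  "x epowr a =
     (if a = 0 then 1
      else if x = 0 then (if 0 < a then 0 else top)
      else if x = top then (if 0 < a then top else 0)
      else ennreal (enn2real x powr a))"

text \<open>The interval \<open>(a,L)\<close> for \<open>a \<ge> 0\<close>; \<open>L = \<infinity>\<close> is allowed.\<close>

definition ival :: "real \<Rightarrow> ennreal \<Rightarrow> real set" where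
  "ival a L = {s. a < s \<and> ennreal s < L}"

text \<open>The filter of \<open>t \<rightarrow> L-\<close>.\<close>

definition at_right_end :: "ennreal \<Rightarrow> real filter" where
  "at_right_end L = (if L = top then at_top else at_left (enn2real L))"


definition atom :: "'a measure \<Rightarrow> 'a set \<Rightarrow> bool" where
  "atom M A \<longleftrightarrow> A \<in> sets M \<and> 0 < emeasure M A \<and>
     (\<forall>B\<in>sets M. B \<subseteq> A \<longrightarrow> emeasure M B = 0 \<or> emeasure M B = emeasure M A)"

definition nonatomic :: "'a measure \<Rightarrow> bool" where
  "nonatomic M \<longleftrightarrow> (\<forall>A. \<not> atom M A)"

text \<open>The infimum of the empty set is \<open>\<infinity>\<close>.\<close>

definition rearrangement :: "'a measure \<Rightarrow> ('a \<Rightarrow> ereal) \<Rightarrow> real \<Rightarrow> ennreal" where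
  "rearrangement M f t =
     (INF y\<in>{y::real. 0 \<le> y \<and> emeasure M {x \<in> space M. ereal y < \<bar>f x\<bar>} \<le> ennreal t}. ennreal y)"


text \<open>
  \<open>cumul v t\<close> is \<open>\<integral>\<^sub>0\<^sup>t v\<close> for \<open>t \<in> [0,\<infinity>]\<close>. A weight is only almost everywhere nonnegative;
  \<^const>\<open>ennreal\<close> sends its negative values (on a null set) to \<open>0\<close>.
\<close>

definition cumul :: "(real \<Rightarrow> real) \<Rightarrow> ennreal \<Rightarrow> ennreal" where
  "cumul v t = (\<integral>\<^sup>+s\<in>ival 0 t. ennreal (v s) \<partial>lebesgue)"

definition weight :: "ennreal \<Rightarrow> (real \<Rightarrow> real) \<Rightarrow> bool" where
  "weight L v \<longleftrightarrow>
     v \<in> borel_measurable (lebesgue_on (ival 0 L)) \<and>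
     (AE s in lebesgue_on (ival 0 L). 0 \<le> v s) \<and>
     (\<forall>t\<in>ival 0 L. 0 < cumul v (ennreal t) \<and> cumul v (ennreal t) < top)"

definition Lambda_norm ::
    "'a measure \<Rightarrow> real \<Rightarrow> (real \<Rightarrow> real) \<Rightarrow> ('a \<Rightarrow> ereal) \<Rightarrow> ennreal" where
  "Lambda_norm M q w f =
     (\<integral>\<^sup>+t\<in>ival 0 (emeasure M (space M)). rearrangement M f t epowr q * ennreal (w t) \<partial>lebesgue)
       epowr (1 / q)"

definition Gamma_norm ::
    "'a measure \<Rightarrow> real \<Rightarrow> (real \<Rightarrow> real) \<Rightarrow> (real \<Rightarrow> real) \<Rightarrow> ('a \<Rightarrow> ereal) \<Rightarrow> ennreal" where
  "Gamma_norm M p u v f =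
     (\<integral>\<^sup>+t\<in>ival 0 (emeasure M (space M)).
        ((1 / cumul u (ennreal t)) *
          (\<integral>\<^sup>+s\<in>ival 0 (ennreal t). rearrangement M f s * ennreal (u s) \<partial>lebesgue)) epowr p
        * ennreal (v t) \<partial>lebesgue) epowr (1 / p)"

definition best_const ::
    "'a measure \<Rightarrow> real \<Rightarrow> real \<Rightarrow> (real \<Rightarrow> real) \<Rightarrow> (real \<Rightarrow> real) \<Rightarrow> (real \<Rightarrow> real) \<Rightarrow> ennreal" where
  "best_const M p q u v w =
     Sup {Lambda_norm M q w f | f. f \<in> borel_measurable M \<and> Gamma_norm M p u v f \<le> 1}"


text \<open>\<open>\<integral>\<^sub>t\<^sup>L v U\<^sup>-\<^sup>p\<close>\<close>

definition tail_int :: "real \<Rightarrow> ennreal \<Rightarrow> (real \<Rightarrow> real) \<Rightarrow> (real \<Rightarrow> real) \<Rightarrow> real \<Rightarrow> ennreal" where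
  "tail_int p L u v t =
     (\<integral>\<^sup>+s\<in>ival t L. ennreal (v s) * cumul u (ennreal s) epowr (- p) \<partial>lebesgue)"

text \<open>\<open>V(t) + U\<^sup>p(t) \<integral>\<^sub>t\<^sup>L v U\<^sup>-\<^sup>p\<close>\<close>

definition fund :: "real \<Rightarrow> ennreal \<Rightarrow> (real \<Rightarrow> real) \<Rightarrow> (real \<Rightarrow> real) \<Rightarrow> real \<Rightarrow> ennreal" where
  "fund p L u v t =
     cumul v (ennreal t) + cumul u (ennreal t) epowr p * tail_int p L u v t"

text \<open>\<open>\<integral>\<^sub>t\<^sup>L W\<^sup>r w U\<^sup>-\<^sup>r\<close> with \<open>r = q/(1-q)\<close>\<close>

definition tail_W :: "real \<Rightarrow> ennreal \<Rightarrow> (real \<Rightarrow> real) \<Rightarrow> (real \<Rightarrow> real) \<Rightarrow> real \<Rightarrow> ennreal" where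
  "tail_W q L u w t =
     (\<integral>\<^sup>+s\<in>ival t L. cumul w (ennreal s) epowr (q / (1 - q)) * ennreal (w s)
        * cumul u (ennreal s) epowr (- (q / (1 - q))) \<partial>lebesgue)"

definition A1 ::
    "real \<Rightarrow> real \<Rightarrow> ennreal \<Rightarrow> (real \<Rightarrow> real) \<Rightarrow> (real \<Rightarrow> real) \<Rightarrow> (real \<Rightarrow> real) \<Rightarrow> ennreal" where
  "A1 p q L u v w =
     (SUP t\<in>ival 0 L. cumul w (ennreal t) epowr (1 / q) / fund p L u v t epowr (1 / p))"

definition A2 ::
    "real \<Rightarrow> real \<Rightarrow> ennreal \<Rightarrow> (real \<Rightarrow> real) \<Rightarrow> (real \<Rightarrow> real) \<Rightarrow> (real \<Rightarrow> real) \<Rightarrow> ennreal" where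
  "A2 p q L u v w =
     (\<integral>\<^sup>+t\<in>ival 0 L.
        (cumul v (ennreal t) * tail_int p L u v t
          * cumul u (ennreal t) epowr (p * q / (p - q) + p - 1) * ennreal (u t)
          * (SUP \<tau>\<in>{\<tau>. t \<le> \<tau> \<and> ennreal \<tau> < L}.
               cumul u (ennreal \<tau>) epowr (- (p * q / (p - q))) * cumul w (ennreal \<tau>) epowr (p / (p - q))))
        / fund p L u v t epowr (q / (p - q) + 2) \<partial>lebesgue) epowr ((p - q) / (p * q))
     + Lim (at_right 0) (\<lambda>t. cumul u (ennreal t) epowr p / fund p L u v t) epowr (1 / p)
       * (SUP t\<in>ival 0 L. cumul w (ennreal t) / cumul u (ennreal t) epowr q) epowr (1 / q)
     + Lim (at_right_end L) (\<lambda>t. 1 / fund p L u v t) epowr (1 / p)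
       * cumul w L epowr (1 / q)"

definition A3 ::
    "real \<Rightarrow> real \<Rightarrow> ennreal \<Rightarrow> (real \<Rightarrow> real) \<Rightarrow> (real \<Rightarrow> real) \<Rightarrow> (real \<Rightarrow> real) \<Rightarrow> ennreal" where
  "A3 p q L u v w =
     (SUP t\<in>ival 0 L.
        (cumul w (ennreal t) epowr (1 / q)
          + cumul u (ennreal t) * tail_W q L u w t epowr ((1 - q) / q))
        / fund p L u v t epowr (1 / p))"

definition A4 ::
    "real \<Rightarrow> real \<Rightarrow> ennreal \<Rightarrow> (real \<Rightarrow> real) \<Rightarrow> (real \<Rightarrow> real) \<Rightarrow> (real \<Rightarrow> real) \<Rightarrow> ennreal" where
  "A4 p q L u v w =
     Lim (at_right 0) (\<lambda>t. cumul u (ennreal t) epowr p / fund p L u v t) epowr (1 / p)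
       * tail_W q L u w 0 epowr ((1 - q) / q)
     + Lim (at_right_end L) (\<lambda>t. 1 / fund p L u v t) epowr (1 / p)
       * (\<integral>\<^sup>+t\<in>ival 0 L. cumul w (ennreal t) epowr (q / (1 - q)) * ennreal (w t) \<partial>lebesgue)
           epowr ((1 - q) / q)
     + (\<integral>\<^sup>+t\<in>ival 0 L.
          (cumul w (ennreal t) epowr (1 / (1 - q))
             + cumul u (ennreal t) epowr (q / (1 - q)) * tail_W q L u w t)
            epowr (p * (1 - q) / (p - q))
          / fund p L u v t epowr (q / (p - q) + 2)
          * (cumul v (ennreal t) * cumul u (ennreal t) epowr (p - 1) * ennreal (u t)
             * tail_int p L u v t) \<partial>lebesgue) epowr ((p - q) / (p * q))"


definition approx_with :: "real \<Rightarrow> ennreal \<Rightarrow> ennreal \<Rightarrow> bool" where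
  "approx_with c A B \<longleftrightarrow> 0 < c \<and> ennreal (1 / c) * A \<le> B \<and> B \<le> ennreal c * A"

text \<open>
  \<open>c\<close> is an equivalence constant between \<^const>\<open>best_const\<close> and \<open>A\<close>, valid for all admissible
  spaces carried by the type \<^typ>\<open>'a\<close> and all admissible weights.
\<close>

definition equivalence_constant ::
    "'a itself \<Rightarrow> real \<Rightarrow> real \<Rightarrow>
     (real \<Rightarrow> real \<Rightarrow> ennreal \<Rightarrow> (real \<Rightarrow> real) \<Rightarrow> (real \<Rightarrow> real) \<Rightarrow> (real \<Rightarrow> real) \<Rightarrow> ennreal) \<Rightarrow>
     real \<Rightarrow> bool" where
  "equivalence_constant (_ :: 'a itself) p q A c \<longleftrightarrow> 0 < c \<and>
     (\<forall>(M :: 'a measure) L u v w.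
        0 < L \<and> sigma_finite_measure M \<and> nonatomic M \<and> emeasure M (space M) = L \<and>
        weight L u \<and> (AE s in lebesgue_on (ival 0 L). 0 < u s) \<and> weight L v \<and> weight L w
        \<longrightarrow> approx_with c (best_const M p q u v w) (A p q L u v w))"

text \<open>
  The equivalence constant may depend on \<open>p\<close> and \<open>q\<close> only, so not on the carrier type \<^typ>\<open>'a\<close>
  either. HOL cannot write \<open>\<exists>c. \<forall>'a. \<dots>\<close>; a plain \<open>\<exists>c\<close> in a statement mentioning \<^typ>\<open>'a\<close> would let
  \<open>c\<close> vary with \<^typ>\<open>'a\<close>. Hence: there is a constant for the spaces carried by \<^typ>\<open>real\<close> (a statement
  without \<^typ>\<open>'a\<close>), and every such constant also serves the spaces carried by \<^typ>\<open>'a\<close>. As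
  \<^typ>\<open>'a\<close> is arbitrary, one \<open>c\<close> then serves all types.
\<close>

definition uniformly_equivalent ::
    "'a itself \<Rightarrow> real \<Rightarrow> real \<Rightarrow>
     (real \<Rightarrow> real \<Rightarrow> ennreal \<Rightarrow> (real \<Rightarrow> real) \<Rightarrow> (real \<Rightarrow> real) \<Rightarrow> (real \<Rightarrow> real) \<Rightarrow> ennreal) \<Rightarrow> bool" where
  "uniformly_equivalent (T :: 'a itself) p q A \<longleftrightarrow>
     (\<exists>c. equivalence_constant TYPE(real) p q A c) \<and>
     (\<forall>c. equivalence_constant TYPE(real) p q A c \<longrightarrow> equivalence_constant T p q A c)"

end

theory Submission
  imports Defs "HOL-Probability.Distribution_Functions"
begin

text \<open>
  Only \<open>f\<^sup>*\<close> enters the two norms, and on a nonatomic space every nonincreasing function is the limit of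
  rearrangements. Hence \<open>C\<close> is the best constant in an inequality between nonincreasing functions on
  \<open>(0,L)\<close>, and the substitution \<open>x = U(t)\<close> reduces it to \<open>u = 1\<close>, with measures \<open>\<nu>\<close>, \<open>\<omega>\<close> on \<open>(0,\<infinity>)\<close> in place of
  \<open>v dt\<close>, \<open>w dt\<close>.

  Let \<open>\<sigma>(x) = V(x) + x\<^sup>p \<integral>\<^sub>x\<^sup>\<infinity> z\<^sup>-\<^sup>p d\<nu>\<close>, and let \<open>N(x)\<close> be the supremum of \<open>\<integral> \<psi>\<^sup>q d\<omega>\<close> over the nonincreasing \<open>\<psi>\<close> with
  \<open>\<integral>\<^sub>0\<^sup>z \<psi> \<le> min(z,x)\<close> for all \<open>z\<close>. Cut \<open>(0,\<infinity>)\<close> at points between which both \<open>\<sigma>\<close> and \<open>x\<^sup>p/\<sigma>\<close> grow by the factor 4.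
  Every nonincreasing function splits into pieces that are comparable to multiples of competitors for
  \<open>N(x\<^sub>k)\<close>; conversely such competitors can be added up, since the geometric growth makes them nearly
  orthogonal in the Gamma norm. So \<open>C\<^sup>q\<close> is comparable to the supremum of \<open>N \<sigma>\<^sup>-\<^sup>q\<^sup>/\<^sup>p\<close> if \<open>p \<le> q\<close>, and to its
  sequence norm with exponent \<open>p/(p-q)\<close> along the points if \<open>q < p\<close>; the latter is an integral against
  \<open>V(x) x\<^sup>p\<^sup>-\<^sup>1 (\<integral>\<^sub>x\<^sup>\<infinity> z\<^sup>-\<^sup>p d\<nu>) / \<sigma>\<^sup>2\<close> plus the two boundary limits.

  It remains to compute \<open>N\<close>. With \<open>W(x) = \<omega>(0,x)\<close> it is comparable to \<open>x\<^sup>q sup\<^sub>z\<^sub>\<ge>\<^sub>x W(z) z\<^sup>-\<^sup>q\<close> if \<open>q \<ge> 1\<close>, and to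
  \<open>W(x) + x\<^sup>q (\<integral>\<^sub>x\<^sup>\<infinity> (W(z)/z)\<^sup>r d\<omega>)\<^sup>1\<^sup>-\<^sup>q\<close> with \<open>r = q/(1-q)\<close> if \<open>q < 1\<close>.
\<close>

section \<open>Real powers of extended nonnegative reals\<close>

text \<open>Both \<sigma> and b = x^p/\<sigma> are nondecreasing, and T b + V/\<sigma> = 1, where T
  is the tail integral. One and the same density equals T b' and V (-1/\<sigma>)', up to a power of
  \<sigma>-free factors already contained in it; so the share T b of a point can be charged to an
  integral on its left and the share V/\<sigma> to one on its right. What cannot be charged at a
  first or last point becomes a limit at 0 or at L. Of \<nu> and \<omega> only distribution
  functions without atoms are used, never a density in x: derivatives of \<sigma> and b and
  comparisons of integrals go through increments, medians and level sets. Two situations are split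
  off: if \<sigma> is infinite everywhere, C = 0; otherwise, if W(L) is infinite and U(L) finite, C
  is infinite. In all others \<omega> is finite on bounded intervals. If U(L) is finite, the
  transported measures live on (0,U(L)), and each passage back to (0,L) must deal with points beyond
  U(L). C depends on the space through L alone, so (0,L) with Lebesgue measure represents every
  carrier type.\<close>

lemma epowr_ennreal: "0 < x \<Longrightarrow> ennreal x epowr a = ennreal (x powr a)"
  by (simp add: epowr_def)

lemma epowr_0_left [simp]: "0 < a \<Longrightarrow> 0 epowr a = 0"
  by (simp add: epowr_def)

lemma epowr_top_left [simp]: "0 < a \<Longrightarrow> top epowr a = top"
  by (simp add: epowr_def)

lemma epowr_0_right [simp]: "x epowr 0 = 1"
  by (simp add: epowr_def)

lemma epowr_1_left [simp]: "1 epowr a = 1"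
  by (simp add: epowr_def)

lemma ennreal_cases_pos:
  obtains "x = 0" | "x = top" | r where "0 < r" "x = ennreal r"
proof (cases x)
  case (real r)
  then show ?thesis using that by (cases "r = 0") auto
qed (use that in auto)

lemma epowr_1_right [simp]: "x epowr 1 = x"
  by (cases x rule: ennreal_cases_pos) (auto simp: epowr_ennreal)

lemma epowr_eq_0_iff: "0 < a \<Longrightarrow> x epowr a = 0 \<longleftrightarrow> x = 0"
  by (cases x rule: ennreal_cases_pos) (auto simp: epowr_ennreal)

lemma epowr_eq_top_iff: "0 < a \<Longrightarrow> x epowr a = top \<longleftrightarrow> x = top"
  by (cases x rule: ennreal_cases_pos) (auto simp: epowr_ennreal)

lemma epowr_mono: "0 \<le> a \<Longrightarrow> x \<le> y \<Longrightarrow> x epowr a \<le> y epowr a"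
  by (cases x rule: ennreal_cases_pos; cases y rule: ennreal_cases_pos; cases "a = 0")
    (auto simp: epowr_ennreal ennreal_le_iff powr_mono2 top_unique)

lemma epowr_mult:
  assumes "0 < a"
  shows "(x * y) epowr a = x epowr a * y epowr a"
  using assms
  by (cases x rule: ennreal_cases_pos; cases y rule: ennreal_cases_pos)
    (auto simp: epowr_ennreal powr_mult ennreal_mult_top ennreal_top_mult simp flip: ennreal_mult)

lemma epowr_epowr:
  assumes "0 < a" "0 < b"
  shows "(x epowr a) epowr b = x epowr (a * b)"
  using assms
  by (cases x rule: ennreal_cases_pos) (auto simp: epowr_ennreal powr_powr)

lemma epowr_add:
  assumes "0 < a" "0 < b"
  shows "x epowr (a + b) = x epowr a * x epowr b"
  using assms
  by (cases x rule: ennreal_cases_pos) (auto simp: epowr_ennreal powr_add simp flip: ennreal_mult)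

lemma epowr_minus: "x epowr (- a) = inverse (x epowr a)"
  by (cases x rule: ennreal_cases_pos; cases a "0 :: real" rule: linorder_cases)
    (auto simp: epowr_def inverse_ennreal powr_minus)

lemma epowr_inverse: "inverse x epowr a = inverse (x epowr a)"
  by (cases x rule: ennreal_cases_pos; cases a "0 :: real" rule: linorder_cases)
    (auto simp: epowr_def inverse_ennreal powr_minus inverse_powr)

lemma epowr_divide: "0 < a \<Longrightarrow> (x / y) epowr a = x epowr a / y epowr a"
  by (simp add: divide_ennreal_def epowr_mult epowr_inverse)

lemma epowr_inv: "0 < a \<Longrightarrow> (x epowr a) epowr (1 / a) = x" "0 < a \<Longrightarrow> (x epowr (1 / a)) epowr a = x"
  by (simp_all add: epowr_epowr)

lemma epowr_le_iff: "0 < a \<Longrightarrow> x epowr a \<le> y epowr a \<longleftrightarrow> x \<le> y"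
  by (metis epowr_inv(1) epowr_mono less_imp_le zero_less_divide_1_iff)

lemma epowr_le_swap: "0 < a \<Longrightarrow> x epowr a \<le> y \<longleftrightarrow> x \<le> y epowr (1 / a)"
  by (metis epowr_inv(2) epowr_le_iff)

lemma le_epowr_swap: "0 < a \<Longrightarrow> y \<le> x epowr a \<longleftrightarrow> y epowr (1 / a) \<le> x"
  by (metis epowr_inv(2) epowr_le_iff)

lemma epowr_SUP:
  assumes "0 < a"
  shows "(SUP i\<in>I. f i) epowr a = (SUP i\<in>I. f i epowr a)"
proof (rule antisym)
  have "(SUP i\<in>I. f i) \<le> (SUP i\<in>I. f i epowr a) epowr (1 / a)"
    by (intro SUP_least) (metis SUP_upper assms epowr_le_swap)
  then show "(SUP i\<in>I. f i) epowr a \<le> (SUP i\<in>I. f i epowr a)"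
    using assms epowr_le_swap by blast
  show "(SUP i\<in>I. f i epowr a) \<le> (SUP i\<in>I. f i) epowr a"
    by (intro SUP_least epowr_mono SUP_upper) (use assms in auto)
qed

lemma epowr_borel [measurable]: "(\<lambda>x. x epowr a) \<in> borel_measurable borel"
  unfolding epowr_def by measurable

text \<open>The larger of the two terms carries the estimate, so one constant serves exponents below
  1, where powers are subadditive, and above 1, where they are not.\<close>

lemma epowr_add_le:
  assumes "0 < a"
  shows "(x + y) epowr a \<le> ennreal (2 powr a) * (x epowr a + y epowr a)"
proof -
  have "x + y \<le> 2 * max x y"
    by (metis add_mono max.cobounded1 max.cobounded2 mult_2)
  then have "(x + y) epowr a \<le> (2 * max x y) epowr a"
    using assms by (intro epowr_mono) auto
  also have "\<dots> = ennreal (2 powr a) * (max x y) epowr a"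
    using assms epowr_ennreal[of 2 a] by (simp add: epowr_mult)
  also have "(max x y) epowr a \<le> x epowr a + y epowr a"
    by (auto simp: max_def)
  finally show ?thesis by (simp add: mult_left_mono)
qed

text \<open>Superlevel sets of a monotone function are intervals. Competitors, their integrals and
  the distribution functions get their measurability from here or from the increasing
  version.\<close>

lemma antimono_ennreal_borel:
  fixes f :: "real \<Rightarrow> ennreal"
  assumes "antimono f"
  shows "f \<in> borel_measurable borel"
proof (rule borel_measurableI_greater)
  fix y
  have "is_interval {x. y < f x}"
    unfolding is_interval_1 using assms by (auto simp: antimono_def intro: less_le_trans)
  then show "{x \<in> space borel. y < f x} \<in> sets borel"
    using real_interval_borel_measurable by simp
qed

lemma mono_ennreal_borel:
  fixes f :: "real \<Rightarrow> ennreal"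
  assumes "mono f"
  shows "f \<in> borel_measurable borel"
proof (rule borel_measurableI_greater)
  fix y
  have "is_interval {x. y < f x}"
    unfolding is_interval_1 using assms by (auto simp: mono_def intro: less_le_trans)
  then show "{x \<in> space borel. y < f x} \<in> sets borel"
    using real_interval_borel_measurable by simp
qed

text \<open>The larger of a and d = b^(1/(1-s)) already bounds the product, since b = d^(1-s) and
  the exponents s and 1-s add up to 1. In this form infinite values need no separate
  treatment.\<close>

lemma young_ennreal:
  assumes "0 < s" "s < 1"
  shows "a epowr s * b \<le> a + b epowr (1 / (1 - s))"
proof (cases "b epowr (1 / (1 - s)) \<le> a")
  case True
  then have "b \<le> a epowr (1 - s)"
    using assms by (simp add: epowr_le_swap)
  then have "a epowr s * b \<le> a epowr s * a epowr (1 - s)"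
    by (simp add: mult_left_mono)
  also have "\<dots> = a"
    using assms epowr_add[of s "1 - s" a] by simp
  finally show ?thesis by (simp add: add_increasing2)
next
  case False
  define d where "d = b epowr (1 / (1 - s))"
  have b: "b = d epowr (1 - s)" using assms epowr_inv(2)[of "1 - s" b] by (simp add: d_def)
  have "a epowr s * b \<le> d epowr s * d epowr (1 - s)"
    unfolding b using False assms by (intro mult_mono epowr_mono) (auto simp: d_def)
  also have "\<dots> = d"
    using assms epowr_add[of s "1 - s" d] by simp
  finally show ?thesis by (simp add: d_def add_increasing)
qed

lemma ennreal_mult_divide_cancel: "0 < (c::ennreal) \<Longrightarrow> c < top \<Longrightarrow> c * (x / c) = x"
  by (metis ennreal_mult_divide_eq ennreal_times_divide less_irrefl mult.commute)

text \<open>Young's inequality after both integrals are normalized to 1; each of the two summands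
  then contributes 1, whence the factor 2.\<close>

lemma holder_nn_integral:
  assumes [measurable]: "f \<in> borel_measurable M" "g \<in> borel_measurable M"
    and s: "0 < s" "s < 1"
  shows "(\<integral>\<^sup>+x. f x epowr s * g x \<partial>M)
    \<le> 2 * ((\<integral>\<^sup>+x. f x \<partial>M) epowr s * (\<integral>\<^sup>+x. g x epowr (1 / (1 - s)) \<partial>M) epowr (1 - s))"
    (is "_ \<le> 2 * (?A epowr s * ?B epowr (1 - s))")
proof -
  \<comment> \<open>By \<open>0 * top = 0\<close> the right side vanishes even if the other integral
    is infinite, so the left side has to be shown to be 0 whenever one of the two integrals
    is.\<close>
  have zero: "(\<integral>\<^sup>+x. f x epowr s * g x \<partial>M) = 0" if "?A = 0 \<or> ?B = 0"
  proof -
    have "AE x in M. f x epowr s * g x = 0"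
      using that
    proof
      assume "?A = 0"
      then have "AE x in M. f x = 0" by (simp add: nn_integral_0_iff_AE)
      then show ?thesis by eventually_elim (use s in simp)
    next
      assume "?B = 0"
      then have "AE x in M. g x epowr (1 / (1 - s)) = 0" by (simp add: nn_integral_0_iff_AE)
      then show ?thesis by eventually_elim (use s in \<open>simp add: epowr_eq_0_iff\<close>)
    qed
    then show ?thesis by (simp add: nn_integral_0_iff_AE)
  qed
  show ?thesis
  proof (cases "?A = 0 \<or> ?B = 0 \<or> ?A = top \<or> ?B = top")
    case True
    then show ?thesis
      using zero s by (auto simp: ennreal_mult_top ennreal_top_mult epowr_eq_0_iff)
  next
    case False
    then have A: "0 < ?A" "?A < top" and B: "0 < ?B" "?B < top"
      by (auto simp: less_top zero_less_iff_neq_zero)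
    have Bs: "0 < ?B epowr (1 - s)" "?B epowr (1 - s) < top"
      using B s epowr_eq_0_iff[of "1 - s" ?B] epowr_eq_top_iff[of "1 - s" ?B]
      by (metis diff_gt_0_iff_gt zero_less_iff_neq_zero less_irrefl, metis diff_gt_0_iff_gt less_top)
    define a where "a = ?A epowr s * ?B epowr (1 - s)"
    have "(\<integral>\<^sup>+x. f x epowr s * g x \<partial>M) \<le>
        (\<integral>\<^sup>+x. a * (f x / ?A + g x epowr (1 / (1 - s)) / ?B) \<partial>M)"
    proof (intro nn_integral_mono)
      fix x
      have "f x epowr s * g x = (?A epowr s * (f x / ?A) epowr s) * (?B epowr (1 - s) * (g x / ?B epowr (1 - s)))"
      proof -
        have "f x epowr s = (?A * (f x / ?A)) epowr s"
          by (simp only: ennreal_mult_divide_cancel[OF A])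
        then have "f x epowr s = ?A epowr s * (f x / ?A) epowr s"
          by (simp only: epowr_mult[OF s(1)])
        moreover have "?B epowr (1 - s) * (g x / ?B epowr (1 - s)) = g x"
          by (rule ennreal_mult_divide_cancel[OF Bs])
        ultimately show ?thesis by (simp only:)
      qed
      also have "\<dots> = a * ((f x / ?A) epowr s * (g x / ?B epowr (1 - s)))"
        unfolding a_def by (simp only: mult_ac)
      also have "\<dots> \<le> a * (f x / ?A + (g x / ?B epowr (1 - s)) epowr (1 / (1 - s)))"
        by (intro mult_left_mono young_ennreal s) auto
      also have "(g x / ?B epowr (1 - s)) epowr (1 / (1 - s)) = g x epowr (1 / (1 - s)) / ?B"
        using s by (simp add: epowr_divide epowr_epowr)
      finally show "f x epowr s * g x \<le> a * (f x / ?A + g x epowr (1 / (1 - s)) / ?B)" .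
    qed
    also have "\<dots> = a * (?A / ?A + ?B / ?B)"
      by (simp add: nn_integral_cmult nn_integral_add nn_integral_divide)
    also have "\<dots> = 2 * a"
      using A B by (simp add: ennreal_divide_self mult.commute)
    finally show ?thesis by (simp add: a_def)
  qed
qed

section \<open>Measures on the line\<close>

text \<open>The length of the set of levels below x; in this form the layer cake formula also covers
  infinite values.\<close>

lemma ennreal_eq_level_length: "(x::ennreal) = (\<integral>\<^sup>+l. indicator {l. 0 < l \<and> ennreal l < x} l \<partial>lborel)"
proof (cases x)
  case (real r)
  have "{l. 0 < l \<and> ennreal l < x} = {0<..<r}"
    using real by (auto simp: ennreal_less_iff)
  then show ?thesis using real by simp
next
  case top
  have "{l. 0 < l \<and> ennreal l < x} = {0<..}"
    using top by auto
  moreover have "emeasure lborel {0::real<..} = top"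
  proof -
    have "ennreal (real n) \<le> emeasure lborel {0::real<..}" for n
    proof -
      have "emeasure lborel {0::real<..<real n} \<le> emeasure lborel {0::real<..}"
        by (intro emeasure_mono) auto
      then show ?thesis by simp
    qed
    then show ?thesis
      by (metis ennreal_of_nat_eq_real_of_nat ennreal_Ex_less_of_nat less_le_not_le top.not_eq_extremum)
  qed
  ultimately show ?thesis using top by simp
qed

lemma nn_integral_layer_cake:
  fixes f :: "real \<Rightarrow> ennreal"
  assumes "sigma_finite_measure m" and sets [measurable_cong]: "sets m = sets borel"
    and [measurable]: "f \<in> borel_measurable borel"
  shows "(\<integral>\<^sup>+z. f z \<partial>m) = (\<integral>\<^sup>+l. indicator {0<..} l * emeasure m {z. ennreal l < f z} \<partial>lborel)"
proof -
  interpret m: sigma_finite_measure m by fact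
  interpret P: pair_sigma_finite lborel m ..
  have sp: "space m = UNIV" using sets_eq_imp_space_eq[OF sets] by simp
  have [measurable]: "{x. ennreal l < f x} \<in> sets borel" for l
    by measurable
  have "(\<integral>\<^sup>+z. f z \<partial>m) = (\<integral>\<^sup>+z. (\<integral>\<^sup>+l. indicator {l. 0 < l \<and> ennreal l < f z} l \<partial>lborel) \<partial>m)"
    using ennreal_eq_level_length by simp
  also have "\<dots> = (\<integral>\<^sup>+z. (\<integral>\<^sup>+l. indicator {0<..} l * indicator {w. ennreal l < f w} z \<partial>lborel) \<partial>m)"
    by (intro nn_integral_cong) (auto simp: indicator_def)
  also have "\<dots> = (\<integral>\<^sup>+l. (\<integral>\<^sup>+z. indicator {0<..} l * indicator {w. ennreal l < f w} z \<partial>m) \<partial>lborel)"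
    by (rule P.Fubini') measurable
  also have "\<dots> = (\<integral>\<^sup>+l. indicator {0<..} l * emeasure m {z. ennreal l < f z} \<partial>lborel)"
    by (intro nn_integral_cong) (simp add: nn_integral_cmult)
  finally show ?thesis .
qed

lemma emeasure_UNIV_SUP_lessThan:
  assumes "sets m = sets (borel :: real measure)"
  shows "emeasure m UNIV = (SUP n. emeasure m {..<real n})"
proof -
  have "(SUP n. emeasure m {..<real n}) = emeasure m (\<Union>n. {..<real n})"
    by (rule SUP_emeasure_incseq) (auto simp: assms incseq_def)
  also have "(\<Union>n. {..<real n}) = UNIV"
    using reals_Archimedean2 by blast
  finally show ?thesis by simp
qed

text \<open>Through the layer cake formula the claim is about superlevel sets. For a nonincreasing
  integrand these are half-lines unbounded to the left, so an inequality between distribution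
  functions suffices. Such a half-line may be closed; its endpoint has no mass for
  \<open>m1\<close>.\<close>

lemma nn_integral_antimono_dominated:
  fixes f :: "real \<Rightarrow> ennreal"
  assumes "sigma_finite_measure m1" "sigma_finite_measure m2"
    and sets: "sets m1 = sets borel" "sets m2 = sets borel"
    and le: "\<And>t. emeasure m1 {..<t} \<le> emeasure m2 {..<t}"
    and atom: "\<And>t. emeasure m1 {t} = 0"
    and f: "antimono f"
  shows "(\<integral>\<^sup>+z. f z \<partial>m1) \<le> (\<integral>\<^sup>+z. f z \<partial>m2)"
proof -
  have down: "emeasure m1 S \<le> emeasure m2 S"
    if S: "\<And>x y. y \<in> S \<Longrightarrow> x \<le> y \<Longrightarrow> x \<in> S" "S \<in> sets borel" for S
  proof (cases "S = {} \<or> \<not> bdd_above S")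
    case True
    then show ?thesis
    proof
      assume "\<not> bdd_above S"
      then have "S = UNIV"
        using S(1) by (metis UNIV_eq_I bdd_above.I linorder_linear)
      then show ?thesis
        using le by (auto simp: emeasure_UNIV_SUP_lessThan sets intro!: SUP_mono)
    qed simp
  next
    case False
    define t where "t = Sup S"
    have sub: "S \<subseteq> {..t}"
      using False by (auto simp: t_def intro: cSup_upper)
    have sub2: "{..<t} \<subseteq> S"
    proof
      fix x assume "x \<in> {..<t}"
      then obtain y where "y \<in> S" "x < y" using False by (auto simp: t_def less_cSup_iff)
      then show "x \<in> S" using S(1) by (meson less_imp_le)
    qed
    note sub = sub sub2
    have "emeasure m1 S \<le> emeasure m1 ({..<t} \<union> {t})"
      using sub by (intro emeasure_mono) (auto simp: sets)
    also have "\<dots> \<le> emeasure m1 {..<t} + emeasure m1 {t}"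
      by (intro emeasure_subadditive) (auto simp: sets)
    also have "\<dots> \<le> emeasure m2 {..<t}" using le atom by simp
    also have "\<dots> \<le> emeasure m2 S"
      using sub S by (intro emeasure_mono) (auto simp: sets)
    finally show ?thesis .
  qed
  have [measurable]: "f \<in> borel_measurable borel" by (rule antimono_ennreal_borel[OF f])
  have "emeasure m1 {z. ennreal l < f z} \<le> emeasure m2 {z. ennreal l < f z}" for l
    by (rule down) (use f in \<open>auto simp: antimono_def intro: less_le_trans\<close>)
  then show ?thesis
    by (subst (1 2) nn_integral_layer_cake) (auto intro!: nn_integral_mono mult_left_mono simp: assms)
qed

text \<open>Cutting \<open>m\<close> off at x + 1 makes it finite without changing its distribution
  function near x, and without atoms open and closed half-lines have equal measure.\<close>

lemma isCont_measure_lessThan: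
  fixes m :: "real measure"
  assumes sets: "sets m = sets borel" and fin: "\<And>x. emeasure m {..<x} \<noteq> top"
    and atom: "\<And>x. emeasure m {x} = 0"
  shows "isCont (\<lambda>x. measure m {..<x}) x"
proof -
  note sets [measurable_cong]
  define d where "d = density m (indicator {..<x+1})"
  have d: "emeasure d A = emeasure m (A \<inter> {..<x+1})" if "A \<in> sets borel" for A
  proof -
    have "emeasure d A = (\<integral>\<^sup>+y. indicator {..<x+1} y * indicator A y \<partial>m)"
      unfolding d_def using that by (subst emeasure_density) (auto simp: sets)
    also have "\<dots> = (\<integral>\<^sup>+y. indicator (A \<inter> {..<x+1}) y \<partial>m)"
      by (intro nn_integral_cong) (simp add: indicator_inter_arith mult.commute)
    finally show ?thesis using that by (simp add: sets)
  qed
  have "finite_measure d"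
    by standard (use fin sets_eq_imp_space_eq[OF sets] in \<open>auto simp: d space_density d_def emeasure_density sets\<close>)
  then interpret d: finite_borel_measure d
    by (simp add: finite_borel_measure_def finite_borel_measure_axioms_def d_def sets)
  have "emeasure m ({x} \<inter> {..<x+1}) \<le> emeasure m {x}"
    by (intro emeasure_mono) (auto simp: sets)
  then have "measure d {x} = 0" by (simp add: measure_def d atom)
  then have c: "isCont (cdf d) x" by (simp add: d.isCont_cdf)
  have "cdf d y = measure m {..<y}" if "y < x + 1" for y
  proof -
    have "emeasure m {..y} = emeasure m ({..<y} \<union> {y})"
      by (intro arg_cong[where f = "emeasure m"]) auto
    also have "\<dots> = emeasure m {..<y}"
      using emeasure_Un_null_set[of "{..<y}" m "{y}"] by (simp add: sets null_sets_def atom)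
    finally have "emeasure m {..y} = emeasure m {..<y}" .
    moreover have "{..y} \<inter> {..<x+1} = {..y}" using that by auto
    ultimately show ?thesis by (simp add: cdf_def measure_def d)
  qed
  then have "eventually (\<lambda>y. cdf d y = measure m {..<y}) (nhds x)"
    using eventually_nhds_in_open[of "{..<x+1}" x] by (auto elim: eventually_mono)
  then have "isCont (cdf d) x = isCont (\<lambda>y. measure m {..<y}) x" by (rule isCont_cong)
  then show ?thesis using c by simp
qed

text \<open>With F for the distribution function this is the formula F^(1+s) = (1+s) times the
  integral of F^s dF, up to a constant. A median argument replaces differentiation: the part of the
  half-line below z on which F is at least F(z)/2 carries half of the mass.\<close>

lemma cdf_powr_le:
  fixes m :: "real measure"
  assumes sets [measurable_cong]: "sets m = sets borel" and fin: "\<And>x. emeasure m {..<x} \<noteq> top"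
    and atom: "\<And>x. emeasure m {x} = 0" and zero: "emeasure m {..<a} = 0" and s: "0 < s"
  shows "emeasure m {..<z} epowr (1 + s)
    \<le> ennreal (2 powr (1 + s)) * (\<integral>\<^sup>+t\<in>{..<z}. emeasure m {..<t} epowr s \<partial>m)"
proof -
  define F where "F x = measure m {..<x}" for x
  have F: "emeasure m {..<x} = ennreal (F x)" for x
    by (simp add: F_def emeasure_eq_ennreal_measure fin)
  have F0: "0 \<le> F x" for x by (simp add: F_def)
  have mono: "F x \<le> F y" if "x \<le> y" for x y
  proof -
    have "emeasure m {..<x} \<le> emeasure m {..<y}" using that by (intro emeasure_mono) (auto simp: sets)
    then show ?thesis using F0 by (simp add: F)
  qed
  show ?thesis
  proof (cases "F z = 0")
    case True
    then show ?thesis using s by (simp add: F)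
  next
    case False
    then have Fz: "0 < F z" using F0[of z] by simp
    have Fa: "F a = 0" using zero F0[of a] by (simp add: F)
    have az: "a \<le> z" using mono[of z a] Fz Fa by force
    \<comment> \<open>The median. F vanishes at a, which gives the intermediate value theorem its
      left end.\<close>
    have "\<exists>x\<ge>a. x \<le> z \<and> F x = F z / 2"
    proof (rule IVT)
      have "isCont F t" for t
        unfolding F_def by (rule isCont_measure_lessThan) (use fin atom in \<open>auto simp: sets\<close>)
      then show "\<forall>x. a \<le> x \<and> x \<le> z \<longrightarrow> isCont F x" by blast
    qed (use az Fa Fz in auto)
    then obtain x where x: "a \<le> x" "x \<le> z" "F x = F z / 2" by blast
    have "ennreal (F z / 2) = ennreal (F z) - ennreal (F x)"
      using x F0[of x] by (simp add: ennreal_minus)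
    also have "\<dots> = emeasure m ({..<z} - {..<x})"
      unfolding F[symmetric] by (rule emeasure_Diff[symmetric]) (use fin x in \<open>auto simp: sets\<close>)
    also have "{..<z} - {..<x} = {x..<z}" by auto
    finally have e: "emeasure m {x..<z} = ennreal (F z / 2)" by simp
    have [measurable]: "(\<lambda>t. emeasure m {..<t} epowr s) \<in> borel_measurable borel"
      by (rule mono_ennreal_borel) (use s in \<open>auto simp: mono_def F intro!: epowr_mono mono ennreal_leI\<close>)
    have "ennreal (F z / 2) epowr (1 + s) = ennreal (F z / 2) epowr s * emeasure m {x..<z}"
      using s epowr_add[of s 1 "ennreal (F z / 2)"] by (simp add: e add.commute)
    also have "\<dots> = (\<integral>\<^sup>+t. ennreal (F z / 2) epowr s * indicator {x..<z} t \<partial>m)"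
      by (simp add: nn_integral_cmult)
    also have "\<dots> \<le> (\<integral>\<^sup>+t\<in>{..<z}. emeasure m {..<t} epowr s \<partial>m)"
    proof (intro nn_integral_mono)
      fix t
      show "ennreal (F z / 2) epowr s * indicator {x..<z} t \<le> emeasure m {..<t} epowr s * indicator {..<z} t"
        using s mono[of x t] x(3) by (auto simp: indicator_def F intro!: epowr_mono ennreal_leI)
    qed
    finally have *: "ennreal (F z / 2) epowr (1 + s) \<le> (\<integral>\<^sup>+t\<in>{..<z}. emeasure m {..<t} epowr s \<partial>m)" .
    have "emeasure m {..<z} epowr (1 + s) = ennreal (2 powr (1 + s)) * ennreal (F z / 2) epowr (1 + s)"
      using Fz s by (simp add: F epowr_ennreal powr_divide flip: ennreal_mult)
    then show ?thesis using * by (simp add: mult_left_mono)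
  qed
qed

section \<open>The fundamental function\<close>

text \<open>If the increments of f lie between those of c weighted with the values of g at the two
  ends, then df = g dc in the Stieltjes sense, and continuity of g turns this into f' = c' g. It
  serves to differentiate \<sigma>, whose increments involve \<nu>, with c(x) = x^p and g =
  T.\<close>

lemma has_real_derivative_sandwich:
  fixes f g c :: "real \<Rightarrow> real"
  assumes S: "open S" "x \<in> S"
    and lo: "\<And>y z. y \<in> S \<Longrightarrow> z \<in> S \<Longrightarrow> y < z \<Longrightarrow> (c z - c y) * g z \<le> f z - f y"
    and up: "\<And>y z. y \<in> S \<Longrightarrow> z \<in> S \<Longrightarrow> y < z \<Longrightarrow> f z - f y \<le> (c z - c y) * g y"
    and g: "isCont g x" and c: "(c has_real_derivative D) (at x)"
    and mono: "\<And>y z. y \<in> S \<Longrightarrow> z \<in> S \<Longrightarrow> y < z \<Longrightarrow> c y \<le> c z"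
  shows "(f has_real_derivative D * g x) (at x)"
proof -
  have ev: "eventually (\<lambda>y. y \<in> S) (at x)"
    using S by (simp add: eventually_at_topological) blast
  have gx: "(g \<longlongrightarrow> g x) (at x)" using g by (simp add: isCont_def)
  have cx: "((\<lambda>y. (c y - c x) / (y - x)) \<longlongrightarrow> D) (at x)"
    using c by (simp add: has_field_derivative_iff)
  have "((\<lambda>y. (f y - f x) / (y - x) - (c y - c x) / (y - x) * g x) \<longlongrightarrow> 0) (at x)"
  proof (rule Lim_null_comparison)
    show "\<forall>\<^sub>F y in at x. norm ((f y - f x) / (y - x) - (c y - c x) / (y - x) * g x)
        \<le> \<bar>(c y - c x) / (y - x)\<bar> * \<bar>g y - g x\<bar>"
      using ev eventually_neq_at_within[of x x UNIV]
    proof eventually_elim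
      case (elim y)
      have "\<bar>(f y - f x) - (c y - c x) * g x\<bar> \<le> \<bar>c y - c x\<bar> * \<bar>g y - g x\<bar>"
      proof (cases "x < y")
        case True
        have "(c y - c x) * g y \<le> f y - f x" "f y - f x \<le> (c y - c x) * g x" "c x \<le> c y"
          using lo[OF S(2) elim(1) True] up[OF S(2) elim(1) True] mono[OF S(2) elim(1) True] .
        then have "\<bar>(f y - f x) - (c y - c x) * g x\<bar> \<le> - ((c y - c x) * (g y - g x))"
          by (simp add: algebra_simps)
        also have "\<dots> \<le> \<bar>c y - c x\<bar> * \<bar>g y - g x\<bar>"
          by (metis abs_ge_minus_self abs_mult)
        finally show ?thesis .
      next
        case False
        then have "y < x" using elim by simp
        note * = lo[OF elim(1) S(2) this] up[OF elim(1) S(2) this]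
        then have "\<bar>(f y - f x) - (c y - c x) * g x\<bar> \<le> - ((c y - c x) * (g y - g x))"
          by (simp add: algebra_simps)
        also have "\<dots> \<le> \<bar>c y - c x\<bar> * \<bar>g y - g x\<bar>"
          by (metis abs_ge_minus_self abs_mult)
        finally show ?thesis .
      qed
      then have "\<bar>((f y - f x) - (c y - c x) * g x) / (y - x)\<bar> \<le> \<bar>c y - c x\<bar> * \<bar>g y - g x\<bar> / \<bar>y - x\<bar>"
        by (simp add: abs_divide divide_right_mono)
      moreover have "((f y - f x) - (c y - c x) * g x) / (y - x)
          = (f y - f x) / (y - x) - (c y - c x) / (y - x) * g x"
        by (subst diff_divide_distrib) (simp only: times_divide_eq_left)
      moreover have "\<bar>c y - c x\<bar> * \<bar>g y - g x\<bar> / \<bar>y - x\<bar> = \<bar>(c y - c x) / (y - x)\<bar> * \<bar>g y - g x\<bar>"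
        by (simp add: abs_divide)
      ultimately show ?case by (simp only: real_norm_def)
    qed
    have "((\<lambda>y. \<bar>(c y - c x) / (y - x)\<bar> * \<bar>g y - g x\<bar>) \<longlongrightarrow> \<bar>D\<bar> * \<bar>g x - g x\<bar>) (at x)"
      by (intro tendsto_intros gx cx)
    then show "((\<lambda>y. \<bar>(c y - c x) / (y - x)\<bar> * \<bar>g y - g x\<bar>) \<longlongrightarrow> 0) (at x)" by simp
  qed
  from tendsto_add[OF this tendsto_mult[OF cx tendsto_const[of "g x"]]]
  show ?thesis by (simp add: has_field_derivative_iff)
qed

text \<open>\<open>\<nu>\<close> and \<open>\<omega>\<close> are \<open>v dt\<close> and \<open>w dt\<close> carried to the variable \<open>x = U(t)\<close>; \<open>sg\<close> is \<open>\<sigma>\<close>.\<close>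

locale gamma_data =
  fixes p q :: real and \<nu> \<omega> :: "real measure"
  assumes p: "0 < p" and q: "0 < q"
    and sets_nu [measurable_cong]: "sets \<nu> = sets borel"
    and sets_om [measurable_cong]: "sets \<omega> = sets borel"
    and nu_nonpos: "emeasure \<nu> {..0} = 0" and om_nonpos: "emeasure \<omega> {..0} = 0"
    and nu_atom: "emeasure \<nu> {x} = 0" and om_atom: "emeasure \<omega> {x} = 0"
    and nu_pos: "0 < x \<Longrightarrow> 0 < emeasure \<nu> {..<x}" and om_pos: "0 < x \<Longrightarrow> 0 < emeasure \<omega> {..<x}"
    and nu_fin: "0 < x \<Longrightarrow> emeasure \<nu> {..<x} \<noteq> top"
    and tail_fin: "0 < x \<Longrightarrow> (\<integral>\<^sup>+z\<in>{x<..}. ennreal (z powr - p) \<partial>\<nu>) \<noteq> top"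
begin

definition V where "V x = measure \<nu> {..<x}"
definition T where "T x = enn2real (\<integral>\<^sup>+z\<in>{x<..}. ennreal (z powr - p) \<partial>\<nu>)"
definition sg where "sg x = V x + x powr p * T x"
definition bb where "bb x = x powr p / sg x"

lemma space_nu [simp]: "space \<nu> = UNIV" and space_om [simp]: "space \<omega> = UNIV"
  using sets_eq_imp_space_eq[OF sets_nu] sets_eq_imp_space_eq[OF sets_om] by simp_all

lemma AE_nu_pos: "AE x in \<nu>. 0 < x"
  using nu_nonpos by (intro AE_I[where N = "{..0}"]) (auto simp: sets_nu)

lemma AE_om_pos: "AE x in \<omega>. 0 < x"
  using om_nonpos by (intro AE_I[where N = "{..0}"]) (auto simp: sets_om)

lemma V: "0 < x \<Longrightarrow> emeasure \<nu> {..<x} = ennreal (V x)"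
  by (simp add: V_def emeasure_eq_ennreal_measure nu_fin)

lemma T: "0 < x \<Longrightarrow> (\<integral>\<^sup>+z\<in>{x<..}. ennreal (z powr - p) \<partial>\<nu>) = ennreal (T x)"
  using tail_fin[of x] by (simp add: T_def less_top)

lemma V_pos: "0 < x \<Longrightarrow> 0 < V x"
  using nu_pos[of x] V[of x] by simp

lemma T_nonneg: "0 \<le> T x" by (simp add: T_def)

lemma sg_pos: "0 < x \<Longrightarrow> 0 < sg x"
  unfolding sg_def using V_pos[of x] T_nonneg[of x] by (simp add: add_pos_nonneg)

lemma bb_pos: "0 < x \<Longrightarrow> 0 < bb x"
  using sg_pos[of x] by (simp add: bb_def)

lemma emeasure_nu_Ico: "0 < x \<Longrightarrow> x \<le> y \<Longrightarrow> emeasure \<nu> {x..<y} = ennreal (V y - V x)"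
proof -
  assume xy: "0 < x" "x \<le> y"
  have "emeasure \<nu> {x..<y} = emeasure \<nu> ({..<y} - {..<x})"
    by (intro arg_cong[where f = "emeasure \<nu>"]) auto
  also have "\<dots> = emeasure \<nu> {..<y} - emeasure \<nu> {..<x}"
    by (rule emeasure_Diff) (use xy nu_fin in \<open>auto simp: sets_nu\<close>)
  finally show ?thesis using xy V V_pos[of x] by (simp add: ennreal_minus)
qed

lemma AE_nu_neq: "AE z in \<nu>. z \<noteq> x"
  using nu_atom[of x] by (intro AE_I[where N = "{x}"]) (auto simp: sets_nu)

lemma V_mono: "0 < x \<Longrightarrow> x \<le> y \<Longrightarrow> V x \<le> V y"
proof -
  assume xy: "0 < x" "x \<le> y"
  have "emeasure \<nu> {..<x} \<le> emeasure \<nu> {..<y}"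
    using xy by (intro emeasure_mono) (auto simp: sets_nu)
  then show ?thesis using xy V_pos[of x] V_pos[of y] by (simp add: V)
qed

lemma T_diff:
  assumes "0 < x" "x \<le> y"
  shows "(\<integral>\<^sup>+z\<in>{x..<y}. ennreal (z powr - p) \<partial>\<nu>) = ennreal (T x - T y)" and "T y \<le> T x"
proof -
  have "ennreal (T x) = (\<integral>\<^sup>+z\<in>{x<..}. ennreal (z powr - p) \<partial>\<nu>)" using assms T by simp
  also have "\<dots> = (\<integral>\<^sup>+z. ennreal (z powr - p) * indicator {x..<y} z + ennreal (z powr - p) * indicator {y<..} z \<partial>\<nu>)"
    using AE_nu_neq[of x] AE_nu_neq[of y] assms
    by (intro nn_integral_cong_AE) (auto simp: indicator_def)
  also have "\<dots> = (\<integral>\<^sup>+z\<in>{x..<y}. ennreal (z powr - p) \<partial>\<nu>) + ennreal (T y)"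
    using assms by (subst nn_integral_add) (auto simp: T)
  finally have *: "ennreal (T x) = (\<integral>\<^sup>+z\<in>{x..<y}. ennreal (z powr - p) \<partial>\<nu>) + ennreal (T y)" .
  then have "ennreal (T y) \<le> ennreal (T x)" by simp
  then show "T y \<le> T x" by (simp add: T_nonneg)
  show "(\<integral>\<^sup>+z\<in>{x..<y}. ennreal (z powr - p) \<partial>\<nu>) = ennreal (T x - T y)"
    using * by (simp add: ennreal_minus[symmetric] T_nonneg)
qed

text \<open>The increment of V over [x,y) is the integral of z^p against the measure z^(-p) d\<nu>,
  whose mass there is T x - T y, and z^p stays between x^p and y^p.\<close>

lemma VT_diff:
  assumes "0 < x" "x \<le> y"
  shows "x powr p * (T x - T y) \<le> V y - V x" and "V y - V x \<le> y powr p * (T x - T y)"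
proof -
  have d: "0 \<le> T x - T y" "0 \<le> V y - V x" using T_diff[OF assms] V_mono[OF assms] by auto
  have "ennreal (x powr p * (T x - T y)) = (\<integral>\<^sup>+z. ennreal (x powr p) * (ennreal (z powr - p) * indicator {x..<y} z) \<partial>\<nu>)"
    using assms d by (simp add: nn_integral_cmult T_diff ennreal_mult)
  also have "\<dots> \<le> (\<integral>\<^sup>+z. indicator {x..<y} z \<partial>\<nu>)"
  proof (intro nn_integral_mono)
    fix z
    have "x powr p * z powr - p \<le> 1" if "x \<le> z"
      using assms that p by (simp add: powr_minus field_simps powr_mono2)
    then show "ennreal (x powr p) * (ennreal (z powr - p) * indicator {x..<y} z) \<le> indicator {x..<y} z"
      by (auto simp: indicator_def simp flip: ennreal_mult)
  qed
  also have "\<dots> = ennreal (V y - V x)" using assms by (simp add: emeasure_nu_Ico)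
  finally show "x powr p * (T x - T y) \<le> V y - V x" using d by simp
  have "ennreal (V y - V x) = (\<integral>\<^sup>+z. indicator {x..<y} z \<partial>\<nu>)" using assms by (simp add: emeasure_nu_Ico)
  also have "\<dots> \<le> (\<integral>\<^sup>+z. ennreal (y powr p) * (ennreal (z powr - p) * indicator {x..<y} z) \<partial>\<nu>)"
  proof (intro nn_integral_mono)
    fix z
    have "1 \<le> y powr p * z powr - p" if "x \<le> z" "z < y"
      using assms that p by (simp add: powr_minus field_simps powr_mono2)
    then show "indicator {x..<y} z \<le> ennreal (y powr p) * (ennreal (z powr - p) * indicator {x..<y} z)"
      by (auto simp: indicator_def simp flip: ennreal_mult)
  qed
  also have "\<dots> = ennreal (y powr p * (T x - T y))"
    using assms d by (simp add: nn_integral_cmult T_diff ennreal_mult)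
  finally show "V y - V x \<le> y powr p * (T x - T y)" using d by (simp add: mult_nonneg_nonneg)
qed

text \<open>In the increment of \<sigma> = V + x^p T the contributions dV and x^p dT cancel to first
  order, leaving T d(x^p); \<open>VT_diff\<close> bounds the error on each side.\<close>

lemma sg_lo: "0 < x \<Longrightarrow> x \<le> y \<Longrightarrow> (y powr p - x powr p) * T y \<le> sg y - sg x"
  using VT_diff[of x y] by (simp add: sg_def algebra_simps)

lemma sg_up: "0 < x \<Longrightarrow> x \<le> y \<Longrightarrow> sg y - sg x \<le> (y powr p - x powr p) * T x"
  using VT_diff[of x y] by (simp add: sg_def algebra_simps)

lemma powr_p_mono: "0 < x \<Longrightarrow> x \<le> y \<Longrightarrow> x powr p \<le> y powr p"
  using p by (simp add: powr_mono2)

lemma sg_mono: "0 < x \<Longrightarrow> x \<le> y \<Longrightarrow> sg x \<le> sg y"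
  using sg_lo[of x y] powr_p_mono[of x y] T_nonneg[of y]
  by (smt (verit, best) mult_nonneg_nonneg)

lemma bb_mono: "0 < x \<Longrightarrow> x \<le> y \<Longrightarrow> bb x \<le> bb y"
proof -
  assume xy: "0 < x" "x \<le> y"
  have 1: "x powr p * (V y - V x) \<le> x powr p * (y powr p * (T x - T y))"
    using VT_diff[OF xy] by (intro mult_left_mono) auto
  have 2: "x powr p * V x \<le> y powr p * V x"
    using powr_p_mono[OF xy] V_pos[of x] xy by (intro mult_right_mono) auto
  have "x powr p * sg y \<le> y powr p * sg x"
    using 1 2 by (simp add: sg_def algebra_simps)
  then show ?thesis using sg_pos[of x] sg_pos[of y] xy by (simp add: bb_def field_simps)
qed

text \<open>Near x, T is the total mass minus the distribution function of z^(-p) d\<nu> on the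
  half-line beyond x/2, a finite measure without atoms. The cut at x/2 excludes the neighbourhood of
  0, where z^(-p) need not be integrable.\<close>

lemma isCont_T:
  assumes "0 < x" shows "isCont T x"
proof -
  define m where "m = density \<nu> (\<lambda>z. ennreal (z powr - p) * indicator {x/2<..} z)"
  have m: "emeasure m A = (\<integral>\<^sup>+z. ennreal (z powr - p) * indicator ({x/2<..} \<inter> A) z \<partial>\<nu>)" if "A \<in> sets borel" for A
    using that unfolding m_def
    by (subst emeasure_density) (auto simp: sets_nu indicator_inter_arith mult.assoc intro!: nn_integral_cong)
  have fin: "emeasure m UNIV \<noteq> top"
    using tail_fin[of "x/2"] assms by (simp add: m)
  have sets_m: "sets m = sets borel" by (simp add: m_def sets_nu)
  have fin': "emeasure m A \<noteq> top" for A
    using emeasure_mono[of A UNIV m] fin by (metis emeasure_space less_top order_le_less_trans sets_eq_imp_space_eq sets_m space_borel)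
  have atom: "emeasure m {y} = 0" for y
    using AE_nu_neq[of y] by (auto simp: m nn_integral_0_iff_AE indicator_def)
  have c: "isCont (\<lambda>y. measure m {..<y}) x"
    by (rule isCont_measure_lessThan) (use sets_m fin' atom in auto)
  have "T y = measure m UNIV - measure m {..<y}" if "x/2 < y" for y
  proof -
    have "measure m UNIV - measure m {..<y} = measure m (UNIV - {..<y})"
      by (rule measure_Diff[symmetric]) (auto simp: sets_m fin')
    also have "UNIV - {..<y} = {y..}" by auto
    also have "measure m {y..} = T y"
      unfolding measure_def T_def using that AE_nu_neq[of y]
      by (auto simp: m intro!: arg_cong[where f = enn2real] nn_integral_cong_AE)
        (auto simp: indicator_def elim!: eventually_mono)
    finally show ?thesis by simp
  qed
  then have "eventually (\<lambda>y. measure m UNIV - measure m {..<y} = T y) (nhds x)"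
    using eventually_nhds_in_open[of "{x/2<..}" x] assms by (auto elim: eventually_mono)
  then have "isCont (\<lambda>y. measure m UNIV - measure m {..<y}) x = isCont T x" by (rule isCont_cong)
  then show ?thesis using c by (auto intro: continuous_intros)
qed

lemma DERIV_powr_p: "0 < x \<Longrightarrow> ((\<lambda>x. x powr p) has_real_derivative p * x powr (p - 1)) (at x)"
  by (rule has_real_derivative_powr)

lemma DERIV_sg:
  assumes "0 < x"
  shows "(sg has_real_derivative p * x powr (p - 1) * T x) (at x)"
  by (rule has_real_derivative_sandwich[where S = "{0<..}" and c = "\<lambda>x. x powr p"])
    (use assms in \<open>auto simp: isCont_T sg_lo sg_up DERIV_powr_p powr_p_mono\<close>)

lemma isCont_sg: "0 < x \<Longrightarrow> isCont sg x"
  using DERIV_sg DERIV_isCont by blast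

lemma isCont_bb: "0 < x \<Longrightarrow> isCont bb x"
  unfolding bb_def[abs_def] using sg_pos[of x] isCont_sg[of x] by (auto intro!: continuous_intros)

text \<open>The quotient rule leaves \<sigma> - x^p T = V in the numerator.\<close>

lemma DERIV_bb:
  assumes "0 < x"
  shows "(bb has_real_derivative p * x powr (p - 1) * V x / (sg x)\<^sup>2) (at x)"
proof -
  have "((\<lambda>x. x powr p / sg x) has_real_derivative
    (p * x powr (p - 1) * sg x - x powr p * (p * x powr (p - 1) * T x)) / (sg x * sg x)) (at x)"
    by (rule DERIV_divide[OF DERIV_powr_p DERIV_sg]) (use assms sg_pos[of x] in auto)
  moreover have "p * x powr (p - 1) * sg x - x powr p * (p * x powr (p - 1) * T x) = p * x powr (p - 1) * V x"
    by (simp add: sg_def algebra_simps)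
  ultimately show ?thesis unfolding bb_def[abs_def] by (simp add: power2_eq_square)
qed

lemma DERIV_inverse_sg:
  assumes "0 < x"
  shows "((\<lambda>x. - (1 / sg x)) has_real_derivative p * x powr (p - 1) * T x / (sg x)\<^sup>2) (at x)"
  using assms sg_pos[of x]
  by (auto intro!: derivative_eq_intros DERIV_sg simp: power2_eq_square)

text \<open>The definition of \<sigma> divided by \<sigma>. The two terms are the shares of a point
  that are later charged to the integrals on its left and on its right.\<close>

lemma sg_split: "0 < x \<Longrightarrow> T x * bb x + V x / sg x = 1"
proof -
  assume "0 < x"
  have "T x * bb x + V x / sg x = (V x + x powr p * T x) / sg x"
    by (simp add: bb_def add_divide_distrib mult.commute)
  also have "\<dots> = 1" using sg_pos[OF \<open>0 < x\<close>] by (simp flip: sg_def)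
  finally show ?thesis .
qed

end

lemma nn_integral_FTC_Ioc:
  fixes F f :: "real \<Rightarrow> real"
  assumes [measurable]: "f \<in> borel_measurable borel"
    and "\<And>x. a \<le> x \<Longrightarrow> x \<le> b \<Longrightarrow> (F has_real_derivative f x) (at x)"
    and "\<And>x. a \<le> x \<Longrightarrow> x \<le> b \<Longrightarrow> 0 \<le> f x" and "a \<le> b"
  shows "(\<integral>\<^sup>+x\<in>{a<..b}. ennreal (f x) \<partial>lborel) = ennreal (F b - F a)"
proof -
  have "(\<integral>\<^sup>+x\<in>{a<..b}. ennreal (f x) \<partial>lborel) = (\<integral>\<^sup>+x\<in>{a..b}. ennreal (f x) \<partial>lborel)"
    using AE_lborel_singleton[of a] by (intro nn_integral_cong_AE) (auto simp: indicator_def)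
  then show ?thesis using nn_integral_FTC_Icc[of f a b F] assms by simp
qed

lemma nn_integral_Ioc_sum:
  fixes xs :: "nat \<Rightarrow> real"
  assumes sets [measurable_cong]: "sets m = sets borel" and [measurable]: "f \<in> borel_measurable borel"
    and "\<And>k. k < n \<Longrightarrow> xs k \<le> xs (Suc k)"
  shows "(\<Sum>k<n. \<integral>\<^sup>+x\<in>{xs k<..xs (Suc k)}. f x \<partial>m) = (\<integral>\<^sup>+x\<in>{xs 0<..xs n}. f x \<partial>m)"
  using assms(3)
proof (induction n)
  case (Suc n)
  have "k \<le> n \<Longrightarrow> xs 0 \<le> xs k" for k
    by (induction k) (use Suc.prems in \<open>auto intro: order_trans\<close>)
  then have "xs 0 \<le> xs n" by simp
  then have "(\<integral>\<^sup>+x\<in>{xs 0<..xs (Suc n)}. f x \<partial>m)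
      = (\<integral>\<^sup>+x. f x * indicator {xs 0<..xs n} x + f x * indicator {xs n<..xs (Suc n)} x \<partial>m)"
    using Suc.prems[of n] by (intro nn_integral_cong) (auto simp: indicator_def)
  also have "\<dots> = (\<integral>\<^sup>+x\<in>{xs 0<..xs n}. f x \<partial>m) + (\<integral>\<^sup>+x\<in>{xs n<..xs (Suc n)}. f x \<partial>m)"
    by (subst nn_integral_add) auto
  finally show ?case using Suc by simp
qed simp

section \<open>Chains with geometric growth of both functions\<close>

context gamma_data
begin

text \<open>Along a chain both \<open>\<sigma>\<close> and \<open>x\<^sup>p/\<sigma>\<close> grow geometrically, so the pieces of a function between
  consecutive points hardly interact.\<close>

definition step where "step x y \<longleftrightarrow> x < y \<and> 4 * sg x \<le> sg y \<and> 4 * bb x \<le> bb y"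
text \<open>Control of one of the two functions is enough on a block: a point at which both have at
  least quadrupled can be chosen such that one of them has grown by exactly the factor 4.\<close>

definition adj where "adj x y \<longleftrightarrow> x \<le> y \<and> (sg y \<le> 4 * sg x \<or> bb y \<le> 4 * bb x)"
definition chain where "chain xs n \<longleftrightarrow> 0 < xs 0 \<and> (\<forall>k<n. step (xs k) (xs (Suc k)))"

lemma chain_pos_mono: "chain xs n \<Longrightarrow> i \<le> j \<Longrightarrow> j \<le> n \<Longrightarrow> xs i \<le> xs j"
proof -
  assume c: "chain xs n" and ij: "i \<le> j" "j \<le> n"
  from ij(1) ij(2) show ?thesis
  proof (induction rule: dec_induct)
    case (step m)
    have "xs m \<le> xs (Suc m)" using c step by (auto simp: chain_def step_def intro: less_imp_le)
    then show ?case using step by simp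
  qed simp
qed

lemma chain_pos: "chain xs n \<Longrightarrow> k \<le> n \<Longrightarrow> 0 < xs k"
  using chain_pos_mono[of xs n 0 k] by (auto simp: chain_def)

lemma chain_growth:
  assumes c: "chain xs n" and ij: "i \<le> j" "j \<le> n"
  shows "4 ^ (j - i) * sg (xs i) \<le> sg (xs j)" and "4 ^ (j - i) * bb (xs i) \<le> bb (xs j)"
proof -
  from ij have "4 ^ (j - i) * sg (xs i) \<le> sg (xs j) \<and> 4 ^ (j - i) * bb (xs i) \<le> bb (xs j)"
  proof (induction rule: dec_induct)
    case (step m)
    have "4 * sg (xs m) \<le> sg (xs (Suc m))" "4 * bb (xs m) \<le> bb (xs (Suc m))"
      using c step by (auto simp: chain_def step_def)
    then show ?case using step by (simp add: Suc_diff_le)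
  qed simp
  then show "4 ^ (j - i) * sg (xs i) \<le> sg (xs j)" "4 ^ (j - i) * bb (xs i) \<le> bb (xs j)" by auto
qed

lemma bb_hit:
  assumes "0 < a" "a \<le> c" "bb a \<le> l" "l \<le> bb c"
  obtains x where "a \<le> x" "x \<le> c" "bb x = l"
  using IVT[of bb a l c] assms isCont_bb by auto

lemma sg_hit:
  assumes "0 < a" "a \<le> c" "sg a \<le> l" "l \<le> sg c"
  obtains x where "a \<le> x" "x \<le> c" "sg x = l"
  using IVT[of sg a l c] assms isCont_sg by auto

text \<open>Greedy choice: from a go to the later of two points at which \<sigma> and b are 4 times
  their values at a, as long as both quadruple up to z. Each step multiplies \<sigma> by at least 4,
  so the length of the chain is bounded in terms of \<open>sg z / sg a\<close>. The endpoint z only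
  has to be adjacent to the last chain point.\<close>

lemma chain_exists:
  assumes "0 < a" "a \<le> z"
  obtains xs n where "chain xs n" "xs 0 = a" "xs (Suc n) = z" "\<And>k. k \<le> n \<Longrightarrow> adj (xs k) (xs (Suc k))"
proof -
  \<comment> \<open>The induction runs over this exponent, which drops by one with every step of the
    chain.\<close>
  obtain m where m: "sg z < 4 ^ m * sg a"
    using real_arch_pow[of 4 "sg z / sg a"] sg_pos[OF assms(1)] by (auto simp: field_simps)
  have "\<exists>xs n. chain xs n \<and> xs 0 = a \<and> xs (Suc n) = z \<and> (\<forall>k\<le>n. adj (xs k) (xs (Suc k)))"
    using assms m
  proof (induction m arbitrary: a)
    case 0
    then show ?case using sg_mono[of a z] by simp
  next
    case (Suc m)
    show ?case
    proof (cases "4 * sg a \<le> sg z \<and> 4 * bb a \<le> bb z")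
      case False
      then have "adj a z" using Suc.prems by (auto simp: adj_def)
      then show ?thesis using Suc.prems
        by (intro exI[of _ "\<lambda>k. if k = 0 then a else z"] exI[of _ 0]) (auto simp: chain_def)
    next
      case True
      note pos = sg_pos[OF Suc.prems(1)] bb_pos[OF Suc.prems(1)]
      obtain x1 where x1: "a \<le> x1" "x1 \<le> z" "sg x1 = 4 * sg a"
        using sg_hit[of a z "4 * sg a"] True Suc.prems pos by auto
      obtain x2 where x2: "a \<le> x2" "x2 \<le> z" "bb x2 = 4 * bb a"
        using bb_hit[of a z "4 * bb a"] True Suc.prems pos by auto
      \<comment> \<open>At the maximum both functions have grown by at least 4; the one whose point
        is the maximum has grown by exactly 4, which gives adjacency.\<close>
      define y where "y = max x1 x2"
      have y: "step a y" "adj a y" "y \<le> z" "0 < y" "4 * sg a \<le> sg y"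
        using x1 x2 pos Suc.prems sg_mono[of x1 x2] bb_mono[of x2 x1]
        by (auto simp: y_def step_def adj_def max_def less_le)
      have "sg z < 4 ^ m * sg y"
      proof -
        have "sg z < 4 ^ m * (4 * sg a)" using Suc.prems(3) by (simp add: mult_ac)
        also have "\<dots> \<le> 4 ^ m * sg y" using y(5) by (intro mult_left_mono) auto
        finally show ?thesis .
      qed
      from Suc.IH[OF y(4,3) this] obtain xs n where xs: "chain xs n" "xs 0 = y" "xs (Suc n) = z"
        "\<forall>k\<le>n. adj (xs k) (xs (Suc k))" by blast
      have "chain (case_nat a xs) (Suc n)"
        using xs y Suc.prems by (auto simp: chain_def split: nat.split)
      moreover have "\<forall>k\<le>Suc n. adj (case_nat a xs k) (case_nat a xs (Suc k))"
        using xs y by (auto split: nat.split)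
      ultimately show ?thesis using xs by (intro exI[of _ "case_nat a xs"] exI[of _ "Suc n"]) auto
    qed
  qed
  then show ?thesis using that by blast
qed

definition mm where "mm x = (if x \<le> 0 then 0 else p * x powr (p - 1) * V x * T x / (sg x)\<^sup>2)"

lemma V_measurable [measurable]: "V \<in> borel_measurable borel"
proof -
  have "(\<lambda>x. emeasure \<nu> {..<x}) \<in> borel_measurable borel"
    by (intro mono_ennreal_borel monoI emeasure_mono) (auto simp: sets_nu)
  then show ?thesis unfolding V_def[abs_def] measure_def by measurable
qed

lemma T_measurable [measurable]: "T \<in> borel_measurable borel"
proof -
  have "(\<lambda>x. \<integral>\<^sup>+z\<in>{x<..}. ennreal (z powr - p) \<partial>\<nu>) \<in> borel_measurable borel"
    by (intro antimono_ennreal_borel antimonoI nn_integral_mono) (auto simp: indicator_def)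
  then show ?thesis unfolding T_def[abs_def] by measurable
qed

lemma sg_measurable [measurable]: "sg \<in> borel_measurable borel"
  unfolding sg_def[abs_def] by measurable

lemma mm_measurable [measurable]: "mm \<in> borel_measurable borel"
  unfolding mm_def[abs_def] by measurable

lemma mm_nonneg: "0 \<le> mm x"
  using p by (cases "0 < x") (auto simp: mm_def intro!: divide_nonneg_nonneg mult_nonneg_nonneg T_nonneg less_imp_le[OF V_pos])

text \<open>\<open>p x\<^sup>p\<^sup>-\<^sup>1 V T / \<sigma>\<^sup>2\<close> is both \<open>T\<close> times the derivative of \<open>b\<close> and \<open>V\<close> times that of \<open>-1/\<sigma>\<close>.\<close>

lemma bb_integral:
  assumes "0 < a" "a \<le> x"
  shows "(\<integral>\<^sup>+z\<in>{a<..x}. ennreal (if z \<le> 0 then 0 else p * z powr (p - 1) * V z / (sg z)\<^sup>2) \<partial>lborel) = ennreal (bb x - bb a)"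
  by (rule nn_integral_FTC_Ioc)
    (use assms p DERIV_bb in \<open>auto intro!: divide_nonneg_nonneg mult_nonneg_nonneg less_imp_le[OF V_pos]\<close>)

lemma isg_integral:
  assumes "0 < a" "a \<le> x"
  shows "(\<integral>\<^sup>+z\<in>{a<..x}. ennreal (if z \<le> 0 then 0 else p * z powr (p - 1) * T z / (sg z)\<^sup>2) \<partial>lborel) = ennreal (1 / sg a - 1 / sg x)"
  by (subst nn_integral_FTC_Ioc[where F = "\<lambda>x. - (1 / sg x)"])
    (use assms p DERIV_inverse_sg in \<open>auto intro!: divide_nonneg_nonneg mult_nonneg_nonneg T_nonneg\<close>)

lemma sg_integral:
  assumes "0 < a" "a \<le> x"
  shows "(\<integral>\<^sup>+z\<in>{a<..x}. ennreal (if z \<le> 0 then 0 else p * z powr (p - 1) * T z) \<partial>lborel) = ennreal (sg x - sg a)"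
  by (rule nn_integral_FTC_Ioc)
    (use assms p DERIV_sg in \<open>auto intro!: divide_nonneg_nonneg mult_nonneg_nonneg T_nonneg\<close>)

end

text \<open>\<open>R\<close> will be a power of \<open>Q\<close>. Passing between sums of R along
  chains and integrals against \<open>mm\<close> uses only that, to the right, R falls by at most
  the factor K while \<sigma> at most quadruples, and rises by at most K while b at most
  quadruples.\<close>

locale gamma_weighted = gamma_data +
  fixes R :: "real \<Rightarrow> ennreal" and K :: real
  assumes R_measurable [measurable]: "R \<in> borel_measurable borel"
    and K: "1 \<le> K"
    and Rs: "0 < x \<Longrightarrow> x \<le> y \<Longrightarrow> sg y \<le> 4 * sg x \<Longrightarrow> R x \<le> ennreal K * R y"
    and Rb: "0 < x \<Longrightarrow> x \<le> y \<Longrightarrow> bb y \<le> 4 * bb x \<Longrightarrow> R y \<le> ennreal K * R x"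
begin

text \<open>On the last stretch (a',x], along which b climbs from b(x)/4 to b(x), R is at least
  R(x)/K and T at least T(x). There \<open>mm\<close> is T b', and b' integrates to 3/4 b(x); the
  factor 2 absorbs 4/3.\<close>

lemma R_left:
  assumes "0 < a" "a \<le> x" "4 * bb a \<le> bb x"
  shows "ennreal (T x * bb x) * R x \<le> ennreal (2 * K) * (\<integral>\<^sup>+z\<in>{a<..x}. R z * ennreal (mm z) \<partial>lborel)"
proof -
  have x: "0 < x" using assms by simp
  obtain a' where a': "a \<le> a'" "a' \<le> x" "bb a' = bb x / 4"
    using bb_hit[of a x "bb x / 4"] assms bb_pos[OF x] by auto
  define f where "f z = (if z \<le> 0 then 0 else p * z powr (p - 1) * V z / (sg z)\<^sup>2)" for z
  have f0: "0 \<le> f z" for z using p by (auto simp: f_def intro!: divide_nonneg_nonneg mult_nonneg_nonneg less_imp_le[OF V_pos])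
  have [measurable]: "f \<in> borel_measurable borel" unfolding f_def[abs_def] by measurable
  have d: "bb x - bb a' = 3/4 * bb x" using a' by simp
  have I: "(\<integral>\<^sup>+z\<in>{a'<..x}. ennreal (f z) \<partial>lborel) = ennreal (3/4 * bb x)"
    unfolding f_def by (subst bb_integral) (use assms a' in \<open>auto simp: d\<close>)
  have "ennreal (T x * (3/4 * bb x)) * R x = R x * ennreal (T x) * (\<integral>\<^sup>+z\<in>{a'<..x}. ennreal (f z) \<partial>lborel)"
    unfolding I by (subst ennreal_mult[OF T_nonneg]) (use bb_pos[OF x] in \<open>auto simp: mult_ac\<close>)
  also have "\<dots> = (\<integral>\<^sup>+z. R x * ennreal (T x) * (ennreal (f z) * indicator {a'<..x} z) \<partial>lborel)"
    by (simp add: nn_integral_cmult)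
  also have "\<dots> \<le> (\<integral>\<^sup>+z. ennreal K * (R z * ennreal (mm z) * indicator {a<..x} z) \<partial>lborel)"
  proof (intro nn_integral_mono)
    fix z
    show "R x * ennreal (T x) * (ennreal (f z) * indicator {a'<..x} z) \<le> ennreal K * (R z * ennreal (mm z) * indicator {a<..x} z)"
    proof (cases "z \<in> {a'<..x}")
      case True
      then have z: "0 < z" "z \<le> x" "a < z" using a' assms by auto
      have "bb a' \<le> bb z" using True a' assms by (intro bb_mono) auto
      then have 1: "R x \<le> ennreal K * R z" using a' z by (intro Rb) auto
      have "T x \<le> T z" using z T_diff(2) by simp
      then have "T x * f z \<le> T z * f z" using f0 by (rule mult_right_mono)
      also have "\<dots> = mm z" using z by (simp add: f_def mm_def)
      finally have 2: "ennreal (T x * f z) \<le> ennreal (mm z)" by (rule ennreal_leI)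
      have "R x * ennreal (T x * f z) \<le> (ennreal K * R z) * ennreal (mm z)"
        by (intro mult_mono 1 2) auto
      then show ?thesis using True z by (simp add: ennreal_mult T_nonneg f0 mult_ac)
    qed simp
  qed
  also have "\<dots> = ennreal K * (\<integral>\<^sup>+z\<in>{a<..x}. R z * ennreal (mm z) \<partial>lborel)"
    by (simp add: nn_integral_cmult)
  finally have *: "ennreal (T x * (3/4 * bb x)) * R x \<le> ennreal K * (\<integral>\<^sup>+z\<in>{a<..x}. R z * ennreal (mm z) \<partial>lborel)" .
  have "ennreal (T x * bb x) \<le> ennreal (2 * (T x * (3/4 * bb x)))"
    using T_nonneg[of x] bb_pos[OF x] by (intro ennreal_leI) (simp add: mult_left_mono)
  also have "\<dots> = ennreal 2 * ennreal (T x * (3/4 * bb x))" by (rule ennreal_mult') simp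
  finally have "ennreal (T x * bb x) * R x \<le> ennreal 2 * (ennreal (T x * (3/4 * bb x)) * R x)"
    by (metis mult.assoc mult_right_mono zero_le)
  also have "\<dots> \<le> ennreal 2 * (ennreal K * (\<integral>\<^sup>+z\<in>{a<..x}. R z * ennreal (mm z) \<partial>lborel))"
    by (intro mult_left_mono *) auto
  finally show ?thesis using K by (simp add: ennreal_mult mult.assoc)
qed

text \<open>The mirror image, with V in place of T and the derivative of -1/\<sigma> in place of b':
  the stretch runs until \<sigma> has quadrupled, where 1/\<sigma> has lost 3/4 of its
  value.\<close>

lemma R_right:
  assumes "0 < x" "x \<le> c" "4 * sg x \<le> sg c"
  shows "ennreal (V x / sg x) * R x \<le> ennreal (2 * K) * (\<integral>\<^sup>+z\<in>{x<..c}. R z * ennreal (mm z) \<partial>lborel)"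
proof -
  obtain c' where c': "x \<le> c'" "c' \<le> c" "sg c' = 4 * sg x"
    using sg_hit[of x c "4 * sg x"] assms sg_pos[of x] by auto
  note V0 = less_imp_le[OF V_pos[OF assms(1)]]
  define f where "f z = (if z \<le> 0 then 0 else p * z powr (p - 1) * T z / (sg z)\<^sup>2)" for z
  have f0: "0 \<le> f z" for z using p by (auto simp: f_def intro!: divide_nonneg_nonneg mult_nonneg_nonneg T_nonneg)
  have [measurable]: "f \<in> borel_measurable borel" unfolding f_def[abs_def] by measurable
  have d: "1 / sg x - 1 / sg c' = 3/4 / sg x" using c' sg_pos[of x] assms by (simp add: field_simps)
  have I: "(\<integral>\<^sup>+z\<in>{x<..c'}. ennreal (f z) \<partial>lborel) = ennreal (3/4 / sg x)"
    unfolding f_def by (subst isg_integral) (use assms c' in \<open>auto simp: d\<close>)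
  have "ennreal (V x * (3/4 / sg x)) * R x = R x * ennreal (V x) * (\<integral>\<^sup>+z\<in>{x<..c'}. ennreal (f z) \<partial>lborel)"
    unfolding I by (subst ennreal_mult[OF V0]) (use sg_pos[of x] assms in \<open>auto simp: mult_ac\<close>)
  also have "\<dots> = (\<integral>\<^sup>+z. R x * ennreal (V x) * (ennreal (f z) * indicator {x<..c'} z) \<partial>lborel)"
    by (simp add: nn_integral_cmult)
  also have "\<dots> \<le> (\<integral>\<^sup>+z. ennreal K * (R z * ennreal (mm z) * indicator {x<..c} z) \<partial>lborel)"
  proof (intro nn_integral_mono)
    fix z
    show "R x * ennreal (V x) * (ennreal (f z) * indicator {x<..c'} z) \<le> ennreal K * (R z * ennreal (mm z) * indicator {x<..c} z)"
    proof (cases "z \<in> {x<..c'}")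
      case True
      then have z: "0 < z" "x \<le> z" "z \<le> c" using c' assms by auto
      have "sg z \<le> sg c'" using True c' assms by (intro sg_mono) auto
      then have 1: "R x \<le> ennreal K * R z" using c' z assms by (intro Rs) auto
      have "V x \<le> V z" using z V_mono assms by simp
      then have "V x * f z \<le> V z * f z" using f0 by (rule mult_right_mono)
      also have "\<dots> = mm z" using z by (simp add: f_def mm_def)
      finally have 2: "ennreal (V x * f z) \<le> ennreal (mm z)" by (rule ennreal_leI)
      have "R x * ennreal (V x * f z) \<le> (ennreal K * R z) * ennreal (mm z)"
        by (intro mult_mono 1 2) auto
      then show ?thesis using True z by (simp add: ennreal_mult V0 f0 mult_ac)
    qed simp
  qed
  also have "\<dots> = ennreal K * (\<integral>\<^sup>+z\<in>{x<..c}. R z * ennreal (mm z) \<partial>lborel)"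
    by (simp add: nn_integral_cmult)
  finally have *: "ennreal (V x * (3/4 / sg x)) * R x \<le> ennreal K * (\<integral>\<^sup>+z\<in>{x<..c}. R z * ennreal (mm z) \<partial>lborel)" .
  have "ennreal (V x / sg x) \<le> ennreal (2 * (V x * (3/4 / sg x)))"
    using V0 sg_pos[OF assms(1)] by (intro ennreal_leI) (simp add: field_simps)
  also have "\<dots> = ennreal 2 * ennreal (V x * (3/4 / sg x))" by (rule ennreal_mult') simp
  finally have "ennreal (V x / sg x) * R x \<le> ennreal 2 * (ennreal (V x * (3/4 / sg x)) * R x)"
    by (metis mult.assoc mult_right_mono zero_le)
  also have "\<dots> \<le> ennreal 2 * (ennreal K * (\<integral>\<^sup>+z\<in>{x<..c}. R z * ennreal (mm z) \<partial>lborel))"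
    by (intro mult_left_mono *) auto
  finally show ?thesis using K by (simp add: ennreal_mult mult.assoc)
qed

lemma R_split: "0 < x \<Longrightarrow> R x = ennreal (T x * bb x) * R x + ennreal (V x / sg x) * R x"
  using sg_split[of x] T_nonneg[of x] bb_pos[of x] sg_pos[of x] V_pos[of x]
  by (simp add: distrib_right[symmetric] ennreal_plus[symmetric] del: ennreal_plus)

text \<open>The share T b of each point is charged to the block on its left and the share V/\<sigma>
  to the block on its right, so every block is charged at most twice. If b never falls to a quarter
  of its value to the left of the first point, \<open>E0\<close> pays for that point; if \<sigma>
  never quadruples to the right of the last point, \<open>E1\<close> does.\<close>

lemma chain_sum_le:
  assumes c: "chain xs n"
    and E0: "\<And>x. 0 < x \<Longrightarrow> (\<And>a. 0 < a \<Longrightarrow> a \<le> x \<Longrightarrow> bb x < 4 * bb a) \<Longrightarrow> R x \<le> ennreal K * E0"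
    and E1: "\<And>x. 0 < x \<Longrightarrow> (\<And>c. x \<le> c \<Longrightarrow> sg c < 4 * sg x) \<Longrightarrow> R x \<le> ennreal K * E1"
  shows "(\<Sum>k\<le>n. R (xs k)) \<le> ennreal (4 * K) * ((\<integral>\<^sup>+z\<in>{0<..}. R z * ennreal (mm z) \<partial>lborel) + E0 + E1)"
proof -
  define I where "I S = (\<integral>\<^sup>+z\<in>S. R z * ennreal (mm z) \<partial>lborel)" for S
  have I_mono: "I S \<le> I S'" if "S \<subseteq> S'" for S S'
    unfolding I_def using that by (intro nn_integral_mono mult_left_mono) (auto simp: indicator_def)
  have pos: "0 < xs k" if "k \<le> n" for k using chain_pos[OF c that] .
  have st: "xs k \<le> xs (Suc k)" "4 * bb (xs k) \<le> bb (xs (Suc k))" "4 * sg (xs k) \<le> sg (xs (Suc k))" if "k < n" for k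
    using c that by (auto simp: chain_def step_def)
  have sumI: "(\<Sum>k<n. I {xs k<..xs (Suc k)}) = I {xs 0<..xs n}"
    unfolding I_def by (rule nn_integral_Ioc_sum) (use st in auto)
  have K2: "ennreal K \<le> ennreal (2 * K)" using K by (intro ennreal_leI) simp
  have le1: "ennreal (T x * bb x) \<le> 1" "ennreal (V x / sg x) \<le> 1" if "0 < x" for x
  proof -
    have "0 \<le> T x * bb x" "0 \<le> V x / sg x"
      using T_nonneg[of x] bb_pos[OF that] sg_pos[OF that] V_pos[OF that] by auto
    with sg_split[OF that] have "T x * bb x \<le> 1" "V x / sg x \<le> 1" by linarith+
    then show "ennreal (T x * bb x) \<le> 1" "ennreal (V x / sg x) \<le> 1" by (simp_all only: ennreal_le_1)
  qed
  have l0: "ennreal (T (xs 0) * bb (xs 0)) * R (xs 0) \<le> ennreal (2 * K) * (I {0<..xs 0} + E0)"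
  proof (cases "\<exists>a. 0 < a \<and> a \<le> xs 0 \<and> 4 * bb a \<le> bb (xs 0)")
    case True
    then obtain a where a: "0 < a" "a \<le> xs 0" "4 * bb a \<le> bb (xs 0)" by blast
    have "ennreal (T (xs 0) * bb (xs 0)) * R (xs 0) \<le> ennreal (2 * K) * I {a<..xs 0}"
      unfolding I_def by (rule R_left[OF a])
    also have "\<dots> \<le> ennreal (2 * K) * (I {0<..xs 0} + E0)"
      using a by (intro mult_left_mono add_increasing2 I_mono) auto
    finally show ?thesis .
  next
    case False
    then have "R (xs 0) \<le> ennreal K * E0" using pos[of 0] by (intro E0) (auto simp: not_le)
    then have "ennreal (T (xs 0) * bb (xs 0)) * R (xs 0) \<le> 1 * (ennreal K * E0)"
      using le1(1)[OF pos[of 0]] by (intro mult_mono) auto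
    also have "\<dots> \<le> ennreal (2 * K) * (I {0<..xs 0} + E0)"
      using K2 by (simp add: mult_mono add_increasing)
    finally show ?thesis .
  qed
  have r0: "ennreal (V (xs n) / sg (xs n)) * R (xs n) \<le> ennreal (2 * K) * (I {xs n<..} + E1)"
  proof (cases "\<exists>a\<ge>xs n. 4 * sg (xs n) \<le> sg a")
    case True
    then obtain a where a: "xs n \<le> a" "4 * sg (xs n) \<le> sg a" by blast
    have "ennreal (V (xs n) / sg (xs n)) * R (xs n) \<le> ennreal (2 * K) * I {xs n<..a}"
      unfolding I_def by (rule R_right[OF pos a]) simp
    also have "\<dots> \<le> ennreal (2 * K) * (I {xs n<..} + E1)"
      by (intro mult_left_mono add_increasing2 I_mono) auto
    finally show ?thesis .
  next
    case False
    then have "R (xs n) \<le> ennreal K * E1" using pos[of n] by (intro E1) (simp, meson not_le)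
    then have "ennreal (V (xs n) / sg (xs n)) * R (xs n) \<le> 1 * (ennreal K * E1)"
      using le1(2)[OF pos[of n]] by (intro mult_mono) auto
    also have "\<dots> \<le> ennreal (2 * K) * (I {xs n<..} + E1)"
      using K2 by (simp add: mult_mono add_increasing)
    finally show ?thesis .
  qed
  have "(\<Sum>k\<le>n. ennreal (T (xs k) * bb (xs k)) * R (xs k))
      = ennreal (T (xs 0) * bb (xs 0)) * R (xs 0) + (\<Sum>k<n. ennreal (T (xs (Suc k)) * bb (xs (Suc k))) * R (xs (Suc k)))"
    by (rule sum.atMost_shift)
  also have "\<dots> \<le> ennreal (2 * K) * (I {0<..xs 0} + E0) + (\<Sum>k<n. ennreal (2 * K) * I {xs k<..xs (Suc k)})"
    using l0 pos st unfolding I_def by (intro add_mono sum_mono R_left) (auto simp: I_def)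
  also have "\<dots> = ennreal (2 * K) * ((I {0<..xs 0} + I {xs 0<..xs n}) + E0)"
    unfolding sum_distrib_left[symmetric] sumI by (simp add: distrib_left add_ac)
  also have "I {0<..xs 0} + I {xs 0<..xs n} = I {0<..xs n}"
    unfolding I_def using pos[of 0] chain_pos_mono[OF c, of 0 n]
    by (subst nn_integral_add[symmetric]) (auto intro!: nn_integral_cong simp: indicator_def)
  also have "\<dots> \<le> I {0<..}" by (rule I_mono) auto
  finally have L: "(\<Sum>k\<le>n. ennreal (T (xs k) * bb (xs k)) * R (xs k)) \<le> ennreal (2 * K) * (I {0<..} + E0)"
    by (simp add: mult_left_mono add_mono)
  have "(\<Sum>k\<le>n. ennreal (V (xs k) / sg (xs k)) * R (xs k))
      = (\<Sum>k<n. ennreal (V (xs k) / sg (xs k)) * R (xs k)) + ennreal (V (xs n) / sg (xs n)) * R (xs n)"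
    by (simp add: lessThan_Suc_atMost[symmetric])
  also have "\<dots> \<le> (\<Sum>k<n. ennreal (2 * K) * I {xs k<..xs (Suc k)}) + ennreal (2 * K) * (I {xs n<..} + E1)"
    using r0 pos st unfolding I_def by (intro add_mono sum_mono R_right) (auto simp: I_def)
  also have "\<dots> = ennreal (2 * K) * ((I {xs 0<..xs n} + I {xs n<..}) + E1)"
    unfolding sum_distrib_left[symmetric] sumI by (simp add: distrib_left add_ac)
  also have "I {xs 0<..xs n} + I {xs n<..} = I {xs 0<..}"
    unfolding I_def using chain_pos_mono[OF c, of 0 n]
    by (subst nn_integral_add[symmetric]) (auto intro!: nn_integral_cong simp: indicator_def)
  also have "\<dots> \<le> I {0<..}" using pos[of 0] by (intro I_mono) auto
  finally have Rr: "(\<Sum>k\<le>n. ennreal (V (xs k) / sg (xs k)) * R (xs k)) \<le> ennreal (2 * K) * (I {0<..} + E1)"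
    by (simp add: mult_left_mono add_mono)
  have "(\<Sum>k\<le>n. R (xs k)) = (\<Sum>k\<le>n. ennreal (T (xs k) * bb (xs k)) * R (xs k) + ennreal (V (xs k) / sg (xs k)) * R (xs k))"
    by (intro sum.cong refl R_split pos) auto
  also have "\<dots> \<le> ennreal (2 * K) * (I {0<..} + E0) + ennreal (2 * K) * (I {0<..} + E1)"
    unfolding sum.distrib by (intro add_mono L Rr)
  also have "\<dots> \<le> ennreal (2 * K) * (2 * (I {0<..} + E0 + E1))"
  proof -
    have "I {0<..} + E0 \<le> I {0<..} + E0 + E1" by (simp add: add_increasing2)
    moreover have "I {0<..} + E1 \<le> I {0<..} + E0 + E1" by (rule add_right_mono) (simp add: add_increasing2)
    ultimately show ?thesis
      unfolding distrib_left[symmetric] mult_2 by (meson add_mono mult_left_mono zero_le)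
  qed
  also have "\<dots> = ennreal (4 * K) * (I {0<..} + E0 + E1)"
  proof -
    have "ennreal (4 * K) = ennreal (2 * K) * 2"
      using K by (subst ennreal_numeral[symmetric], subst ennreal_mult[symmetric]) (auto simp: mult.commute)
    then show ?thesis by (simp add: mult.assoc)
  qed
  finally show ?thesis unfolding I_def .
qed

text \<open>If \<sigma> at most quadruples, \<open>mm\<close> is at most \<sigma>'/\<sigma>(x),
  since V/\<sigma> \<le> 1; this integrates to at most 4 - 1 = 3, and R is at most K times its value
  at y. If b at most quadruples, the same works with b'/b(x), since T \<le> 1/b, and with the value
  of R at x.\<close>

lemma adj_integral_le:
  assumes "0 < x" "adj x y"
  shows "(\<integral>\<^sup>+z\<in>{x<..y}. R z * ennreal (mm z) \<partial>lborel) \<le> ennreal (3 * K) * (R x + R y)"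
proof -
  have xy: "x \<le> y" using assms by (simp add: adj_def)
  have bound: "(\<integral>\<^sup>+z\<in>{x<..y}. R z * ennreal (mm z) \<partial>lborel) \<le> ennreal (3 * K) * (R x + R y)"
    if f: "(\<integral>\<^sup>+z\<in>{x<..y}. ennreal (f z) \<partial>lborel) = ennreal (F y - F x)" and Fx: "0 < F x"
      "F y \<le> 4 * F x" and le: "\<And>z. x < z \<Longrightarrow> z \<le> y \<Longrightarrow> mm z \<le> f z / F x"
      and Rle: "\<And>z. x < z \<Longrightarrow> z \<le> y \<Longrightarrow> R z \<le> ennreal K * (R x + R y)"
      and [measurable]: "f \<in> borel_measurable borel" for f F
  proof -
    have "(\<integral>\<^sup>+z\<in>{x<..y}. R z * ennreal (mm z) \<partial>lborel)
        \<le> (\<integral>\<^sup>+z. (ennreal K * (R x + R y)) * ennreal (1 / F x) * (ennreal (f z) * indicator {x<..y} z) \<partial>lborel)"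
    proof (intro nn_integral_mono)
      fix z
      show "R z * ennreal (mm z) * indicator {x<..y} z
          \<le> (ennreal K * (R x + R y)) * ennreal (1 / F x) * (ennreal (f z) * indicator {x<..y} z)"
      proof (cases "z \<in> {x<..y}")
        case True
        have "ennreal (mm z) \<le> ennreal (1 / F x) * ennreal (f z)"
          using le[of z] True Fx by (subst ennreal_mult'[symmetric]) (auto intro: ennreal_leI)
        then have "R z * ennreal (mm z) \<le> (ennreal K * (R x + R y)) * (ennreal (1 / F x) * ennreal (f z))"
          using True by (intro mult_mono Rle) auto
        then show ?thesis using True by (simp only: mult.assoc indicator_simps mult_1_right)
      qed simp
    qed
    also have "\<dots> = (ennreal K * (R x + R y)) * (ennreal (1 / F x) * ennreal (F y - F x))"
      by (simp add: nn_integral_cmult f mult.assoc)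
    also have "ennreal (1 / F x) * ennreal (F y - F x) \<le> ennreal 3"
    proof -
      have "1 / F x * (F y - F x) \<le> 3" using Fx by (simp add: field_simps)
      then show ?thesis using Fx by (subst ennreal_mult'[symmetric]) (auto intro: ennreal_leI simp del: ennreal_numeral)
    qed
    finally have "(\<integral>\<^sup>+z\<in>{x<..y}. R z * ennreal (mm z) \<partial>lborel) \<le> ennreal K * (R x + R y) * ennreal 3"
      by (simp add: mult_left_mono)
    then show ?thesis using K by (subst ennreal_mult) (auto simp: mult_ac)
  qed
  from assms(2) consider "sg y \<le> 4 * sg x" | "bb y \<le> 4 * bb x" by (auto simp: adj_def)
  then show ?thesis
  proof cases
    case 1
    show ?thesis
    proof (rule bound[OF sg_integral])
      fix z assume z: "x < z" "z \<le> y"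
      then have z0: "0 < z" and sgz: "sg x \<le> sg z" "sg z \<le> sg y"
        using assms by (auto intro!: sg_mono)
      have "V z \<le> sg z" using T_nonneg[of z] by (simp add: sg_def)
      then have "V z / sg z \<le> 1" using sg_pos[OF z0] by simp
      have "mm z = (p * z powr (p - 1) * T z) * ((V z / sg z) * (1 / sg z))"
        using z0 by (simp add: mm_def power2_eq_square)
      also have "\<dots> \<le> (p * z powr (p - 1) * T z) * (1 * (1 / sg x))"
        using p T_nonneg[of z] V_pos[OF z0] sg_pos[OF z0] sg_pos[of x] sgz assms \<open>V z / sg z \<le> 1\<close>
        by (intro mult_left_mono mult_mono) (auto intro: divide_left_mono)
      finally show "mm z \<le> (if z \<le> 0 then 0 else p * z powr (p - 1) * T z) / sg x" using z0 by simp
      have "R z \<le> ennreal K * R y" using z z0 sgz 1 by (intro Rs) auto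
      also have "\<dots> \<le> ennreal K * (R x + R y)" by (intro mult_left_mono add_increasing) auto
      finally show "R z \<le> ennreal K * (R x + R y)" .
    qed (use 1 assms xy sg_pos in auto)
  next
    case 2
    show ?thesis
    proof (rule bound[OF bb_integral])
      fix z assume z: "x < z" "z \<le> y"
      then have z0: "0 < z" and bbz: "bb x \<le> bb z" "bb z \<le> bb y"
        using assms by (auto intro!: bb_mono)
      have "T z * bb z \<le> 1" using sg_split[OF z0] V_pos[OF z0] sg_pos[OF z0] by (smt (verit) divide_pos_pos)
      then have "T z \<le> 1 / bb z" using bb_pos[OF z0] by (simp add: field_simps)
      also have "\<dots> \<le> 1 / bb x" using bbz bb_pos[OF assms(1)] bb_pos[OF z0] by (simp add: field_simps)
      finally have "(p * z powr (p - 1) * V z / (sg z)\<^sup>2) * T z \<le> (p * z powr (p - 1) * V z / (sg z)\<^sup>2) * (1 / bb x)"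
        using p V_pos[OF z0] by (intro mult_left_mono) auto
      then show "mm z \<le> (if z \<le> 0 then 0 else p * z powr (p - 1) * V z / (sg z)\<^sup>2) / bb x"
        using z0 by (simp add: mm_def)
      have "R z \<le> ennreal K * R x" using z assms(1) bbz 2 by (intro Rb) auto
      also have "\<dots> \<le> ennreal K * (R x + R y)" by (intro mult_left_mono add_increasing2) auto
      finally show "R z \<le> ennreal K * (R x + R y)" .
    qed (use 2 assms xy bb_pos in auto)
  qed
qed

lemma chain_integral_le:
  assumes c: "chain xs n" and a: "\<And>k. k \<le> n \<Longrightarrow> adj (xs k) (xs (Suc k))"
  shows "(\<integral>\<^sup>+z\<in>{xs 0<..xs (Suc n)}. R z * ennreal (mm z) \<partial>lborel)
    \<le> ennreal (6 * K) * ((\<Sum>k\<le>n. R (xs k)) + R (xs (Suc n)))"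
proof -
  have "(\<integral>\<^sup>+z\<in>{xs 0<..xs (Suc n)}. R z * ennreal (mm z) \<partial>lborel)
      = (\<Sum>k<Suc n. \<integral>\<^sup>+z\<in>{xs k<..xs (Suc k)}. R z * ennreal (mm z) \<partial>lborel)"
    by (rule nn_integral_Ioc_sum[symmetric]) (use a in \<open>auto simp: adj_def\<close>)
  also have "\<dots> \<le> (\<Sum>k<Suc n. ennreal (3 * K) * (R (xs k) + R (xs (Suc k))))"
    by (intro sum_mono adj_integral_le a chain_pos[OF c]) auto
  also have "\<dots> = ennreal (3 * K) * ((\<Sum>k<Suc n. R (xs k)) + (\<Sum>k<Suc n. R (xs (Suc k))))"
    by (simp only: sum_distrib_left[symmetric] sum.distrib)
  also have "\<dots> \<le> ennreal (3 * K) * (((\<Sum>k\<le>n. R (xs k)) + R (xs (Suc n))) + ((\<Sum>k\<le>n. R (xs k)) + R (xs (Suc n))))"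
  proof (intro mult_left_mono add_mono)
    show "(\<Sum>k<Suc n. R (xs k)) \<le> (\<Sum>k\<le>n. R (xs k)) + R (xs (Suc n))"
      by (simp only: lessThan_Suc_atMost add_increasing2 zero_le order_refl)
    have "(\<Sum>k<Suc n. R (xs (Suc k))) \<le> R (xs 0) + (\<Sum>k<Suc n. R (xs (Suc k)))"
      by (simp add: add_increasing)
    also have "\<dots> = (\<Sum>k\<le>Suc n. R (xs k))" by (rule sum.atMost_shift[symmetric])
    finally show "(\<Sum>k<Suc n. R (xs (Suc k))) \<le> (\<Sum>k\<le>n. R (xs k)) + R (xs (Suc n))" by simp
  qed auto
  also have "\<dots> = ennreal (6 * K) * ((\<Sum>k\<le>n. R (xs k)) + R (xs (Suc n)))"
  proof -
    have "ennreal (6 * K) = ennreal (3 * K) + ennreal (3 * K)"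
      using K by (subst ennreal_plus[symmetric]) auto
    then show ?thesis by (simp only: distrib_left distrib_right add_ac)
  qed
  finally show ?thesis .
qed

end

section \<open>The inequality for nonincreasing functions\<close>

definition hh :: "(real \<Rightarrow> ennreal) \<Rightarrow> real \<Rightarrow> ennreal" where
  "hh \<psi> x = (\<integral>\<^sup>+z\<in>{0<..<x}. \<psi> z \<partial>lborel)"

lemma hh_le: "(\<And>z. 0 < z \<Longrightarrow> z < x \<Longrightarrow> \<psi> z \<le> \<psi>' z) \<Longrightarrow> hh \<psi> x \<le> hh \<psi>' x"
  unfolding hh_def by (intro nn_integral_mono) (auto simp: indicator_def)

lemma hh_mono: "x \<le> y \<Longrightarrow> hh \<psi> x \<le> hh \<psi> y"
  unfolding hh_def by (intro nn_integral_mono) (auto simp: indicator_def)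

lemma hh_measurable [measurable]: "hh \<psi> \<in> borel_measurable borel"
  by (intro mono_ennreal_borel monoI hh_mono)

lemma hh_cmult:
  assumes "antimono \<psi>" shows "hh (\<lambda>z. c * \<psi> z) x = c * hh \<psi> x"
proof -
  have [measurable]: "\<psi> \<in> borel_measurable borel" by (rule antimono_ennreal_borel[OF assms])
  show ?thesis unfolding hh_def by (simp add: mult.assoc nn_integral_cmult)
qed

lemma hh_const: "0 \<le> x \<Longrightarrow> hh (\<lambda>_. c) x = c * ennreal x"
  unfolding hh_def by (simp add: nn_integral_cmult)

lemma hh_ge: "antimono \<psi> \<Longrightarrow> 0 \<le> x \<Longrightarrow> \<psi> x * ennreal x \<le> hh \<psi> x"
  unfolding hh_const[symmetric] by (intro hh_le) (auto simp: antimono_def)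

text \<open>What is added between x and y has density at most \<psi> x, which is at most the mean of
  \<psi> over (0,x).\<close>

lemma hh_antimono_avg:
  assumes \<psi>: "antimono \<psi>" and xy: "0 < x" "x \<le> y"
  shows "hh \<psi> y * ennreal x \<le> hh \<psi> x * ennreal y"
proof -
  have [measurable]: "\<psi> \<in> borel_measurable borel" by (rule antimono_ennreal_borel[OF \<psi>])
  have "hh \<psi> y = (\<integral>\<^sup>+z. \<psi> z * indicator {0<..<x} z + \<psi> z * indicator {x..<y} z \<partial>lborel)"
    unfolding hh_def using xy by (intro nn_integral_cong) (auto simp: indicator_def)
  also have "\<dots> = hh \<psi> x + (\<integral>\<^sup>+z\<in>{x..<y}. \<psi> z \<partial>lborel)"
    unfolding hh_def by (subst nn_integral_add) auto
  also have "(\<integral>\<^sup>+z\<in>{x..<y}. \<psi> z \<partial>lborel) \<le> (\<integral>\<^sup>+z. \<psi> x * indicator {x..<y} z \<partial>lborel)"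
    using \<psi> by (intro nn_integral_mono) (auto simp: indicator_def antimono_def)
  also have "\<dots> = \<psi> x * ennreal (y - x)" using xy by (simp add: nn_integral_cmult)
  finally have "hh \<psi> y * ennreal x \<le> (hh \<psi> x + \<psi> x * ennreal (y - x)) * ennreal x"
    by (simp add: mult_right_mono)
  also have "\<dots> = hh \<psi> x * ennreal x + (\<psi> x * ennreal x) * ennreal (y - x)"
    by (subst distrib_right) (simp only: mult_ac)
  also have "\<dots> \<le> hh \<psi> x * ennreal x + hh \<psi> x * ennreal (y - x)"
    using xy by (intro add_mono mult_right_mono hh_ge \<psi>) auto
  also have "\<dots> = hh \<psi> x * ennreal y"
    using xy by (simp add: distrib_left[symmetric] ennreal_plus[symmetric] del: ennreal_plus)
  finally show ?thesis .
qed

lemma min_powr: "0 < x \<Longrightarrow> x \<le> z \<Longrightarrow> min 1 (x / z) powr a = x powr a * z powr - a"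
  for x z a :: real
  by (simp add: min_absorb2 powr_divide powr_minus_divide)

context gamma_data
begin

definition gg where "gg \<psi> x = (hh \<psi> x / ennreal x) epowr p"
definition Gm where "Gm \<psi> = (\<integral>\<^sup>+x. gg \<psi> x \<partial>\<nu>)"
definition Lm where "Lm \<psi> = (\<integral>\<^sup>+x. \<psi> x epowr q \<partial>\<omega>)"
definition Dq where "Dq = Sup {Lm \<psi> |\<psi>. antimono \<psi> \<and> Gm \<psi> \<le> 1}"

text \<open>For \<open>\<psi> \<in> feas x\<close> the integral \<open>Gm \<psi>\<close> is at most \<open>\<sigma>(x)\<close>, so \<open>Q x = Nq x \<cdot> \<sigma>(x)\<^sup>-\<^sup>q\<^sup>/\<^sup>p\<close> bounds \<open>Dq\<close> from below.\<close>

definition feas where "feas x = {\<psi>. antimono \<psi> \<and> (\<forall>z>0. hh \<psi> z \<le> ennreal (min z x))}"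
definition Nq where "Nq x = (SUP \<psi>\<in>feas x. Lm \<psi>)"

lemma gg_measurable [measurable]: "gg \<psi> \<in> borel_measurable borel"
  unfolding gg_def[abs_def] by measurable

lemma Dq_upper: "antimono \<psi> \<Longrightarrow> Gm \<psi> \<le> 1 \<Longrightarrow> Lm \<psi> \<le> Dq"
  unfolding Dq_def by (auto intro: Sup_upper)

lemma gg_antimono:
  assumes "antimono \<psi>" "0 < x" "x \<le> y"
  shows "gg \<psi> y \<le> gg \<psi> x"
proof -
  have y: "0 < y" using assms by simp
  have "hh \<psi> y / ennreal y = hh \<psi> y * ennreal x * ennreal (1 / x / y)"
    unfolding mult.assoc ennreal_mult'[OF less_imp_le[OF assms(2)], symmetric]
    using assms(2) y by (simp add: divide_ennreal_def inverse_ennreal inverse_eq_divide)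
  also have "\<dots> \<le> hh \<psi> x * ennreal y * ennreal (1 / x / y)"
    using assms by (intro mult_right_mono hh_antimono_avg) auto
  also have "\<dots> = hh \<psi> x / ennreal x"
    unfolding mult.assoc ennreal_mult'[OF less_imp_le[OF y], symmetric]
    using assms(2) y by (simp add: divide_ennreal_def inverse_ennreal inverse_eq_divide)
  finally show ?thesis unfolding gg_def using p by (intro epowr_mono) auto
qed

lemma gg_powr: "0 < x \<Longrightarrow> gg \<psi> x * ennreal (x powr p) = hh \<psi> x epowr p"
proof -
  assume x: "0 < x"
  have "gg \<psi> x * ennreal (x powr p) = (hh \<psi> x / ennreal x * ennreal x) epowr p"
    unfolding gg_def using x p by (simp add: epowr_mult epowr_ennreal[symmetric])
  also have "hh \<psi> x / ennreal x * ennreal x = hh \<psi> x"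
    using x by (simp add: divide_ennreal_def inverse_ennreal mult.assoc flip: ennreal_mult)
  finally show ?thesis .
qed

lemma gg_mono_powr:
  assumes "0 < x" "x \<le> y"
  shows "gg \<psi> x * ennreal (x powr p) \<le> gg \<psi> y * ennreal (y powr p)"
  using assms p by (simp add: gg_powr epowr_mono hh_mono)

lemma gg_cmult:
  assumes "antimono \<psi>" shows "gg (\<lambda>z. c * \<psi> z) x = c epowr p * gg \<psi> x"
  unfolding gg_def using p
  by (simp add: hh_cmult[OF assms] epowr_mult[symmetric] divide_ennreal_def mult.assoc)

lemma Gm_cmult: "antimono \<psi> \<Longrightarrow> Gm (\<lambda>z. c * \<psi> z) = c epowr p * Gm \<psi>"
proof -
  assume "antimono \<psi>"
  then have "gg (\<lambda>z. c * \<psi> z) = (\<lambda>x. c epowr p * gg \<psi> x)" by (simp add: fun_eq_iff gg_cmult)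
  then show ?thesis unfolding Gm_def by (simp add: nn_integral_cmult)
qed

lemma Lm_cmult: 
  assumes "antimono \<psi>" shows "Lm (\<lambda>z. c * \<psi> z) = c epowr q * Lm \<psi>"
proof -
  have [measurable]: "\<psi> \<in> borel_measurable borel" by (rule antimono_ennreal_borel[OF assms])
  show ?thesis unfolding Lm_def using q by (simp add: epowr_mult nn_integral_cmult)
qed

lemma antimono_cmult: "antimono \<psi> \<Longrightarrow> antimono (\<lambda>z. c * \<psi> z :: ennreal)"
  by (auto simp: antimono_def mult_left_mono)

text \<open>Homogeneity: \<psi>/s is a competitor for \<open>Nq x\<close>. For s = 0 the bound
  forces \<psi> to vanish on the positive half-line, where \<omega> lives.\<close>

lemma Lm_le_Nq:
  assumes \<psi>: "antimono \<psi>" and s: "0 \<le> s" and h: "\<And>z. 0 < z \<Longrightarrow> hh \<psi> z \<le> ennreal s * ennreal (min z x)"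
    and x: "0 < x"
  shows "Lm \<psi> \<le> ennreal s epowr q * Nq x"
proof (cases "s = 0")
  case True
  have "\<psi> z = 0" if "0 < z" for z
    using hh_ge[OF \<psi>, of z] h[of z] that True by auto
  then have "AE z in \<omega>. \<psi> z epowr q = 0"
    using AE_om_pos by (auto simp: q elim: eventually_mono)
  then have "Lm \<psi> = 0" unfolding Lm_def by (subst nn_integral_cong_AE[where v = "\<lambda>_. 0"]) auto
  then show ?thesis by simp
next
  case False
  then have s0: "0 < s" using s by simp
  define \<phi> where "\<phi> z = ennreal (1 / s) * \<psi> z" for z
  have "\<phi> \<in> feas x"
    unfolding feas_def
  proof (intro CollectI conjI allI impI)
    show "antimono \<phi>" unfolding \<phi>_def[abs_def] by (rule antimono_cmult[OF \<psi>])
    fix z :: real assume "0 < z"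
    have "hh \<phi> z \<le> ennreal (1/s) * (ennreal s * ennreal (min z x))"
      unfolding \<phi>_def[abs_def] hh_cmult[OF \<psi>] by (intro mult_left_mono h \<open>0 < z\<close>) auto
    also have "\<dots> = ennreal (min z x)"
      using s0 by (simp flip: mult.assoc ennreal_mult)
    finally show "hh \<phi> z \<le> ennreal (min z x)" .
  qed
  then have "Lm \<phi> \<le> Nq x" unfolding Nq_def by (rule SUP_upper)
  moreover have "\<psi> = (\<lambda>z. ennreal s * \<phi> z)"
    using s0 by (simp add: \<phi>_def fun_eq_iff flip: mult.assoc ennreal_mult)
  then have "Lm \<psi> = ennreal s epowr q * Lm \<phi>"
    using Lm_cmult[of \<phi> "ennreal s"] antimono_cmult[OF \<psi>] by (simp add: \<phi>_def[abs_def])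
  ultimately show ?thesis by (simp add: mult_left_mono)
qed

lemma Nq_mono: "x \<le> y \<Longrightarrow> Nq x \<le> Nq y"
proof -
  assume "x \<le> y"
  then have "ennreal (min z x) \<le> ennreal (min z y)" for z by (intro ennreal_leI) auto
  then have "feas x \<subseteq> feas y" by (auto simp: feas_def intro: order_trans)
  then show ?thesis unfolding Nq_def by (intro SUP_subset_mono) auto
qed

lemma Nq_measurable [measurable]: "Nq \<in> borel_measurable borel"
  by (intro mono_ennreal_borel monoI Nq_mono)

text \<open>Since min(z,y) is at most (y/x) min(z,x), a competitor for y divided by y/x is a
  competitor for x. With \<open>Nq_mono\<close>, Nq x is nondecreasing and Nq x / x^q
  nonincreasing.\<close>

lemma Nq_avg:
  assumes "0 < x" "x \<le> y"
  shows "Nq y \<le> ennreal ((y / x) powr q) * Nq x"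
  unfolding Nq_def[of y]
proof (rule SUP_least)
  fix \<psi> assume "\<psi> \<in> feas y"
  then have \<psi>: "antimono \<psi>" "\<And>z. 0 < z \<Longrightarrow> hh \<psi> z \<le> ennreal (min z y)" by (auto simp: feas_def)
  have "Lm \<psi> \<le> ennreal (y / x) epowr q * Nq x"
  proof (rule Lm_le_Nq[OF \<psi>(1)])
    fix z :: real assume z: "0 < z"
    have "1 * z \<le> (y / x) * z" using assms z by (intro mult_right_mono) auto
    then have "min z y \<le> (y / x) * min z x" using assms z by (auto simp: min_def)
    then have "ennreal (min z y) \<le> ennreal (y / x) * ennreal (min z x)"
      using assms by (subst ennreal_mult'[symmetric]) (auto intro: ennreal_leI)
    then show "hh \<psi> z \<le> ennreal (y / x) * ennreal (min z x)" using \<psi>(2)[OF z] by simp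
  qed (use assms in auto)
  then show "Lm \<psi> \<le> ennreal ((y / x) powr q) * Nq x" using assms by (simp add: epowr_ennreal)
qed

text \<open>The simplest competitors: indicators of (0,t) with t beyond x, scaled to have integral
  x.\<close>

lemma char_feas: "0 < x \<Longrightarrow> x \<le> t \<Longrightarrow> (\<lambda>z. ennreal (x / t) * indicator {..<t} z) \<in> feas x"
proof -
  assume x: "0 < x" "x \<le> t"
  have "hh (\<lambda>z. ennreal (x / t) * indicator {..<t} z) z \<le> ennreal (min z x)" if z: "0 < z" for z
  proof -
    have "hh (\<lambda>z. ennreal (x / t) * indicator {..<t} z) z = (\<integral>\<^sup>+y. ennreal (x / t) * indicator {0<..<min z t} y \<partial>lborel)"
      unfolding hh_def using x z by (intro nn_integral_cong) (auto simp: indicator_def)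
    also have "\<dots> = ennreal (x / t * min z t)"
      using x z by (simp add: nn_integral_cmult ennreal_mult'[symmetric] del: times_divide_eq_left)
    also have "\<dots> \<le> ennreal (min z x)"
      using x z by (intro ennreal_leI) (auto simp: min_def field_simps)
    finally show ?thesis .
  qed
  moreover have "antimono (\<lambda>z. ennreal (x / t) * indicator {..<t} z)"
    by (auto simp: antimono_def indicator_def)
  ultimately show ?thesis by (simp add: feas_def)
qed

lemma Lm_char: "0 < x \<Longrightarrow> x \<le> t \<Longrightarrow> Lm (\<lambda>z. ennreal (x / t) * indicator {..<t} z) = ennreal ((x / t) powr q) * emeasure \<omega> {..<t}"
proof -
  assume x: "0 < x" "x \<le> t"
  have "Lm (\<lambda>z. ennreal (x / t) * indicator {..<t} z) = (\<integral>\<^sup>+z. ennreal ((x / t) powr q) * indicator {..<t} z \<partial>\<omega>)"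
    unfolding Lm_def using x q by (intro nn_integral_cong) (auto simp: indicator_def epowr_ennreal)
  then show ?thesis by (simp add: nn_integral_cmult sets_om)
qed

lemma Nq_ge_char: "0 < x \<Longrightarrow> x \<le> t \<Longrightarrow> ennreal ((x / t) powr q) * emeasure \<omega> {..<t} \<le> Nq x"
  unfolding Nq_def Lm_char[symmetric] by (intro SUP_upper char_feas)

lemma Nq_ge: "0 < x \<Longrightarrow> emeasure \<omega> {..<x} \<le> Nq x"
  using Nq_ge_char[of x x] by simp

lemma Nq_pos: "0 < x \<Longrightarrow> 0 < Nq x"
  using Nq_ge[of x] om_pos[of x] by simp

lemma feas_le1: "\<psi> \<in> feas x \<Longrightarrow> 0 < z \<Longrightarrow> \<psi> z \<le> 1" and feas_mult_le: "\<psi> \<in> feas x \<Longrightarrow> 0 < z \<Longrightarrow> \<psi> z * ennreal z \<le> ennreal x"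
proof -
  assume \<psi>: "\<psi> \<in> feas x" and z: "0 < z"
  have *: "\<psi> z * ennreal z \<le> ennreal (min z x)"
    using \<psi> z hh_ge[of \<psi> z] by (auto simp: feas_def intro: order_trans)
  then show "\<psi> z * ennreal z \<le> ennreal x" by (rule order_trans) (auto intro: ennreal_leI)
  have "\<psi> z * ennreal z \<le> 1 * ennreal z" using * by (rule order_trans) (auto intro: ennreal_leI)
  then show "\<psi> z \<le> 1"
    using z by (metis ennreal_less_top ennreal_eq_0_iff ennreal_mult_le_mult_iff mult.commute not_le top.not_eq_extremum)
qed

lemma Nq_le: "Nq x \<le> emeasure \<omega> UNIV"
  unfolding Nq_def
proof (rule SUP_least)
  fix \<psi> assume \<psi>: "\<psi> \<in> feas x"
  have "Lm \<psi> \<le> (\<integral>\<^sup>+z. 1 \<partial>\<omega>)"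
    unfolding Lm_def
  proof (rule nn_integral_mono_AE, use AE_om_pos in eventually_elim)
    case (elim z)
    then show ?case using feas_le1[OF \<psi>] epowr_mono[of q "\<psi> z" 1] q by simp
  qed
  then show "Lm \<psi> \<le> emeasure \<omega> UNIV" by simp
qed

text \<open>min(1,x/z) is the mean over (0,z) of the indicator of (0,x), so \<sigma>(x) is the p-th
  power of the Gamma norm of that indicator. The point z = x has no mass.\<close>

lemma sg_eq_integral:
  assumes "0 < x"
  shows "(\<integral>\<^sup>+z. ennreal (min 1 (x / z) powr p) \<partial>\<nu>) = ennreal (sg x)"
proof -
  have "(\<integral>\<^sup>+z. ennreal (min 1 (x / z) powr p) \<partial>\<nu>)
      = (\<integral>\<^sup>+z. indicator {..<x} z + ennreal (x powr p) * (ennreal (z powr - p) * indicator {x<..} z) \<partial>\<nu>)"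
  proof (rule nn_integral_cong_AE, use AE_nu_pos AE_nu_neq[of x] in eventually_elim)
    case (elim z)
    show ?case
    proof (cases "z < x")
      case True
      then show ?thesis using elim by (simp add: min_def)
    next
      case False
      then show ?thesis using elim assms min_powr[of x z p] by (simp add: ennreal_mult)
    qed
  qed
  also have "\<dots> = emeasure \<nu> {..<x} + ennreal (x powr p) * ennreal (T x)"
    using assms by (simp add: nn_integral_add nn_integral_cmult sets_nu T)
  also have "\<dots> = ennreal (sg x)"
    using assms V_pos[OF assms] T_nonneg[of x]
    by (simp add: V sg_def ennreal_mult[symmetric] ennreal_plus[symmetric] del: ennreal_plus)
  finally show ?thesis .
qed

lemma feas_Gm_le:
  assumes \<psi>: "\<psi> \<in> feas x" and x: "0 < x"
  shows "Gm \<psi> \<le> ennreal (sg x)"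
  unfolding Gm_def sg_eq_integral[OF x, symmetric]
proof (rule nn_integral_mono_AE, use AE_nu_pos in eventually_elim)
  case (elim z)
  have "hh \<psi> z / ennreal z \<le> ennreal (min z x) / ennreal z"
    using \<psi> elim by (intro divide_right_mono_ennreal) (auto simp: feas_def)
  also have "\<dots> = ennreal (min 1 (x / z))"
    using elim x by (subst divide_ennreal) (auto simp: min_def)
  finally have "gg \<psi> z \<le> ennreal (min 1 (x / z)) epowr p" unfolding gg_def using p by (intro epowr_mono) auto
  then show ?case using elim x by (simp add: epowr_ennreal)
qed

definition Q where "Q x = Nq x * ennreal (sg x powr - (q / p))"

lemma Nq_eq_Q: "0 < x \<Longrightarrow> Nq x = Q x * ennreal (sg x powr (q / p))"
  using sg_pos[of x] by (simp add: Q_def mult.assoc flip: ennreal_mult powr_add)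

lemma Q_measurable [measurable]: "Q \<in> borel_measurable borel"
  unfolding Q_def[abs_def] by measurable

lemma Q_le_Dq:
  assumes x: "0 < x" shows "Q x \<le> Dq"
proof -
  have "Lm \<psi> * ennreal (sg x powr - (q / p)) \<le> Dq" if \<psi>: "\<psi> \<in> feas x" for \<psi>
  proof -
    \<comment> \<open>This factor brings a competitor, whose Gamma integral is at most \<sigma>(x),
      into the unit ball.\<close>
    define c where "c = ennreal (sg x powr - (1 / p))"
    have am: "antimono \<psi>" using \<psi> by (simp add: feas_def)
    have cp: "c epowr p = ennreal (1 / sg x)" "c epowr q = ennreal (sg x powr - (q / p))"
      unfolding c_def using sg_pos[OF x] p
       by (simp_all add: epowr_ennreal powr_powr powr_minus_divide[of _ 1])
    have "Gm (\<lambda>z. c * \<psi> z) \<le> ennreal (1 / sg x) * ennreal (sg x)"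
      unfolding Gm_cmult[OF am] cp by (intro mult_left_mono feas_Gm_le \<psi> x) auto
    also have "\<dots> = 1" using sg_pos[OF x] by (simp flip: ennreal_mult)
    finally have "Lm (\<lambda>z. c * \<psi> z) \<le> Dq" by (intro Dq_upper antimono_cmult am)
    then show ?thesis unfolding Lm_cmult[OF am] cp by (simp add: mult.commute)
  qed
  then show ?thesis unfolding Q_def Nq_def SUP_mult_right_ennreal by (intro SUP_least)
qed

text \<open>The \<nu>-integral of the largest multiple of min(1,x/z)^p lying below
  \<open>gg \<psi>\<close>, the multiple being determined by equality at z = x. It measures how much
  of the Gamma integral a single competitor at x accounts for.\<close>

definition X where "X \<psi> x = gg \<psi> x * ennreal (sg x)"

text \<open>V' and x^p T' are each at most \<sigma>(x)/4, so removing both leaves at least half of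
  \<sigma>(x). This is what growth by the factor 4 is needed for.\<close>

lemma X_le:
  assumes x: "0 < x"
    and V': "V' \<le> sg x / 4" "V' \<le> V x" and T': "T' \<le> 1 / (4 * bb x)" "T' \<le> T x"
  shows "X \<psi> x \<le> 2 * (gg \<psi> x * ennreal (V x - V') + gg \<psi> x * ennreal (x powr p) * ennreal (T x - T'))"
proof -
  have "x powr p * T' \<le> x powr p * (1 / (4 * bb x))" using T' by (intro mult_left_mono) auto
  also have "\<dots> = sg x / 4" using x sg_pos[OF x] by (simp add: bb_def)
  finally have 1: "x powr p * T' \<le> sg x / 4" .
  define d where "d = x powr p * (T x - T')"
  have "sg x = (V x - V') + d + V' + x powr p * T'"
    by (simp add: d_def sg_def algebra_simps)
  then have "sg x \<le> 2 * ((V x - V') + d)" using 1 V'(1) by argo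
  then have "sg x \<le> 2 * ((V x - V') + x powr p * (T x - T'))" by (simp only: d_def)
  then have "ennreal (sg x) \<le> ennreal (2 * ((V x - V') + x powr p * (T x - T')))" by (rule ennreal_leI)
  also have "\<dots> = 2 * (ennreal (V x - V') + ennreal (x powr p) * ennreal (T x - T'))"
  proof -
    have "ennreal (2 * ((V x - V') + x powr p * (T x - T'))) = ennreal 2 * ennreal ((V x - V') + x powr p * (T x - T'))"
      by (rule ennreal_mult') simp
    also have "ennreal ((V x - V') + x powr p * (T x - T')) = ennreal (V x - V') + ennreal (x powr p * (T x - T'))"
      using V' T' by (intro ennreal_plus) auto
    also have "ennreal (x powr p * (T x - T')) = ennreal (x powr p) * ennreal (T x - T')"
      by (rule ennreal_mult') simp
    finally show ?thesis by simp
  qed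
  finally have "X \<psi> x \<le> gg \<psi> x * (2 * (ennreal (V x - V') + ennreal (x powr p) * ennreal (T x - T')))"
    unfolding X_def by (rule mult_left_mono) simp
  then show ?thesis by (simp add: distrib_left mult_ac)
qed

text \<open>\<open>gg \<psi>\<close> is nonincreasing, which settles z \<le> x, while z^p times it
  is nondecreasing, which settles z > x.\<close>

lemma X_upper:
  assumes \<psi>: "antimono \<psi>" and x: "0 < x"
  shows "X \<psi> x \<le> Gm \<psi>"
proof -
  have "X \<psi> x = (\<integral>\<^sup>+z. gg \<psi> x * ennreal (min 1 (x / z) powr p) \<partial>\<nu>)"
    unfolding X_def sg_eq_integral[OF x, symmetric] by (simp add: nn_integral_cmult)
  also have "\<dots> \<le> Gm \<psi>"
    unfolding Gm_def
  proof (rule nn_integral_mono_AE, use AE_nu_pos in eventually_elim)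
    case (elim z)
    show ?case
    proof (cases "z \<le> x")
      case True
      then show ?thesis using elim gg_antimono[OF \<psi> elim True] by (simp add: min_def)
    next
      case False
      have "gg \<psi> x * ennreal (min 1 (x / z) powr p) = gg \<psi> x * ennreal (x powr p) * ennreal (z powr - p)"
        using False x min_powr[of x z p] by (simp add: ennreal_mult mult.assoc)
      also have "\<dots> \<le> gg \<psi> z * ennreal (z powr p) * ennreal (z powr - p)"
        using False x by (intro mult_right_mono gg_mono_powr) auto
      also have "\<dots> = gg \<psi> z" using elim by (simp add: mult.assoc flip: ennreal_mult powr_add)
      finally show ?thesis .
    qed
  qed
  finally show ?thesis .
qed

text \<open>In \<sigma> at the k-th point, V is reduced by its value at the previous point and T by
  its value at the next one; the growth along the chain makes these reductions admissible for
  \<open>X_le\<close>. What remains of \<nu> are the blocks to the left and to the right of the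
  point. Every block is thus met once from each side, and with the factor 2 this gives 4.\<close>

lemma X_chain_sum:
  assumes \<psi>: "antimono \<psi>" and c: "chain xs n"
  shows "(\<Sum>k\<le>n. X \<psi> (xs k)) \<le> 4 * Gm \<psi>"
proof -
  note sp = chain_pos[OF c]
  define I where "I S = (\<integral>\<^sup>+z\<in>S. gg \<psi> z \<partial>\<nu>)" for S
  have I_mono: "I S \<le> I S'" if "S \<subseteq> S'" for S S'
    unfolding I_def using that by (intro nn_integral_mono mult_left_mono) (auto simp: indicator_def)
  have IG: "I S \<le> Gm \<psi>" for S unfolding I_def Gm_def by (intro nn_integral_mono) (auto simp: indicator_def)
  have st: "xs k \<le> xs (Suc k)" "4 * bb (xs k) \<le> bb (xs (Suc k))" "4 * sg (xs k) \<le> sg (xs (Suc k))" if "k < n" for k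
    using c that by (auto simp: chain_def step_def)
  have sumI: "(\<Sum>k<n. I {xs k<..xs (Suc k)}) = I {xs 0<..xs n}"
    unfolding I_def by (rule nn_integral_Ioc_sum) (use st in \<open>auto simp: sets_nu\<close>)
  have L: "gg \<psi> x * emeasure \<nu> S \<le> I S" if "S \<subseteq> {0<..x}" "S \<in> sets borel" for S x
  proof -
    have "gg \<psi> x * emeasure \<nu> S = (\<integral>\<^sup>+z. gg \<psi> x * indicator S z \<partial>\<nu>)"
      using that by (simp add: nn_integral_cmult sets_nu)
    also have "\<dots> \<le> I S"
      unfolding I_def using that gg_antimono[OF \<psi>] by (intro nn_integral_mono) (auto simp: indicator_def)
    finally show ?thesis .
  qed
  have Rr: "gg \<psi> x * ennreal (x powr p) * (\<integral>\<^sup>+z\<in>S. ennreal (z powr - p) \<partial>\<nu>) \<le> I S"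
    if "S \<subseteq> {x..}" "S \<in> sets borel" "0 < x" for S x
  proof -
    have [measurable]: "S \<in> sets borel" by fact
    have "gg \<psi> x * ennreal (x powr p) * (\<integral>\<^sup>+z\<in>S. ennreal (z powr - p) \<partial>\<nu>)
        = (\<integral>\<^sup>+z. gg \<psi> x * ennreal (x powr p) * (ennreal (z powr - p) * indicator S z) \<partial>\<nu>)"
      by (simp add: nn_integral_cmult)
    also have "\<dots> \<le> I S"
      unfolding I_def
    proof (intro nn_integral_mono)
      fix z
      show "gg \<psi> x * ennreal (x powr p) * (ennreal (z powr - p) * indicator S z) \<le> gg \<psi> z * indicator S z"
      proof (cases "z \<in> S")
        case True
        then have z: "x \<le> z" using that by auto
        have "gg \<psi> x * ennreal (x powr p) * ennreal (z powr - p) \<le> gg \<psi> z * ennreal (z powr p) * ennreal (z powr - p)"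
          using that z by (intro mult_right_mono gg_mono_powr) auto
        also have "\<dots> = gg \<psi> z" using z that by (simp add: mult.assoc flip: ennreal_mult powr_add)
        finally show ?thesis using True by simp
      qed simp
    qed
    finally show ?thesis .
  qed
  \<comment> \<open>The first left block reaches down to 0 and the last right block is unbounded,
    matching the absence of a reduction at the two ends.\<close>
  define A where "A k = (if k = 0 then {0<..xs 0} else {xs (k - 1)<..xs k})" for k
  define B where "B k = (if k = n then {xs n<..} else {xs k<..xs (Suc k)})" for k
  have emA: "ennreal (V (xs k) - (if k = 0 then 0 else V (xs (k - 1)))) = emeasure \<nu> (A k)" if k: "k \<le> n" for k
  proof (cases k)
    case 0
    have "emeasure \<nu> (A 0) = emeasure \<nu> {..<xs 0}"
      using AE_nu_pos AE_nu_neq[of "xs 0"] by (intro emeasure_eq_AE) (auto simp: A_def sets_nu)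
    then show ?thesis using 0 V[OF sp[of 0]] by simp
  next
    case (Suc j)
    have "emeasure \<nu> (A k) = emeasure \<nu> {xs j..<xs k}"
      using AE_nu_neq[of "xs j"] AE_nu_neq[of "xs k"] Suc by (intro emeasure_eq_AE) (auto simp: A_def sets_nu)
    also have "\<dots> = ennreal (V (xs k) - V (xs j))"
      using Suc k st[of j] sp[of j] by (intro emeasure_nu_Ico) auto
    finally show ?thesis using Suc by simp
  qed
  have emB: "ennreal (T (xs k) - (if k = n then 0 else T (xs (Suc k)))) = (\<integral>\<^sup>+z\<in>B k. ennreal (z powr - p) \<partial>\<nu>)" if k: "k \<le> n" for k
  proof (cases "k = n")
    case True
    then show ?thesis using T[OF sp[of n]] by (simp add: B_def)
  next
    case False
    then have "ennreal (T (xs k) - T (xs (Suc k))) = (\<integral>\<^sup>+z\<in>{xs k..<xs (Suc k)}. ennreal (z powr - p) \<partial>\<nu>)"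
      using k st[of k] sp[of k] by (intro T_diff(1)[symmetric]) auto
    also have "\<dots> = (\<integral>\<^sup>+z\<in>B k. ennreal (z powr - p) \<partial>\<nu>)"
      using False AE_nu_neq[of "xs k"] AE_nu_neq[of "xs (Suc k)"]
      by (intro nn_integral_cong_AE) (auto simp: B_def indicator_def)
    finally show ?thesis using False by simp
  qed
  have "X \<psi> (xs k) \<le> 2 * (I (A k) + I (B k))" if k: "k \<le> n" for k
  proof -
    have "X \<psi> (xs k) \<le> 2 * (gg \<psi> (xs k) * ennreal (V (xs k) - (if k = 0 then 0 else V (xs (k - 1))))
        + gg \<psi> (xs k) * ennreal (xs k powr p) * ennreal (T (xs k) - (if k = n then 0 else T (xs (Suc k)))))"
    proof (rule X_le[OF sp[OF k]])
      show "(if k = 0 then 0 else V (xs (k - 1))) \<le> V (xs k)"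
      proof (cases k)
        case (Suc j)
        then show ?thesis using V_mono[of "xs j" "xs k"] st(1)[of j] sp[of j] k by simp
      qed (use V_pos[OF sp[of 0]] in auto)
      show "(if k = 0 then 0 else V (xs (k - 1))) \<le> sg (xs k) / 4"
      proof (cases k)
        case (Suc j)
        have "V (xs j) \<le> sg (xs j)" using T_nonneg[of "xs j"] by (simp add: sg_def)
        also have "\<dots> \<le> sg (xs k) / 4" using st(3)[of j] k Suc by simp
        finally show ?thesis using Suc by simp
      qed (use sg_pos[OF sp[of 0]] in auto)
      show "(if k = n then 0 else T (xs (Suc k))) \<le> T (xs k)"
        using T_diff(2)[of "xs k" "xs (Suc k)"] st(1)[of k] sp[OF k] k T_nonneg[of "xs k"] by auto
      show "(if k = n then 0 else T (xs (Suc k))) \<le> 1 / (4 * bb (xs k))"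
      proof (cases "k = n")
        case False
        then have k': "k < n" using k by simp
        note pos = sp[of "Suc k"]
        have "T (xs (Suc k)) * bb (xs (Suc k)) \<le> 1"
          using sg_split[of "xs (Suc k)"] V_pos[of "xs (Suc k)"] sg_pos[of "xs (Suc k)"] pos k'
          by (smt (verit) divide_pos_pos Suc_leI)
        then have "T (xs (Suc k)) \<le> 1 / bb (xs (Suc k))" using bb_pos[OF pos] k' by (simp add: field_simps)
        also have "\<dots> \<le> 1 / (4 * bb (xs k))"
          using st(2)[OF k'] bb_pos[OF sp[OF k]] by (intro divide_left_mono) (auto intro!: mult_pos_pos)
        finally show ?thesis using False by simp
      qed (use bb_pos[OF sp[OF k]] in auto)
    qed
    also have "\<dots> \<le> 2 * (I (A k) + I (B k))"
      unfolding emA[OF k] emB[OF k]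
      using k sp[of 0] less_trans[OF sp[of "k - 1"]] sp[OF k] by (intro mult_left_mono add_mono L Rr) (auto simp: A_def B_def)
    finally show ?thesis .
  qed
  then have "(\<Sum>k\<le>n. X \<psi> (xs k)) \<le> (\<Sum>k\<le>n. 2 * (I (A k) + I (B k)))" by (intro sum_mono) auto
  also have "\<dots> = 2 * ((\<Sum>k\<le>n. I (A k)) + (\<Sum>k\<le>n. I (B k)))"
    by (simp only: sum_distrib_left[symmetric] sum.distrib)
  also have "(\<Sum>k\<le>n. I (A k)) = I {0<..xs 0} + I {xs 0<..xs n}"
    unfolding sumI[symmetric] by (subst sum.atMost_shift) (simp add: A_def)
  also have "\<dots> = I {0<..xs n}"
    unfolding I_def using sp[of 0] chain_pos_mono[OF c, of 0 n]
    by (subst nn_integral_add[symmetric]) (auto intro!: nn_integral_cong simp: indicator_def)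
  also have "\<dots> \<le> Gm \<psi>" by (rule IG)
  also have "(\<Sum>k\<le>n. I (B k)) = I {xs 0<..xs n} + I {xs n<..}"
    unfolding sumI[symmetric] by (simp add: B_def lessThan_Suc_atMost[symmetric])
  also have "\<dots> = I {xs 0<..}"
    unfolding I_def using chain_pos_mono[OF c, of 0 n]
    by (subst nn_integral_add[symmetric]) (auto intro!: nn_integral_cong simp: indicator_def)
  also have "\<dots> \<le> Gm \<psi>" by (rule IG)
  finally have "(\<Sum>k\<le>n. X \<psi> (xs k)) \<le> 2 * (Gm \<psi> + Gm \<psi>)" by (simp add: mult_left_mono add_mono)
  also have "\<dots> = 4 * Gm \<psi>"
    by (simp add: mult_2[symmetric] mult.assoc[symmetric])
  finally show ?thesis .
qed

end

text \<open>Exhaustion by the intervals from 1/(n+1) to n+1. It reduces estimates on the half-line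
  to intervals bounded away from 0 and infinity, where finite chains exist.\<close>

lemma nn_integral_Ioi_le:
  assumes sets [measurable_cong]: "sets m = sets borel" and [measurable]: "f \<in> borel_measurable borel"
    and le: "\<And>a z. 0 < a \<Longrightarrow> a \<le> z \<Longrightarrow> (\<integral>\<^sup>+x\<in>{a<..z}. f x \<partial>m) \<le> B"
  shows "(\<integral>\<^sup>+x\<in>{0::real<..}. f x \<partial>m) \<le> B"
proof -
  let ?S = "\<lambda>n. {1 / real (Suc n)<..real (Suc n)}"
  have mono: "?S i \<subseteq> ?S j" if "i \<le> j" for i j
  proof -
    have "1 / real (Suc j) \<le> 1 / real (Suc i)" using that by (intro frac_le) auto
    moreover have "real (Suc i) \<le> real (Suc j)" using that by simp
    ultimately show ?thesis by (meson greaterThanAtMost_iff le_less_trans order_trans subsetI)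
  qed
  have ex: "\<exists>i. x \<in> ?S i" if "0 < x" for x :: real
  proof -
    obtain i :: nat where i: "1 / real (Suc i) < x" using \<open>0 < x\<close> by (rule nat_approx_posE)
    obtain j :: nat where j: "x \<le> real j" using real_arch_simple by blast
    have "x \<in> ?S (max i j)" 
    proof -
      have "1 / real (Suc (max i j)) \<le> 1 / real (Suc i)" by (intro frac_le) auto
      then show ?thesis using i j by auto
    qed
    then show ?thesis ..
  qed
  have "(\<integral>\<^sup>+x\<in>{0<..}. f x \<partial>m) = (\<integral>\<^sup>+x. (SUP n. f x * indicator (?S n) x) \<partial>m)"
  proof (intro nn_integral_cong antisym)
    fix x :: real
    show "f x * indicator {0<..} x \<le> (SUP n. f x * indicator (?S n) x)"
    proof (cases "0 < x")
      case True
      then obtain i where "x \<in> ?S i" using ex by blast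
      then have "f x * indicator {0<..} x = f x * indicator (?S i) x" using True by simp
      also have "\<dots> \<le> (SUP n. f x * indicator (?S n) x)" by (rule SUP_upper) simp
      finally show ?thesis .
    qed simp
    show "(SUP n. f x * indicator (?S n) x) \<le> f x * indicator {0<..} x"
    proof (rule SUP_least)
      fix n
      have "0 < x" if "1 / real (Suc n) < x"
        by (rule less_trans[OF _ that]) simp
      then show "f x * indicator (?S n) x \<le> f x * indicator {0<..} x" by (auto simp: indicator_def)
    qed
  qed
  also have "\<dots> = (SUP n. \<integral>\<^sup>+x. f x * indicator (?S n) x \<partial>m)"
  proof (rule nn_integral_monotone_convergence_SUP)
    show "incseq (\<lambda>n x. f x * indicator (?S n) x)"
      unfolding incseq_def le_fun_def
      by (intro allI impI mult_left_mono indicator_leI) (erule (1) subsetD[OF mono], simp)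
  qed measurable
  also have "\<dots> \<le> B" 
    by (intro SUP_least le) (auto simp: field_simps)
  finally show ?thesis .
qed

text \<open>The distance of two indices: one of the truncated differences is 0.\<close>

definition ndist :: "nat \<Rightarrow> nat \<Rightarrow> nat" where "ndist k j = (k - j) + (j - k)"

lemma sum_power_ndist_le:
  fixes x :: real
  assumes "0 < x" "x < 1"
  shows "(\<Sum>k\<le>n. x ^ ndist k j) \<le> 2 / (1 - x)"
proof -
  have "(\<Sum>k\<le>n. x ^ ndist k j) \<le> (\<Sum>k\<in>{..j} \<union> {j..j+n}. x ^ ndist k j)"
    using assms by (intro sum_mono2) auto
  also have "\<dots> \<le> (\<Sum>k\<le>j. x ^ ndist k j) + (\<Sum>k\<in>{j..j+n}. x ^ ndist k j)"
    using assms by (subst sum_Un) (auto intro!: sum_nonneg)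
  also have "(\<Sum>k\<le>j. x ^ ndist k j) = (\<Sum>k\<le>j. x ^ k)"
    by (rule sum.reindex_bij_witness[of _ "\<lambda>k. j - k" "\<lambda>k. j - k"]) (auto simp: ndist_def)
  also have "(\<Sum>k\<in>{j..j+n}. x ^ ndist k j) = (\<Sum>k\<le>n. x ^ k)"
    by (rule sum.reindex_bij_witness[of _ "\<lambda>k. k + j" "\<lambda>k. k - j"]) (auto simp: ndist_def)
  also have "(\<Sum>k\<le>j. x ^ k) \<le> 1 / (1 - x)" "(\<Sum>k\<le>n. x ^ k) \<le> 1 / (1 - x)" 
    using assms by (auto simp: sum_gp0 divide_right_mono)
  then have "(\<Sum>k\<le>j. x ^ k) + (\<Sum>k\<le>n. x ^ k) \<le> 2 / (1 - x)" by simp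
  finally show ?thesis by simp
qed

definition geo :: "real \<Rightarrow> real \<Rightarrow> real" where "geo s e = (2 / (1 - 2 powr - (e / s))) powr s"

lemma geo_pos: "0 < s \<Longrightarrow> 0 < e \<Longrightarrow> 0 < geo s e"
proof -
  assume se: "0 < s" "0 < e"
  then have "2 powr - (e / s) < (1::real)" using powr_less_mono[of "- (e / s)" 0 2] by simp
  then show ?thesis using se by (simp add: geo_def)
qed

text \<open>A substitute for the triangle inequality that is valid for every s > 0. Around an
  arbitrary index j the terms are weighted with 2^(e|k-j|); each a_k is then at most 2^(-e|k-j|/s)
  times the s-th root of the weighted sum, and these bounds form a geometric series. The price is
  exponential growth in |k-j|, at a rate e of free choice.\<close>

lemma sum_epowr_geometric:
  fixes a :: "nat \<Rightarrow> ennreal"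
  assumes s: "0 < s" and e: "0 < e"
  shows "(\<Sum>k\<le>n. a k) epowr s \<le> ennreal (geo s e) * (\<Sum>k\<le>n. ennreal (2 powr (e * ndist k j)) * a k epowr s)"
proof -
  define Z where "Z = (\<Sum>k\<le>n. ennreal (2 powr (e * ndist k j)) * a k epowr s)"
  define x where "x = 2 powr - (e / s)"
  have x: "0 < x" "x < 1" using s e powr_less_mono[of "- (e / s)" 0 2] by (auto simp: x_def)
  have ak: "a k \<le> Z epowr (1 / s) * ennreal (x ^ ndist k j)" if k: "k \<le> n" for k
  proof -
    have "ennreal (2 powr (e * ndist k j)) * a k epowr s \<le> Z"
      unfolding Z_def using k by (intro member_le_sum) auto
    then have "(ennreal (2 powr (e * ndist k j)) * a k epowr s) epowr (1 / s) \<le> Z epowr (1 / s)"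
      using s by (intro epowr_mono) auto
    then have le: "ennreal (2 powr (e * ndist k j / s)) * a k \<le> Z epowr (1 / s)"
      using s by (simp add: epowr_mult epowr_ennreal epowr_epowr powr_powr)
    have "x ^ ndist k j * 2 powr (e * ndist k j / s) = 1"
      by (simp add: x_def powr_realpow[symmetric] powr_powr powr_add[symmetric])
    then have "a k = ennreal (2 powr (e * ndist k j / s)) * a k * ennreal (x ^ ndist k j)"
      using x by (simp add: mult_ac flip: ennreal_mult mult.assoc)
    also have "\<dots> \<le> Z epowr (1 / s) * ennreal (x ^ ndist k j)"
      by (intro mult_right_mono le) auto
    finally show ?thesis .
  qed
  have "(\<Sum>k\<le>n. a k) \<le> (\<Sum>k\<le>n. Z epowr (1 / s) * ennreal (x ^ ndist k j))"
    by (intro sum_mono ak) auto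
  also have "\<dots> = Z epowr (1 / s) * ennreal (\<Sum>k\<le>n. x ^ ndist k j)"
    using x by (simp add: sum_distrib_left[symmetric] sum_ennreal)
  also have "\<dots> \<le> Z epowr (1 / s) * ennreal (2 / (1 - x))"
    by (intro mult_left_mono ennreal_leI sum_power_ndist_le x) auto
  finally have "(\<Sum>k\<le>n. a k) epowr s \<le> (Z epowr (1 / s) * ennreal (2 / (1 - x))) epowr s"
    using s by (intro epowr_mono) auto
  also have "\<dots> = Z * ennreal (geo s e)"
    using s x by (simp add: epowr_mult epowr_inv epowr_ennreal geo_def x_def[symmetric])
  finally show ?thesis by (simp add: Z_def mult.commute)
qed

context gamma_data
begin

lemma X_powr:
  assumes "0 < x"
  shows "X \<psi> x epowr (q / p) = hh \<psi> x epowr q * ennreal (bb x powr - (q / p))"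
proof -
  have "sg x = x powr p * (1 / bb x)" using assms sg_pos[OF assms] by (simp add: bb_def)
  then have "X \<psi> x = gg \<psi> x * ennreal (x powr p) * ennreal (1 / bb x)"
    using bb_pos[OF assms] by (simp add: X_def mult.assoc flip: ennreal_mult)
  also have "\<dots> = hh \<psi> x epowr p * ennreal (1 / bb x)" using assms by (simp add: gg_powr)
  finally show ?thesis
    using p q bb_pos[OF assms]
    by (simp add: epowr_mult epowr_epowr epowr_ennreal powr_divide powr_minus_divide)
qed

text \<open>On the block \<psi> is replaced by its truncation at the height \<psi>(x) and at the
  endpoint y, a multiple of a competitor. If \<sigma> at most quadruples, the mean s of \<psi> over
  (0,x) bounds the height, and the truncation compares with \<open>Nq y\<close>. If b at most
  quadruples, s is the integral over (0,y) divided by x, and it compares with \<open>Nq x\<close>.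
  The factor 4^(q/p) exchanges the values of \<sigma>, or of b, at x and y.\<close>

lemma Lm_block:
  assumes \<psi>: "antimono \<psi>" and fin: "\<And>z. 0 < z \<Longrightarrow> hh \<psi> z < top" and x: "0 < x" and adj: "adj x y"
  shows "(\<integral>\<^sup>+z\<in>{x<..y}. \<psi> z epowr q \<partial>\<omega>)
    \<le> ennreal (4 powr (q / p)) * (X \<psi> x epowr (q / p) * Q y + X \<psi> y epowr (q / p) * Q x)"
proof -
  have xy: "x \<le> y" and y: "0 < y" using adj x by (auto simp: adj_def)
  define \<phi> where "\<phi> z = (if z \<le> y then min (\<psi> z) (\<psi> x) else 0)" for z
  have am: "antimono \<phi>"
    using \<psi> by (auto simp: \<phi>_def antimono_def intro: min.coboundedI1)
  have bl: "(\<integral>\<^sup>+z\<in>{x<..y}. \<psi> z epowr q \<partial>\<omega>) \<le> Lm \<phi>"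
    unfolding Lm_def
  proof (intro nn_integral_mono)
    fix z
    show "\<psi> z epowr q * indicator {x<..y} z \<le> \<phi> z epowr q"
      using \<psi> by (auto simp: \<phi>_def indicator_def min_def antimono_def intro: epowr_mono dest: less_imp_le)
  qed
  have h1: "hh \<phi> z \<le> \<psi> x * ennreal (min z y)" if "0 < z" for z
  proof -
    have "hh \<phi> z \<le> (\<integral>\<^sup>+t. \<psi> x * indicator {0..min z y} t \<partial>lborel)"
      unfolding hh_def by (intro nn_integral_mono) (auto simp: \<phi>_def indicator_def)
    also have "\<dots> = \<psi> x * ennreal (min z y)" using that y by (simp add: nn_integral_cmult)
    finally show ?thesis .
  qed
  have h2: "hh \<phi> z \<le> hh \<psi> y" for z
  proof -
    have "hh \<phi> z \<le> hh \<phi> (max z y)" by (rule hh_mono) simp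
    also have "\<dots> = (\<integral>\<^sup>+t. \<phi> t * indicator {0<..<y} t \<partial>lborel)"
      unfolding hh_def using AE_lborel_singleton[of y]
      by (intro nn_integral_cong_AE) (auto simp: \<phi>_def indicator_def)
    also have "\<dots> \<le> hh \<psi> y" unfolding hh_def by (intro nn_integral_mono) (auto simp: \<phi>_def indicator_def)
    finally show ?thesis .
  qed
  from adj consider "sg y \<le> 4 * sg x" | "bb y \<le> 4 * bb x" by (auto simp: adj_def)
  then show ?thesis
  proof cases
    case 1
    define s where "s = enn2real (hh \<psi> x) / x"
    have hx: "hh \<psi> x = ennreal (s * x)" using fin[OF x] x by (simp add: s_def)
    have s0: "0 \<le> s" using x by (simp add: s_def)
    have "\<psi> x * ennreal x \<le> ennreal s * ennreal x" using hh_ge[OF \<psi>, of x] x s0 by (simp add: hx ennreal_mult)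
    then have px: "\<psi> x \<le> ennreal s"
      using x by (metis ennreal_less_top ennreal_eq_0_iff ennreal_mult_le_mult_iff mult.commute not_le top.not_eq_extremum)
    have "Lm \<phi> \<le> ennreal s epowr q * Nq y"
    proof (rule Lm_le_Nq[OF am s0 _ y])
      fix z :: real assume z: "0 < z"
      show "hh \<phi> z \<le> ennreal s * ennreal (min z y)" using h1[OF z] px by (meson mult_right_mono order_trans zero_le)
    qed
    also have "\<dots> = ennreal s epowr q * (ennreal (sg y powr (q / p)) * Q y)" using Nq_eq_Q[OF y] by (simp add: mult_ac)
    also have "ennreal (sg y powr (q / p)) \<le> ennreal (4 powr (q / p)) * ennreal (sg x powr (q / p))"
    proof -
      have "sg y powr (q / p) \<le> (4 * sg x) powr (q / p)" using 1 p q sg_pos[OF y] by (intro powr_mono2) auto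
      then show ?thesis using sg_pos[OF x] by (simp add: powr_mult ennreal_leI flip: ennreal_mult)
    qed
    also have "ennreal s epowr q * (ennreal (4 powr (q / p)) * ennreal (sg x powr (q / p)) * Q y)
        = ennreal (4 powr (q / p)) * ((ennreal s epowr q * ennreal (sg x powr (q / p))) * Q y)"
      by (simp only: mult_ac)
    also have "ennreal s epowr q * ennreal (sg x powr (q / p)) = X \<psi> x epowr (q / p)"
    proof (cases "s = 0")
      case True
      then show ?thesis using q hx x by (simp add: X_powr)
    next
      case False
      have "bb x powr - (q / p) = sg x powr (q / p) * x powr - q"
        using sg_pos[OF x] x p by (simp add: bb_def powr_minus_divide powr_divide powr_powr)
      then show ?thesis using False s0 x
        by (simp add: X_powr hx epowr_ennreal powr_mult powr_minus flip: ennreal_mult)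
    qed
    finally have "Lm \<phi> \<le> ennreal (4 powr (q / p)) * (X \<psi> x epowr (q / p) * Q y)" by (simp add: mult_left_mono mult_right_mono)
    also have "\<dots> \<le> ennreal (4 powr (q / p)) * (X \<psi> x epowr (q / p) * Q y + X \<psi> y epowr (q / p) * Q x)"
      by (intro mult_left_mono) auto
    finally show ?thesis using bl by simp
  next
    case 2
    \<comment> \<open>Now s x is the whole integral over (0,y). It still bounds the height, because
      already the integral over (0,x) is at least x \<psi>(x).\<close>
    define s where "s = enn2real (hh \<psi> y) / x"
    have hy: "hh \<psi> y = ennreal (s * x)" using fin[OF y] x by (simp add: s_def)
    have s0: "0 \<le> s" using x by (simp add: s_def)
    have "\<psi> x * ennreal x \<le> ennreal s * ennreal x"
      using hh_ge[OF \<psi>, of x] x s0 hh_mono[OF xy, of \<psi>] hy by (simp add: ennreal_mult)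
    then have px: "\<psi> x \<le> ennreal s"
      using x by (metis ennreal_less_top ennreal_eq_0_iff ennreal_mult_le_mult_iff mult.commute not_le top.not_eq_extremum)
    have "Lm \<phi> \<le> ennreal s epowr q * Nq x"
    proof (rule Lm_le_Nq[OF am s0 _ x])
      fix z :: real assume z: "0 < z"
      have "hh \<phi> z \<le> ennreal s * ennreal z"
        using h1[OF z] px z y by (elim order_trans) (auto intro!: mult_mono ennreal_leI)
      moreover have "hh \<phi> z \<le> ennreal s * ennreal x" using h2[of z] hy s0 x by (simp add: ennreal_mult)
      ultimately show "hh \<phi> z \<le> ennreal s * ennreal (min z x)" by (simp add: min_def)
    qed
    also have "\<dots> = ennreal s epowr q * (ennreal (sg x powr (q / p)) * Q x)" using Nq_eq_Q[OF x] by (simp add: mult_ac)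
    also have "\<dots> = (ennreal s epowr q * ennreal (sg x powr (q / p))) * Q x" by (simp only: mult_ac)
    also have "ennreal s epowr q * ennreal (sg x powr (q / p)) \<le> ennreal (4 powr (q / p)) * X \<psi> y epowr (q / p)"
    proof (cases "s = 0")
      case True
      then show ?thesis using q by simp
    next
      case False
      have "bb y powr - (q / p) * 4 powr (q / p) = (bb y / 4) powr - (q / p)"
        using bb_pos[OF y] by (simp add: powr_divide powr_minus_divide)
      also have "\<dots> \<ge> bb x powr - (q / p)"
        using 2 p q bb_pos[OF y] by (intro powr_mono2') auto
      also have "bb x powr - (q / p) = sg x powr (q / p) * x powr - q"
        using sg_pos[OF x] x p by (simp add: bb_def powr_minus_divide powr_divide powr_powr)
      finally have *: "(s * x) powr q * (sg x powr (q / p) * x powr - q) \<le> (s * x) powr q * (bb y powr - (q / p) * 4 powr (q / p))"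
        by (intro mult_left_mono) auto
      have e: "(s * x) powr q * (sg x powr (q / p) * x powr - q) = s powr q * sg x powr (q / p)"
        using s0 x by (simp add: powr_mult powr_minus)
      have "s powr q * sg x powr (q / p) \<le> 4 powr (q / p) * ((s * x) powr q * bb y powr - (q / p))"
        using * unfolding e by (simp only: mult_ac)
      then show ?thesis using False s0 x y
        by (simp add: X_powr hy epowr_ennreal ennreal_leI flip: ennreal_mult)
    qed
    finally have "Lm \<phi> \<le> ennreal (4 powr (q / p)) * (X \<psi> y epowr (q / p) * Q x)" by (simp add: mult_right_mono mult.assoc)
    also have "\<dots> \<le> ennreal (4 powr (q / p)) * (X \<psi> x epowr (q / p) * Q y + X \<psi> y epowr (q / p) * Q x)"
      by (intro mult_left_mono) auto
    finally show ?thesis using bl by simp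
  qed
qed

lemma hh_finite:
  assumes "antimono \<psi>" "Gm \<psi> \<le> 1" "0 < z"
  shows "hh \<psi> z < top"
proof -
  have "X \<psi> z \<le> 1" using X_upper[OF assms(1,3)] assms(2) by simp
  then have "gg \<psi> z \<noteq> top" using sg_pos[OF assms(3)] by (auto simp: X_def ennreal_top_mult top_unique)
  then have "hh \<psi> z \<noteq> top" using p by (auto simp: gg_def ennreal_top_divide)
  then show ?thesis by (simp add: less_top)
qed

text \<open>The hypothesis \<open>Y\<close> separates the products in \<open>Lm_block\<close>. It is
  met with bounded Q and F = 0 if p \<le> q, and by Young's inequality, with F proportional to a
  power of Q, if q < p. The 10 is 5 + 5, for the left and the right ends of the blocks.\<close>

lemma Lm_chain_le:
  assumes \<psi>: "antimono \<psi>" and G: "Gm \<psi> \<le> 1" and c: "chain xs n" and a: "\<And>k. k \<le> n \<Longrightarrow> adj (xs k) (xs (Suc k))"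
    and Y: "\<And>x y. 0 < x \<Longrightarrow> 0 < y \<Longrightarrow> X \<psi> x epowr (q / p) * Q y \<le> b * (X \<psi> x + F y)"
    and F: "(\<Sum>k\<le>n. F (xs k)) + F (xs (Suc n)) \<le> B"
  shows "(\<integral>\<^sup>+z\<in>{xs 0<..xs (Suc n)}. \<psi> z epowr q \<partial>\<omega>) \<le> ennreal (4 powr (q / p)) * (b * (10 + 2 * B))"
proof -
  have [measurable]: "\<psi> \<in> borel_measurable borel" by (rule antimono_ennreal_borel[OF \<psi>])
  have pos: "0 < xs k" if "k \<le> Suc n" for k
    using that chain_pos[OF c, of k] chain_pos[OF c, of n] a[of n] by (auto simp: le_Suc_eq adj_def)
  have "(\<integral>\<^sup>+z\<in>{xs 0<..xs (Suc n)}. \<psi> z epowr q \<partial>\<omega>) = (\<Sum>k<Suc n. \<integral>\<^sup>+z\<in>{xs k<..xs (Suc k)}. \<psi> z epowr q \<partial>\<omega>)"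
    by (rule nn_integral_Ioc_sum[symmetric]) (use a sets_om in \<open>auto simp: adj_def\<close>)
  also have "\<dots> \<le> (\<Sum>k<Suc n. ennreal (4 powr (q / p)) * (b * ((X \<psi> (xs k) + X \<psi> (xs (Suc k))) + (F (xs k) + F (xs (Suc k))))))"
  proof (rule sum_mono)
    fix k assume k: "k \<in> {..<Suc n}"
    have "(\<integral>\<^sup>+z\<in>{xs k<..xs (Suc k)}. \<psi> z epowr q \<partial>\<omega>)
      \<le> ennreal (4 powr (q / p)) * (X \<psi> (xs k) epowr (q / p) * Q (xs (Suc k)) + X \<psi> (xs (Suc k)) epowr (q / p) * Q (xs k))"
      using k by (intro Lm_block \<psi> hh_finite[OF \<psi> G] pos a) auto
    also have "\<dots> \<le> ennreal (4 powr (q / p)) * (b * (X \<psi> (xs k) + F (xs (Suc k))) + b * (X \<psi> (xs (Suc k)) + F (xs k)))"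
      using k by (intro mult_left_mono add_mono Y pos) auto
    also have "\<dots> = ennreal (4 powr (q / p)) * (b * ((X \<psi> (xs k) + X \<psi> (xs (Suc k))) + (F (xs k) + F (xs (Suc k)))))"
      by (simp only: distrib_left add_ac)
    finally show "(\<integral>\<^sup>+z\<in>{xs k<..xs (Suc k)}. \<psi> z epowr q \<partial>\<omega>)
      \<le> ennreal (4 powr (q / p)) * (b * ((X \<psi> (xs k) + X \<psi> (xs (Suc k))) + (F (xs k) + F (xs (Suc k)))))" .
  qed
  also have "\<dots> = ennreal (4 powr (q / p)) * (b * (((\<Sum>k<Suc n. X \<psi> (xs k)) + (\<Sum>k<Suc n. X \<psi> (xs (Suc k))))
      + ((\<Sum>k<Suc n. F (xs k)) + (\<Sum>k<Suc n. F (xs (Suc k))))))"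
    by (simp only: sum_distrib_left[symmetric] sum.distrib)
  also have "\<dots> \<le> ennreal (4 powr (q / p)) * (b * ((5 + 5) + (B + B)))"
  proof (intro mult_left_mono add_mono)
    have shift: "(\<Sum>k<Suc n. f (xs (Suc k))) \<le> (\<Sum>k\<le>n. f (xs k)) + f (xs (Suc n))" for f :: "real \<Rightarrow> ennreal"
    proof -
      have "(\<Sum>k<Suc n. f (xs (Suc k))) \<le> f (xs 0) + (\<Sum>k<Suc n. f (xs (Suc k)))" by (simp add: add_increasing)
      also have "\<dots> = (\<Sum>k\<le>Suc n. f (xs k))" by (rule sum.atMost_shift[symmetric])
      finally show ?thesis by simp
    qed
    \<comment> \<open>4 for the chain, and 1 for the endpoint, to which the chain estimate does not
      extend.\<close>
    have X5: "(\<Sum>k\<le>n. X \<psi> (xs k)) + X \<psi> (xs (Suc n)) \<le> 5"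
    proof -
      have "(\<Sum>k\<le>n. X \<psi> (xs k)) + X \<psi> (xs (Suc n)) \<le> 4 * 1 + 1"
        using X_chain_sum[OF \<psi> c] X_upper[OF \<psi> pos[of "Suc n"]] G mult_left_mono[OF G, of 4]
        by (intro add_mono) auto
      then show ?thesis by simp
    qed
    show "(\<Sum>k<Suc n. X \<psi> (xs (Suc k))) \<le> 5" using shift X5 by (rule order_trans)
    show "(\<Sum>k<Suc n. F (xs (Suc k))) \<le> B" using shift F by (rule order_trans)
    have "(\<Sum>k<Suc n. X \<psi> (xs k)) \<le> (\<Sum>k\<le>n. X \<psi> (xs k)) + X \<psi> (xs (Suc n))" by (simp only: lessThan_Suc_atMost add_increasing2 zero_le order_refl)
    then show "(\<Sum>k<Suc n. X \<psi> (xs k)) \<le> 5" using X5 by (rule order_trans)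
    have "(\<Sum>k<Suc n. F (xs k)) \<le> (\<Sum>k\<le>n. F (xs k)) + F (xs (Suc n))" by (simp only: lessThan_Suc_atMost add_increasing2 zero_le order_refl)
    then show "(\<Sum>k<Suc n. F (xs k)) \<le> B" using F by (rule order_trans)
  qed auto
  also have "\<dots> = ennreal (4 powr (q / p)) * (b * (10 + 2 * B))" by (simp add: mult_2)
  finally show ?thesis .
qed

lemma Lm_Ioi:
  assumes "antimono \<psi>"
  shows "Lm \<psi> = (\<integral>\<^sup>+z\<in>{0<..}. \<psi> z epowr q \<partial>\<omega>)"
  unfolding Lm_def by (rule nn_integral_cong_AE, use AE_om_pos in eventually_elim) auto

lemma Dq_leI:
  assumes "\<And>\<psi> xs n. antimono \<psi> \<Longrightarrow> Gm \<psi> \<le> 1 \<Longrightarrow> chain xs n \<Longrightarrow> (\<And>k. k \<le> n \<Longrightarrow> adj (xs k) (xs (Suc k)))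
    \<Longrightarrow> (\<integral>\<^sup>+z\<in>{xs 0<..xs (Suc n)}. \<psi> z epowr q \<partial>\<omega>) \<le> B"
  shows "Dq \<le> B"
  unfolding Dq_def
proof (rule Sup_least)
  fix l assume "l \<in> {Lm \<psi> |\<psi>. antimono \<psi> \<and> Gm \<psi> \<le> 1}"
  then obtain \<psi> where \<psi>: "antimono \<psi>" "Gm \<psi> \<le> 1" and l: "l = Lm \<psi>" by blast
  have [measurable]: "\<psi> \<in> borel_measurable borel" by (rule antimono_ennreal_borel[OF \<psi>(1)])
  show "l \<le> B"
    unfolding l Lm_Ioi[OF \<psi>(1)]
  proof (rule nn_integral_Ioi_le)
    fix a z :: real assume "0 < a" "a \<le> z"
    then obtain xs n where "chain xs n" "xs 0 = a" "xs (Suc n) = z" "\<And>k. k \<le> n \<Longrightarrow> adj (xs k) (xs (Suc k))"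
      using chain_exists by blast
    then show "(\<integral>\<^sup>+z\<in>{a<..z}. \<psi> z epowr q \<partial>\<omega>) \<le> B" using assms[OF \<psi>, of xs n] by simp
  qed (auto simp: sets_om)
qed

text \<open>\<open>X\<close> is at most 1, so for q/p \<ge> 1 its power is at most \<open>X\<close>
  itself, whose sum along a chain is controlled.\<close>

lemma Dq_le_sup:
  assumes pq: "p \<le> q" and A: "\<And>x. 0 < x \<Longrightarrow> Q x \<le> A"
  shows "Dq \<le> ennreal (10 * 4 powr (q / p)) * A"
proof (rule Dq_leI)
  fix \<psi> xs n
  assume \<psi>: "antimono \<psi>" and G: "Gm \<psi> \<le> 1" and c: "chain xs n" and a: "\<And>k. k \<le> n \<Longrightarrow> adj (xs k) (xs (Suc k))"
  have "(\<integral>\<^sup>+z\<in>{xs 0<..xs (Suc n)}. \<psi> z epowr q \<partial>\<omega>) \<le> ennreal (4 powr (q / p)) * (A * (10 + 2 * 0))"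
  proof (rule Lm_chain_le[OF \<psi> G c a, where F = "\<lambda>_. 0"])
    fix x y :: real assume xy: "0 < x" "0 < y"
    have X1: "X \<psi> x \<le> 1" using X_upper[OF \<psi> xy(1)] G by simp
    have "X \<psi> x epowr (q / p) \<le> X \<psi> x epowr 1"
    proof (cases "X \<psi> x" rule: ennreal_cases_pos)
      case (3 r)
      then have "r \<le> 1" using X1 by (simp add: ennreal_le_1)
      then have "r powr (q / p) \<le> r powr 1" using 3 pq p by (intro powr_mono') auto
      then show ?thesis using 3 by (auto simp: epowr_ennreal intro!: ennreal_leI)
    qed (use p q X1 in auto)
    then have "X \<psi> x epowr (q / p) * Q y \<le> X \<psi> x * A" using A[OF xy(2)] by (simp add: mult_mono)
    then show "X \<psi> x epowr (q / p) * Q y \<le> A * (X \<psi> x + 0)" by (simp add: mult.commute)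
  qed simp_all
  also have "\<dots> = ennreal (10 * 4 powr (q / p)) * A" by (simp add: ennreal_mult' mult_ac)
  finally show "(\<integral>\<^sup>+z\<in>{xs 0<..xs (Suc n)}. \<psi> z epowr q \<partial>\<omega>) \<le> ennreal (10 * 4 powr (q / p)) * A" .
qed

end

section \<open>The case \<open>q < p\<close>\<close>

locale gamma_data_less = gamma_data +
  assumes qp: "q < p"
begin

text \<open>The exponent conjugate to p/q, as it arises when sums of q-th powers are bounded under a
  constraint on p-th powers.\<close>

definition \<rho> where "\<rho> = p / (p - q)"
definition R where "R x = Q x epowr \<rho>"

lemma \<rho>_pos: "0 < \<rho>" using p qp by (simp add: \<rho>_def)

lemma R_measurable' [measurable]: "R \<in> borel_measurable borel"
  unfolding R_def[abs_def] by measurable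

lemma Q_step_sg:
  assumes "0 < x" "x \<le> y" "sg y \<le> 4 * sg x"
  shows "Q x \<le> ennreal (4 powr (q / p)) * Q y"
proof -
  have y: "0 < y" using assms by simp
  have "sg x powr - (q / p) \<le> (sg y / 4) powr - (q / p)"
    using assms p q sg_pos[OF y] by (intro powr_mono2') auto
  also have "\<dots> = 4 powr (q / p) * sg y powr - (q / p)"
    using sg_pos[OF y] by (simp add: powr_divide powr_minus_divide)
  finally have "ennreal (sg x powr - (q / p)) \<le> ennreal (4 powr (q / p)) * ennreal (sg y powr - (q / p))"
    by (simp add: ennreal_leI flip: ennreal_mult)
  then have "Q x \<le> Nq y * (ennreal (4 powr (q / p)) * ennreal (sg y powr - (q / p)))"
    unfolding Q_def using assms by (intro mult_mono Nq_mono) auto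
  then show ?thesis by (simp add: Q_def mult_ac)
qed

text \<open>\<open>Q\<close> is Nq x / x^q times b^(q/p). The first factor is nonincreasing by
  \<open>Nq_avg\<close>, the second grows by at most 4^(q/p).\<close>

lemma Q_step_bb:
  assumes "0 < x" "x \<le> y" "bb y \<le> 4 * bb x"
  shows "Q y \<le> ennreal (4 powr (q / p)) * Q x"
proof -
  have y: "0 < y" using assms by simp
  have e: "z powr q * sg z powr - (q / p) = bb z powr (q / p)" if "0 < z" for z
    using that sg_pos[OF that] p by (simp add: bb_def powr_divide powr_powr powr_minus_divide)
  have "bb y powr (q / p) \<le> (4 * bb x) powr (q / p)"
    using assms p q bb_pos[OF y] by (intro powr_mono2) auto
  also have "\<dots> = 4 powr (q / p) * bb x powr (q / p)" using bb_pos[of x] assms by (simp add: powr_mult)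
  finally have "x powr - q * bb y powr (q / p) \<le> x powr - q * (4 powr (q / p) * bb x powr (q / p))"
    by (intro mult_left_mono) auto
  moreover have "(y / x) powr q * sg y powr - (q / p) = x powr - q * bb y powr (q / p)"
    using assms y by (simp add: e[symmetric] powr_divide powr_minus_divide)
  moreover have "x powr - q * (4 powr (q / p) * bb x powr (q / p)) = 4 powr (q / p) * sg x powr - (q / p)"
    using assms by (simp add: e[symmetric] powr_minus_divide)
  ultimately have *: "ennreal ((y / x) powr q) * ennreal (sg y powr - (q / p)) \<le> ennreal (4 powr (q / p)) * ennreal (sg x powr - (q / p))"
    by (simp add: ennreal_leI flip: ennreal_mult)
  have "Q y \<le> (ennreal ((y / x) powr q) * Nq x) * ennreal (sg y powr - (q / p))"
    unfolding Q_def using assms by (intro mult_right_mono Nq_avg) auto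
  also have "\<dots> = Nq x * (ennreal ((y / x) powr q) * ennreal (sg y powr - (q / p)))" by (simp only: mult_ac)
  also have "\<dots> \<le> Nq x * (ennreal (4 powr (q / p)) * ennreal (sg x powr - (q / p)))"
    by (intro mult_left_mono *) auto
  finally show ?thesis by (simp add: Q_def mult_ac)
qed

definition KR where "KR = 4 powr (q / (p - q))"

lemma KR_epowr: "ennreal (4 powr (q / p)) epowr \<rho> = ennreal KR"
  using p qp by (simp add: epowr_ennreal powr_powr \<rho>_def KR_def)

sublocale gamma_weighted p q \<nu> \<omega> R KR
proof
  show "1 \<le> KR" using p q qp by (auto simp: KR_def intro: ge_one_powr_ge_zero)
  fix x y :: real assume xy: "0 < x" "x \<le> y"
  { assume "sg y \<le> 4 * sg x"
    from epowr_mono[OF less_imp_le[OF \<rho>_pos] Q_step_sg[OF xy this]]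
    show "R x \<le> ennreal KR * R y" by (simp add: R_def epowr_mult \<rho>_pos KR_epowr) }
  { assume "bb y \<le> 4 * bb x"
    from epowr_mono[OF less_imp_le[OF \<rho>_pos] Q_step_bb[OF xy this]]
    show "R y \<le> ennreal KR * R x" by (simp add: R_def epowr_mult \<rho>_pos KR_epowr) }
qed measurable

definition EE where "EE = (\<integral>\<^sup>+z\<in>{0<..}. R z * ennreal (mm z) \<partial>lborel)"
text \<open>By \<open>R_eq_bb\<close> and \<open>R_eq_sg\<close>, R is a product of powers of
  monotone factors whose limits at 0, or at infinity, are these infima and suprema.
  \<open>E0\<close> and \<open>E1\<close> are the products of the limits, with
  \<open>0 * top = 0\<close>.\<close>

definition E0 where "E0 = (INF x\<in>{0<..}. ennreal (bb x)) epowr (q / (p - q)) * (SUP x\<in>{0<..}. (Nq x * ennreal (x powr - q)) epowr \<rho>)"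
definition E1 where "E1 = (INF x\<in>{0<..}. ennreal (1 / sg x)) epowr (q / (p - q)) * emeasure \<omega> UNIV epowr \<rho>"

lemma R_eq_bb: "0 < x \<Longrightarrow> R x = (Nq x * ennreal (x powr - q)) epowr \<rho> * ennreal (bb x) epowr (q / (p - q))"
proof -
  assume x: "0 < x"
  have "sg x powr - (q / p) = x powr - q * bb x powr (q / p)"
    using x p sg_pos[OF x] by (simp add: bb_def powr_divide powr_powr powr_minus_divide)
  then have "Q x = Nq x * ennreal (x powr - q) * ennreal (bb x powr (q / p))"
    by (simp add: Q_def ennreal_mult mult.assoc)
  then have "R x = (Nq x * ennreal (x powr - q)) epowr \<rho> * ennreal (bb x powr (q / p)) epowr \<rho>"
    by (simp add: R_def epowr_mult \<rho>_pos)
  also have "ennreal (bb x powr (q / p)) epowr \<rho> = ennreal (bb x) epowr (q / (p - q))"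
    using bb_pos[OF x] p qp by (simp add: epowr_ennreal powr_powr \<rho>_def)
  finally show ?thesis .
qed

lemma R_eq_sg: "0 < x \<Longrightarrow> R x = Nq x epowr \<rho> * ennreal (1 / sg x) epowr (q / (p - q))"
proof -
  assume x: "0 < x"
  have "R x = Nq x epowr \<rho> * ennreal (sg x powr - (q / p)) epowr \<rho>"
    by (simp add: R_def Q_def epowr_mult \<rho>_pos)
  also have "ennreal (sg x powr - (q / p)) epowr \<rho> = ennreal (sg x powr (- (q / p) * \<rho>))"
    using sg_pos[OF x] by (simp add: epowr_ennreal powr_powr)
  also have "- (q / p) * \<rho> = - (q / (p - q))" using p by (simp add: \<rho>_def)
  also have "ennreal (sg x powr - (q / (p - q))) = ennreal (1 / sg x) epowr (q / (p - q))"
    using sg_pos[OF x] by (simp add: epowr_ennreal powr_minus_divide powr_divide)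
  finally show ?thesis .
qed

lemma R_le_Dq: "0 < x \<Longrightarrow> R x \<le> Dq epowr \<rho>"
  unfolding R_def by (intro epowr_mono Q_le_Dq) (use \<rho>_pos in auto)

lemma E0_le: "E0 \<le> Dq epowr \<rho>"
  unfolding E0_def SUP_mult_left_ennreal
proof (rule SUP_least)
  fix x :: real assume "x \<in> {0<..}"
  then have x: "0 < x" by simp
  have "(INF x\<in>{0<..}. ennreal (bb x)) epowr (q / (p - q)) \<le> ennreal (bb x) epowr (q / (p - q))"
    using x p q qp by (intro epowr_mono INF_lower) auto
  then have "(INF x\<in>{0<..}. ennreal (bb x)) epowr (q / (p - q)) * (Nq x * ennreal (x powr - q)) epowr \<rho> \<le> R x"
    unfolding R_eq_bb[OF x] by (subst mult.commute) (rule mult_left_mono, auto)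
  then show "(INF x\<in>{0<..}. ennreal (bb x)) epowr (q / (p - q)) * (Nq x * ennreal (x powr - q)) epowr \<rho> \<le> Dq epowr \<rho>"
    using R_le_Dq[OF x] by simp
qed

lemma om_UNIV_SUP: "emeasure \<omega> UNIV = (SUP x\<in>{0<..}. Nq x)"
proof (rule antisym)
  show "emeasure \<omega> UNIV \<le> (SUP x\<in>{0<..}. Nq x)"
    unfolding emeasure_UNIV_SUP_lessThan[OF sets_om]
  proof (rule SUP_least)
    fix n :: nat
    have "emeasure \<omega> {..<real n} \<le> emeasure \<omega> {..<real (Suc n)}"
      by (intro emeasure_mono) (auto simp: sets_om)
    also have "\<dots> \<le> Nq (real (Suc n))" by (rule Nq_ge) simp
    also have "\<dots> \<le> (SUP x\<in>{0<..}. Nq x)" by (rule SUP_upper) simp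
    finally show "emeasure \<omega> {..<real n} \<le> (SUP x\<in>{0<..}. Nq x)" .
  qed
qed (intro SUP_least Nq_le)

lemma E1_le: "E1 \<le> Dq epowr \<rho>"
  unfolding E1_def om_UNIV_SUP epowr_SUP[OF \<rho>_pos] SUP_mult_left_ennreal
proof (rule SUP_least)
  fix x :: real assume "x \<in> {0<..}"
  then have x: "0 < x" by simp
  have "(INF x\<in>{0<..}. ennreal (1 / sg x)) epowr (q / (p - q)) \<le> ennreal (1 / sg x) epowr (q / (p - q))"
    using x p q qp by (intro epowr_mono INF_lower) auto
  then have "(INF x\<in>{0<..}. ennreal (1 / sg x)) epowr (q / (p - q)) * Nq x epowr \<rho> \<le> R x"
    unfolding R_eq_sg[OF x] by (subst mult.commute) (rule mult_left_mono, auto)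
  then show "(INF x\<in>{0<..}. ennreal (1 / sg x)) epowr (q / (p - q)) * Nq x epowr \<rho> \<le> Dq epowr \<rho>"
    using R_le_Dq[OF x] by simp
qed

lemma chain_R_sum_le:
  assumes c: "chain xs n"
  shows "(\<Sum>k\<le>n. R (xs k)) \<le> ennreal (4 * KR) * (EE + E0 + E1)"
  unfolding EE_def
proof (rule chain_sum_le[OF c])
  fix x :: real assume x: "0 < x"
  { assume *: "\<And>a. 0 < a \<Longrightarrow> a \<le> x \<Longrightarrow> bb x < 4 * bb a"
    \<comment> \<open>If b stays above b(x)/4 to the left of x, its limit at 0 is at least b(x)/4,
      and \<open>E0\<close> dominates R(x).\<close>
    have "ennreal (bb x / 4) \<le> (INF x\<in>{0<..}. ennreal (bb x))"
    proof (rule INF_greatest)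
      fix a :: real assume "a \<in> {0<..}"
      then show "ennreal (bb x / 4) \<le> ennreal (bb a)"
        using *[of a] bb_mono[OF x, of a] bb_pos[OF x] by (intro ennreal_leI) (cases "a \<le> x", auto)
    qed
    then have "(ennreal 4 * ennreal (bb x / 4)) epowr (q / (p - q)) \<le> (ennreal 4 * (INF x\<in>{0<..}. ennreal (bb x))) epowr (q / (p - q))"
      using p q qp by (intro epowr_mono mult_left_mono) auto
    moreover have "ennreal 4 * ennreal (bb x / 4) = ennreal (bb x)"
      by (subst ennreal_mult'[symmetric]) auto
    moreover have "ennreal 4 epowr (q / (p - q)) = ennreal KR" by (simp only: KR_def epowr_ennreal zero_less_numeral)
    ultimately have "ennreal (bb x) epowr (q / (p - q)) \<le> ennreal KR * (INF x\<in>{0<..}. ennreal (bb x)) epowr (q / (p - q))"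
      using p q qp by (simp only: epowr_mult divide_pos_pos diff_gt_0_iff_gt)
    then have "R x \<le> (SUP x\<in>{0<..}. (Nq x * ennreal (x powr - q)) epowr \<rho>) * (ennreal KR * (INF x\<in>{0<..}. ennreal (bb x)) epowr (q / (p - q)))"
      unfolding R_eq_bb[OF x] using x by (intro mult_mono SUP_upper) auto
    then show "R x \<le> ennreal KR * E0" by (simp add: E0_def mult_ac) }
  { assume *: "\<And>c. x \<le> c \<Longrightarrow> sg c < 4 * sg x"
    have "ennreal (1 / sg x / 4) \<le> (INF x\<in>{0<..}. ennreal (1 / sg x))"
    proof (rule INF_greatest)
      fix a :: real assume "a \<in> {0<..}"
      then have a: "0 < a" by simp
      have "sg a \<le> 4 * sg x"
        using *[of a] sg_mono[OF a, of x] sg_pos[OF x] by (cases "x \<le> a") auto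
      then have "1 / (4 * sg x) \<le> 1 / sg a" using sg_pos[OF a] by (intro divide_left_mono) (auto intro!: mult_pos_pos sg_pos x)
      then show "ennreal (1 / sg x / 4) \<le> ennreal (1 / sg a)" by (intro ennreal_leI) (simp add: mult.commute)
    qed
    then have "(ennreal 4 * ennreal (1 / sg x / 4)) epowr (q / (p - q)) \<le> (ennreal 4 * (INF x\<in>{0<..}. ennreal (1 / sg x))) epowr (q / (p - q))"
      using p q qp by (intro epowr_mono mult_left_mono) auto
    moreover have "ennreal 4 * ennreal (1 / sg x / 4) = ennreal (1 / sg x)"
      by (subst ennreal_mult'[symmetric]) auto
    moreover have "ennreal 4 epowr (q / (p - q)) = ennreal KR" by (simp only: KR_def epowr_ennreal zero_less_numeral)
    ultimately have "ennreal (1 / sg x) epowr (q / (p - q)) \<le> ennreal KR * (INF x\<in>{0<..}. ennreal (1 / sg x)) epowr (q / (p - q))"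
      using p q qp by (simp only: epowr_mult divide_pos_pos diff_gt_0_iff_gt)
    then have "R x \<le> emeasure \<omega> UNIV epowr \<rho> * (ennreal KR * (INF x\<in>{0<..}. ennreal (1 / sg x)) epowr (q / (p - q)))"
      unfolding R_eq_sg[OF x] using \<rho>_pos by (intro mult_mono epowr_mono Nq_le) auto
    then show "R x \<le> ennreal KR * E1" by (simp add: E1_def mult_ac) }
qed

lemma KR_ge1: "1 \<le> KR" by (rule K)

lemma R_single_le: "0 < x \<Longrightarrow> R x \<le> ennreal (4 * KR) * (EE + E0 + E1)"
  using chain_R_sum_le[of "\<lambda>_. x" 0] by (simp add: chain_def)

text \<open>10 + 2 * (8 KR) comes from \<open>Lm_chain_le\<close>, the 8 being 4 for the chain and 4
  for the endpoint.\<close>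

definition Kup where "Kup = (4 powr (q / p) * (10 + 16 * KR)) powr \<rho>"

text \<open>Young's inequality is not homogeneous, so Q is first divided by c = E^(1/\<rho>) with E
  the sum of the three terms; then the quotients R/E have bounded sums along chains. E is positive
  because R 1 is, and an infinite E makes the claim trivial.\<close>

lemma Dq_upper_bound: "Dq epowr \<rho> \<le> ennreal Kup * (EE + E0 + E1)"
proof (cases "EE + E0 + E1 = top")
  case True
  have "0 < Kup" using KR_ge1 by (simp add: Kup_def)
  then show ?thesis unfolding True by (simp add: ennreal_mult_top)
next
  case False
  define E where "E = EE + E0 + E1"
  have "R 1 \<noteq> 0"
    using Nq_pos[of 1] sg_pos[of 1] by (auto simp: R_def Q_def epowr_eq_0_iff \<rho>_pos)
  then have E: "0 < E" "E < top"
    using R_single_le[of 1] False by (auto simp: E_def less_top zero_less_iff_neq_zero)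
  define c where "c = E epowr (1 / \<rho>)"
  have c: "0 < c" "c < top" using E \<rho>_pos
    by (auto simp: c_def epowr_eq_0_iff epowr_eq_top_iff zero_less_iff_neq_zero less_top[symmetric])
  have ce: "c epowr \<rho> = E" using \<rho>_pos by (simp add: c_def epowr_inv)
  have "Dq \<le> ennreal (4 powr (q / p)) * (c * (10 + 2 * (8 * ennreal KR)))"
  proof (rule Dq_leI)
    fix \<psi> xs n
    assume \<psi>: "antimono \<psi>" and G: "Gm \<psi> \<le> 1" and ch: "chain xs n" and a: "\<And>k. k \<le> n \<Longrightarrow> adj (xs k) (xs (Suc k))"
    show "(\<integral>\<^sup>+z\<in>{xs 0<..xs (Suc n)}. \<psi> z epowr q \<partial>\<omega>) \<le> ennreal (4 powr (q / p)) * (c * (10 + 2 * (8 * ennreal KR)))"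
    proof (rule Lm_chain_le[OF \<psi> G ch a, where F = "\<lambda>x. R x / E"])
      fix x y :: real assume "0 < x" "0 < y"
      have 1: "1 / (1 - q / p) = \<rho>" using p qp by (simp add: \<rho>_def field_simps)
      have "X \<psi> x epowr (q / p) * Q y = c * (X \<psi> x epowr (q / p) * (Q y / c))"
        using ennreal_mult_divide_cancel[OF c, of "Q y"] by (metis mult.left_commute)
      also have "\<dots> \<le> c * (X \<psi> x + (Q y / c) epowr (1 / (1 - q / p)))"
        using p q qp by (intro mult_left_mono young_ennreal) auto
      also have "(Q y / c) epowr (1 / (1 - q / p)) = R y / E"
        unfolding 1 by (simp add: epowr_divide \<rho>_pos ce R_def)
      finally show "X \<psi> x epowr (q / p) * Q y \<le> c * (X \<psi> x + R y / E)" .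
    next
      have 0: "0 < xs (Suc n)" using chain_pos[OF ch, of n] a[of n] by (simp add: adj_def)
      have "(\<Sum>k\<le>n. R (xs k) / E) + R (xs (Suc n)) / E = ((\<Sum>k\<le>n. R (xs k)) + R (xs (Suc n))) / E"
        by (simp add: divide_ennreal_def sum_distrib_right distrib_right)
      also have "\<dots> \<le> (ennreal (4 * KR) * E + ennreal (4 * KR) * E) / E"
        unfolding E_def by (intro divide_right_mono_ennreal add_mono chain_R_sum_le ch R_single_le 0)
      also have "\<dots> = (8 * ennreal KR * E) / E"
      proof -
        have "ennreal (4 * KR) = 4 * ennreal KR" by (simp add: ennreal_mult')
        then show ?thesis by (simp add: distrib_right[symmetric])
      qed
      also have "\<dots> = 8 * ennreal KR"
        using E by (simp add: ennreal_mult_divide_eq)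
      finally show "(\<Sum>k\<le>n. R (xs k) / E) + R (xs (Suc n)) / E \<le> 8 * ennreal KR" .
    qed
  qed
  also have "\<dots> = ennreal (4 powr (q / p) * (10 + 16 * KR)) * c"
  proof -
    have "ennreal (10 + 16 * KR) = ennreal 10 + ennreal 16 * ennreal KR"
      using KR_ge1 by (simp add: ennreal_mult')
    then have "10 + 2 * (8 * ennreal KR) = ennreal (10 + 16 * KR)"
      by (simp add: mult.assoc[symmetric])
    then show ?thesis by (simp add: ennreal_mult' mult_ac)
  qed
  finally have "Dq epowr \<rho> \<le> (ennreal (4 powr (q / p) * (10 + 16 * KR)) * c) epowr \<rho>"
    using \<rho>_pos by (intro epowr_mono) auto
  also have "\<dots> = ennreal Kup * E"
    using KR_ge1 by (simp add: epowr_mult \<rho>_pos ce epowr_ennreal Kup_def add_pos_pos)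
  finally show ?thesis by (simp add: E_def)
qed

end

section \<open>Almost orthogonal sums of competitors\<close>

context gamma_data
begin

text \<open>B is the block between the points j-1 and j. To the left of the k-th point its mass is
  at most \<sigma> at the point j, which has decayed by 4^(-(k-j)). To the right, T at the point j-1
  is at most 1/b there, and the growth of b gives the decay; as the block begins at the point j-1,
  one step is lost, whence the factor 4.\<close>

lemma chain_block_integral:
  assumes c: "chain xs n" and k: "k \<le> n"
    and B: "B = {x. 0 < x \<and> (j \<noteq> 0 \<longrightarrow> xs (j - 1) < x) \<and> (j \<le> n \<longrightarrow> x \<le> xs j)}" and j: "j \<le> Suc n"
  shows "(\<integral>\<^sup>+x\<in>B. ennreal (min 1 (xs k / x) powr p) \<partial>\<nu>) \<le> ennreal (4 * (1/4) ^ ndist k j * sg (xs k))"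
proof (cases "j \<le> k")
  case True
  then have jn: "j \<le> n" using k by simp
  note pj = chain_pos[OF c jn]
  have "(\<integral>\<^sup>+x\<in>B. ennreal (min 1 (xs k / x) powr p) \<partial>\<nu>) \<le> (\<integral>\<^sup>+x. indicator {..<xs j} x \<partial>\<nu>)"
  proof (rule nn_integral_mono_AE, use AE_nu_pos AE_nu_neq[of "xs j"] in eventually_elim)
    case (elim x)
    have "min 1 (xs k / x) powr p \<le> 1"
      using p elim chain_pos[OF c k] by (intro powr_le1) auto
    then show ?case using elim jn by (auto simp: indicator_def B)
  qed
  also have "\<dots> = ennreal (V (xs j))" using pj by (simp add: V sets_nu)
  also have "V (xs j) \<le> 4 * (1/4) ^ ndist k j * sg (xs k)"
  proof -
    have "V (xs j) \<le> sg (xs j)" using T_nonneg[of "xs j"] by (simp add: sg_def)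
    also have "\<dots> \<le> (1/4) ^ (k - j) * sg (xs k)"
      using chain_growth(1)[OF c True k] by (simp add: field_simps power_divide)
    also have "\<dots> \<le> 4 * (1/4) ^ ndist k j * sg (xs k)"
      using True sg_pos[OF chain_pos[OF c k]] by (intro mult_right_mono) (auto simp: ndist_def)
    finally show ?thesis .
  qed
  finally show ?thesis by (simp add: ennreal_leI)
next
  case False
  define i where "i = j - 1"
  have i: "k \<le> i" "i \<le> n" "j = Suc i" using False j by (auto simp: i_def)
  note pi = chain_pos[OF c i(2)] and pk = chain_pos[OF c k]
  have ki: "xs k \<le> xs i" using chain_pos_mono[OF c i(1,2)] .
  have "(\<integral>\<^sup>+x\<in>B. ennreal (min 1 (xs k / x) powr p) \<partial>\<nu>)
      \<le> (\<integral>\<^sup>+x. ennreal (xs k powr p) * (ennreal (x powr - p) * indicator {xs i<..} x) \<partial>\<nu>)"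
  proof (intro nn_integral_mono)
    fix x
    show "ennreal (min 1 (xs k / x) powr p) * indicator B x \<le> ennreal (xs k powr p) * (ennreal (x powr - p) * indicator {xs i<..} x)"
      using i(3) ki pk min_powr[of "xs k" x p] by (auto simp: indicator_def B ennreal_mult)
  qed
  also have "\<dots> = ennreal (xs k powr p * T (xs i))"
    using pi T_nonneg by (simp add: nn_integral_cmult T ennreal_mult)
  also have "xs k powr p * T (xs i) \<le> 4 * (1/4) ^ ndist k j * sg (xs k)"
  proof -
    have "T (xs i) * bb (xs i) \<le> 1" using sg_split[OF pi] V_pos[OF pi] sg_pos[OF pi] by (smt (verit) divide_pos_pos)
    then have "T (xs i) \<le> 1 / bb (xs i)" using bb_pos[OF pi] by (simp add: field_simps)
    also have "\<dots> \<le> 1 / (4 ^ (i - k) * bb (xs k))"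
      using chain_growth(2)[OF c i(1,2)] bb_pos[OF pk] bb_pos[OF pi] by (intro divide_left_mono) auto
    finally have "xs k powr p * T (xs i) \<le> xs k powr p * (1 / (4 ^ (i - k) * bb (xs k)))"
      by (intro mult_left_mono) auto
    also have "\<dots> = (1/4) ^ (i - k) * sg (xs k)"
      using pk sg_pos[OF pk] by (simp add: bb_def power_divide)
    also have "(1/4) ^ (i - k) = 4 * (1/4::real) ^ ndist k j"
      using i by (simp add: ndist_def Suc_diff_le)
    finally show ?thesis .
  qed
  finally show ?thesis by (simp add: ennreal_leI)
qed

text \<open>Coefficients may grow like 2^|k-j| on block j, since the mass seen there decays like
  4^(-|k-j|). The bound 16 is the 4 of \<open>chain_block_integral\<close> times 4 for the two-sided
  series of powers of 1/2.\<close>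

lemma Gm_chain_le:
  fixes C :: "nat \<Rightarrow> ennreal"
  assumes c: "chain xs n"
    and g: "\<And>j x. 0 < x \<Longrightarrow> gg \<phi> x \<le> K1 * (\<Sum>k\<le>n. ennreal (2 ^ ndist k j) * (C k * ennreal (min 1 (xs k / x) powr p)))"
  shows "Gm \<phi> \<le> K1 * (16 * (\<Sum>k\<le>n. C k * ennreal (sg (xs k))))"
proof -
  \<comment> \<open>The n + 2 blocks cover the half-line: block 0 begins at 0, and block n + 1 is
    unbounded.\<close>
  define B where "B j = {x. 0 < x \<and> (j \<noteq> 0 \<longrightarrow> xs (j - 1) < x) \<and> (j \<le> n \<longrightarrow> x \<le> xs j)}" for j
  have [measurable]: "B j \<in> sets borel" for j unfolding B_def by measurable
  have ex: "\<exists>j\<le>Suc n. x \<in> B j" if x: "0 < x" for x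
  proof (cases "\<exists>j\<le>n. x \<le> xs j")
    case True
    define j where "j = (LEAST j. j \<le> n \<and> x \<le> xs j)"
    have j: "j \<le> n \<and> x \<le> xs j" unfolding j_def by (rule LeastI_ex) (use True in blast)
    have "xs (j - 1) < x" if "j \<noteq> 0"
      using not_less_Least[of "j - 1" "\<lambda>j. j \<le> n \<and> x \<le> xs j"] that j by (auto simp: j_def[symmetric])
    then show ?thesis using j x by (intro exI[of _ j]) (auto simp: B_def)
  next
    case False
    then show ?thesis using x by (intro exI[of _ "Suc n"]) (auto simp: B_def)
  qed
  let ?m = "\<lambda>k x. ennreal (min 1 (xs k / x) powr p)"
  have "Gm \<phi> \<le> (\<integral>\<^sup>+x. (\<Sum>j\<le>Suc n. gg \<phi> x * indicator (B j) x) \<partial>\<nu>)"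
    unfolding Gm_def
  proof (rule nn_integral_mono_AE, use AE_nu_pos in eventually_elim)
    case (elim x)
    then obtain j where "j \<le> Suc n" "x \<in> B j" using ex by blast
    then have "gg \<phi> x = gg \<phi> x * indicator (B j) x" by simp
    also have "\<dots> \<le> (\<Sum>j\<le>Suc n. gg \<phi> x * indicator (B j) x)"
      using \<open>j \<le> Suc n\<close> by (intro member_le_sum) auto
    finally show ?case .
  qed
  also have "\<dots> = (\<Sum>j\<le>Suc n. \<integral>\<^sup>+x. gg \<phi> x * indicator (B j) x \<partial>\<nu>)"
    by (rule nn_integral_sum) measurable
  also have "\<dots> \<le> (\<Sum>j\<le>Suc n. \<integral>\<^sup>+x. K1 * (\<Sum>k\<le>n. ennreal (2 ^ ndist k j) * C k * (?m k x * indicator (B j) x)) \<partial>\<nu>)"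
  proof (intro sum_mono nn_integral_mono)
    fix j x
    show "gg \<phi> x * indicator (B j) x \<le> K1 * (\<Sum>k\<le>n. ennreal (2 ^ ndist k j) * C k * (?m k x * indicator (B j) x))"
      using g[of x j] by (cases "x \<in> B j") (auto simp: B_def mult.assoc)
  qed
  also have "\<dots> = (\<Sum>j\<le>Suc n. K1 * (\<Sum>k\<le>n. ennreal (2 ^ ndist k j) * C k * (\<integral>\<^sup>+x\<in>B j. ?m k x \<partial>\<nu>)))"
    by (simp add: nn_integral_cmult nn_integral_sum)
  also have "\<dots> \<le> (\<Sum>j\<le>Suc n. K1 * (\<Sum>k\<le>n. ennreal (2 ^ ndist k j) * C k * ennreal (4 * (1/4) ^ ndist k j * sg (xs k))))"
    by (intro sum_mono mult_left_mono chain_block_integral[OF c]) (auto simp: B_def)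
  also have "\<dots> = K1 * (\<Sum>j\<le>Suc n. \<Sum>k\<le>n. C k * ennreal (sg (xs k)) * ennreal (4 * (1/2) ^ ndist k j))"
  proof -
    have "ennreal (2 ^ ndist k j) * C k * ennreal (4 * (1/4) ^ ndist k j * sg (xs k))
        = C k * ennreal (sg (xs k)) * ennreal (4 * (1/2) ^ ndist k j)" if "k \<le> n" for j k
    proof -
      have "(2::real) ^ ndist k j * (4 * (1/4) ^ ndist k j * sg (xs k)) = sg (xs k) * (4 * (2 ^ ndist k j * (1/4) ^ ndist k j))"
        by (simp only: mult_ac)
      also have "(2::real) ^ ndist k j * (1/4) ^ ndist k j = (1/2) ^ ndist k j"
        by (subst power_mult_distrib[symmetric]) simp
      finally have e: "(2::real) ^ ndist k j * (4 * (1/4) ^ ndist k j * sg (xs k)) = sg (xs k) * (4 * (1/2) ^ ndist k j)" .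
      have "ennreal (2 ^ ndist k j) * C k * ennreal (4 * (1/4) ^ ndist k j * sg (xs k))
          = C k * ennreal (2 ^ ndist k j * (4 * (1/4) ^ ndist k j * sg (xs k)))"
        by (subst ennreal_mult') (auto simp: mult_ac)
      also have "\<dots> = C k * (ennreal (sg (xs k)) * ennreal (4 * (1/2) ^ ndist k j))"
        unfolding e using sg_pos[OF chain_pos[OF c that]] by (subst ennreal_mult) auto
      finally show ?thesis by (simp only: mult.assoc)
    qed
    then have eq: "(\<Sum>k\<le>n. ennreal (2 ^ ndist k j) * C k * ennreal (4 * (1/4) ^ ndist k j * sg (xs k)))
        = (\<Sum>k\<le>n. C k * ennreal (sg (xs k)) * ennreal (4 * (1/2) ^ ndist k j))" for j
      by (intro sum.cong refl) auto
    show ?thesis unfolding eq by (rule sum_distrib_left[symmetric])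
  qed
  also have "(\<Sum>j\<le>Suc n. \<Sum>k\<le>n. C k * ennreal (sg (xs k)) * ennreal (4 * (1/2) ^ ndist k j))
      = (\<Sum>k\<le>n. C k * ennreal (sg (xs k)) * ennreal (\<Sum>j\<le>Suc n. 4 * (1/2) ^ ndist k j))"
    by (subst sum.swap) (simp only: sum_distrib_left[symmetric] sum_ennreal[symmetric] mult_nonneg_nonneg zero_le_power zero_le_numeral zero_le_divide_1_iff sum_ennreal)
  also have "\<dots> \<le> (\<Sum>k\<le>n. C k * ennreal (sg (xs k)) * ennreal 16)"
  proof (intro sum_mono mult_left_mono ennreal_leI)
    fix k
    have "(\<Sum>j\<le>Suc n. (1/2::real) ^ ndist j k) \<le> 2 / (1 - 1/2)"
      by (rule sum_power_ndist_le) auto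
    moreover have "ndist j k = ndist k j" for j by (simp add: ndist_def)
    ultimately have "(\<Sum>j\<le>Suc n. (1/2::real) ^ ndist k j) \<le> 4" by simp
    then show "(\<Sum>j\<le>Suc n. 4 * (1/2::real) ^ ndist k j) \<le> 16" unfolding sum_distrib_left[symmetric] by linarith
  qed auto
  also have "\<dots> = 16 * (\<Sum>k\<le>n. C k * ennreal (sg (xs k)))"
    by (simp add: sum_distrib_left mult.commute)
  finally show ?thesis by (simp add: mult_left_mono)
qed

definition Kg where "Kg = geo (1 / q) (1 / (2 * p)) powr p * geo p (1 / 2)"

lemma Kg_pos: "0 < Kg"
  using geo_pos[of "1 / q" "1 / (2 * p)"] geo_pos[of p "1/2"] p q by (simp add: Kg_def)

text \<open>A combination of q-th powers makes the left functional exactly additive, for all q > 0.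
  For the Gamma integral it has to be linearized before the averages are taken, and the resulting
  sum has to be raised to the power p; both are done with \<open>sum_epowr_geometric\<close> around
  the index of the block.\<close>

lemma feas_combination:
  fixes C :: "nat \<Rightarrow> ennreal"
  assumes c: "chain xs n" and \<psi>: "\<And>k. k \<le> n \<Longrightarrow> \<psi> k \<in> feas (xs k)"
  defines "\<phi> \<equiv> \<lambda>z. (\<Sum>k\<le>n. C k * \<psi> k z epowr q) epowr (1 / q)"
  shows "antimono \<phi>" and "Lm \<phi> = (\<Sum>k\<le>n. C k * Lm (\<psi> k))"
    and "Gm \<phi> \<le> ennreal Kg * (16 * (\<Sum>k\<le>n. C k epowr (p / q) * ennreal (sg (xs k))))"
proof -
  have am: "antimono (\<psi> k)" if "k \<le> n" for k using \<psi>[OF that] by (simp add: feas_def)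
  have meas: "\<psi> k \<in> borel_measurable borel" if "k \<le> n" for k by (rule antimono_ennreal_borel[OF am[OF that]])
  show am\<phi>: "antimono \<phi>"
    unfolding \<phi>_def using q am
    by (intro antimonoI epowr_mono sum_mono mult_left_mono) (auto simp: antimono_def)
  have "\<phi> z epowr q = (\<Sum>k\<le>n. C k * \<psi> k z epowr q)" for z
    using q by (simp add: \<phi>_def epowr_inv)
  then have "Lm \<phi> = (\<integral>\<^sup>+z. (\<Sum>k\<le>n. C k * \<psi> k z epowr q) \<partial>\<omega>)" by (simp add: Lm_def)
  also have "\<dots> = (\<Sum>k\<le>n. \<integral>\<^sup>+z. C k * \<psi> k z epowr q \<partial>\<omega>)"
    by (rule nn_integral_sum) (use meas in \<open>auto simp: sets_om cong: measurable_cong_sets\<close>)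
  also have "\<dots> = (\<Sum>k\<le>n. C k * Lm (\<psi> k))"
    unfolding Lm_def by (intro sum.cong refl nn_integral_cmult) (use meas in \<open>auto simp: sets_om cong: measurable_cong_sets\<close>)
  finally show "Lm \<phi> = (\<Sum>k\<le>n. C k * Lm (\<psi> k))" .
  define e where "e = 1 / (2 * p)"
  define G1 where "G1 = geo (1 / q) e"
  have e: "0 < e" using p by (simp add: e_def)
  have G1: "0 < G1" unfolding G1_def using q e by (intro geo_pos) auto
  define D where "D k = C k epowr (1 / q)" for k
  have \<phi>_le: "\<phi> z \<le> ennreal G1 * (\<Sum>k\<le>n. ennreal (2 powr (e * ndist k j)) * (D k * \<psi> k z))" for z j
  proof -
    have "\<phi> z \<le> ennreal G1 * (\<Sum>k\<le>n. ennreal (2 powr (e * ndist k j)) * (C k * \<psi> k z epowr q) epowr (1 / q))"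
      unfolding \<phi>_def G1_def using q e by (intro sum_epowr_geometric) auto
    then show ?thesis using q by (simp add: epowr_mult epowr_inv D_def)
  qed
  show "Gm \<phi> \<le> ennreal Kg * (16 * (\<Sum>k\<le>n. C k epowr (p / q) * ennreal (sg (xs k))))"
  proof (rule Gm_chain_le[OF c])
    fix j and x :: real assume x: "0 < x"
    have "hh \<phi> x \<le> hh (\<lambda>z. ennreal G1 * (\<Sum>k\<le>n. ennreal (2 powr (e * ndist k j)) * (D k * \<psi> k z))) x"
      by (intro hh_le \<phi>_le)
    also have "\<dots> = (\<integral>\<^sup>+z. ennreal G1 * (\<Sum>k\<le>n. ennreal (2 powr (e * ndist k j)) * D k * (\<psi> k z * indicator {0<..<x} z)) \<partial>lborel)"
      unfolding hh_def by (intro nn_integral_cong) (auto simp: sum_distrib_right mult.assoc)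
    also have "\<dots> = ennreal G1 * (\<integral>\<^sup>+z. (\<Sum>k\<le>n. ennreal (2 powr (e * ndist k j)) * D k * (\<psi> k z * indicator {0<..<x} z)) \<partial>lborel)"
      using meas by (intro nn_integral_cmult) (auto intro!: borel_measurable_sum)
    also have "(\<integral>\<^sup>+z. (\<Sum>k\<le>n. ennreal (2 powr (e * ndist k j)) * D k * (\<psi> k z * indicator {0<..<x} z)) \<partial>lborel)
        = (\<Sum>k\<le>n. \<integral>\<^sup>+z. ennreal (2 powr (e * ndist k j)) * D k * (\<psi> k z * indicator {0<..<x} z) \<partial>lborel)"
      using meas by (intro nn_integral_sum) auto
    also have "\<dots> = (\<Sum>k\<le>n. ennreal (2 powr (e * ndist k j)) * D k * hh (\<psi> k) x)"
      unfolding hh_def using meas by (intro sum.cong refl nn_integral_cmult) auto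
    also have "\<dots> \<le> (\<Sum>k\<le>n. ennreal (2 powr (e * ndist k j)) * D k * ennreal (min x (xs k)))"
      using \<psi> x by (intro sum_mono mult_left_mono) (auto simp: feas_def)
    finally have "hh \<phi> x \<le> ennreal G1 * (\<Sum>k\<le>n. ennreal (2 powr (e * ndist k j)) * D k * ennreal (min x (xs k)))"
      by (simp add: mult_left_mono)
    then have "hh \<phi> x / ennreal x \<le> ennreal G1 * (\<Sum>k\<le>n. ennreal (2 powr (e * ndist k j)) * D k * ennreal (min x (xs k))) / ennreal x"
      by (rule divide_right_mono_ennreal)
    also have "\<dots> = ennreal G1 * (\<Sum>k\<le>n. ennreal (2 powr (e * ndist k j)) * D k * (ennreal (min x (xs k)) * ennreal (1 / x)))"
      using x by (simp add: divide_ennreal_def inverse_ennreal sum_distrib_right inverse_eq_divide mult.assoc)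
    also have "\<dots> = ennreal G1 * (\<Sum>k\<le>n. ennreal (2 powr (e * ndist k j)) * D k * ennreal (min 1 (xs k / x)))"
    proof -
      have "ennreal (min x (xs k)) * ennreal (1 / x) = ennreal (min 1 (xs k / x))" for k
        using x by (subst ennreal_mult''[symmetric]) (auto simp: min_def field_simps)
      then show ?thesis by simp
    qed
    finally have "gg \<phi> x \<le> (ennreal G1 * (\<Sum>k\<le>n. ennreal (2 powr (e * ndist k j)) * D k * ennreal (min 1 (xs k / x)))) epowr p"
      unfolding gg_def using p by (intro epowr_mono) auto
    also have "\<dots> = ennreal (G1 powr p) * (\<Sum>k\<le>n. ennreal (2 powr (e * ndist k j)) * D k * ennreal (min 1 (xs k / x))) epowr p"
      using p G1 by (simp add: epowr_mult epowr_ennreal)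
    also have "\<dots> \<le> ennreal (G1 powr p) * (ennreal (geo p (1/2)) * (\<Sum>k\<le>n. ennreal (2 powr (1/2 * ndist k j)) *
        (ennreal (2 powr (e * ndist k j)) * D k * ennreal (min 1 (xs k / x))) epowr p))"
      using p by (intro mult_left_mono sum_epowr_geometric) auto
    also have "(\<Sum>k\<le>n. ennreal (2 powr (1/2 * ndist k j)) * (ennreal (2 powr (e * ndist k j)) * D k * ennreal (min 1 (xs k / x))) epowr p)
       = (\<Sum>k\<le>n. ennreal (2 ^ ndist k j) * (C k epowr (p / q) * ennreal (min 1 (xs k / x) powr p)))"
    proof (intro sum.cong refl)
      fix k assume "k \<in> {..n}"
      then have xk: "0 < xs k" using chain_pos[OF c] by simp
      have "(2::real) powr (1/2 * ndist k j) * 2 powr (e * ndist k j * p) = 2 ^ ndist k j"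
        using p by (simp add: e_def powr_add[symmetric] powr_realpow[symmetric])
      then have a: "ennreal (2 powr (1/2 * ndist k j)) * ennreal (2 powr (e * ndist k j)) epowr p = ennreal (2 ^ ndist k j)"
        by (simp add: epowr_ennreal powr_powr flip: ennreal_mult)
      have "D k epowr p = C k epowr (p / q)" using p q by (simp add: D_def epowr_epowr)
      moreover have "ennreal (min 1 (xs k / x)) epowr p = ennreal (min 1 (xs k / x) powr p)"
        using xk x by (intro epowr_ennreal) auto
      ultimately show "ennreal (2 powr (1/2 * ndist k j)) * (ennreal (2 powr (e * ndist k j)) * D k * ennreal (min 1 (xs k / x))) epowr p
        = ennreal (2 ^ ndist k j) * (C k epowr (p / q) * ennreal (min 1 (xs k / x) powr p))"
        unfolding a[symmetric] by (simp add: epowr_mult p mult.assoc)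
    qed
    also have "ennreal (G1 powr p) * (ennreal (geo p (1/2)) * (\<Sum>k\<le>n. ennreal (2 ^ ndist k j) * (C k epowr (p / q) * ennreal (min 1 (xs k / x) powr p))))
      = ennreal Kg * (\<Sum>k\<le>n. ennreal (2 ^ ndist k j) * (C k epowr (p / q) * ennreal (min 1 (xs k / x) powr p)))"
      using geo_pos[of p "1/2"] p by (simp add: Kg_def G1_def e_def ennreal_mult mult.assoc)
    finally show "gg \<phi> x \<le> ennreal Kg * (\<Sum>k\<le>n. ennreal (2 ^ ndist k j) * (C k epowr (p / q) * ennreal (min 1 (xs k / x) powr p)))" .
  qed
qed

end

context gamma_data_less
begin

definition Klo where "Klo = (2 * (16 * Kg) powr (q / p)) powr \<rho>"

text \<open>Duality of sequence spaces made explicit: near-extremal competitors are combined with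
  the coefficients \<kappa>^\<rho>/N. Then the left functional is at least S/2 and the Gamma
  integral at most a multiple of S, where S is the sum of the \<kappa>^\<rho>. Scaling into the unit
  ball leaves S^(1-q/p) = S^(1/\<rho>) below a multiple of Dq.\<close>

lemma chain_R_sum_le_Dq:
  assumes c: "chain xs n"
  shows "(\<Sum>k\<le>n. R (xs k)) \<le> ennreal Klo * Dq epowr \<rho>"
proof (cases "Dq = top")
  case True
  have "0 < Klo" using Kg_pos by (simp add: Klo_def)
  then show ?thesis using True \<rho>_pos by (simp add: ennreal_mult_top)
next
  case False
  note pos = chain_pos[OF c]
  define N where "N k = enn2real (Nq (xs k))" for k
  have N: "Nq (xs k) = ennreal (N k)" "0 < N k" if k: "k \<le> n" for k
  proof -
    have "Q (xs k) < top" using Q_le_Dq[OF pos[OF k]] False by (auto simp: less_top[symmetric] top_unique)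
    then have "Nq (xs k) < top" unfolding Nq_eq_Q[OF pos[OF k]] by (simp add: ennreal_mult_less_top)
    then show "Nq (xs k) = ennreal (N k)" by (simp add: N_def)
    then show "0 < N k" using Nq_pos[OF pos[OF k]] by (simp add: ennreal_less_zero_iff)
  qed
  define \<kappa> where "\<kappa> k = N k * sg (xs k) powr - (q / p)" for k
  have \<kappa>: "0 < \<kappa> k" if "k \<le> n" for k using N(2)[OF that] sg_pos[OF pos[OF that]] by (simp add: \<kappa>_def)
  have Rk: "R (xs k) = ennreal (\<kappa> k powr \<rho>)" if k: "k \<le> n" for k
    using N[OF k] \<kappa>[OF k] by (simp add: R_def Q_def \<kappa>_def epowr_ennreal flip: ennreal_mult)
  define S where "S = (\<Sum>k\<le>n. \<kappa> k powr \<rho>)"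
  have S: "0 < S" unfolding S_def using \<kappa>[of 0] by (intro sum_pos2[of _ 0]) auto
  \<comment> \<open>Half of the supremum is reached by some competitor, because the supremum is
    positive and finite.\<close>
  have "\<exists>\<psi>. \<psi> \<in> feas (xs k) \<and> ennreal (N k / 2) \<le> Lm \<psi>" if k: "k \<le> n" for k
  proof -
    have "ennreal (N k / 2) < Nq (xs k)" using N[OF k] by (simp add: ennreal_less_iff)
    then show ?thesis unfolding Nq_def less_SUP_iff by (auto intro: less_imp_le)
  qed
  then obtain \<psi> where \<psi>: "\<And>k. k \<le> n \<Longrightarrow> \<psi> k \<in> feas (xs k)" "\<And>k. k \<le> n \<Longrightarrow> ennreal (N k / 2) \<le> Lm (\<psi> k)"
    by metis
  define C where "C k = ennreal (\<kappa> k powr \<rho> / N k)" for k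
  define \<phi> where "\<phi> z = (\<Sum>k\<le>n. C k * \<psi> k z epowr q) epowr (1 / q)" for z
  note comb = feas_combination[OF c \<psi>(1), of C, folded \<phi>_def[abs_def]]
  have am: "antimono \<phi>" using comb(1) by simp
  have Lm: "ennreal (S / 2) \<le> Lm \<phi>"
  proof -
    have "ennreal (S / 2) = (\<Sum>k\<le>n. C k * ennreal (N k / 2))"
    proof -
      have "C k * ennreal (N k / 2) = ennreal (\<kappa> k powr \<rho> / 2)" if "k \<le> n" for k
        using N(2)[OF that] by (simp add: C_def flip: ennreal_mult)
      then show ?thesis by (simp add: S_def sum_divide_distrib sum_ennreal)
    qed
    also have "\<dots> \<le> (\<Sum>k\<le>n. C k * Lm (\<psi> k))" by (intro sum_mono mult_left_mono \<psi>(2)) auto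
    also have "\<dots> = Lm \<phi>" using comb(2) by simp
    finally show ?thesis .
  qed
  have Gm: "Gm \<phi> \<le> ennreal (16 * Kg * S)"
  proof -
    \<comment> \<open>The exponents match because \<rho> p/q - p/q = \<rho>, so the same sum S
      governs both functionals of \<phi>.\<close>
    have "C k epowr (p / q) * ennreal (sg (xs k)) = ennreal (\<kappa> k powr \<rho>)" if k: "k \<le> n" for k
    proof -
      note s0 = sg_pos[OF pos[OF k]]
      have e1: "\<kappa> k powr (- (p / q)) = N k powr (- (p / q)) * sg (xs k)"
        using N(2)[OF k] s0 p q by (simp add: \<kappa>_def powr_mult powr_powr)
      have "C k epowr (p / q) = ennreal ((\<kappa> k powr \<rho> / N k) powr (p / q))"
        unfolding C_def using N(2)[OF k] \<kappa>[OF k] by (intro epowr_ennreal) auto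
      also have "(\<kappa> k powr \<rho> / N k) powr (p / q) = \<kappa> k powr (\<rho> * (p / q)) * N k powr (- (p / q))"
        using N(2)[OF k] by (simp add: powr_divide powr_powr powr_minus_divide)
      finally have "C k epowr (p / q) * ennreal (sg (xs k)) = ennreal (\<kappa> k powr (\<rho> * (p / q)) * (N k powr (- (p / q)) * sg (xs k)))"
        using s0 by (simp add: mult.assoc flip: ennreal_mult)
      also have "\<kappa> k powr (\<rho> * (p / q)) * (N k powr (- (p / q)) * sg (xs k)) = \<kappa> k powr (\<rho> * (p / q) - p / q)"
        unfolding e1[symmetric] by (subst powr_add[symmetric]) simp
      also have "\<rho> * (p / q) - p / q = \<rho>" using p q qp by (simp add: \<rho>_def field_simps)
      finally show ?thesis .
    qed
    then have "(\<Sum>k\<le>n. C k epowr (p / q) * ennreal (sg (xs k))) = ennreal S"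
      by (simp add: S_def sum_ennreal)
    then have "Gm \<phi> \<le> ennreal Kg * (16 * ennreal S)" using comb(3) by simp
    also have "\<dots> = ennreal (16 * Kg * S)" using Kg_pos S by (simp add: ennreal_mult' ennreal_mult'' mult_ac)
    finally show ?thesis .
  qed
  define t where "t = (16 * Kg * S) powr - (1 / p)"
  have KS: "0 < 16 * Kg * S" using Kg_pos S by simp
  have t: "0 < t" using Kg_pos S by (simp add: t_def)
  have "Gm (\<lambda>z. ennreal t * \<phi> z) \<le> ennreal (t powr p) * ennreal (16 * Kg * S)"
    unfolding Gm_cmult[OF am] epowr_ennreal[OF t] by (intro mult_left_mono Gm) auto
  also have "t powr p = (16 * Kg * S) powr - 1" using p by (simp add: t_def powr_powr)
  also have "\<dots> = 1 / (16 * Kg * S)" using Kg_pos S by (simp add: powr_minus_divide)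
  also have "ennreal (1 / (16 * Kg * S)) * ennreal (16 * Kg * S) = 1"
    using Kg_pos S by (subst ennreal_mult'[symmetric]) auto
  finally have "Lm (\<lambda>z. ennreal t * \<phi> z) \<le> Dq" by (intro Dq_upper antimono_cmult am)
  then have "ennreal (t powr q) * Lm \<phi> \<le> Dq" unfolding Lm_cmult[OF am] epowr_ennreal[OF t] .
  then have "ennreal (t powr q) * ennreal (S / 2) \<le> Dq" using Lm by (meson mult_left_mono order_trans zero_le)
  then have D: "ennreal (t powr q * (S / 2)) \<le> Dq" by (subst ennreal_mult') auto
  have "ennreal S = ennreal (Klo * (t powr q * (S / 2)) powr \<rho>)"
  proof -
    have "t powr q = (16 * Kg) powr - (q / p) * S powr - (q / p)"
      using Kg_pos S by (simp add: t_def powr_powr powr_mult)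
    then have "2 * (16 * Kg) powr (q / p) * (t powr q * (S / 2)) = S powr - (q / p) * S"
      using Kg_pos by (simp add: powr_minus_divide)
    also have "\<dots> = S powr (1 - q / p)" using S by (simp add: powr_diff powr_minus_divide)
    finally have "(2 * (16 * Kg) powr (q / p) * (t powr q * (S / 2))) powr \<rho> = S powr ((1 - q / p) * \<rho>)"
      by (simp add: powr_powr)
    also have "(1 - q / p) * \<rho> = 1" using p qp by (simp add: \<rho>_def field_simps)
    also have "(2 * (16 * Kg) powr (q / p) * (t powr q * (S / 2))) powr \<rho> = Klo * (t powr q * (S / 2)) powr \<rho>"
      unfolding Klo_def by (rule powr_mult)
    finally show ?thesis using S by simp
  qed
  also have "\<dots> = ennreal Klo * ennreal (t powr q * (S / 2)) epowr \<rho>"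
    using t S by (subst epowr_ennreal) (auto simp: ennreal_mult'' Klo_def)
  also have "\<dots> \<le> ennreal Klo * Dq epowr \<rho>"
    using \<rho>_pos by (intro mult_left_mono epowr_mono D) auto
  finally show ?thesis using Rk by (simp add: S_def sum_ennreal)
qed

definition KE where "KE = 6 * KR * (Klo + 1)"

lemma EE_le: "EE \<le> ennreal KE * Dq epowr \<rho>"
  unfolding EE_def
proof (rule nn_integral_Ioi_le)
  fix a z :: real assume "0 < a" "a \<le> z"
  then obtain xs n where xs: "chain xs n" "xs 0 = a" "xs (Suc n) = z" "\<And>k. k \<le> n \<Longrightarrow> adj (xs k) (xs (Suc k))"
    using chain_exists by blast
  have "(\<integral>\<^sup>+x\<in>{a<..z}. R x * ennreal (mm x) \<partial>lborel) \<le> ennreal (6 * KR) * ((\<Sum>k\<le>n. R (xs k)) + R (xs (Suc n)))"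
    using chain_integral_le[OF xs(1,4)] xs(2,3) by simp
  \<comment> \<open>The endpoint need not continue the chain, so R there is bounded
    separately.\<close>
  also have "\<dots> \<le> ennreal (6 * KR) * (ennreal Klo * Dq epowr \<rho> + Dq epowr \<rho>)"
    using xs(3) \<open>0 < a\<close> \<open>a \<le> z\<close> by (intro mult_left_mono add_mono chain_R_sum_le_Dq xs R_le_Dq) auto
  also have "\<dots> = ennreal KE * Dq epowr \<rho>"
  proof -
    have "0 \<le> Klo" by (simp add: Klo_def)
    then have "ennreal KE = ennreal (6 * KR) * (ennreal Klo + 1)"
      using KR_ge1 by (simp add: KE_def ennreal_mult ennreal_plus)
    then show ?thesis by (simp add: distrib_right mult.assoc)
  qed
  finally show "(\<integral>\<^sup>+x\<in>{a<..z}. R x * ennreal (mm x) \<partial>lborel) \<le> ennreal KE * Dq epowr \<rho>" .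
qed auto

end

section \<open>The size of the testing supremum\<close>

lemma nn_integral_powr_tail:
  assumes "0 < t" "0 < s"
  shows "(\<integral>\<^sup>+z\<in>{t<..}. ennreal (z powr (- 1 - s)) \<partial>lborel) = ennreal (t powr - s / s)"
proof -
  have e: "- 1 - s = - s - 1" by simp
  have "(\<integral>\<^sup>+z\<in>{t<..}. ennreal (z powr (- 1 - s)) \<partial>lborel) = (\<integral>\<^sup>+z. ennreal (z powr (- 1 - s)) * indicator {t..} z \<partial>lborel)"
    using AE_lborel_singleton[of t] by (intro nn_integral_cong_AE) (auto simp: indicator_def)
  also have "\<dots> = ennreal (0 - (- (t powr - s / s)))"
  proof (rule nn_integral_FTC_atLeast)
    fix z assume "t \<le> z"
    then show "((\<lambda>z. - (z powr - s / s)) has_real_derivative z powr (- 1 - s)) (at z)"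
      using assms unfolding e by (auto intro!: derivative_eq_intros)
  next
    have "((\<lambda>z. - (z powr - s / s)) \<longlongrightarrow> - (0 / s)) at_top"
      using assms by (intro tendsto_intros tendsto_neg_powr filterlim_ident) auto
    then show "((\<lambda>z. - (z powr - s / s)) \<longlongrightarrow> 0) at_top" by simp
  qed auto
  finally show ?thesis by simp
qed

lemma sigma_finite_cdf:
  assumes "sets m = sets (borel :: real measure)" "\<And>x. emeasure m {..<x} \<noteq> top"
  shows "sigma_finite_measure m"
proof
  have "(\<Union>n::nat. {..<real n}) = UNIV"
    using reals_Archimedean2 by blast
  then show "\<exists>A. countable A \<and> A \<subseteq> sets m \<and> \<Union>A = space m \<and> (\<forall>a\<in>A. emeasure m a \<noteq> \<infinity>)"
    using sets_eq_imp_space_eq[OF assms(1)] assms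
    by (intro exI[of _ "range (\<lambda>n::nat. {..<real n})"]) auto
qed

text \<open>A form of Hardy's inequality: \<open>cdf_powr_le\<close> bounds the power 1 + s of the
  distribution function F at z by the integral of F^s dm over the half-line below z, and after the
  order of integration is exchanged, the integral of z^(-1-s) beyond t supplies t^(-s)/s.\<close>

lemma cdf_hardy:
  fixes m :: "real measure"
  assumes sets [measurable_cong]: "sets m = sets borel" and fin: "\<And>x. emeasure m {..<x} \<noteq> top"
    and atom: "\<And>x. emeasure m {x} = 0" and zero: "emeasure m {..<a} = 0" and a: "0 < a" and s: "0 < s"
  shows "(\<integral>\<^sup>+z\<in>{0<..}. emeasure m {..<z} epowr (1 + s) * ennreal (z powr (- 1 - s)) \<partial>lborel)
    \<le> ennreal (2 powr (1 + s) / s) * (\<integral>\<^sup>+z. emeasure m {..<z} epowr s * ennreal (z powr - s) \<partial>m)"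
proof -
  have sp: "space m = UNIV" using sets_eq_imp_space_eq[OF sets] by simp
  interpret m: sigma_finite_measure m by (rule sigma_finite_cdf) (use sets fin in auto)
  interpret P: pair_sigma_finite lborel m ..
  have F [measurable]: "(\<lambda>t. emeasure m {..<t} epowr r) \<in> borel_measurable borel" if "0 < r" for r
    by (intro mono_ennreal_borel monoI epowr_mono emeasure_mono) (use that in \<open>auto simp: sets\<close>)
  have pos: "AE t in m. 0 < t"
  proof (rule AE_I[where N = "{..0}"])
    have "emeasure m {..0} \<le> emeasure m {..<a}" using a by (intro emeasure_mono) (auto simp: sets)
    then show "emeasure m {..0} = 0" using zero by simp
  qed (auto simp: sets)
  define G where "G t = emeasure m {..<t} epowr s" for t
  have [measurable]: "G \<in> borel_measurable borel" unfolding G_def[abs_def] by (rule F[OF s])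
  have "(\<integral>\<^sup>+z\<in>{0<..}. emeasure m {..<z} epowr (1 + s) * ennreal (z powr (- 1 - s)) \<partial>lborel)
      \<le> (\<integral>\<^sup>+z. ennreal (2 powr (1 + s)) * (\<integral>\<^sup>+t. G t * (ennreal (z powr (- 1 - s)) * indicator {0<..} z * (if t < z then 1 else 0)) \<partial>m) \<partial>lborel)"
  proof (intro nn_integral_mono)
    fix z
    have "emeasure m {..<z} epowr (1 + s) * ennreal (z powr (- 1 - s)) * indicator {0<..} z
      = emeasure m {..<z} epowr (1 + s) * (ennreal (z powr (- 1 - s)) * indicator {0<..} z)"
      by (simp only: mult.assoc)
    also have "\<dots> \<le> (ennreal (2 powr (1 + s)) * (\<integral>\<^sup>+t\<in>{..<z}. G t \<partial>m)) * (ennreal (z powr (- 1 - s)) * indicator {0<..} z)"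
      by (rule mult_right_mono[OF cdf_powr_le[OF sets fin atom zero s, folded G_def]]) simp
    also have "\<dots> = ennreal (2 powr (1 + s)) * (\<integral>\<^sup>+t. (G t * indicator {..<z} t) * (ennreal (z powr (- 1 - s)) * indicator {0<..} z) \<partial>m)"
      unfolding mult.assoc[of "ennreal (2 powr (1 + s))"] by (subst nn_integral_multc[symmetric]) auto
    also have "\<dots> = ennreal (2 powr (1 + s)) * (\<integral>\<^sup>+t. G t * (ennreal (z powr (- 1 - s)) * indicator {0<..} z * (if t < z then 1 else 0)) \<partial>m)"
    proof -
      have "(G t * indicator {..<z} t) * (ennreal (z powr (- 1 - s)) * indicator {0<..} z)
        = G t * (ennreal (z powr (- 1 - s)) * indicator {0<..} z * (if t < z then 1 else 0))" for t
        by (auto simp: indicator_def)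
      then show ?thesis by (simp only:)
    qed
    finally show "emeasure m {..<z} epowr (1 + s) * ennreal (z powr (- 1 - s)) * indicator {0<..} z \<le> \<dots>" .
  qed
  also have "\<dots> = ennreal (2 powr (1 + s)) * (\<integral>\<^sup>+z. (\<integral>\<^sup>+t. G t * (ennreal (z powr (- 1 - s)) * indicator {0<..} z * (if t < z then 1 else 0)) \<partial>m) \<partial>lborel)"
    by (intro nn_integral_cmult) measurable
  also have "(\<integral>\<^sup>+z. (\<integral>\<^sup>+t. G t * (ennreal (z powr (- 1 - s)) * indicator {0<..} z * (if t < z then 1 else 0)) \<partial>m) \<partial>lborel)
      = (\<integral>\<^sup>+t. (\<integral>\<^sup>+z. G t * (ennreal (z powr (- 1 - s)) * indicator {0<..} z * (if t < z then 1 else 0)) \<partial>lborel) \<partial>m)"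
    by (rule P.Fubini'[symmetric]) (use F[OF s] in measurable)
  also have "\<dots> = (\<integral>\<^sup>+t. ennreal (1 / s) * (G t * ennreal (t powr - s)) \<partial>m)"
  proof (rule nn_integral_cong_AE, use pos in eventually_elim)
    case (elim t)
    have "(\<integral>\<^sup>+z. G t * (ennreal (z powr (- 1 - s)) * indicator {0<..} z * (if t < z then 1 else 0)) \<partial>lborel)
        = (\<integral>\<^sup>+z. G t * (ennreal (z powr (- 1 - s)) * indicator {t<..} z) \<partial>lborel)"
      using elim by (intro nn_integral_cong) (auto simp: indicator_def)
    also have "\<dots> = G t * ennreal (t powr - s / s)"
      by (subst nn_integral_cmult) (auto simp: nn_integral_powr_tail elim s)
    also have "\<dots> = ennreal (1 / s) * (G t * ennreal (t powr - s))"
    proof -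
      have "ennreal (t powr - s / s) = ennreal (1 / s) * ennreal (t powr - s)"
        using s by (subst ennreal_mult''[symmetric]) auto
      then show ?thesis by (simp add: mult_ac)
    qed
    finally show ?case .
  qed
  also have "\<dots> = ennreal (1 / s) * (\<integral>\<^sup>+t. G t * ennreal (t powr - s) \<partial>m)"
    by (intro nn_integral_cmult) (use F[OF s] in measurable)
  finally show ?thesis using s by (simp add: G_def ennreal_mult'' mult.assoc[symmetric] flip: ennreal_mult)
qed

lemma feas_integral_le:
  assumes "\<And>z. 0 < z \<Longrightarrow> hh \<psi> z \<le> B" and [measurable]: "\<psi> \<in> borel_measurable borel"
  shows "(\<integral>\<^sup>+z\<in>{0<..}. \<psi> z \<partial>lborel) \<le> B"
proof (rule nn_integral_Ioi_le)
  fix a z :: real assume "0 < a" "a \<le> z"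
  then have "(\<integral>\<^sup>+x\<in>{a<..z}. \<psi> x \<partial>lborel) \<le> hh \<psi> (z + 1)"
    unfolding hh_def by (intro nn_integral_mono) (auto simp: indicator_def)
  also have "\<dots> \<le> B" using \<open>0 < a\<close> \<open>a \<le> z\<close> by (intro assms) auto
  finally show "(\<integral>\<^sup>+x\<in>{a<..z}. \<psi> x \<partial>lborel) \<le> B" .
qed auto

text \<open>With \<sigma> finite, the transported weight fails this only if W(L) is infinite while
  U(L) is finite, and then C is infinite.\<close>

locale gamma_finite = gamma_data +
  assumes om_fin: "emeasure \<omega> {..<x} \<noteq> top"
begin

text \<open>The cut at n makes the measure finite, and the cut at x > 0 removes the mass near 0, as
  \<open>cdf_hardy\<close> requires. Bounds uniform in n are passed to the limit afterwards.\<close>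

definition om_from where "om_from x n = density \<omega> (indicator {x<..<n})"

lemma om_from: "A \<in> sets borel \<Longrightarrow> emeasure (om_from x n) A = emeasure \<omega> ({x<..<n} \<inter> A)"
proof -
  assume A: "A \<in> sets borel"
  have "emeasure (om_from x n) A = (\<integral>\<^sup>+z. indicator {x<..<n} z * indicator A z \<partial>\<omega>)"
    unfolding om_from_def using A by (subst emeasure_density) (auto simp: sets_om)
  also have "\<dots> = (\<integral>\<^sup>+z. indicator ({x<..<n} \<inter> A) z \<partial>\<omega>)"
    by (intro nn_integral_cong) (simp add: indicator_inter_arith)
  finally show ?thesis using A by (simp add: sets_om)
qed

lemma sets_om_from [simp]: "sets (om_from x n) = sets borel"
  by (simp add: om_from_def sets_om)

lemma om_from_le: "emeasure (om_from x n) {..<z} \<le> emeasure \<omega> {..<z}"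
  by (subst om_from) (auto simp: sets_om intro!: emeasure_mono)

lemma om_from_fin: "emeasure (om_from x n) {..<z} \<noteq> top"
  using om_from_le[of x n z] om_fin[of z] by (auto simp: top_unique)

lemma om_from_atom: "emeasure (om_from x n) {z} = 0"
proof -
  have "emeasure \<omega> ({x<..<n} \<inter> {z}) \<le> emeasure \<omega> {z}" by (intro emeasure_mono) (auto simp: sets_om)
  then show ?thesis by (simp add: om_from om_atom)
qed

lemma om_from_zero: "z \<le> x \<Longrightarrow> emeasure (om_from x n) {..<z} = 0"
proof -
  assume "z \<le> x"
  then have "{x<..<n} \<inter> {..<z} = {}" by auto
  then show ?thesis by (simp add: om_from)
qed

lemma nn_integral_om_from: "f \<in> borel_measurable borel \<Longrightarrow> (\<integral>\<^sup>+z. f z \<partial>om_from x n) = (\<integral>\<^sup>+z\<in>{x<..<n}. f z \<partial>\<omega>)"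
  unfolding om_from_def by (subst nn_integral_density) (auto simp: sets_om mult.commute)

text \<open>Replaces d\<omega> by a density. For a nonincreasing integrand it is enough to compare
  distribution functions, and the mass of g on (t/2,t) alone is asked to exceed that of the
  truncated measure below t; thus g need only be controlled near t.\<close>

lemma om_dominated:
  assumes f: "antimono f" and [measurable]: "g \<in> borel_measurable borel"
    and le: "\<And>t. x < t \<Longrightarrow> emeasure (om_from x n) {..<t} \<le> (\<integral>\<^sup>+z\<in>{t/2<..<t}. g z \<partial>lborel)"
    and gfin: "\<And>z. 0 < z \<Longrightarrow> g z \<noteq> top" and x: "0 < x"
  shows "(\<integral>\<^sup>+z\<in>{x<..<n}. f z \<partial>\<omega>) \<le> (\<integral>\<^sup>+z\<in>{0<..}. f z * g z \<partial>lborel)"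
proof -
  have [measurable]: "f \<in> borel_measurable borel" by (rule antimono_ennreal_borel[OF f])
  define m2 where "m2 = density lborel (\<lambda>z. g z * indicator {0<..} z)"
  have em: "emeasure m2 A = (\<integral>\<^sup>+z. g z * indicator {0<..} z * indicator A z \<partial>lborel)" if "A \<in> sets borel" for A
    unfolding m2_def using that by (subst emeasure_density) auto
  have "(\<integral>\<^sup>+z. f z \<partial>om_from x n) \<le> (\<integral>\<^sup>+z. f z \<partial>m2)"
  proof (rule nn_integral_antimono_dominated[OF _ _ _ _ _ om_from_atom f])
    show "sigma_finite_measure (om_from x n)" by (rule sigma_finite_cdf) (use om_from_fin in auto)
    have "AE z in lborel. g z * indicator {0<..} z \<noteq> \<infinity>" using gfin by (auto simp: indicator_def)
    then show "sigma_finite_measure m2"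
      unfolding m2_def by (subst sigma_finite_measure.sigma_finite_iff_density_finite[OF sigma_finite_lborel]) auto
    show "sets m2 = sets borel" by (simp add: m2_def)
    fix t
    show "emeasure (om_from x n) {..<t} \<le> emeasure m2 {..<t}"
    proof (cases "t \<le> x")
      case False
      then have "emeasure (om_from x n) {..<t} \<le> (\<integral>\<^sup>+z\<in>{t/2<..<t}. g z \<partial>lborel)" by (intro le) auto
      also have "\<dots> \<le> emeasure m2 {..<t}"
        using False x by (subst em) (auto intro!: nn_integral_mono simp: indicator_def)
      finally show ?thesis .
    qed (simp add: om_from_zero)
  qed simp
  also have "(\<integral>\<^sup>+z. f z \<partial>m2) = (\<integral>\<^sup>+z\<in>{0<..}. f z * g z \<partial>lborel)"
    unfolding m2_def by (subst nn_integral_density) (auto intro!: nn_integral_cong simp: mult_ac)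
  finally show ?thesis by (simp add: nn_integral_om_from)
qed

lemma AE_om_neq: "AE z in \<omega>. z \<noteq> x"
  using om_atom[of x] by (intro AE_I[where N = "{x}"]) (auto simp: sets_om)

text \<open>A competitor is at most 1 to the left of x; the part to the right is exhausted by the
  intervals (x,n).\<close>

lemma Lm_split:
  assumes \<psi>: "\<psi> \<in> feas x" and x: "0 < x" and B: "\<And>n. (\<integral>\<^sup>+z\<in>{x<..<n}. \<psi> z epowr q \<partial>\<omega>) \<le> B"
  shows "Lm \<psi> \<le> emeasure \<omega> {..<x} + B"
proof -
  have am: "antimono \<psi>" using \<psi> by (simp add: feas_def)
  have [measurable]: "\<psi> \<in> borel_measurable borel" by (rule antimono_ennreal_borel[OF am])
  have [measurable]: "(\<lambda>z. \<psi> z epowr q) \<in> borel_measurable borel" by measurable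
  have "Lm \<psi> \<le> (\<integral>\<^sup>+z. indicator {..<x} z + \<psi> z epowr q * indicator {x<..} z \<partial>\<omega>)"
    unfolding Lm_def
  proof (rule nn_integral_mono_AE, use AE_om_pos AE_om_neq[of x] in eventually_elim)
    case (elim z)
    show ?case using feas_le1[OF \<psi> elim(1)] epowr_mono[of q "\<psi> z" 1] q elim by (auto simp: indicator_def)
  qed
  also have "\<dots> = emeasure \<omega> {..<x} + (\<integral>\<^sup>+z\<in>{x<..}. \<psi> z epowr q \<partial>\<omega>)"
    by (subst nn_integral_add) (auto simp: sets_om)
  also have "(\<integral>\<^sup>+z\<in>{x<..}. \<psi> z epowr q \<partial>\<omega>) = (\<integral>\<^sup>+z\<in>{0<..}. \<psi> z epowr q * indicator {x<..} z \<partial>\<omega>)"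
    using x by (intro nn_integral_cong) (auto simp: indicator_def)
  also have "\<dots> \<le> B"
  proof (rule nn_integral_Ioi_le)
    fix a z :: real
    have "(\<integral>\<^sup>+y\<in>{a<..z}. \<psi> y epowr q * indicator {x<..} y \<partial>\<omega>) \<le> (\<integral>\<^sup>+y\<in>{x<..<z+1}. \<psi> y epowr q \<partial>\<omega>)"
      by (intro nn_integral_mono) (auto simp: indicator_def)
    also have "\<dots> \<le> B" by (rule B)
    finally show "(\<integral>\<^sup>+y\<in>{a<..z}. \<psi> y epowr q * indicator {x<..} y \<partial>\<omega>) \<le> B" .
  qed (auto simp: sets_om)
  finally show ?thesis by (simp add: add_left_mono)
qed

definition S1 where "S1 x = (SUP t\<in>{x..}. emeasure \<omega> {..<t} * ennreal (t powr - q))"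

lemma Nq_ge_S1: "0 < x \<Longrightarrow> ennreal (x powr q) * S1 x \<le> Nq x"
  unfolding S1_def SUP_mult_left_ennreal
proof (rule SUP_least)
  fix t assume x: "0 < x" and "t \<in> {x..}"
  then have t: "x \<le> t" "0 < t" by auto
  have "ennreal (x powr q) * ennreal (t powr - q) = ennreal ((x / t) powr q)"
    using x t by (simp add: powr_divide powr_minus_divide flip: ennreal_mult)
  then have "ennreal (x powr q) * (emeasure \<omega> {..<t} * ennreal (t powr - q)) = ennreal ((x / t) powr q) * emeasure \<omega> {..<t}"
    by (metis mult.assoc mult.commute)
  then show "ennreal (x powr q) * (emeasure \<omega> {..<t} * ennreal (t powr - q)) \<le> Nq x" using Nq_ge_char[OF x t(1)] by simp
qed

text \<open>With k = S1 x, the distribution function of \<omega> is at most k t^q for t \<ge> x, so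
  beyond x the measure is dominated by the density 2 k q z^(q-1). For a competitor z \<psi>(z) \<le>
  x, so q \<ge> 1 gives \<psi>^q z^(q-1) \<le> \<psi> x^(q-1), and the integral of \<psi> is at most
  x. The 1 in 1 + 2 q pays for the part to the left of x.\<close>

lemma Nq_le_S1:
  assumes q1: "1 \<le> q" and x: "0 < x"
  shows "Nq x \<le> ennreal (1 + 2 * q) * (ennreal (x powr q) * S1 x)"
proof (cases "S1 x")
  case (real k)
  have k: "emeasure \<omega> {..<t} \<le> ennreal (k * t powr q)" if t: "x \<le> t" for t
  proof -
    have t0: "0 < t" using t x by simp
    have "emeasure \<omega> {..<t} * ennreal (t powr - q) \<le> ennreal k"
      unfolding real(2)[symmetric] S1_def using t by (intro SUP_upper) auto
    then have "emeasure \<omega> {..<t} * ennreal (t powr - q) * ennreal (t powr q) \<le> ennreal k * ennreal (t powr q)"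
      by (rule mult_right_mono) simp
    moreover have "ennreal (t powr - q) * ennreal (t powr q) = 1"
      using t0 by (simp flip: ennreal_mult powr_add)
    ultimately show ?thesis using real by (simp add: mult.assoc ennreal_mult)
  qed
  show ?thesis
    unfolding Nq_def
  proof (rule SUP_least)
    fix \<psi> assume \<psi>: "\<psi> \<in> feas x"
    then have am: "antimono \<psi>" by (simp add: feas_def)
    have [measurable]: "\<psi> \<in> borel_measurable borel" by (rule antimono_ennreal_borel[OF am])
    have am': "antimono (\<lambda>z. \<psi> z epowr q)" using am q by (auto simp: antimono_def intro: epowr_mono)
    have "Lm \<psi> \<le> emeasure \<omega> {..<x} + ennreal (2 * k * q * x powr q)"
    proof (rule Lm_split[OF \<psi> x])
      fix n
      have "(\<integral>\<^sup>+z\<in>{x<..<n}. \<psi> z epowr q \<partial>\<omega>) \<le> (\<integral>\<^sup>+z\<in>{0<..}. \<psi> z epowr q * ennreal (2 * k * (q * z powr (q - 1))) \<partial>lborel)"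
      proof (rule om_dominated[OF am' _ _ _ x])
        fix t assume t: "x < t"
        have "emeasure (om_from x n) {..<t} \<le> ennreal (k * t powr q)"
          using om_from_le k[of t] t by (meson less_imp_le order_trans)
        also have "k * t powr q \<le> 2 * k * (t powr q - (t / 2) powr q)"
        proof -
          \<comment> \<open>Here q \<ge> 1 enters again: at least half of the mass k t^q of the
            density k q z^(q-1) on (0,t) lies in (t/2,t).\<close>
          have "2 powr 1 \<le> 2 powr q" using q1 by (intro powr_mono) auto
          then have "2 \<le> 2 powr q" by simp
          then have "t powr q / 2 powr q \<le> t powr q / 2" by (intro divide_left_mono) auto
          then have "t powr q \<le> 2 * (t powr q - (t / 2) powr q)" using t x by (simp add: powr_divide mult.commute)
          then have "k * t powr q \<le> k * (2 * (t powr q - (t / 2) powr q))" using real by (intro mult_left_mono)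
          then show ?thesis by (simp add: mult_ac)
        qed
        also have "ennreal (2 * k * (t powr q - (t / 2) powr q)) = (\<integral>\<^sup>+z\<in>{t/2<..t}. ennreal (2 * k * (q * z powr (q - 1))) \<partial>lborel)"
          unfolding right_diff_distrib
          by (rule nn_integral_FTC_Ioc[symmetric])
            (use t x q real in \<open>auto intro!: DERIV_cmult has_real_derivative_powr\<close>)
        also have "\<dots> = (\<integral>\<^sup>+z\<in>{t/2<..<t}. ennreal (2 * k * (q * z powr (q - 1))) \<partial>lborel)"
          using AE_lborel_singleton[of t] by (intro nn_integral_cong_AE) (auto simp: indicator_def)
        finally show "emeasure (om_from x n) {..<t} \<le> \<dots>" by (simp add: ennreal_leI)
      qed auto
      also have "\<dots> \<le> (\<integral>\<^sup>+z. ennreal (2 * k * q * x powr (q - 1)) * (\<psi> z * indicator {0<..} z) \<partial>lborel)"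
      proof (intro nn_integral_mono)
        fix z :: real
        show "\<psi> z epowr q * ennreal (2 * k * (q * z powr (q - 1))) * indicator {0<..} z \<le> ennreal (2 * k * q * x powr (q - 1)) * (\<psi> z * indicator {0<..} z)"
        proof (cases "0 < z")
          case True
          have "\<psi> z epowr q * ennreal (z powr (q - 1)) \<le> \<psi> z * ennreal (x powr (q - 1))"
          proof (cases "q = 1")
            case False
            then have q': "0 < q - 1" using q1 by simp
            have "\<psi> z epowr q = \<psi> z * \<psi> z epowr (q - 1)" using epowr_add[of 1 "q - 1" "\<psi> z"] q' by simp
            then have "\<psi> z epowr q * ennreal (z powr (q - 1)) = \<psi> z * (\<psi> z * ennreal z) epowr (q - 1)"
              using True q' by (simp add: epowr_mult epowr_ennreal mult.assoc)
            also have "\<dots> \<le> \<psi> z * ennreal x epowr (q - 1)"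
              using q' by (intro mult_left_mono epowr_mono feas_mult_le[OF \<psi> True]) auto
            finally show ?thesis using x by (simp add: epowr_ennreal)
          qed (use True x in simp)
          then have "ennreal (2 * k * q) * (\<psi> z epowr q * ennreal (z powr (q - 1))) \<le> ennreal (2 * k * q) * (\<psi> z * ennreal (x powr (q - 1)))"
            by (intro mult_left_mono) auto
          then show ?thesis using True real q by (simp add: ennreal_mult mult_ac)
        qed simp
      qed
      also have "\<dots> = ennreal (2 * k * q * x powr (q - 1)) * (\<integral>\<^sup>+z\<in>{0<..}. \<psi> z \<partial>lborel)" by (simp add: nn_integral_cmult)
      also have "\<dots> \<le> ennreal (2 * k * q * x powr (q - 1)) * ennreal x"
        using \<psi> by (intro mult_left_mono feas_integral_le) (auto simp: feas_def min_def intro: order_trans ennreal_leI split: if_splits)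
      also have "\<dots> = ennreal (2 * k * q * x powr q)"
        using x real q by (simp add: powr_diff flip: ennreal_mult)
      finally show "(\<integral>\<^sup>+z\<in>{x<..<n}. \<psi> z epowr q \<partial>\<omega>) \<le> ennreal (2 * k * q * x powr q)" .
    qed
    also have "\<dots> \<le> ennreal (k * x powr q) + ennreal (2 * k * q * x powr q)"
      by (intro add_right_mono k) simp
    also have "\<dots> = ennreal ((1 + 2 * q) * (x powr q * k))"
      using real q by (subst ennreal_plus[symmetric]) (auto simp: algebra_simps)
    also have "\<dots> = ennreal (1 + 2 * q) * (ennreal (x powr q) * S1 x)"
      unfolding real(2) using real q by (simp only: ennreal_mult'' ennreal_mult' mult_nonneg_nonneg powr_ge_zero)
    finally show "Lm \<psi> \<le> ennreal (1 + 2 * q) * (ennreal (x powr q) * S1 x)" .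
  qed
next
  case top
  then show ?thesis using x q by (simp add: ennreal_mult_top)
qed

end

section \<open>The testing supremum for exponents below 1\<close>

locale gamma_finite_lt1 = gamma_finite +
  assumes q1: "q < 1"
begin

definition \<beta> where "\<beta> = q / (1 - q)"
definition Om where "Om z = emeasure \<omega> {..<z}"
definition Iw where "Iw x n = (\<integral>\<^sup>+z\<in>{x<..<n}. Om z epowr \<beta> * ennreal (z powr - \<beta>) \<partial>\<omega>)"
definition I1 where "I1 x = (\<integral>\<^sup>+z\<in>{x<..}. Om z epowr \<beta> * ennreal (z powr - \<beta>) \<partial>\<omega>)"

lemma beta: "0 < \<beta>" "1 / (1 - q) = 1 + \<beta>" "(1 + \<beta>) * q = \<beta>" "(1 + \<beta>) * (1 - q) = 1" "\<beta> * (1 - q) = q"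
  using q q1 by (auto simp: \<beta>_def field_simps)

lemma Om_mono: "x \<le> y \<Longrightarrow> Om x \<le> Om y"
  unfolding Om_def by (intro emeasure_mono) (auto simp: sets_om)

lemma Om_measurable [measurable]: "Om \<in> borel_measurable borel"
  by (intro mono_ennreal_borel monoI Om_mono)

lemma Om_fin: "Om x < top" using om_fin by (simp add: Om_def less_top)

definition Fw where "Fw x n z = emeasure (om_from x n) {..<z}"

lemma Fw_mono: "y \<le> z \<Longrightarrow> Fw x n y \<le> Fw x n z"
  unfolding Fw_def by (intro emeasure_mono) auto

lemma Fw_measurable [measurable]: "Fw x n \<in> borel_measurable borel"
  by (intro mono_ennreal_borel monoI Fw_mono)

lemma Fw_le: "Fw x n z \<le> Om z" unfolding Fw_def Om_def by (rule om_from_le)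

definition Kh where "Kh = 2 powr (1 + \<beta>) / \<beta>"

lemma Kh_pos: "0 < Kh" using beta by (simp add: Kh_def)

lemma Fw_hardy:
  assumes x: "0 < x"
  shows "(\<integral>\<^sup>+z\<in>{0<..}. Fw x n z epowr (1 + \<beta>) * ennreal (z powr (- 1 - \<beta>)) \<partial>lborel) \<le> ennreal Kh * Iw x n"
proof -
  have "(\<integral>\<^sup>+z\<in>{0<..}. Fw x n z epowr (1 + \<beta>) * ennreal (z powr (- 1 - \<beta>)) \<partial>lborel)
      \<le> ennreal Kh * (\<integral>\<^sup>+z. Fw x n z epowr \<beta> * ennreal (z powr - \<beta>) \<partial>om_from x n)"
    unfolding Fw_def Kh_def
    by (rule cdf_hardy[where a = x]) (use x om_from_fin om_from_atom om_from_zero beta in auto)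
  also have "(\<integral>\<^sup>+z. Fw x n z epowr \<beta> * ennreal (z powr - \<beta>) \<partial>om_from x n) \<le> Iw x n"
    unfolding Iw_def using beta
    by (subst nn_integral_om_from) (auto intro!: nn_integral_mono mult_right_mono epowr_mono Fw_le)
  finally show ?thesis by (simp add: mult_left_mono)
qed

definition Ku where "Ku = 2 * (2 powr (2 * (1 + \<beta>)) * Kh) powr (1 - q)"

text \<open>Beyond x the measure is dominated by the density g(z) = 2 F(2z)/z, where F is the
  truncated distribution function. Hoelder's inequality separates the integral of \<psi>, at most x,
  from that of g^(1/(1-q)), which \<open>cdf_hardy\<close> brings back to an integral against
  \<omega>.\<close>

lemma Nq_le_I1:
  assumes x: "0 < x"
  shows "Nq x \<le> Om x + ennreal Ku * (ennreal (x powr q) * I1 x epowr (1 - q))"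
  unfolding Nq_def
proof (rule SUP_least)
  fix \<psi> assume \<psi>: "\<psi> \<in> feas x"
  then have am: "antimono \<psi>" by (simp add: feas_def)
  have [measurable]: "\<psi> \<in> borel_measurable borel" by (rule antimono_ennreal_borel[OF am])
  have am': "antimono (\<lambda>z. \<psi> z epowr q)" using am q by (auto simp: antimono_def intro: epowr_mono)
  show "Lm \<psi> \<le> Om x + ennreal Ku * (ennreal (x powr q) * I1 x epowr (1 - q))"
    unfolding Om_def
  proof (rule Lm_split[OF \<psi> x])
    fix n
    \<comment> \<open>For t/2 < z < t monotonicity gives F(2z) \<ge> F(t), and 2/z \<ge> 2/t, so an
      interval of length t/2 carries at least the mass F(t).\<close>
    define g where "g z = 2 * (Fw x n (2 * z) * ennreal (1 / z))" for z
    have [measurable]: "g \<in> borel_measurable borel" unfolding g_def[abs_def] by measurable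
    have "(\<integral>\<^sup>+z\<in>{x<..<n}. \<psi> z epowr q \<partial>\<omega>) \<le> (\<integral>\<^sup>+z\<in>{0<..}. \<psi> z epowr q * g z \<partial>lborel)"
    proof (rule om_dominated[OF am' _ _ _ x])
      fix t assume t: "x < t"
      have "emeasure (om_from x n) {..<t} = Fw x n t * (ennreal (2 / t) * ennreal (t / 2))"
        using t x by (simp add: Fw_def flip: ennreal_mult)
      also have "\<dots> = (\<integral>\<^sup>+z. Fw x n t * ennreal (2 / t) * indicator {t/2<..<t} z \<partial>lborel)"
        using t x by (simp add: nn_integral_cmult mult.assoc)
      also have "\<dots> \<le> (\<integral>\<^sup>+z\<in>{t/2<..<t}. g z \<partial>lborel)"
      proof (intro nn_integral_mono)
        fix z
        show "Fw x n t * ennreal (2 / t) * indicator {t/2<..<t} z \<le> g z * indicator {t/2<..<t} z"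
        proof (cases "z \<in> {t/2<..<t}")
          case True
          have "1 / t \<le> 1 / z" using True t x by (intro divide_left_mono) auto
          then have "Fw x n t * ennreal (1 / t) \<le> Fw x n (2 * z) * ennreal (1 / z)"
            using True by (intro mult_mono Fw_mono ennreal_leI) auto
          then have "2 * (Fw x n t * ennreal (1 / t)) \<le> g z" unfolding g_def by (rule mult_left_mono) simp
          moreover have "ennreal (2 / t) = 2 * ennreal (1 / t)" using ennreal_mult'[of 2 "1 / t"] by simp
          ultimately show ?thesis using True by (simp add: mult_ac)
        qed simp
      qed
      finally show "emeasure (om_from x n) {..<t} \<le> (\<integral>\<^sup>+z\<in>{t/2<..<t}. g z \<partial>lborel)" .
    next
      fix z show "g z \<noteq> top"
        using Fw_le[of x n "2 * z"] Om_fin[of "2 * z"] by (auto simp: g_def ennreal_mult_eq_top_iff top_unique)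
    qed measurable
    also have "\<dots> = (\<integral>\<^sup>+z. (\<psi> z * indicator {0<..} z) epowr q * (g z * indicator {0<..} z) \<partial>lborel)"
      using q by (intro nn_integral_cong) (auto simp: indicator_def)
    also have "\<dots> \<le> 2 * ((\<integral>\<^sup>+z\<in>{0<..}. \<psi> z \<partial>lborel) epowr q * (\<integral>\<^sup>+z. (g z * indicator {0<..} z) epowr (1 / (1 - q)) \<partial>lborel) epowr (1 - q))"
      by (rule holder_nn_integral) (use q q1 in auto)
    also have "\<dots> \<le> 2 * (ennreal x epowr q * (ennreal (2 powr (2 * (1 + \<beta>)) * Kh) * I1 x) epowr (1 - q))"
    proof (intro mult_left_mono mult_mono epowr_mono)
      show "(\<integral>\<^sup>+z\<in>{0<..}. \<psi> z \<partial>lborel) \<le> ennreal x"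
        using \<psi> by (intro feas_integral_le) (auto simp: feas_def min_def intro: order_trans ennreal_leI split: if_splits)
      define f where "f y = Fw x n y epowr (1 + \<beta>) * ennreal (y powr (- 1 - \<beta>)) * indicator {0<..} y" for y
      have [measurable]: "f \<in> borel_measurable borel" unfolding f_def[abs_def] by measurable
      have "(\<integral>\<^sup>+z. (g z * indicator {0<..} z) epowr (1 / (1 - q)) \<partial>lborel)
          = (\<integral>\<^sup>+z. ennreal (2 powr (2 * (1 + \<beta>))) * f (0 + 2 * z) \<partial>lborel)"
      proof (intro nn_integral_cong)
        fix z
        show "(g z * indicator {0<..} z) epowr (1 / (1 - q)) = ennreal (2 powr (2 * (1 + \<beta>))) * f (0 + 2 * z)"
        proof (cases "0 < z")
          case True
          \<comment> \<open>One power 2^(1+\<beta>) is the factor 2 in g; the other comes from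
            writing 1/z as 2/(2z) before the substitution.\<close>
          have "(1 / z) powr (1 + \<beta>) = 2 powr (1 + \<beta>) * (2 * z) powr (- 1 - \<beta>)"
          proof -
            have "- 1 - \<beta> = - (1 + \<beta>)" by simp
            then show ?thesis using True by (simp only: powr_minus_divide) (simp add: powr_divide powr_mult)
          qed
          then have "2 powr (1 + \<beta>) * (1 / z) powr (1 + \<beta>) = 2 powr (2 * (1 + \<beta>)) * (2 * z) powr (- 1 - \<beta>)"
            by (simp add: powr_add[symmetric] mult.assoc[symmetric])
          then have e: "ennreal (2 powr (1 + \<beta>)) * ennreal ((1 / z) powr (1 + \<beta>)) = ennreal (2 powr (2 * (1 + \<beta>))) * ennreal ((2 * z) powr (- 1 - \<beta>))"
            by (simp flip: ennreal_mult)
          have "(g z) epowr (1 + \<beta>) = ennreal (2 powr (1 + \<beta>)) * ennreal ((1 / z) powr (1 + \<beta>)) * Fw x n (2 * z) epowr (1 + \<beta>)"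
            using True beta epowr_ennreal[of 2 "1 + \<beta>"] epowr_ennreal[of "1 / z" "1 + \<beta>"]
            by (simp add: g_def epowr_mult mult_ac)
          then show ?thesis unfolding e beta(2) using True by (simp add: f_def mult_ac)
        qed (use beta in \<open>simp add: f_def\<close>)
      qed
      also have "\<dots> = ennreal (2 powr (2 * (1 + \<beta>))) * (\<integral>\<^sup>+z. f (0 + 2 * z) \<partial>lborel)"
        by (rule nn_integral_cmult) measurable
      also have "(\<integral>\<^sup>+z. f (0 + 2 * z) \<partial>lborel) \<le> (\<integral>\<^sup>+z. f z \<partial>lborel)"
      proof -
        have "1 * (\<integral>\<^sup>+z. f (0 + 2 * z) \<partial>lborel) \<le> ennreal \<bar>2\<bar> * (\<integral>\<^sup>+z. f (0 + 2 * z) \<partial>lborel)"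
          by (intro mult_right_mono) auto
        also have "\<dots> = (\<integral>\<^sup>+z. f z \<partial>lborel)" by (rule nn_integral_real_affine[symmetric]) auto
        finally show ?thesis by simp
      qed
      also have "(\<integral>\<^sup>+z. f z \<partial>lborel) \<le> ennreal Kh * Iw x n" unfolding f_def by (rule Fw_hardy[OF x])
      also have "Iw x n \<le> I1 x" unfolding Iw_def I1_def by (intro nn_integral_mono) (auto simp: indicator_def)
      finally show "(\<integral>\<^sup>+z. (g z * indicator {0<..} z) epowr (1 / (1 - q)) \<partial>lborel) \<le> ennreal (2 powr (2 * (1 + \<beta>)) * Kh) * I1 x"
        using Kh_pos by (simp add: mult_left_mono ennreal_mult mult.assoc)
    qed (use q q1 in auto)
    also have "\<dots> = ennreal Ku * (ennreal (x powr q) * I1 x epowr (1 - q))"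
    proof -
      define d where "d = 2 powr (2 * (1 + \<beta>)) * Kh"
      have "0 < d" using Kh_pos by (simp add: d_def)
      then have "2 * (ennreal x epowr q * (ennreal d * I1 x) epowr (1 - q)) = ennreal (2 * d powr (1 - q)) * (ennreal (x powr q) * I1 x epowr (1 - q))"
        using q1 x by (simp add: epowr_mult epowr_ennreal ennreal_mult' mult_ac)
      then show ?thesis by (simp only: d_def Ku_def)
    qed
    finally show "(\<integral>\<^sup>+z\<in>{x<..<n}. \<psi> z epowr q \<partial>\<omega>) \<le> ennreal Ku * (ennreal (x powr q) * I1 x epowr (1 - q))" .
  qed
qed

definition c1 where "c1 = 2 powr (- (2 + \<beta>) * q)"
definition c2 where "c2 = 2 powr (1 + \<beta>) * (Kh + 1 / \<beta>)"
definition Kv where "Kv = 1 + (2 * c2) powr q / c1"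

text \<open>The test function superposes indicators of (0,s), s > x, with density G(s)^(1+\<beta>)
  s^(-2-\<beta>). By Fubini its integral is at most J, and it is bounded by J/x, so it is at most
  J/x times a competitor at x in the sense of \<open>Lm_le_Nq\<close>. Its q-th power is at least c1
  (Om z / z)^\<beta> on (x,n). Hardy's inequality bounds J by c2 (Iw + P), where P stems from the
  mass to the left of x.\<close>

lemma Nq_ge_Iw:
  assumes x: "0 < x" and n: "x \<le> n"
  shows "ennreal (x powr q) * Iw x n epowr (1 - q) \<le> ennreal Kv * Nq x"
proof -
  have c: "0 < c1" "0 < c2" using Kh_pos beta by (auto simp: c1_def c2_def intro!: mult_pos_pos add_pos_pos)
  \<comment> \<open>Freezing the distribution function beyond n keeps J finite; at z in (x,n) and
    all later points G is at least Om z.\<close>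
  define G where "G s = Om x + Fw x n s" for s
  have [measurable]: "G \<in> borel_measurable borel" unfolding G_def[abs_def] by measurable
  define J where "J = (\<integral>\<^sup>+s\<in>{x<..}. G s epowr (1 + \<beta>) * ennreal (s powr (- 1 - \<beta>)) \<partial>lborel)"
  define P where "P = Om x epowr (1 + \<beta>) * ennreal (x powr - \<beta>)"
  have J_le: "J \<le> ennreal c2 * (Iw x n + P)"
  proof -
    have "J \<le> (\<integral>\<^sup>+s. ennreal (2 powr (1 + \<beta>)) * (Fw x n s epowr (1 + \<beta>) * ennreal (s powr (- 1 - \<beta>)) * indicator {0<..} s
        + Om x epowr (1 + \<beta>) * (ennreal (s powr (- 1 - \<beta>)) * indicator {x<..} s)) \<partial>lborel)"
      unfolding J_def
    proof (intro nn_integral_mono)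
      fix s
      have *: "G s epowr (1 + \<beta>) \<le> ennreal (2 powr (1 + \<beta>)) * (Om x epowr (1 + \<beta>) + Fw x n s epowr (1 + \<beta>))"
        unfolding G_def using beta by (intro epowr_add_le) auto
      show "G s epowr (1 + \<beta>) * ennreal (s powr (- 1 - \<beta>)) * indicator {x<..} s
        \<le> ennreal (2 powr (1 + \<beta>)) * (Fw x n s epowr (1 + \<beta>) * ennreal (s powr (- 1 - \<beta>)) * indicator {0<..} s
        + Om x epowr (1 + \<beta>) * (ennreal (s powr (- 1 - \<beta>)) * indicator {x<..} s))"
      proof (cases "x < s")
        case True
        have "G s epowr (1 + \<beta>) * ennreal (s powr (- 1 - \<beta>)) \<le> ennreal (2 powr (1 + \<beta>)) * (Om x epowr (1 + \<beta>) + Fw x n s epowr (1 + \<beta>)) * ennreal (s powr (- 1 - \<beta>))"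
          by (intro mult_right_mono *) auto
        then show ?thesis using True x by (simp add: distrib_left distrib_right mult_ac add_ac)
      qed simp
    qed
    also have "\<dots> = ennreal (2 powr (1 + \<beta>)) * ((\<integral>\<^sup>+s\<in>{0<..}. Fw x n s epowr (1 + \<beta>) * ennreal (s powr (- 1 - \<beta>)) \<partial>lborel)
        + Om x epowr (1 + \<beta>) * ennreal (x powr - \<beta> / \<beta>))"
      using nn_integral_powr_tail[OF x beta(1)] by (simp add: nn_integral_cmult nn_integral_add)
    also have "\<dots> \<le> ennreal (2 powr (1 + \<beta>)) * (ennreal Kh * Iw x n + ennreal (1 / \<beta>) * P)"
    proof (intro mult_left_mono add_mono Fw_hardy x)
      have "ennreal (x powr - \<beta> / \<beta>) = ennreal (1 / \<beta>) * ennreal (x powr - \<beta>)"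
        using beta by (subst ennreal_mult''[symmetric]) auto
      then show "Om x epowr (1 + \<beta>) * ennreal (x powr - \<beta> / \<beta>) \<le> ennreal (1 / \<beta>) * P"
        by (simp add: P_def mult_ac)
    qed auto
    also have "\<dots> \<le> ennreal (2 powr (1 + \<beta>)) * (ennreal (Kh + 1 / \<beta>) * Iw x n + ennreal (Kh + 1 / \<beta>) * P)"
      using Kh_pos beta by (intro mult_left_mono add_mono mult_right_mono ennreal_leI) auto
    also have "\<dots> = ennreal c2 * (Iw x n + P)"
    proof -
      have "ennreal c2 = ennreal (2 powr (1 + \<beta>)) * ennreal (Kh + 1 / \<beta>)"
        unfolding c2_def by (rule ennreal_mult') simp
      then show ?thesis by (simp only: distrib_left mult.assoc)
    qed
    finally show ?thesis .
  qed
  have Om_n: "Om n = ennreal (enn2real (Om n))" "Om x = ennreal (enn2real (Om x))" using Om_fin by auto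
  have Pfin: "P < top"
    unfolding P_def using beta Om_fin[of x]
    by (simp add: ennreal_mult_eq_top_iff less_top[symmetric] epowr_eq_top_iff)
  have Ifin: "Iw x n < top"
  proof -
    have "Iw x n \<le> (\<integral>\<^sup>+z. (Om n epowr \<beta> * ennreal (x powr - \<beta>)) * indicator {x<..<n} z \<partial>\<omega>)"
      unfolding Iw_def
    proof (intro nn_integral_mono)
      fix z
      show "Om z epowr \<beta> * ennreal (z powr - \<beta>) * indicator {x<..<n} z \<le> Om n epowr \<beta> * ennreal (x powr - \<beta>) * indicator {x<..<n} z"
        using x beta by (auto simp: indicator_def intro!: mult_mono epowr_mono Om_mono ennreal_leI powr_mono2')
    qed
    also have "\<dots> = (Om n epowr \<beta> * ennreal (x powr - \<beta>)) * emeasure \<omega> {x<..<n}"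
      by (simp add: nn_integral_cmult sets_om)
    also have "\<dots> \<le> (Om n epowr \<beta> * ennreal (x powr - \<beta>)) * Om n"
      unfolding Om_def by (intro mult_left_mono emeasure_mono) (auto simp: sets_om)
    also have "\<dots> < top"
      using beta Om_fin[of n] by (simp add: ennreal_mult_eq_top_iff less_top[symmetric] epowr_eq_top_iff)
    finally show ?thesis .
  qed
  have Jfin: "J < top"
    using J_le Pfin Ifin by (auto simp: ennreal_mult_less_top intro: le_less_trans)
  define \<psi> where "\<psi> z = (\<integral>\<^sup>+s\<in>{max z x<..}. G s epowr (1 + \<beta>) * ennreal (s powr (- 2 - \<beta>)) \<partial>lborel)" for z
  have am: "antimono \<psi>"
    unfolding \<psi>_def by (intro antimonoI nn_integral_mono mult_left_mono) (auto simp: indicator_def)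
  have [measurable]: "\<psi> \<in> borel_measurable borel" by (rule antimono_ennreal_borel[OF am])
  have pw: "s powr (- 1 - \<beta>) = s * s powr (- 2 - \<beta>)" if "0 < s" for s
    using powr_add[of s 1 "- 2 - \<beta>"] that by simp
  have h1: "hh \<psi> z \<le> J" for z
  proof -
    have "hh \<psi> z \<le> (\<integral>\<^sup>+t. (\<integral>\<^sup>+s. (G s epowr (1 + \<beta>) * ennreal (s powr (- 2 - \<beta>)) * indicator {x<..} s) * (if 0 < t \<and> t < s then 1 else 0) \<partial>lborel) \<partial>lborel)"
      unfolding hh_def \<psi>_def
      by (subst nn_integral_multc[symmetric], measurable) (auto intro!: nn_integral_mono simp: indicator_def)
    also have "\<dots> = (\<integral>\<^sup>+s. (\<integral>\<^sup>+t. (G s epowr (1 + \<beta>) * ennreal (s powr (- 2 - \<beta>)) * indicator {x<..} s) * (if 0 < t \<and> t < s then 1 else 0) \<partial>lborel) \<partial>lborel)"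
      by (rule lborel_pair.Fubini') measurable
    also have "\<dots> = J"
      unfolding J_def
    proof (intro nn_integral_cong)
      fix s
      have "(\<integral>\<^sup>+t. (G s epowr (1 + \<beta>) * ennreal (s powr (- 2 - \<beta>)) * indicator {x<..} s) * (if 0 < t \<and> t < s then 1 else 0) \<partial>lborel)
        = (\<integral>\<^sup>+t. (G s epowr (1 + \<beta>) * ennreal (s powr (- 2 - \<beta>)) * indicator {x<..} s) * indicator {0<..<s} t \<partial>lborel)"
        by (intro nn_integral_cong) (auto simp: indicator_def)
      also have "\<dots> = (G s epowr (1 + \<beta>) * ennreal (s powr (- 2 - \<beta>)) * indicator {x<..} s) * emeasure lborel {0<..<s}"
        by (simp add: nn_integral_cmult)
      also have "\<dots> = G s epowr (1 + \<beta>) * ennreal (s powr (- 1 - \<beta>)) * indicator {x<..} s"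
        using x by (cases "x < s") (auto simp: pw ennreal_mult mult_ac)
      finally show "(\<integral>\<^sup>+t. (G s epowr (1 + \<beta>) * ennreal (s powr (- 2 - \<beta>)) * indicator {x<..} s) * (if 0 < t \<and> t < s then 1 else 0) \<partial>lborel)
        = G s epowr (1 + \<beta>) * ennreal (s powr (- 1 - \<beta>)) * indicator {x<..} s" .
    qed
    finally show ?thesis .
  qed
  have psi_le: "\<psi> z \<le> J * ennreal (1 / x)" for z
  proof -
    have "\<psi> z \<le> (\<integral>\<^sup>+s. (G s epowr (1 + \<beta>) * ennreal (s powr (- 1 - \<beta>)) * indicator {x<..} s) * ennreal (1 / x) \<partial>lborel)"
      unfolding \<psi>_def
    proof (intro nn_integral_mono)
      fix s
      show "G s epowr (1 + \<beta>) * ennreal (s powr (- 2 - \<beta>)) * indicator {max z x<..} s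
        \<le> (G s epowr (1 + \<beta>) * ennreal (s powr (- 1 - \<beta>)) * indicator {x<..} s) * ennreal (1 / x)"
      proof (cases "max z x < s")
        case True
        then have s: "0 < s" "x < s" using x by auto
        have "x * s powr (- 2 - \<beta>) \<le> s * s powr (- 2 - \<beta>)" using s by (intro mult_right_mono) auto
        then have "s powr (- 2 - \<beta>) \<le> s powr (- 1 - \<beta>) * (1 / x)" using x s by (simp add: pw field_simps)
        then have "ennreal (s powr (- 2 - \<beta>)) \<le> ennreal (s powr (- 1 - \<beta>)) * ennreal (1 / x)"
          by (subst ennreal_mult'[symmetric]) (auto intro: ennreal_leI)
        then show ?thesis using True s by (simp add: mult.assoc mult_left_mono)
      qed simp
    qed
    also have "\<dots> = J * ennreal (1 / x)" unfolding J_def by (rule nn_integral_multc) measurable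
    finally show ?thesis .
  qed
  define j where "j = enn2real J"
  have j: "J = ennreal j" "0 \<le> j" using Jfin by (auto simp: j_def)
  have main: "Lm \<psi> \<le> ennreal (j / x) epowr q * Nq x"
  proof (rule Lm_le_Nq[OF am _ _ x])
    show "0 \<le> j / x" using j x by simp
    fix z :: real assume z: "0 < z"
    have "hh \<psi> z \<le> ennreal (j / x) * ennreal z"
    proof -
      have "hh \<psi> z \<le> hh (\<lambda>_. J * ennreal (1 / x)) z" by (intro hh_le psi_le)
      also have "\<dots> = J * ennreal (1 / x) * ennreal z" using z by (simp add: hh_const)
      also have "\<dots> = ennreal (j / x) * ennreal z" using j x by (simp flip: ennreal_mult)
      finally show ?thesis .
    qed
    moreover have "hh \<psi> z \<le> ennreal (j / x) * ennreal x" using h1[of z] j x by (simp flip: ennreal_mult)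
    ultimately show "hh \<psi> z \<le> ennreal (j / x) * ennreal (min z x)" by (simp add: min_def)
  qed
  have low: "ennreal c1 * Iw x n \<le> Lm \<psi>"
  proof -
    have "ennreal c1 * Iw x n = (\<integral>\<^sup>+z. ennreal c1 * (Om z epowr \<beta> * ennreal (z powr - \<beta>) * indicator {x<..<n} z) \<partial>\<omega>)"
      unfolding Iw_def by (rule nn_integral_cmult[symmetric]) measurable
    also have "\<dots> \<le> Lm \<psi>"
      unfolding Lm_def
    proof (intro nn_integral_mono)
      fix z
      show "ennreal c1 * (Om z epowr \<beta> * ennreal (z powr - \<beta>) * indicator {x<..<n} z) \<le> \<psi> z epowr q"
      proof (cases "z \<in> {x<..<n}")
        case True
        then have z: "0 < z" "x < z" "z < n" using x by auto
        have Gz: "Om z \<le> G s" if "z \<le> s" for s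
        proof -
          have "Om z \<le> emeasure \<omega> ({..<x} \<union> ({x} \<union> {x<..<z}))"
            unfolding Om_def by (intro emeasure_mono) (auto simp: sets_om)
          also have "\<dots> \<le> Om x + (emeasure \<omega> {x} + emeasure \<omega> {x<..<z})"
            unfolding Om_def by (intro order_trans[OF emeasure_subadditive] add_left_mono emeasure_subadditive) (auto simp: sets_om)
          also have "emeasure \<omega> {x} = 0" by (rule om_atom)
          also have "emeasure \<omega> {x<..<z} = emeasure \<omega> ({x<..<n} \<inter> {..<z})"
            using z by (intro arg_cong[where f = "emeasure \<omega>"]) auto
          also have "\<dots> = Fw x n z" by (simp add: Fw_def om_from)
          also have "\<dots> \<le> Fw x n s" by (rule Fw_mono[OF that])
          finally show ?thesis by (simp add: G_def add_left_mono)
        qed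
        \<comment> \<open>Only s between z and 2z is kept, where s is comparable with z and G(s) is
          at least Om z.\<close>
        have "Om z epowr (1 + \<beta>) * ennreal (z powr (- 1 - \<beta>) * 2 powr (- 2 - \<beta>))
            = (\<integral>\<^sup>+s. Om z epowr (1 + \<beta>) * ennreal ((2 * z) powr (- 2 - \<beta>)) * indicator {z<..<2 * z} s \<partial>lborel)"
        proof -
          have "(\<integral>\<^sup>+s. Om z epowr (1 + \<beta>) * ennreal ((2 * z) powr (- 2 - \<beta>)) * indicator {z<..<2 * z} s \<partial>lborel)
            = Om z epowr (1 + \<beta>) * ennreal ((2 * z) powr (- 2 - \<beta>)) * ennreal z"
            using z by (simp add: nn_integral_cmult)
          also have "\<dots> = Om z epowr (1 + \<beta>) * ennreal ((2 * z) powr (- 2 - \<beta>) * z)"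
            using z by (simp add: ennreal_mult mult.assoc)
          also have "(2 * z) powr (- 2 - \<beta>) * z = z powr (- 1 - \<beta>) * 2 powr (- 2 - \<beta>)"
            using z by (simp add: pw powr_mult)
          finally show ?thesis by simp
        qed
        also have "\<dots> \<le> \<psi> z"
          unfolding \<psi>_def
        proof (intro nn_integral_mono)
          fix s
          show "Om z epowr (1 + \<beta>) * ennreal ((2 * z) powr (- 2 - \<beta>)) * indicator {z<..<2 * z} s
            \<le> G s epowr (1 + \<beta>) * ennreal (s powr (- 2 - \<beta>)) * indicator {max z x<..} s"
            using z beta(1) by (auto simp: indicator_def intro!: mult_mono epowr_mono Gz ennreal_leI powr_mono2')
        qed
        finally have "(Om z epowr (1 + \<beta>) * ennreal (z powr (- 1 - \<beta>) * 2 powr (- 2 - \<beta>))) epowr q \<le> \<psi> z epowr q"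
          using q by (intro epowr_mono) auto
        also have "(Om z epowr (1 + \<beta>) * ennreal (z powr (- 1 - \<beta>) * 2 powr (- 2 - \<beta>))) epowr q
           = Om z epowr \<beta> * ennreal (z powr - \<beta> * c1)"
        proof -
          have "(z powr (- 1 - \<beta>) * 2 powr (- 2 - \<beta>)) powr q = z powr (- ((1 + \<beta>) * q)) * c1"
          proof -
            have "(- 2 - \<beta>) * q = - (2 + \<beta>) * q" "(- 1 - \<beta>) * q = - ((1 + \<beta>) * q)"
              by (simp_all add: algebra_simps)
            then show ?thesis by (simp only: powr_mult powr_powr c1_def)
          qed
          then have "ennreal (z powr (- 1 - \<beta>) * 2 powr (- 2 - \<beta>)) epowr q = ennreal (z powr - \<beta> * c1)"
            unfolding beta(3) using z by (simp add: epowr_ennreal)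
          then show ?thesis using q beta by (simp add: epowr_mult epowr_epowr)
        qed
        finally show ?thesis using True c by (simp add: ennreal_mult mult_ac)
      qed simp
    qed
    finally show ?thesis .
  qed
  \<comment> \<open>If P dominates, the trivial bound Om x \<le> Nq x suffices. Otherwise J is at
    most 2 c2 Iw, and the power Iw^q can be cancelled, since Iw is positive and finite.\<close>
  show ?thesis
  proof (cases "Iw x n \<le> P")
    case True
    have "ennreal (x powr q) * Iw x n epowr (1 - q) \<le> ennreal (x powr q) * P epowr (1 - q)"
      using True q1 by (intro mult_left_mono epowr_mono) auto
    also have "\<dots> = Om x * (ennreal (x powr q) * ennreal (x powr - q))"
      unfolding P_def using x q1 beta
      by (simp add: epowr_mult epowr_epowr epowr_ennreal powr_powr mult_ac)
    also have "\<dots> = Om x" using x by (simp flip: ennreal_mult powr_add)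
    also have "\<dots> \<le> Nq x" unfolding Om_def by (rule Nq_ge[OF x])
    also have "\<dots> \<le> ennreal Kv * Nq x"
      using c mult_right_mono[of 1 "ennreal Kv" "Nq x"] by (simp add: Kv_def)
    finally show ?thesis .
  next
    case False
    define i where "i = enn2real (Iw x n)"
    have "0 < Iw x n" using False by (simp add: not_le le_less_trans[OF zero_le])
    then have i: "Iw x n = ennreal i" "0 < i" using Ifin by (auto simp: i_def enn2real_positive_iff)
    have "J \<le> ennreal c2 * (Iw x n + Iw x n)"
      using J_le False by (elim order_trans) (auto intro!: mult_left_mono add_left_mono)
    also have "\<dots> = ennreal (2 * c2 * i)" using i c by (simp add: ennreal_mult ennreal_plus[symmetric] mult_ac del: ennreal_plus flip: mult_2)
    finally have ji: "j \<le> 2 * c2 * i" using j i c by simp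
    have "ennreal c1 * ennreal i \<le> ennreal (j / x) epowr q * Nq x" using low main i by simp
    also have "\<dots> \<le> ennreal ((2 * c2 * i / x) powr q) * Nq x"
    proof -
      have "ennreal (j / x) \<le> ennreal (2 * c2 * i / x)" using ji x by (intro ennreal_leI divide_right_mono) auto
      then have "ennreal (j / x) epowr q \<le> ennreal (2 * c2 * i / x) epowr q" using q by (intro epowr_mono) auto
      also have "\<dots> = ennreal ((2 * c2 * i / x) powr q)" using c i x by (intro epowr_ennreal) auto
      finally show ?thesis by (intro mult_right_mono) auto
    qed
    finally have "ennreal (x powr q * i powr - q / c1) * (ennreal c1 * ennreal i)
      \<le> ennreal (x powr q * i powr - q / c1) * (ennreal ((2 * c2 * i / x) powr q) * Nq x)"
      by (intro mult_left_mono) auto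
    also have "ennreal (x powr q * i powr - q / c1) * (ennreal c1 * ennreal i) = ennreal (x powr q * i powr (1 - q))"
      using c i x by (simp add: powr_diff powr_minus_divide flip: ennreal_mult)
    also have "\<dots> = ennreal (x powr q) * Iw x n epowr (1 - q)" using i by (simp add: epowr_ennreal ennreal_mult)
    also have "ennreal (x powr q * i powr - q / c1) * (ennreal ((2 * c2 * i / x) powr q) * Nq x)
        = ennreal ((2 * c2) powr q / c1) * Nq x"
    proof -
      have "x powr q * i powr - q / c1 * (2 * c2 * i / x) powr q = (2 * c2) powr q / c1"
        using c i x by (simp add: powr_mult powr_divide powr_minus_divide)
      then show ?thesis using c by (simp add: mult.assoc[symmetric] flip: ennreal_mult)
    qed
    also have "\<dots> \<le> ennreal Kv * Nq x" by (intro mult_right_mono ennreal_leI) (auto simp: Kv_def)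
    finally show ?thesis .
  qed
qed

lemma Nq_ge_I1:
  assumes x: "0 < x"
  shows "ennreal (x powr q) * I1 x epowr (1 - q) \<le> ennreal Kv * Nq x"
proof -
  have "I1 x = (\<integral>\<^sup>+z. (SUP k. Om z epowr \<beta> * ennreal (z powr - \<beta>) * indicator {x<..<x + real k} z) \<partial>\<omega>)"
    unfolding I1_def
  proof (intro nn_integral_cong antisym)
    fix z
    show "Om z epowr \<beta> * ennreal (z powr - \<beta>) * indicator {x<..} z \<le> (SUP k. Om z epowr \<beta> * ennreal (z powr - \<beta>) * indicator {x<..<x + real k} z)"
    proof (cases "x < z")
      case True
      obtain k :: nat where "z - x < real k" using reals_Archimedean2 by blast
      then have "Om z epowr \<beta> * ennreal (z powr - \<beta>) * indicator {x<..} z = Om z epowr \<beta> * ennreal (z powr - \<beta>) * indicator {x<..<x + real k} z"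
        using True by simp
      also have "\<dots> \<le> (SUP k. Om z epowr \<beta> * ennreal (z powr - \<beta>) * indicator {x<..<x + real k} z)" by (rule SUP_upper) simp
      finally show ?thesis .
    qed simp
    show "(SUP k. Om z epowr \<beta> * ennreal (z powr - \<beta>) * indicator {x<..<x + real k} z) \<le> Om z epowr \<beta> * ennreal (z powr - \<beta>) * indicator {x<..} z"
      by (intro SUP_least mult_left_mono) (auto simp: indicator_def)
  qed
  also have "\<dots> = (SUP k. Iw x (x + real k))"
    unfolding Iw_def
  proof (rule nn_integral_monotone_convergence_SUP)
    show "incseq (\<lambda>k z. Om z epowr \<beta> * ennreal (z powr - \<beta>) * indicator {x<..<x + real k} z)"
      unfolding incseq_def le_fun_def by (intro allI impI mult_left_mono indicator_leI) auto
  qed measurable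
  finally have "ennreal (x powr q) * I1 x epowr (1 - q) = (SUP k. ennreal (x powr q) * Iw x (x + real k) epowr (1 - q))"
    using q1 by (simp add: epowr_SUP SUP_mult_left_ennreal)
  also have "\<dots> \<le> ennreal Kv * Nq x" by (intro SUP_least Nq_ge_Iw x) auto
  finally show ?thesis .
qed

end

section \<open>Nonatomic spaces\<close>

lemma nonatomicD:
  assumes "nonatomic M" "A \<in> sets M" "0 < emeasure M A"
  obtains B where "B \<in> sets M" "B \<subseteq> A" "emeasure M B \<noteq> 0" "emeasure M B \<noteq> emeasure M A"
  using assms unfolding nonatomic_def atom_def by blast

text \<open>Splitting \<open>A\<close> by a nonatomic measure into a part of at most half its measure, again and again.\<close>

lemma nonatomic_small_subset:
  assumes M: "nonatomic M" and A: "A \<in> sets M" "0 < emeasure M A" "emeasure M A \<noteq> top" and e: "0 < e"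
  obtains B where "B \<in> sets M" "B \<subseteq> A" "0 < emeasure M B" "emeasure M B \<le> ennreal e"
proof -
  have half: "\<exists>B. B \<in> sets M \<and> B \<subseteq> A' \<and> 0 < emeasure M B \<and> 2 * emeasure M B \<le> emeasure M A'"
    if A': "A' \<in> sets M" "0 < emeasure M A'" "emeasure M A' \<noteq> top" for A'
  proof -
    obtain B where B: "B \<in> sets M" "B \<subseteq> A'" "emeasure M B \<noteq> 0" "emeasure M B \<noteq> emeasure M A'"
      using nonatomicD[OF M A'(1,2)] by blast
    have Bf: "emeasure M B \<noteq> top"
      using emeasure_mono[OF B(2) A'(1)] A'(3) by (auto simp: top_unique)
    have sum: "emeasure M A' = emeasure M B + emeasure M (A' - B)"
    proof -
      have "emeasure M (B \<union> (A' - B)) = emeasure M B + emeasure M (A' - B)"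
        using B A' by (intro plus_emeasure[symmetric]) auto
      moreover have "B \<union> (A' - B) = A'" using B by auto
      ultimately show ?thesis by simp
    qed
    have d0: "emeasure M (A' - B) \<noteq> 0" using sum B(4) by auto
    show ?thesis
    proof (cases "emeasure M B \<le> emeasure M (A' - B)")
      case True
      then show ?thesis using B sum by (intro exI[of _ B]) (auto simp: mult_2 zero_less_iff_neq_zero intro: add_left_mono)
    next
      case False
      then have "2 * emeasure M (A' - B) \<le> emeasure M A'" unfolding sum mult_2 by (intro add_right_mono) auto
      then show ?thesis using B A' d0 by (intro exI[of _ "A' - B"]) (auto simp: zero_less_iff_neq_zero)
    qed
  qed
  have "\<exists>B. B \<in> sets M \<and> B \<subseteq> A \<and> 0 < emeasure M B \<and> 2 ^ n * emeasure M B \<le> emeasure M A" for n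
  proof (induction n)
    case 0
    then show ?case using A by auto
  next
    case (Suc n)
    then obtain B where B: "B \<in> sets M" "B \<subseteq> A" "0 < emeasure M B" "2 ^ n * emeasure M B \<le> emeasure M A" by blast
    have "emeasure M B \<noteq> top" using emeasure_mono[OF B(2) A(1)] A(3) by (auto simp: top_unique)
    from half[OF B(1,3) this] obtain C where C: "C \<in> sets M" "C \<subseteq> B" "0 < emeasure M C" "2 * emeasure M C \<le> emeasure M B" by blast
    have "2 ^ Suc n * emeasure M C = 2 ^ n * (2 * emeasure M C)" by (simp add: mult_ac)
    also have "\<dots> \<le> 2 ^ n * emeasure M B" using C(4) by (rule mult_left_mono) simp
    finally show ?case using B C by (intro exI[of _ C]) auto
  qed
  note ex = this
  define a where "a = enn2real (emeasure M A)"
  have a: "emeasure M A = ennreal a" "0 \<le> a" using A(3) by (auto simp: a_def less_top)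
  obtain n where n: "a / e < 2 ^ n" using real_arch_pow[of 2 "a / e"] by auto
  obtain B where B: "B \<in> sets M" "B \<subseteq> A" "0 < emeasure M B" "2 ^ n * emeasure M B \<le> emeasure M A" using ex by blast
  have "emeasure M B \<noteq> top" using emeasure_mono[OF B(2) A(1)] A(3) by (auto simp: top_unique)
  then obtain b where b: "emeasure M B = ennreal b" "0 \<le> b" by (cases "emeasure M B") auto
  have "ennreal (2 ^ n * b) \<le> ennreal a"
    using B(4) a b by (simp add: ennreal_mult ennreal_power[symmetric])
  then have "2 ^ n * b \<le> a" using a by simp
  moreover have "a \<le> 2 ^ n * e" using n e by (simp add: field_simps)
  ultimately have "2 ^ n * b \<le> 2 ^ n * e" by linarith
  then have "b \<le> e" by simp
  then show ?thesis using B b that by (auto intro: ennreal_leI)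
qed

text \<open>Greedy exhaustion: C (n+1) is, up to 1/(n+1), as large as possible among the sets
  between C n and A of measure at most t. If the union D missed t, a small set E from A - D could be
  added at every stage, and near-maximality would force the measure of E below every
  1/(n+1).\<close>

lemma nonatomic_subset_finite:
  assumes M: "nonatomic M" and A: "A \<in> sets M" "emeasure M A \<noteq> top" and t: "t \<le> emeasure M A"
  obtains B where "B \<in> sets M" "B \<subseteq> A" "emeasure M B = t"
proof -
  define F where "F C = {B \<in> sets M. C \<subseteq> B \<and> B \<subseteq> A \<and> emeasure M B \<le> t}" for C
  define s where "s C = (SUP B\<in>F C. emeasure M B)" for C
  have fin: "emeasure M B \<noteq> top" if "B \<subseteq> A" "B \<in> sets M" for B
    using emeasure_mono[OF that(1) A(1)] A(2) by (auto simp: top_unique)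
  have step: "\<exists>B. B \<in> F C \<and> s C \<le> emeasure M B + ennreal (1 / real (Suc n))" if C: "C \<in> F C" for C n
  proof -
    have sle: "s C \<le> t" unfolding s_def by (rule SUP_least) (auto simp: F_def)
    then have sfin: "s C \<noteq> top" using t A(2) by (auto simp: top_unique)
    show ?thesis
    proof (cases "s C = 0")
      case True
      then show ?thesis using C by (intro exI[of _ C]) auto
    next
      case False
      then have "s C - ennreal (1 / real (Suc n)) < s C"
        using sfin by (intro ennreal_between) (auto simp: zero_less_iff_neq_zero less_top)
      then have "\<exists>B\<in>F C. s C - ennreal (1 / real (Suc n)) < emeasure M B" unfolding s_def less_SUP_iff by simp
      then obtain B where B: "B \<in> F C" "s C - ennreal (1 / real (Suc n)) < emeasure M B" by blast
      then have "s C \<le> emeasure M B + ennreal (1 / real (Suc n))"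
        by (metis add.commute ennreal_minus_le_iff less_imp_le)
      then show ?thesis using B by blast
    qed
  qed
  have F_refl: "B \<in> F B" if "B \<in> F C" for B C using that by (auto simp: F_def)
  have e0: "{} \<in> F {}" by (auto simp: F_def)
  define C where "C = rec_nat {} (\<lambda>n C. SOME B. B \<in> F C \<and> s C \<le> emeasure M B + ennreal (1 / real (Suc n)))"
  have C0: "C 0 = {}" and CS: "C (Suc n) = (SOME B. B \<in> F (C n) \<and> s (C n) \<le> emeasure M B + ennreal (1 / real (Suc n)))" for n
    by (simp_all add: C_def)
  have CF: "C n \<in> F (C n)" for n
  proof (induction n)
    case (Suc n)
    then show ?case using someI_ex[OF step[OF Suc, of n], folded CS] F_refl by blast
  qed (simp add: C0 e0)
  have C1: "C (Suc n) \<in> F (C n)" "s (C n) \<le> emeasure M (C (Suc n)) + ennreal (1 / real (Suc n))" for n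
    using someI_ex[OF step[OF CF, of n n], folded CS] by auto
  have Cm: "C n \<in> sets M" "C n \<subseteq> A" "emeasure M (C n) \<le> t" "C n \<subseteq> C (Suc n)" for n
    using CF[of n] C1(1)[of n] by (auto simp: F_def)
  have inc: "incseq C" using Cm(4) by (rule incseq_SucI)
  define D where "D = (\<Union>n. C n)"
  have D: "D \<in> sets M" "D \<subseteq> A" using Cm by (auto simp: D_def)
  have eD: "emeasure M D = (SUP n. emeasure M (C n))"
    unfolding D_def by (rule SUP_emeasure_incseq[symmetric]) (use Cm inc in auto)
  then have Dt: "emeasure M D \<le> t" using Cm by (auto intro: SUP_least)
  have "emeasure M D = t"
  proof (rule ccontr)
    assume "emeasure M D \<noteq> t"
    then have lt: "emeasure M D < t" using Dt by simp
    have Df: "emeasure M D \<noteq> top" using fin D by blast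
    have "t - emeasure M D \<noteq> 0" "t - emeasure M D \<noteq> top"
      using lt t A(2) Df by (auto simp: ennreal_minus_eq_0 not_le[symmetric] top_unique ennreal_minus_eq_top)
    then obtain e where e: "t - emeasure M D = ennreal e" "0 < e"
      by (cases "t - emeasure M D" rule: ennreal_cases_pos) auto
    have diff: "emeasure M (A - D) = emeasure M A - emeasure M D" using D A Df by (intro emeasure_Diff) auto
    have "emeasure M D < emeasure M A" using lt t by simp
    then have "0 < emeasure M (A - D)" unfolding diff by (simp add: diff_gt_0_iff_gt_ennreal)
    then obtain E where E: "E \<in> sets M" "E \<subseteq> A - D" "0 < emeasure M E" "emeasure M E \<le> ennreal e"
      using nonatomic_small_subset[OF M, of "A - D" e] A D fin[of "A - D"] e by auto
    have Ef: "emeasure M E \<noteq> top" using E D A fin by blast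
    have DE: "emeasure M (D \<union> E) = emeasure M D + emeasure M E" using D E by (intro plus_emeasure[symmetric]) auto
    have "emeasure M (D \<union> E) \<le> emeasure M D + (t - emeasure M D)" unfolding DE e(1) by (intro add_left_mono E)
    also have "\<dots> = t" using Dt Df by (simp add: ennreal_add_diff_cancel_left add_diff_eq_iff_ennreal diff_add_cancel_ennreal add.commute)
    finally have "D \<union> E \<in> F (C n)" for n using D E A by (auto simp: F_def D_def)
    then have "emeasure M (D \<union> E) \<le> s (C n)" for n unfolding s_def by (rule SUP_upper)
    then have le: "emeasure M (D \<union> E) \<le> emeasure M D + ennreal (1 / real (Suc n))" for n
    proof -
      have "emeasure M (C (Suc n)) \<le> emeasure M D" unfolding eD by (rule SUP_upper) simp
      then show ?thesis using C1(2)[of n] \<open>\<And>n. emeasure M (D \<union> E) \<le> s (C n)\<close>[of n]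
        by (meson add_right_mono order_trans)
    qed
    have "emeasure M E \<le> ennreal (1 / real (Suc n))" for n
      using le[of n] Df unfolding DE by (simp add: ennreal_add_left_cancel_le)
    moreover obtain x where x: "emeasure M E = ennreal x" "0 < x"
      using E(3) Ef by (cases "emeasure M E" rule: ennreal_cases_pos) auto
    ultimately have "x \<le> 1 / real (Suc n)" for n by (metis ennreal_le_iff of_nat_0_le_iff zero_le_divide_1_iff)
    moreover obtain n :: nat where "1 / real (Suc n) < x" using \<open>0 < x\<close> by (rule nat_approx_posE)
    ultimately show False by (meson not_le)
  qed
  then show ?thesis using D that by blast
qed

text \<open>If A has infinite measure and t is finite, sigma-finiteness supplies a part of A whose
  measure is finite and exceeds t.\<close>

lemma nonatomic_subset:
  assumes "sigma_finite_measure M" and M: "nonatomic M" and A: "A \<in> sets M" and t: "t \<le> emeasure M A"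
  obtains B where "B \<in> sets M" "B \<subseteq> A" "emeasure M B = t"
proof (cases "emeasure M A = top \<and> t \<noteq> top")
  case False
  show ?thesis
  proof (cases "emeasure M A = top")
    case True
    then show ?thesis using False A that[of A] by auto
  next
    case False
    then show ?thesis using nonatomic_subset_finite[OF M A _ t] that by blast
  qed
next
  case True
  interpret sigma_finite_measure M by fact
  obtain F where F: "range F \<subseteq> sets M" "(\<Union>i. F i) = space M" "\<And>i. emeasure M (F i) \<noteq> \<infinity>" "incseq F"
    using sigma_finite_incseq by metis
  have "(SUP i. emeasure M (A \<inter> F i)) = emeasure M (\<Union>i. A \<inter> F i)"
  proof (rule SUP_emeasure_incseq)
    show "incseq (\<lambda>i. A \<inter> F i)" using F(4) unfolding incseq_def by blast
  qed (use F A in auto)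
  also have "(\<Union>i. A \<inter> F i) = A" using F(2) sets.sets_into_space[OF A] by auto
  finally have eq: "(SUP i. emeasure M (A \<inter> F i)) = emeasure M A" .
  have "t < (SUP i. emeasure M (A \<inter> F i))" unfolding eq using True by (simp add: less_top[symmetric])
  then obtain i where i: "t < emeasure M (A \<inter> F i)" unfolding less_SUP_iff by blast
  have "emeasure M (A \<inter> F i) \<le> emeasure M (F i)" using F by (intro emeasure_mono) auto
  then have "emeasure M (A \<inter> F i) \<noteq> top" using F(3)[of i] by (auto simp: top_unique)
  from nonatomic_subset_finite[OF M _ this less_imp_le[OF i]] F A
  obtain B where "B \<in> sets M" "B \<subseteq> A \<inter> F i" "emeasure M B = t" by auto
  then show ?thesis using that by blast
qed

lemma nonatomic_chain:
  assumes "sigma_finite_measure M" "nonatomic M"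
    and "\<And>i. i \<le> (n::nat) \<Longrightarrow> s i \<le> emeasure M (space M)" and "\<And>i. i < n \<Longrightarrow> s (Suc i) \<le> s i"
  shows "\<exists>E. (\<forall>i\<le>n. E i \<in> sets M \<and> emeasure M (E i) = s i) \<and> (\<forall>i<n. E (Suc i) \<subseteq> E i)"
  using assms(3,4)
proof (induction n)
  case 0
  then have "s 0 \<le> emeasure M (space M)" by simp
  then obtain B where "B \<in> sets M" "B \<subseteq> space M" "emeasure M B = s 0"
    by (rule nonatomic_subset[OF assms(1,2) sets.top])
  then show ?case by (intro exI[of _ "\<lambda>_. B"]) auto
next
  case (Suc n)
  then obtain E where E: "\<forall>i\<le>n. E i \<in> sets M \<and> emeasure M (E i) = s i" "\<forall>i<n. E (Suc i) \<subseteq> E i"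
    by (metis le_SucI less_SucI)
  have "s (Suc n) \<le> emeasure M (E n)" using E Suc.prems(2)[of n] by simp
  moreover have "E n \<in> sets M" using E by simp
  ultimately obtain B where B: "B \<in> sets M" "B \<subseteq> E n" "emeasure M B = s (Suc n)"
    using nonatomic_subset[OF assms(1,2)] by metis
  show ?case
  proof (intro exI[of _ "E(Suc n := B)"] conjI allI impI)
    fix i
    show "(E(Suc n := B)) i \<in> sets M" "emeasure M ((E(Suc n := B)) i) = s i" if "i \<le> Suc n"
      using E(1) B that by (auto simp: le_Suc_eq)
    show "(E(Suc n := B)) (Suc i) \<subseteq> (E(Suc n := B)) i" if "i < Suc n"
      using E(2) B that by (cases "i = n") auto
  qed
qed

text \<open>An atom is cut by intervals of length 1/(n+1). If it were larger than that, no piece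
  could carry its full measure, so all of the countably many pieces would be null.\<close>

lemma nonatomic_lebesgue_on:
  fixes A :: "real set"
  assumes A: "A \<in> sets lebesgue"
  shows "nonatomic (lebesgue_on A)"
  unfolding nonatomic_def
proof (intro allI notI)
  fix S assume at: "atom (lebesgue_on A) S"
  then have S: "S \<in> sets (lebesgue_on A)" "0 < emeasure (lebesgue_on A) S"
    and dich: "\<And>B. B \<in> sets (lebesgue_on A) \<Longrightarrow> B \<subseteq> S \<Longrightarrow> emeasure (lebesgue_on A) B = 0 \<or> emeasure (lebesgue_on A) B = emeasure (lebesgue_on A) S"
    by (auto simp: atom_def)
  have Sl: "S \<in> sets lebesgue" "S \<subseteq> A" using S(1) A by (auto simp: sets_restrict_space_iff)
  have em: "emeasure (lebesgue_on A) B = emeasure lebesgue B" if "B \<subseteq> A" for B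
    using that A by (simp add: emeasure_restrict_space)
  have small: "emeasure lebesgue S \<le> ennreal (1 / real (Suc n))" for n
  proof (rule ccontr)
    assume big: "\<not> ?thesis"
    define I where "I (k::int) = {real_of_int k / real (Suc n)..<real_of_int (k + 1) / real (Suc n)}" for k
    have zero: "emeasure lebesgue (S \<inter> I k) = 0" for k
    proof -
      have "emeasure lebesgue (S \<inter> I k) \<le> emeasure lebesgue (I k)" by (intro emeasure_mono) (auto simp: I_def)
      also have "\<dots> = ennreal (1 / real (Suc n))"
        unfolding I_def by (subst emeasure_completion) (auto simp: field_simps)
      finally have "emeasure lebesgue (S \<inter> I k) \<noteq> emeasure lebesgue S" using big by auto
      moreover have "S \<inter> I k \<in> sets (lebesgue_on A)" using Sl A by (auto simp: sets_restrict_space_iff I_def)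
      ultimately show ?thesis using dich[of "S \<inter> I k"] Sl em by (metis inf.cobounded1 order_trans)
    qed
    have "S = (\<Union>k. S \<inter> I k)"
    proof -
      have "x \<in> I \<lfloor>x * real (Suc n)\<rfloor>" for x
        unfolding I_def by (auto simp: pos_divide_le_eq pos_less_divide_eq simp del: of_nat_Suc)
      then show ?thesis by blast
    qed
    moreover have "emeasure lebesgue (\<Union>k. S \<inter> I k) = 0"
      by (intro null_setsD1 null_sets_UN) (use zero Sl in \<open>auto simp: I_def null_sets_def\<close>)
    ultimately show False using S(2) em[OF Sl(2)] by simp
  qed
  have "emeasure lebesgue S = 0"
  proof (rule ccontr)
    assume "emeasure lebesgue S \<noteq> 0"
    moreover have "emeasure lebesgue S \<noteq> top" using small[of 0] by (auto simp: top_unique)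
    ultimately obtain x where x: "emeasure lebesgue S = ennreal x" "0 < x"
      by (cases "emeasure lebesgue S" rule: ennreal_cases_pos) auto
    obtain n :: nat where "1 / real (Suc n) < x" using x(2) by (rule nat_approx_posE)
    moreover have "x \<le> 1 / real (Suc n)" using small[of n] x by simp
    ultimately show False by simp
  qed
  then show False using S(2) em[OF Sl(2)] by simp
qed

section \<open>The interval (0,L) as a model of every nonatomic space\<close>

lemma ival_borel [measurable]: "ival a L \<in> sets borel"
proof -
  have "is_interval (ival a L)"
    unfolding is_interval_1 ival_def by (auto intro: le_less_trans ennreal_leI)
  then show ?thesis by (rule real_interval_borel_measurable)
qed

lemma ival_lebesgue [simp]: "ival a L \<in> sets lebesgue"
  using ival_borel by (metis sets_completionI_sets sets_lborel)

lemma ivalD: "s \<in> ival 0 L \<Longrightarrow> 0 < s" "s \<in> ival 0 L \<Longrightarrow> ennreal s < L"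
  by (auto simp: ival_def)

lemma emeasure_ival: "emeasure lebesgue (ival 0 L) = L"
proof (cases L)
  case (real l)
  have "ival 0 L = {0<..<l}" using real by (auto simp: ival_def ennreal_less_iff)
  then show ?thesis using real by simp
next
  case top
  have "ennreal (real n) \<le> emeasure lebesgue (ival 0 L)" for n
  proof -
    have "emeasure lebesgue {0<..<real n} \<le> emeasure lebesgue (ival 0 L)"
      using top by (intro emeasure_mono) (auto simp: ival_def)
    then show ?thesis by simp
  qed
  then show ?thesis using top
    by (metis ennreal_of_nat_eq_real_of_nat ennreal_Ex_less_of_nat less_le_not_le top.not_eq_extremum)
qed

lemma nn_integral_ival:
  "(\<integral>\<^sup>+t\<in>ival 0 L. f t \<partial>lebesgue) = (\<integral>\<^sup>+t. f t \<partial>lebesgue_on (ival 0 L))"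
  by (subst nn_integral_restrict_space) auto

lemma rearrangement_antimono: "antimono (rearrangement M f)"
  unfolding rearrangement_def
  by (intro antimonoI INF_superset_mono) (auto intro: order_trans ennreal_leI)

definition Lam where
  "Lam L q w \<phi> = (\<integral>\<^sup>+t\<in>ival 0 L. \<phi> t epowr q * ennreal (w t) \<partial>lebesgue)"

definition Gam where
  "Gam L p u v \<phi> = (\<integral>\<^sup>+t\<in>ival 0 L. ((1 / cumul u (ennreal t)) *
     (\<integral>\<^sup>+s\<in>ival 0 (ennreal t). \<phi> s * ennreal (u s) \<partial>lebesgue)) epowr p * ennreal (v t) \<partial>lebesgue)"

text \<open>The q-th power of the best constant for nonincreasing functions on (0,L). The measure
  space has disappeared except for L, which lets one equivalence constant serve all carrier
  types.\<close>

definition Dfun where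
  "Dfun L p q u v w = Sup {Lam L q w \<phi> |\<phi>. antimono \<phi> \<and> Gam L p u v \<phi> \<le> 1}"

lemma Gam_mono:
  assumes p: "0 < p" and le: "\<And>t. t \<in> ival 0 L \<Longrightarrow> \<phi> t \<le> \<phi>' t"
  shows "Gam L p u v \<phi> \<le> Gam L p u v \<phi>'"
proof -
  have "(\<integral>\<^sup>+s\<in>ival 0 (ennreal t). \<phi> s * ennreal (u s) \<partial>lebesgue) \<le> (\<integral>\<^sup>+s\<in>ival 0 (ennreal t). \<phi>' s * ennreal (u s) \<partial>lebesgue)"
    if t: "t \<in> ival 0 L" for t
  proof (intro nn_integral_mono)
    fix s
    have "s \<in> ival 0 L" if "s \<in> ival 0 (ennreal t)"
      using t that by (auto simp: ival_def)
    then show "\<phi> s * ennreal (u s) * indicator (ival 0 (ennreal t)) s \<le> \<phi>' s * ennreal (u s) * indicator (ival 0 (ennreal t)) s"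
      using le[of s] by (auto simp: indicator_def intro: mult_right_mono)
  qed
  then show ?thesis
    unfolding Gam_def using p
    by (intro nn_integral_mono) (auto simp: indicator_def intro!: mult_right_mono epowr_mono mult_left_mono)
qed

text \<open>Discretizing the levels of \<open>\<phi>\<close> gives a function on \<open>X\<close> whose rearrangement lies below \<open>\<phi>\<close>
  and almost reaches it.\<close>

lemma rearrangement_realize:
  assumes sf: "sigma_finite_measure M" and na: "nonatomic M" and L: "emeasure M (space M) = L"
    and \<phi>: "antimono \<phi>" and d: "0 < d"
  obtains f where "f \<in> borel_measurable M" "\<And>t. t \<in> ival 0 L \<Longrightarrow> rearrangement M f t \<le> \<phi> t"
    "\<And>j t t'. \<lbrakk>0 < t; t < t'; ennreal t' < L; j \<le> N; ennreal (real j * d) < \<phi> t'\<rbrakk> \<Longrightarrow> ennreal (real j * d) \<le> rearrangement M f t"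
proof -
  \<comment> \<open>Level sets of \<phi> at the heights (i+1) d; a decreasing family E of sets in
    the space is given the same measures.\<close>
  define S where "S i = {t \<in> ival 0 L. ennreal (real (Suc i) * d) < \<phi> t}" for i
  have [measurable]: "\<phi> \<in> borel_measurable borel" by (rule antimono_ennreal_borel[OF \<phi>])
  have S_borel [measurable]: "S i \<in> sets borel" for i
    unfolding S_def using ival_borel[of 0 L] by measurable
  have S_leb: "S i \<in> sets lebesgue" for i using S_borel by (metis sets_completionI_sets sets_lborel)
  define s where "s i = emeasure lebesgue (S i)" for i
  have sL: "s i \<le> L" for i
  proof -
    have "s i \<le> emeasure lebesgue (ival 0 L)" unfolding s_def by (intro emeasure_mono) (auto simp: S_def)
    then show ?thesis by (simp add: emeasure_ival)
  qed
  have s_dec: "s (Suc i) \<le> s i" for i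
    unfolding s_def
  proof (intro emeasure_mono S_leb)
    have "ennreal (real (Suc i) * d) \<le> ennreal (real (Suc (Suc i)) * d)"
      using d by (intro ennreal_leI mult_right_mono) auto
    then show "S (Suc i) \<subseteq> S i" unfolding S_def by (auto intro: le_less_trans)
  qed
  obtain E where E: "\<forall>i\<le>N. E i \<in> sets M \<and> emeasure M (E i) = s i" "\<forall>i<N. E (Suc i) \<subseteq> E i"
    using nonatomic_chain[OF sf na, of N s] sL L s_dec by auto
  have nest: "E j \<subseteq> E i" if "i \<le> j" "j \<le> N" for i j
    using that(1,2)
  proof (induction rule: dec_induct)
    case (step k)
    have "E (Suc k) \<subseteq> E k" using E(2) step by simp
    then show ?case using step by auto
  qed simp
  \<comment> \<open>f = d K is a step function: as the E i are nested, f exceeds the level i d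
    exactly on E i, for i < N.\<close>
  define K where "K x = card {i. i < N \<and> x \<in> E i}" for x
  have K_sum: "real (K x) * d = (\<Sum>i<N. d * indicator (E i) x)" for x
  proof -
    have "{i. i < N \<and> x \<in> E i} = {..<N} \<inter> {i. x \<in> E i}" by auto
    then have "real (K x) * d = (\<Sum>i\<in>{..<N} \<inter> {i. x \<in> E i}. d)" by (simp add: K_def)
    also have "\<dots> = (\<Sum>i<N. if i \<in> {i. x \<in> E i} then d else 0)" by (rule sum.inter_restrict) simp
    also have "\<dots> = (\<Sum>i<N. d * indicator (E i) x)" by (intro sum.cong) (auto simp: indicator_def)
    finally show ?thesis .
  qed
  define f where "f x = ereal (real (K x) * d)" for x
  have K_ge: "Suc i \<le> K x" if "x \<in> E i" "i < N" for x i
  proof -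
    have "{..i} \<subseteq> {i. i < N \<and> x \<in> E i}" using that nest[of _ i] by auto
    then have "card {..i} \<le> K x" unfolding K_def by (intro card_mono) auto
    then show ?thesis by simp
  qed
  have K_mem: "x \<in> E i" "i < N" if "Suc i \<le> K x" for x i
  proof -
    have "\<not> {j. j < N \<and> x \<in> E j} \<subseteq> {..<i}"
      using card_mono[of "{..<i}" "{j. j < N \<and> x \<in> E j}"] that by (auto simp: K_def)
    then obtain j where "j < N" "x \<in> E j" "\<not> j < i" by blast
    then have "j < N" "x \<in> E j" "i \<le> j" by auto
    then show "x \<in> E i" "i < N" using nest[of i j] by auto
  qed
  have fabs: "\<bar>f x\<bar> = ereal (real (K x) * d)" for x using d by (simp add: f_def)
  have "f \<in> borel_measurable M"
    unfolding f_def K_sum using E(1) by (intro borel_measurable_ereal borel_measurable_sum borel_measurable_times borel_measurable_indicator borel_measurable_const) auto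
  moreover have "rearrangement M f t \<le> \<phi> t" if t: "t \<in> ival 0 L" for t
  proof (cases "\<phi> t")
    case (real y)
    have "emeasure M {x \<in> space M. ereal y < \<bar>f x\<bar>} \<le> ennreal t"
    proof -
      \<comment> \<open>The largest m with m d \<le> y. If m < N, f exceeds y exactly on E m,
        otherwise nowhere; and \<phi> is at most (m+1) d from t on, so S m lies in (0,t).\<close>
      define m where "m = nat \<lfloor>y / d\<rfloor>"
      have m: "real m \<le> y / d" "y / d < real (Suc m)" using real d by (auto simp: m_def) linarith+
      have key: "real (K x) * d > y \<longleftrightarrow> Suc m \<le> K x" for x
      proof
        assume "y < real (K x) * d"
        then have "y / d < real (K x)" using d by (simp add: field_simps)
        then show "Suc m \<le> K x" using m(1) by linarith
      next
        assume "Suc m \<le> K x"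
        then have "real (Suc m) \<le> real (K x)" by simp
        then have "y / d < real (K x)" using m(2) by linarith
        then show "y < real (K x) * d" using d by (simp add: field_simps)
      qed
      show ?thesis
      proof (cases "m < N")
        case True
        have "emeasure M {x \<in> space M. ereal y < \<bar>f x\<bar>} \<le> emeasure M (E m)"
          using E(1) True K_mem by (intro emeasure_mono) (auto simp: fabs key)
        also have "\<dots> = s m" using E(1) True by simp
        also have "\<dots> \<le> emeasure lebesgue {0<..<t}"
          unfolding s_def
        proof (intro emeasure_mono subsetI)
          fix r assume r: "r \<in> S m"
          have "y < real (Suc m) * d" using m(2) d by (simp add: field_simps)
          then have "\<phi> t \<le> ennreal (real (Suc m) * d)" using real by (simp add: ennreal_leI)
          then have "\<phi> t < \<phi> r" using r by (auto simp: S_def)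
          then have "r < t" using \<phi> by (auto simp: antimono_def not_le[symmetric])
          then show "r \<in> {0<..<t}" using r by (auto simp: S_def ival_def)
        qed auto
        also have "\<dots> = ennreal t" using ivalD[OF t] by simp
        finally show ?thesis .
      next
        case False
        then have empty: "{x \<in> space M. ereal y < \<bar>f x\<bar>} = {}" using K_mem(2) by (auto simp: fabs key)
        show ?thesis unfolding empty by simp
      qed
    qed
    then show ?thesis unfolding rearrangement_def real by (intro INF_lower) (use real in auto)
  qed simp
  moreover have "ennreal (real j * d) \<le> rearrangement M f t"
    if t: "0 < t" "t < t'" "ennreal t' < L" "j \<le> N" "ennreal (real j * d) < \<phi> t'" for j t t'
  proof (cases j)
    case (Suc i)
    show ?thesis
      unfolding rearrangement_def
    proof (rule INF_greatest)
      fix y assume "y \<in> {y. 0 \<le> y \<and> emeasure M {x \<in> space M. ereal y < \<bar>f x\<bar>} \<le> ennreal t}"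
      then have y: "0 \<le> y" "emeasure M {x \<in> space M. ereal y < \<bar>f x\<bar>} \<le> ennreal t" by auto
      show "ennreal (real j * d) \<le> ennreal y"
      proof (rule ccontr)
        assume "\<not> ?thesis"
        then have yj: "y < real j * d" using y(1) by (simp add: not_le ennreal_less_iff)
        have "ennreal t' = emeasure lebesgue {0<..<t'}" using t by simp
        also have "\<dots> \<le> s i"
          unfolding s_def
        proof (intro emeasure_mono S_leb subsetI)
          fix r assume r: "r \<in> {0<..<t'}"
          then have "ennreal r < L" by (intro le_less_trans[OF ennreal_leI t(3)]) auto
          moreover have "\<phi> t' \<le> \<phi> r" using \<phi> r by (auto simp: antimono_def)
          ultimately show "r \<in> S i" using r t(5) Suc by (auto simp: S_def ival_def)
        qed
        also have "\<dots> = emeasure M (E i)" using E(1) t Suc by simp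
        also have "\<dots> \<le> emeasure M {x \<in> space M. ereal y < \<bar>f x\<bar>}"
        proof (intro emeasure_mono subsetI)
          fix x assume x: "x \<in> E i"
          have "Suc i \<le> K x" using t(4) Suc by (intro K_ge[OF x]) simp
          then have "j \<le> K x" using Suc by simp
          then have "real j * d \<le> real (K x) * d" using d by (intro mult_right_mono) auto
          then have "y < real (K x) * d" using yj by simp
          moreover have "E i \<in> sets M" using E(1) t(4) Suc by simp
          then have "x \<in> space M" using x sets.sets_into_space by blast
          ultimately show "x \<in> {x \<in> space M. ereal y < \<bar>f x\<bar>}" by (simp add: fabs)
        next
          have [measurable]: "f \<in> borel_measurable M" by fact
          show "{x \<in> space M. ereal y < \<bar>f x\<bar>} \<in> sets M" by measurable
        qed
        also have "\<dots> \<le> ennreal t" by (rule y)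
        finally show False using t by simp
      qed
    qed
  qed simp
  ultimately show ?thesis by (rule that)
qed

text \<open>A realized rearrangement is bounded below at t only by values of \<phi> at later points,
  so its limit reaches the right-hand limit of \<phi>. That falls short of \<phi> t on a countable
  set: a rational between the two values serves at most one t.\<close>

lemma AE_right_limit:
  fixes \<phi> :: "real \<Rightarrow> ennreal"
  assumes \<phi>: "antimono \<phi>"
  shows "AE t in lebesgue_on (ival 0 L). \<forall>c<\<phi> t. \<exists>t'>t. ennreal t' < L \<and> c < \<phi> t'"
proof -
  define B where "B r = {t \<in> ival 0 L. ennreal (real_of_rat r) < \<phi> t \<and> (\<forall>t'>t. ennreal t' < L \<longrightarrow> \<phi> t' \<le> ennreal (real_of_rat r))}" for r :: rat
  have one: "t1 = t2" if "t1 \<in> B r" "t2 \<in> B r" for t1 t2 r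
    using that by (cases t1 t2 rule: linorder_cases) (auto simp: B_def ival_def not_le[symmetric])
  have "countable (B r)" for r
  proof (cases "B r = {}")
    case False
    then obtain t where "t \<in> B r" by blast
    then have "B r \<subseteq> {t}" using one by blast
    then show ?thesis by (rule countable_subset) simp
  qed simp
  then have c: "countable (\<Union>r. B r)" by auto
  then have null: "(\<Union>r. B r) \<in> null_sets lebesgue" 
    using countable_imp_null_set_lborel null_sets_completionI by blast
  have "AE t in lebesgue. t \<in> ival 0 L \<longrightarrow> (\<forall>c<\<phi> t. \<exists>t'>t. ennreal t' < L \<and> c < \<phi> t')"
  proof (rule AE_I'[OF null], rule subsetI)
    fix t assume "t \<in> {t \<in> space lebesgue. \<not> (t \<in> ival 0 L \<longrightarrow> (\<forall>c<\<phi> t. \<exists>t'>t. ennreal t' < L \<and> c < \<phi> t'))}"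
    then have t: "t \<in> ival 0 L" and "\<exists>c<\<phi> t. \<forall>t'>t. ennreal t' < L \<longrightarrow> \<not> c < \<phi> t'"
      by blast+
    then obtain c where c: "c < \<phi> t" "\<And>t'. t < t' \<Longrightarrow> ennreal t' < L \<Longrightarrow> \<phi> t' \<le> c"
      by (auto simp only: not_less)
    obtain r where r: "c < ennreal (real_of_rat r)" "ennreal (real_of_rat r) < \<phi> t"
      using ennreal_rat_dense[OF c(1)] by blast
    then have "t \<in> B r" using t c(2) by (auto simp: B_def intro: order_trans less_imp_le)
    then show "t \<in> (\<Union>r. B r)" by blast
  qed
  then show ?thesis by (subst AE_restrict_space_iff) auto
qed

text \<open>One inequality uses the rearrangement of f as a competitor. For the other, \<phi> is
  approximated from below by rearrangements of mesh 2^(-n); lying below \<phi> they keep the Gamma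
  constraint, and Fatou's lemma passes the left functional to the limit.\<close>

lemma best_const_eq:
  assumes sf: "sigma_finite_measure M" and na: "nonatomic M" and L: "emeasure M (space M) = L"
    and p: "0 < p" and q: "0 < q" and w [measurable]: "w \<in> borel_measurable (lebesgue_on (ival 0 L))"
  shows "best_const M p q u v w = Dfun L p q u v w epowr (1 / q)"
proof (rule antisym)
  have LG: "Lambda_norm M q w f = Lam L q w (rearrangement M f) epowr (1 / q)"
    "Gamma_norm M p u v f = Gam L p u v (rearrangement M f) epowr (1 / p)" for f
    by (simp_all add: Lambda_norm_def Gamma_norm_def Lam_def Gam_def L)
  have G1: "Gamma_norm M p u v f \<le> 1 \<longleftrightarrow> Gam L p u v (rearrangement M f) \<le> 1" for f
    using epowr_le_iff[of "1/p" _ 1] p by (simp add: LG)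
  show "best_const M p q u v w \<le> Dfun L p q u v w epowr (1 / q)"
    unfolding best_const_def
  proof (rule Sup_least, clarify)
    fix f :: "'a \<Rightarrow> ereal" assume "f \<in> borel_measurable M" "Gamma_norm M p u v f \<le> 1"
    then have "Lam L q w (rearrangement M f) \<le> Dfun L p q u v w"
      unfolding Dfun_def G1 using rearrangement_antimono by (auto intro!: Sup_upper)
    then show "Lambda_norm M q w f \<le> Dfun L p q u v w epowr (1 / q)"
      unfolding LG using q by (intro epowr_mono) auto
  qed
  have up: "Lam L q w (rearrangement M f) \<le> best_const M p q u v w epowr q"
    if "f \<in> borel_measurable M" "Gam L p u v (rearrangement M f) \<le> 1" for f
  proof -
    have "Lambda_norm M q w f \<le> best_const M p q u v w"
      unfolding best_const_def using that G1 by (auto intro!: Sup_upper)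
    then show ?thesis unfolding LG using q epowr_le_swap[of "1/q"] by simp
  qed
  have "Dfun L p q u v w \<le> best_const M p q u v w epowr q"
    unfolding Dfun_def
  proof (rule Sup_least, clarify)
    fix \<phi> :: "real \<Rightarrow> ennreal" assume \<phi>: "antimono \<phi>" and G: "Gam L p u v \<phi> \<le> 1"
    \<comment> \<open>With n 2^n levels of mesh 2^(-n) the levels reach the height n, so mesh and
      height improve together.\<close>
    have "\<exists>f. f \<in> borel_measurable M \<and> (\<forall>t. t \<in> ival 0 L \<longrightarrow> rearrangement M f t \<le> \<phi> t) \<and>
      (\<forall>j t t'. 0 < t \<longrightarrow> t < t' \<longrightarrow> ennreal t' < L \<longrightarrow> j \<le> n * 2 ^ n \<longrightarrow> ennreal (real j * (1 / 2 ^ n)) < \<phi> t' \<longrightarrow> ennreal (real j * (1 / 2 ^ n)) \<le> rearrangement M f t)" for n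
      by (rule rearrangement_realize[OF sf na L \<phi>, of "1 / 2 ^ n" "n * 2 ^ n"]) (simp, blast)
    then obtain f where f: "\<And>n. f n \<in> borel_measurable M" "\<And>n t. t \<in> ival 0 L \<Longrightarrow> rearrangement M (f n) t \<le> \<phi> t"
      "\<And>n j t t'. \<lbrakk>0 < t; t < t'; ennreal t' < L; j \<le> n * 2 ^ n; ennreal (real j * (1 / 2 ^ n)) < \<phi> t'\<rbrakk> \<Longrightarrow> ennreal (real j * (1 / 2 ^ n)) \<le> rearrangement M (f n) t"
      by metis
    define \<psi> where "\<psi> n = rearrangement M (f n)" for n
    have \<psi>b: "\<psi> n \<in> borel_measurable borel" for n
      unfolding \<psi>_def by (rule antimono_ennreal_borel[OF rearrangement_antimono])
    have id: "(\<lambda>x. x) \<in> measurable (lebesgue_on (ival 0 L)) borel"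
      by (intro measurable_restrict_space1 measurable_completion) simp
    have [measurable]: "\<psi> n \<in> borel_measurable (lebesgue_on (ival 0 L))" for n
      using measurable_compose[OF id \<psi>b] by simp
    have lim: "\<phi> t epowr q * ennreal (w t) \<le> liminf (\<lambda>n. \<psi> n t epowr q * ennreal (w t))"
      if t: "t \<in> ival 0 L" and right: "\<forall>c<\<phi> t. \<exists>t'>t. ennreal t' < L \<and> c < \<phi> t'" for t
    proof -
      have ev: "\<forall>\<^sub>F n in sequentially. c < \<psi> n t" if c: "c < \<phi> t" for c
      proof -
        obtain t' where t': "t < t'" "ennreal t' < L" "c < \<phi> t'" using right c by blast
        obtain r' where r': "c < ennreal (real_of_rat r')" "ennreal (real_of_rat r') < \<phi> t'"
          using ennreal_rat_dense[OF t'(3)] by blast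
        define e where "e = real_of_rat r'"
        obtain a where a: "c = ennreal a" "0 \<le> a" using r'(1) by (cases c) auto
        have ae: "a < e" using r'(1) a by (simp add: e_def ennreal_less_iff)
        then have e0: "0 < e" using a by simp
        have "\<forall>\<^sub>F n in sequentially. (1/2::real) ^ n < e - a"
          using LIMSEQ_power_zero[of "1/2::real"] ae by (intro order_tendstoD(2)) auto
        moreover have "\<forall>\<^sub>F n in sequentially. e \<le> real n"
          by (meson eventually_sequentiallyI nle_le of_nat_le_iff order_trans real_arch_simple)
        ultimately show ?thesis
        proof eventually_elim
          case (elim n)
          \<comment> \<open>The last level not above e. It lies within 2^(-n) of e, and e \<le> n
            keeps it among the available levels.\<close>
          define j where "j = nat \<lfloor>e * 2 ^ n\<rfloor>"
          have j: "real j \<le> e * 2 ^ n" "e * 2 ^ n < real j + 1" using e0 by (auto simp: j_def)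
          have "e * 2 ^ n \<le> real n * 2 ^ n" using elim by (intro mult_right_mono) auto
          then have "real j \<le> real n * 2 ^ n" using j by linarith
          then have "real j \<le> real (n * 2 ^ n)" by simp
          then have jn: "j \<le> n * 2 ^ n" by (simp only: of_nat_le_iff)
          have "real j * (1 / 2 ^ n) \<le> e" using j by (simp add: field_simps)
          then have "ennreal (real j * (1 / 2 ^ n)) < \<phi> t'"
            using r'(2) unfolding e_def[symmetric] by (meson ennreal_leI le_less_trans)
          then have 1: "ennreal (real j * (1 / 2 ^ n)) \<le> \<psi> n t"
            unfolding \<psi>_def using t t' jn by (intro f(3)) (auto simp: ival_def)
          have "e - (1/2) ^ n < real j * (1 / 2 ^ n)"
          proof -
            have "e < (real j + 1) / 2 ^ n" using j(2) by (simp add: pos_less_divide_eq)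
            then show ?thesis by (simp add: add_divide_distrib power_one_over)
          qed
          then have "a < real j * (1 / 2 ^ n)" using elim by simp
          then have "c < ennreal (real j * (1 / 2 ^ n))" using a by (simp add: ennreal_less_iff)
          then show "c < \<psi> n t" using 1 by simp
        qed
      qed
      show ?thesis
      proof (cases "w t \<le> 0")
        case True
        then show ?thesis by (simp add: ennreal_neg)
      next
        case False
        then have w0: "0 < ennreal (w t)" "ennreal (w t) < top" by auto
        show ?thesis
          unfolding le_Liminf_iff
        proof (intro allI impI)
          fix y assume y: "y < \<phi> t epowr q * ennreal (w t)"
          define c where "c = (y / ennreal (w t)) epowr (1 / q)"
          have ye: "y = c epowr q * ennreal (w t)"
            using ennreal_mult_divide_cancel[OF w0, of y] q by (simp add: c_def epowr_inv mult.commute)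
          have "c < \<phi> t"
          proof (rule ccontr)
            assume "\<not> c < \<phi> t"
            then have "\<phi> t epowr q * ennreal (w t) \<le> y"
              unfolding ye using q by (intro mult_right_mono epowr_mono) (auto simp: not_less)
            then show False using y by simp
          qed
          from ev[OF this] show "\<forall>\<^sub>F n in sequentially. y < \<psi> n t epowr q * ennreal (w t)"
          proof eventually_elim
            case (elim n)
            have lt: "c epowr q < \<psi> n t epowr q" using elim epowr_le_iff[OF q, of "\<psi> n t" c] by (simp add: not_le[symmetric])
            then show ?case unfolding ye using w0
              by (metis ennreal_mult_strict_left_mono mult.commute)
          qed
        qed
      qed
    qed
    have "Lam L q w \<phi> = (\<integral>\<^sup>+t. \<phi> t epowr q * ennreal (w t) \<partial>lebesgue_on (ival 0 L))"
      unfolding Lam_def nn_integral_ival ..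
    also have "\<dots> \<le> (\<integral>\<^sup>+t. liminf (\<lambda>n. \<psi> n t epowr q * ennreal (w t)) \<partial>lebesgue_on (ival 0 L))"
    proof (rule nn_integral_mono_AE, use AE_right_limit[OF \<phi>, of L] AE_space[of "lebesgue_on (ival 0 L)"] in eventually_elim)
      case (elim t)
      then show ?case by (intro lim) auto
    qed
    also have "\<dots> \<le> liminf (\<lambda>n. \<integral>\<^sup>+t. \<psi> n t epowr q * ennreal (w t) \<partial>lebesgue_on (ival 0 L))"
      by (rule nn_integral_liminf) measurable
    also have "\<dots> \<le> best_const M p q u v w epowr q"
    proof (rule Liminf_le)
      show "\<forall>\<^sub>F n in sequentially. (\<integral>\<^sup>+t. \<psi> n t epowr q * ennreal (w t) \<partial>lebesgue_on (ival 0 L)) \<le> best_const M p q u v w epowr q"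
      proof (intro always_eventually allI)
        fix n
        have "Gam L p u v (rearrangement M (f n)) \<le> Gam L p u v \<phi>"
          by (rule Gam_mono[OF p f(2)])
        then have "Gam L p u v (rearrangement M (f n)) \<le> 1" using G by simp
        from up[OF f(1) this] show "(\<integral>\<^sup>+t. \<psi> n t epowr q * ennreal (w t) \<partial>lebesgue_on (ival 0 L)) \<le> best_const M p q u v w epowr q"
          unfolding Lam_def nn_integral_ival \<psi>_def .
      qed
    qed simp
    finally show "Lam L q w \<phi> \<le> best_const M p q u v w epowr q" .
  qed
  then show "Dfun L p q u v w epowr (1 / q) \<le> best_const M p q u v w"
    using q le_epowr_swap by blast
qed

section \<open>Change of variables\<close>

lemma cumul_mono: "x \<le> y \<Longrightarrow> cumul v x \<le> cumul v y"
  unfolding cumul_def by (intro nn_integral_mono mult_left_mono) (auto simp: indicator_def ival_def)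

lemma ival_sub: "t \<in> ival 0 L \<Longrightarrow> ival 0 (ennreal t) = {s \<in> ival 0 L. s < t}"
proof -
  assume t: "t \<in> ival 0 L"
  have "ennreal s < L" if "s < t" for s
    using t that by (auto simp: ival_def intro: le_less_trans[OF ennreal_leI[OF less_imp_le]])
  then show ?thesis using t by (auto simp: ival_def ennreal_less_iff)
qed

lemma cumul_SUP:
  assumes v: "v \<in> borel_measurable (lebesgue_on (ival 0 L))" and L: "0 < L"
  shows "cumul v L = (SUP t\<in>ival 0 L. cumul v (ennreal t))"
proof (rule antisym)
  \<comment> \<open>Interior points increasing to L; the shifts by 1 and 2 keep \<open>b 0\<close>
    positive.\<close>
  define b where "b n = (if L = top then real n + 1 else enn2real L * (1 - 1 / (real n + 2)))" for n
  have b: "b n \<in> ival 0 L" for n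
  proof (cases L)
    case (real l)
    then have "l * (1 - 1 / (real n + 2)) < l * 1" using L by (intro mult_strict_left_mono) auto
    then show ?thesis using real L by (auto simp: b_def ival_def ennreal_less_iff intro!: mult_pos_pos)
  qed (auto simp: b_def ival_def)
  have bm: "b m \<le> b n" if "m \<le> n" for m n
    using that by (auto simp: b_def intro!: mult_left_mono frac_le)
  have ex: "\<exists>n. s < b n" if s: "s \<in> ival 0 L" for s
  proof (cases L)
    case (real l)
    then have sl: "0 < s" "s < l" using s by (auto simp: ival_def ennreal_less_iff)
    then have "0 < 1 - s / l" by simp
    then obtain n :: nat where "1 / real (Suc n) < 1 - s / l" by (rule nat_approx_posE)
    moreover have "1 / (real n + 2) \<le> 1 / real (Suc n)" by (intro frac_le) auto
    ultimately have "s / l < 1 - 1 / (real n + 2)" by linarith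
    then have "s < l * (1 - 1 / (real n + 2))" using sl by (simp add: pos_divide_less_eq mult.commute)
    then show ?thesis using real sl by (intro exI[of _ n]) (auto simp: b_def)
  next
    case top
    obtain n :: nat where "s < real n" using reals_Archimedean2 by blast
    then show ?thesis using top by (intro exI[of _ n]) (simp add: b_def)
  qed
  let ?\<Lambda> = "lebesgue_on (ival 0 L)"
  have [measurable]: "v \<in> borel_measurable ?\<Lambda>" by fact
  have id: "(\<lambda>x. x) \<in> measurable ?\<Lambda> borel"
    by (intro measurable_restrict_space1 measurable_completion) simp
  have "cumul v L = (\<integral>\<^sup>+s. ennreal (v s) \<partial>?\<Lambda>)" unfolding cumul_def nn_integral_ival ..
  also have "\<dots> = (\<integral>\<^sup>+s. (SUP n. ennreal (v s) * indicator {..<b n} s) \<partial>?\<Lambda>)"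
  proof (rule nn_integral_cong)
    fix s assume "s \<in> space ?\<Lambda>"
    then have "s \<in> ival 0 L" by (simp add: space_restrict_space)
    then obtain n where "s < b n" using ex by blast
    then have "ennreal (v s) = ennreal (v s) * indicator {..<b n} s" by simp
    also have "\<dots> \<le> (SUP n. ennreal (v s) * indicator {..<b n} s)" by (rule SUP_upper) simp
    finally show "ennreal (v s) = (SUP n. ennreal (v s) * indicator {..<b n} s)"
      by (intro antisym SUP_least) (auto simp: indicator_def)
  qed
  also have "\<dots> = (SUP n. \<integral>\<^sup>+s. ennreal (v s) * indicator {..<b n} s \<partial>?\<Lambda>)"
  proof (rule nn_integral_monotone_convergence_SUP)
    show "incseq (\<lambda>n s. ennreal (v s) * indicator {..<b n} s)"
      using bm by (auto simp: incseq_def le_fun_def indicator_def intro: less_le_trans)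
    show "(\<lambda>s. ennreal (v s) * indicator {..<b n} s) \<in> borel_measurable ?\<Lambda>" for n
      using measurable_compose[OF id borel_measurable_indicator[of "{..<b n}"]] by measurable
  qed
  also have "\<dots> \<le> (SUP t\<in>ival 0 L. cumul v (ennreal t))"
  proof (rule SUP_least)
    fix n
    have "(\<integral>\<^sup>+s. ennreal (v s) * indicator {..<b n} s \<partial>?\<Lambda>) = cumul v (ennreal (b n))"
      unfolding cumul_def nn_integral_ival[symmetric] ival_sub[OF b]
      by (intro nn_integral_cong) (auto simp: indicator_def)
    also have "\<dots> \<le> (SUP t\<in>ival 0 L. cumul v (ennreal t))" by (rule SUP_upper[OF b])
    finally show "(\<integral>\<^sup>+s. ennreal (v s) * indicator {..<b n} s \<partial>?\<Lambda>) \<le> (SUP t\<in>ival 0 L. cumul v (ennreal t))" .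
  qed
  finally show "cumul v L \<le> (SUP t\<in>ival 0 L. cumul v (ennreal t))" .
  show "(SUP t\<in>ival 0 L. cumul v (ennreal t)) \<le> cumul v L"
    by (intro SUP_least cumul_mono) (auto simp: ival_def less_imp_le)
qed

locale weight_change =
  fixes L :: ennreal and u :: "real \<Rightarrow> real"
  assumes L: "0 < L" and u: "weight L u" and u_pos: "AE s in lebesgue_on (ival 0 L). 0 < u s"
begin

abbreviation "II \<equiv> ival 0 L"
abbreviation "\<Lambda> \<equiv> lebesgue_on II"

definition U where "U t = enn2real (cumul u (ennreal t))"
definition push where "push v = distr (density \<Lambda> (\<lambda>t. ennreal (v t))) borel U"

lemma u_meas [measurable]: "u \<in> borel_measurable \<Lambda>" using u by (simp add: weight_def)

lemma id_meas [measurable]: "(\<lambda>x. x) \<in> measurable \<Lambda> borel"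
  by (intro measurable_restrict_space1 measurable_completion) simp

lemma meas_borel: "f \<in> borel_measurable borel \<Longrightarrow> f \<in> borel_measurable \<Lambda>"
  using measurable_compose[OF id_meas] by simp

lemma U_borel: "U \<in> borel_measurable borel"
proof -
  have "(\<lambda>t. cumul u (ennreal t)) \<in> borel_measurable borel"
    by (intro mono_ennreal_borel monoI cumul_mono ennreal_leI)
  then show ?thesis unfolding U_def[abs_def] by measurable
qed

lemma U_meas [measurable]: "U \<in> borel_measurable \<Lambda>"
  by (rule meas_borel[OF U_borel])

lemma U: "t \<in> II \<Longrightarrow> cumul u (ennreal t) = ennreal (U t)" and U_pos: "t \<in> II \<Longrightarrow> 0 < U t"
proof -
  assume "t \<in> II"
  then have *: "0 < cumul u (ennreal t)" "cumul u (ennreal t) < top" using u by (auto simp: weight_def)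
  then show "cumul u (ennreal t) = ennreal (U t)" by (simp add: U_def)
  with * show "0 < U t" by simp
qed

lemma II_sub: "t \<in> II \<Longrightarrow> 0 < s \<Longrightarrow> s \<le> t \<Longrightarrow> s \<in> II"
  by (auto simp: ival_def intro: le_less_trans[OF ennreal_leI])

lemma space_\<Lambda> [simp]: "space \<Lambda> = II" by (simp add: space_restrict_space)

lemma cumul_\<Lambda>: "t \<in> II \<Longrightarrow> cumul v (ennreal t) = (\<integral>\<^sup>+s. ennreal (v s) * indicator {..<t} s \<partial>\<Lambda>)"
  unfolding cumul_def nn_integral_ival[symmetric] ival_sub
  by (intro nn_integral_cong) (auto simp: indicator_def)

lemma ind_meas [measurable]: "S \<in> sets borel \<Longrightarrow> (\<lambda>s. indicator S s :: ennreal) \<in> borel_measurable \<Lambda>"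
  by (rule meas_borel) simp

text \<open>Almost everywhere positivity of u gives every subinterval positive mass. With
  \<open>U_surj\<close> this makes U a bijection from (0,L) onto (0,U(L)).\<close>

lemma U_strict: "s \<in> II \<Longrightarrow> t \<in> II \<Longrightarrow> s < t \<Longrightarrow> U s < U t"
proof -
  assume s: "s \<in> II" and t: "t \<in> II" and st: "s < t"
  have "cumul u (ennreal t) = (\<integral>\<^sup>+r. ennreal (u r) * indicator {..<s} r + ennreal (u r) * indicator {s..<t} r \<partial>\<Lambda>)"
    unfolding cumul_\<Lambda>[OF t] using st by (intro nn_integral_cong) (auto simp: indicator_def)
  also have "\<dots> = cumul u (ennreal s) + (\<integral>\<^sup>+r. ennreal (u r) * indicator {s..<t} r \<partial>\<Lambda>)"
    unfolding cumul_\<Lambda>[OF s] by (rule nn_integral_add) measurable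
  finally have eq: "ennreal (U t) = ennreal (U s) + (\<integral>\<^sup>+r. ennreal (u r) * indicator {s..<t} r \<partial>\<Lambda>)"
    using U s t by simp
  have "(\<integral>\<^sup>+r. ennreal (u r) * indicator {s..<t} r \<partial>\<Lambda>) \<noteq> 0"
  proof
    assume "(\<integral>\<^sup>+r. ennreal (u r) * indicator {s..<t} r \<partial>\<Lambda>) = 0"
    then have "AE r in \<Lambda>. ennreal (u r) * indicator {s..<t} r = 0"
      by (subst (asm) nn_integral_0_iff_AE) auto
    with u_pos have "AE r in \<Lambda>. r \<notin> {s..<t}"
      by eventually_elim (auto simp: indicator_def split: if_splits)
    then have "AE r in lebesgue. r \<in> II \<longrightarrow> r \<notin> {s..<t}"
      by (subst (asm) AE_restrict_space_iff) auto
    then have "AE r in lebesgue. r \<notin> {s..<t}"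
      by eventually_elim (use s t II_sub[OF t] in \<open>auto simp: ival_def\<close>)
    then have "emeasure lebesgue {s..<t} = 0"
      by (subst (asm) AE_iff_measurable[of "{s..<t}"]) auto
    then show False using st by simp
  qed
  then have "ennreal (U s) < ennreal (U t)"
    unfolding eq by (simp add: ennreal_less_top zero_less_iff_neq_zero)
  then show "U s < U t" using U_pos[OF s] by (simp add: ennreal_less_iff)
qed

lemma U_less_iff: "s \<in> II \<Longrightarrow> t \<in> II \<Longrightarrow> U s < U t \<longleftrightarrow> s < t"
  using U_strict by (metis linorder_neqE_linordered_idom order_less_asym)

lemma U_le_iff: "s \<in> II \<Longrightarrow> t \<in> II \<Longrightarrow> U s \<le> U t \<longleftrightarrow> s \<le> t"
  using U_less_iff by (meson not_le)

lemma II_next: "t \<in> II \<Longrightarrow> \<exists>t'\<in>II. t < t'"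
proof -
  assume t: "t \<in> II"
  show ?thesis
  proof (cases L)
    case (real l)
    then have "0 < t" "t < l" using t by (auto simp: ival_def ennreal_less_iff)
    then show ?thesis using real by (intro bexI[of _ "(t + l) / 2"]) (auto simp: ival_def ennreal_less_iff)
  next
    case top
    then show ?thesis using t by (intro bexI[of _ "t + 1"]) (auto simp: ival_def)
  qed
qed

lemma II_nonempty: "\<exists>t. t \<in> II"
proof (cases L)
  case (real l)
  then show ?thesis using L by (intro exI[of _ "l / 2"]) (auto simp: ival_def ennreal_less_iff)
next
  case top
  then show ?thesis by (intro exI[of _ 1]) (auto simp: ival_def)
qed

lemma U_less_M: "t \<in> II \<Longrightarrow> ennreal (U t) < cumul u L"
proof -
  assume t: "t \<in> II"
  then obtain t' where t': "t' \<in> II" "t < t'" using II_next by blast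
  have "ennreal (U t) < ennreal (U t')" using U_strict[OF t t'] U_pos[OF t] by (simp add: ennreal_less_iff)
  also have "\<dots> = cumul u (ennreal t')" using U[OF t'(1)] by simp
  also have "\<dots> \<le> cumul u L" using t' by (intro cumul_mono) (auto simp: ival_def less_imp_le)
  finally show ?thesis .
qed

text \<open>The distribution function of u dt, cut off at some t1 with U t1 > x, is continuous on
  the whole line and agrees with U on (0,t1]; the intermediate value theorem applies between 0 and
  t1.\<close>

lemma U_surj:
  assumes x: "0 < x" "ennreal x < cumul u L"
  obtains t where "t \<in> II" "U t = x"
proof -
  have "\<exists>t1\<in>II. ennreal x < cumul u (ennreal t1)"
    using x(2) unfolding cumul_SUP[OF u_meas L] less_SUP_iff .
  then obtain t1 where t1: "t1 \<in> II" "x < U t1" using U x by (auto simp: ennreal_less_iff)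
  define m where "m = distr (density \<Lambda> (\<lambda>t. ennreal (u t) * indicator {..<t1} t)) borel (\<lambda>x. x)"
  have m: "emeasure m S = (\<integral>\<^sup>+t. ennreal (u t) * indicator {..<t1} t * indicator S t \<partial>\<Lambda>)" if S: "S \<in> sets borel" for S
  proof -
    have "S \<inter> II \<in> sets \<Lambda>" using measurable_sets[OF id_meas S] by (simp add: vimage_def Int_def)
    then show ?thesis
      unfolding m_def using S
      by (subst emeasure_distr, simp, simp, subst emeasure_density)
        (auto intro!: nn_integral_cong simp: indicator_def vimage_def Int_def)
  qed
  have sets_m: "sets m = sets borel" by (simp add: m_def)
  have mle: "emeasure m S \<le> ennreal (U t1)" if "S \<in> sets borel" for S
    unfolding m[OF that] U[OF t1(1), symmetric] cumul_\<Lambda>[OF t1(1)]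
    by (intro nn_integral_mono) (auto simp: indicator_def)
  have F: "emeasure m {..<y} = ennreal (U y)" if y: "y \<in> II" "y \<le> t1" for y
    unfolding m[OF lessThan_borel] U[OF y(1), symmetric] cumul_\<Lambda>[OF y(1)]
    using y by (intro nn_integral_cong) (auto simp: indicator_def)
  have atom: "emeasure m {y} = 0" for y
  proof -
    have "AE t in \<Lambda>. t \<noteq> y"
      by (subst AE_restrict_space_iff) (auto intro!: AE_I[where N = "{y}"])
    then have "AE t in \<Lambda>. ennreal (u t) * indicator {..<t1} t * indicator {y} t = 0"
      by eventually_elim auto
    then show ?thesis by (subst m) (auto simp: nn_integral_0_iff_AE)
  qed
  have fin: "emeasure m {..<y} \<noteq> top" for y using mle[of "{..<y}"] by (auto simp: top_unique)
  define F' where "F' y = measure m {..<y}" for y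
  have "emeasure m {..<0} = (\<integral>\<^sup>+t. 0 \<partial>\<Lambda>)"
    unfolding m[OF lessThan_borel] by (intro nn_integral_cong) (use ivalD(1) in \<open>force simp: indicator_def\<close>)
  then have F0: "F' 0 = 0" by (simp add: F'_def measure_def)
  have Ft: "F' y = U y" if "y \<in> II" "y \<le> t1" for y
    using F[OF that] U_pos[OF that(1)] by (simp add: F'_def measure_def)
  have "isCont F' y" for y
    unfolding F'_def by (rule isCont_measure_lessThan) (use sets_m fin atom in auto)
  then have "\<exists>y\<ge>0. y \<le> t1 \<and> F' y = x"
    using t1 x F0 Ft[of t1] ivalD(1)[OF t1(1)] by (intro IVT) auto
  then obtain y where y: "0 \<le> y" "y \<le> t1" "F' y = x" by blast
  then have "0 < y" using F0 x by (cases "y = 0") auto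
  then have "y \<in> II" using II_sub[OF t1(1)] y by blast
  then show ?thesis using that y Ft by auto
qed

lemma sets_push [simp]: "sets (push v) = sets borel" by (simp add: push_def)

lemma nn_integral_push:
  assumes [measurable]: "v \<in> borel_measurable \<Lambda>" and g: "g \<in> borel_measurable borel"
  shows "(\<integral>\<^sup>+x. g x \<partial>push v) = (\<integral>\<^sup>+t. g (U t) * ennreal (v t) \<partial>\<Lambda>)"
proof -
  have [measurable]: "(\<lambda>t. g (U t)) \<in> borel_measurable \<Lambda>" using g by measurable
  show ?thesis
    unfolding push_def using g
    by (subst nn_integral_distr, simp, simp, subst nn_integral_density) (auto intro!: nn_integral_cong simp: mult.commute)
qed

lemma emeasure_push:
  assumes "v \<in> borel_measurable \<Lambda>" "S \<in> sets borel"
  shows "emeasure (push v) S = (\<integral>\<^sup>+t. indicator S (U t) * ennreal (v t) \<partial>\<Lambda>)"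
  using nn_integral_push[OF assms(1), of "indicator S"] assms(2) by simp

lemma push_lessThan:
  assumes v: "v \<in> borel_measurable \<Lambda>" and t: "t \<in> II"
  shows "emeasure (push v) {..<U t} = cumul v (ennreal t)"
  unfolding emeasure_push[OF v lessThan_borel] cumul_\<Lambda>[OF t]
  by (intro nn_integral_cong) (auto simp: indicator_def U_less_iff t)

lemma push_ge_M:
  assumes v: "v \<in> borel_measurable \<Lambda>" and x: "cumul u L \<le> ennreal x"
  shows "emeasure (push v) {..<x} = cumul v L"
  unfolding emeasure_push[OF v lessThan_borel] cumul_def nn_integral_ival
proof (intro nn_integral_cong)
  fix t assume "t \<in> space \<Lambda>"
  then have t: "t \<in> II" by simp
  have "ennreal (U t) < ennreal x" using U_less_M[OF t] x by (rule less_le_trans)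
  then have "U t < x" using U_pos[OF t] by (simp add: ennreal_less_iff)
  then show "indicator {..<x} (U t) * ennreal (v t) = ennreal (v t)" by simp
qed

lemma push_UNIV: "v \<in> borel_measurable \<Lambda> \<Longrightarrow> emeasure (push v) UNIV = cumul v L"
  unfolding cumul_def nn_integral_ival by (subst emeasure_push) auto

lemma push_nonpos:
  assumes v: "v \<in> borel_measurable \<Lambda>" shows "emeasure (push v) {..0} = 0"
proof -
  have "emeasure (push v) {..0} = (\<integral>\<^sup>+t. 0 \<partial>\<Lambda>)"
    unfolding emeasure_push[OF v atMost_borel] 
    by (intro nn_integral_cong) (use U_pos in \<open>force simp: indicator_def\<close>)
  then show ?thesis by simp
qed

lemma push_atom:
  assumes v: "v \<in> borel_measurable \<Lambda>" shows "emeasure (push v) {x} = 0"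
proof (cases "\<exists>t\<in>II. U t = x")
  case True
  then obtain t where t: "t \<in> II" "U t = x" by blast
  have "AE s in \<Lambda>. s \<noteq> t"
    by (subst AE_restrict_space_iff) (auto intro!: AE_I[where N = "{t}"])
  then have "AE s in \<Lambda>. indicator {x} (U s) * ennreal (v s) = 0"
    using AE_space
  proof eventually_elim
    case (elim s)
    then have "U s \<noteq> U t" using U_strict t by (metis linorder_neqE_linordered_idom order_less_irrefl space_\<Lambda>)
    then show ?case using t by simp
  qed
  then have "(\<integral>\<^sup>+s. indicator {x} (U s) * ennreal (v s) \<partial>\<Lambda>) = (\<integral>\<^sup>+s. 0 \<partial>\<Lambda>)" by (rule nn_integral_cong_AE)
  then show ?thesis by (subst emeasure_push[OF v]) auto
next
  case False
  then have "(\<integral>\<^sup>+s. indicator {x} (U s) * ennreal (v s) \<partial>\<Lambda>) = (\<integral>\<^sup>+s. 0 \<partial>\<Lambda>)"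
    by (intro nn_integral_cong) auto
  then show ?thesis by (subst emeasure_push[OF v]) auto
qed

text \<open>Both measures have the distribution function min(a,U(L)) for a > 0. This turns the inner
  integral of the Gamma norm into an unweighted one.\<close>

lemma push_u: "push u = density lborel (indicator {x. 0 < x \<and> ennreal x < cumul u L})"
proof -
  let ?M = "cumul u L"
  let ?D = "density lborel (indicator {x. 0 < x \<and> ennreal x < ?M})"
  have S [measurable]: "{x. 0 < x \<and> ennreal x < ?M} \<in> sets borel" using ival_borel[of 0 ?M] by (simp add: ival_def)
  have D: "emeasure ?D {..<a} = emeasure lborel ({x. 0 < x \<and> ennreal x < ?M} \<inter> {..<a})" for a
  proof -
    have "emeasure ?D {..<a} = (\<integral>\<^sup>+x. indicator {x. 0 < x \<and> ennreal x < ?M} x * indicator {..<a} x \<partial>lborel)"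
      by (subst emeasure_density) (use S in auto)
    also have "\<dots> = (\<integral>\<^sup>+x. indicator ({x. 0 < x \<and> ennreal x < ?M} \<inter> {..<a}) x \<partial>lborel)"
      by (intro nn_integral_cong) (simp add: indicator_inter_arith)
    finally show ?thesis using S by simp
  qed
  have eq: "emeasure (push u) {..<a} = emeasure ?D {..<a}" for a
  proof -
    consider "a \<le> 0" | "0 < a" "ennreal a < ?M" | "0 < a" "?M \<le> ennreal a" by fastforce
    then show ?thesis
    proof cases
      case 1
      have "emeasure (push u) {..<a} \<le> emeasure (push u) {..0}" using 1 by (intro emeasure_mono) auto
      moreover have e: "{x. 0 < x \<and> ennreal x < ?M} \<inter> {..<a} = {}" using 1 by auto
      ultimately show ?thesis unfolding D e by (simp add: push_nonpos u_meas)
    next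
      case 2
      then obtain t where t: "t \<in> II" "U t = a" by (rule U_surj)
      have e: "{x. 0 < x \<and> ennreal x < ?M} \<inter> {..<a} = {0<..<a}"
        using 2 by (auto intro: less_trans[OF _ 2(2)] simp: ennreal_less_iff)
      show ?thesis unfolding D e using push_lessThan[OF u_meas t(1)] U[OF t(1)] t 2 by simp
    next
      case 3
      then have "?M < top" by (meson ennreal_less_top le_less_trans)
      then obtain m where m: "?M = ennreal m" "0 \<le> m" by (cases ?M) auto
      have e: "{x. 0 < x \<and> ennreal x < ?M} \<inter> {..<a} = {0<..<m}" using 3 m by (auto simp: ennreal_less_iff)
      show ?thesis unfolding D e push_ge_M[OF u_meas 3(2)] using m by simp
    qed
  qed
  show ?thesis
  proof (rule measure_eqI_generator_eq[where E = "range lessThan" and \<Omega> = UNIV and A = "\<lambda>n. {..<real n}"])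
    have "{..<a} \<inter> {..<b} = {..<min a b}" for a b :: real by auto
    then show "Int_stable (range lessThan :: real set set)" by (auto simp: Int_stable_def)
    show "sets (push u) = sigma_sets UNIV (range lessThan)" by (simp add: borel_Iio)
    show "sets ?D = sigma_sets UNIV (range lessThan)" by (simp add: borel_Iio)
    show "(\<Union>n. {..<real n}) = UNIV" using reals_Archimedean2 by blast
    show "emeasure (push u) {..<real n} \<noteq> \<infinity>" for n
    proof -
      have "emeasure lborel ({x. 0 < x \<and> ennreal x < ?M} \<inter> {..<real n}) \<le> emeasure lborel {0<..<real n}"
        by (intro emeasure_mono) auto
      then show ?thesis unfolding eq D by (auto simp: top_unique)
    qed
  qed (auto simp: eq)
qed

lemma nn_integral_u:
  assumes g: "g \<in> borel_measurable borel"
  shows "(\<integral>\<^sup>+t. g (U t) * ennreal (u t) \<partial>\<Lambda>) = (\<integral>\<^sup>+x\<in>{x. 0 < x \<and> ennreal x < cumul u L}. g x \<partial>lborel)"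
proof -
  have S [measurable]: "{x. 0 < x \<and> ennreal x < cumul u L} \<in> sets borel" using ival_borel[of 0 "cumul u L"] by (simp add: ival_def)
  show ?thesis
    unfolding nn_integral_push[OF u_meas g, symmetric] push_u using g
    by (subst nn_integral_density) (auto intro!: nn_integral_cong simp: mult.commute)
qed

lemma hh_U:
  assumes \<psi>: "\<psi> \<in> borel_measurable borel" and t: "t \<in> II"
  shows "(\<integral>\<^sup>+s\<in>ival 0 (ennreal t). \<psi> (U s) * ennreal (u s) \<partial>lebesgue) = hh \<psi> (U t)"
proof -
  have "(\<integral>\<^sup>+s\<in>ival 0 (ennreal t). \<psi> (U s) * ennreal (u s) \<partial>lebesgue) = (\<integral>\<^sup>+s\<in>II. \<psi> (U s) * indicator {..<U t} (U s) * ennreal (u s) \<partial>lebesgue)"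
    unfolding ival_sub[OF t] using U_less_iff[OF _ t]
    by (intro nn_integral_cong) (auto simp: indicator_def)
  also have "\<dots> = (\<integral>\<^sup>+x\<in>{x. 0 < x \<and> ennreal x < cumul u L}. \<psi> x * indicator {..<U t} x \<partial>lborel)"
    unfolding nn_integral_ival using \<psi> by (intro nn_integral_u borel_measurable_times_ennreal borel_measurable_indicator) auto
  also have "\<dots> = hh \<psi> (U t)"
    unfolding hh_def
  proof (intro nn_integral_cong)
    fix x
    have "ennreal x < cumul u L" if "x < U t"
      using U_less_M[OF t] that by (metis ennreal_leI le_less_trans less_imp_le)
    then show "\<psi> x * indicator {..<U t} x * indicator {x. 0 < x \<and> ennreal x < cumul u L} x = \<psi> x * indicator {0<..<U t} x"
      by (auto simp: indicator_def)
  qed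
  finally show ?thesis .
qed

text \<open>The supremum over all t with U t \<ge> x extends \<phi> monotonically beyond the range
  of U; to the right of that range it is over the empty set and equals 0.\<close>

lemma lift_antimono:
  assumes \<phi>: "antimono \<phi>"
  obtains \<psi> :: "real \<Rightarrow> ennreal" where "antimono \<psi>" "\<And>t. t \<in> II \<Longrightarrow> \<psi> (U t) = \<phi> t"
proof
  define \<psi> where "\<psi> x = (SUP t\<in>{t \<in> II. x \<le> U t}. \<phi> t)" for x
  show "antimono \<psi>" unfolding \<psi>_def by (intro antimonoI SUP_subset_mono) auto
  show "\<psi> (U t) = \<phi> t" if t: "t \<in> II" for t
    unfolding \<psi>_def using t \<phi> U_le_iff[OF t]
    by (intro antisym SUP_least SUP_upper) (auto simp: antimono_def)
qed

lemma pull_antimono: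
  assumes \<psi>: "antimono \<psi>"
  obtains \<phi> :: "real \<Rightarrow> ennreal" where "antimono \<phi>" "\<And>t. t \<in> II \<Longrightarrow> \<psi> (U t) = \<phi> t"
proof
  \<comment> \<open>Outside (0,L) only monotonicity counts, hence \<open>top\<close> on the left and
    0 on the right.\<close>
  define \<phi> where "\<phi> t = (if t \<le> 0 then top else if t \<in> II then \<psi> (U t) else 0)" for t
  show "\<psi> (U t) = \<phi> t" if "t \<in> II" for t using that ivalD(1)[OF that] by (simp add: \<phi>_def)
  show "antimono \<phi>"
  proof (rule antimonoI)
    fix x y :: real assume xy: "x \<le> y"
    show "\<phi> y \<le> \<phi> x"
    proof (cases "0 < x \<and> y \<in> II")
      case True
      then have "x \<in> II" using II_sub xy by blast
      then show ?thesis using True xy \<psi> U_le_iff[of x y] ivalD(1)[of y L] by (auto simp: \<phi>_def antimono_def)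
    next
      case False
      then show ?thesis using xy by (auto simp: \<phi>_def)
    qed
  qed
qed

end

lemma inverse_antimono_ennreal: "a \<le> b \<Longrightarrow> inverse b \<le> inverse (a :: ennreal)"
  by (cases a rule: ennreal_cases_pos; cases b rule: ennreal_cases_pos)
    (auto simp: inverse_ennreal top_unique intro!: ennreal_leI le_imp_inverse_le)

lemma inverse_inverse_ennreal: "inverse (inverse a) = (a :: ennreal)"
  by (cases a rule: ennreal_cases_pos) (auto simp: inverse_ennreal)

section \<open>The quantities of the statement in the variable x = U(t)\<close>

locale weights = weight_change L u for L u +
  fixes p q :: real and v w :: "real \<Rightarrow> real"
  assumes p: "0 < p" and q: "0 < q" and v: "weight L v" and w: "weight L w"
begin

declare sets_push [measurable_cong]

lemma v_meas [measurable]: "v \<in> borel_measurable \<Lambda>" and w_meas [measurable]: "w \<in> borel_measurable \<Lambda>"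
  using v w by (simp_all add: weight_def)

lemma v_fin: "t \<in> II \<Longrightarrow> 0 < cumul v (ennreal t)" "t \<in> II \<Longrightarrow> cumul v (ennreal t) \<noteq> top"
  using v by (auto simp: weight_def)

lemma w_fin: "t \<in> II \<Longrightarrow> 0 < cumul w (ennreal t)" "t \<in> II \<Longrightarrow> cumul w (ennreal t) \<noteq> top"
  using w by (auto simp: weight_def)

lemma U_epowr: "t \<in> II \<Longrightarrow> cumul u (ennreal t) epowr a = ennreal (U t powr a)"
  by (simp add: U epowr_ennreal U_pos)

lemma ival_tail: "t \<in> II \<Longrightarrow> s \<in> ival t L \<longleftrightarrow> s \<in> II \<and> t < s"
  by (auto simp: ival_def)

lemma nn_integral_tail:
  assumes t: "t \<in> II" and v': "v' \<in> borel_measurable \<Lambda>" and g: "g \<in> borel_measurable borel"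
  shows "(\<integral>\<^sup>+s\<in>ival t L. g (U s) * ennreal (v' s) \<partial>lebesgue) = (\<integral>\<^sup>+x\<in>{U t<..}. g x \<partial>push v')"
proof -
  have "(\<integral>\<^sup>+s\<in>ival t L. g (U s) * ennreal (v' s) \<partial>lebesgue) = (\<integral>\<^sup>+s\<in>II. (g (U s) * indicator {U t<..} (U s)) * ennreal (v' s) \<partial>lebesgue)"
    using ival_tail[OF t] U_less_iff[OF t] by (intro nn_integral_cong) (auto simp: indicator_def)
  also have "\<dots> = (\<integral>\<^sup>+x\<in>{U t<..}. g x \<partial>push v')"
    unfolding nn_integral_ival using g
    by (intro nn_integral_push[OF v', symmetric] borel_measurable_times_ennreal borel_measurable_indicator) auto
  finally show ?thesis .
qed

lemma tail_int_eq: "t \<in> II \<Longrightarrow> tail_int p L u v t = (\<integral>\<^sup>+z\<in>{U t<..}. ennreal (z powr - p) \<partial>push v)"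
proof -
  assume t: "t \<in> II"
  have "tail_int p L u v t = (\<integral>\<^sup>+s\<in>ival t L. ennreal (U s powr - p) * ennreal (v s) \<partial>lebesgue)"
    unfolding tail_int_def
    by (intro nn_integral_cong) (auto simp: indicator_def ival_tail[OF t] U_epowr mult.commute)
  also have "\<dots> = (\<integral>\<^sup>+z\<in>{U t<..}. ennreal (z powr - p) \<partial>push v)"
    by (rule nn_integral_tail[OF t v_meas]) simp
  finally show ?thesis .
qed

lemma fund_eq: "t \<in> II \<Longrightarrow> fund p L u v t = cumul v (ennreal t) + ennreal (U t powr p) * tail_int p L u v t"
  by (simp add: fund_def U_epowr)

lemma push_pos: "0 < x \<Longrightarrow> weight L v' \<Longrightarrow> 0 < emeasure (push v') {..<x}"
proof -
  assume x: "0 < x" and v': "weight L v'"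
  then have m: "v' \<in> borel_measurable \<Lambda>" by (simp add: weight_def)
  obtain t0 where t0: "t0 \<in> II" using II_nonempty by blast
  obtain t where t: "t \<in> II" "U t \<le> x"
  proof (cases "ennreal x < cumul u L")
    case True
    then show ?thesis using x that by (metis U_surj order_refl)
  next
    case False
    then have "ennreal (U t0) \<le> ennreal x" using U_less_M[OF t0] by (metis le_less_trans less_imp_le not_le)
    then show ?thesis using that[OF t0] x by simp
  qed
  have "0 < cumul v' (ennreal t)" using v' t by (simp add: weight_def)
  also have "\<dots> = emeasure (push v') {..<U t}" using push_lessThan[OF m t(1)] by simp
  also have "\<dots> \<le> emeasure (push v') {..<x}" using t by (intro emeasure_mono) auto
  finally show ?thesis .
qed

text \<open>The functions whose limits occur are monotone, so the limits exist and are infima over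
  (0,L); in particular \<open>Lim\<close> denotes an actual limit.\<close>

lemma Lim_right_0:
  fixes g :: "real \<Rightarrow> ennreal"
  assumes g: "\<And>s t. s \<in> II \<Longrightarrow> t \<in> II \<Longrightarrow> s \<le> t \<Longrightarrow> g s \<le> g t"
  shows "Lim (at_right 0) g = (INF t\<in>II. g t)"
proof (rule tendsto_Lim)
  have ev: "eventually (\<lambda>s. s \<in> II \<and> s < t) (at_right 0)" if t: "t \<in> II" for t
    using ivalD(1)[OF t] II_sub[OF t] by (subst eventually_at_right[of 0 t]) (auto intro!: exI[of _ t])
  show "(g \<longlongrightarrow> (INF t\<in>II. g t)) (at_right 0)"
  proof (rule order_tendstoI)
    fix a assume a: "a < (INF t\<in>II. g t)"
    obtain t where "t \<in> II" using II_nonempty by blast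
    from ev[OF this] show "eventually (\<lambda>x. a < g x) (at_right 0)"
      by eventually_elim (use a in \<open>auto intro: less_le_trans INF_lower\<close>)
  next
    fix a assume "(INF t\<in>II. g t) < a"
    then obtain t where t: "t \<in> II" "g t < a" unfolding INF_less_iff by blast
    from ev[OF t(1)] show "eventually (\<lambda>x. g x < a) (at_right 0)"
      by eventually_elim (use t(1) in \<open>auto intro!: le_less_trans[OF g t(2)]\<close>)
  qed
qed simp

lemma Lim_right_end:
  fixes g :: "real \<Rightarrow> ennreal"
  assumes g: "\<And>s t. s \<in> II \<Longrightarrow> t \<in> II \<Longrightarrow> s \<le> t \<Longrightarrow> g t \<le> g s"
  shows "Lim (at_right_end L) g = (INF t\<in>II. g t)"
proof (rule tendsto_Lim)
  have ev: "eventually (\<lambda>s. s \<in> II \<and> t < s) (at_right_end L)" if t: "t \<in> II" for t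
  proof (cases L)
    case (real l)
    then have "0 < t" "t < l" using t by (auto simp: ival_def ennreal_less_iff)
    then show ?thesis using real
      by (simp add: at_right_end_def, subst eventually_at_left[of t l])
        (auto intro!: exI[of _ t] simp: ival_def ennreal_less_iff)
  next
    case top
    then show ?thesis using ivalD(1)[OF t]
      by (auto simp: at_right_end_def ival_def intro: eventually_mono[OF eventually_gt_at_top[of t]])
  qed
  show "(g \<longlongrightarrow> (INF t\<in>II. g t)) (at_right_end L)"
  proof (rule order_tendstoI)
    fix a assume a: "a < (INF t\<in>II. g t)"
    obtain t where "t \<in> II" using II_nonempty by blast
    from ev[OF this] show "eventually (\<lambda>x. a < g x) (at_right_end L)"
      by eventually_elim (use a in \<open>auto intro: less_le_trans INF_lower\<close>)
  next
    fix a assume "(INF t\<in>II. g t) < a"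
    then obtain t where t: "t \<in> II" "g t < a" unfolding INF_less_iff by blast
    from ev[OF t(1)] show "eventually (\<lambda>x. g x < a) (at_right_end L)"
      by eventually_elim (use t(1) in \<open>auto intro!: le_less_trans[OF g t(2)]\<close>)
  qed
  show "at_right_end L \<noteq> bot" by (simp add: at_right_end_def)
qed

text \<open>Only \<open>f = 0\<close> has a finite norm in this case.\<close>

lemma Dfun_degenerate:
  assumes "\<And>t. t \<in> II \<Longrightarrow> fund p L u v t = top"
  shows "Dfun L p q u v w = 0"
proof -
  have "Lam L q w \<phi> = 0" if \<phi>: "antimono \<phi>" and G: "Gam L p u v \<phi> \<le> 1" for \<phi>
  proof -
    have z: "\<phi> t = 0" if t: "t \<in> II" for t
    proof (rule ccontr)
      assume nz: "\<phi> t \<noteq> 0"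
      have gm: "(\<lambda>z. ennreal (min 1 (U t / z) powr p)) \<in> borel_measurable borel" by measurable
      \<comment> \<open>An infinite \<open>fund\<close> at t means that the indicator of (0,t) has
        infinite Gamma norm.\<close>
      have fund_top: "(\<integral>\<^sup>+s. ennreal (min 1 (U t / U s) powr p) * ennreal (v s) \<partial>\<Lambda>) = top"
      proof -
        have "fund p L u v t = (\<integral>\<^sup>+s. ennreal (v s) * indicator {..<t} s \<partial>\<Lambda>) + (\<integral>\<^sup>+s. ennreal (U t powr p) * (ennreal (v s) * ennreal (U s powr - p) * indicator {t<..} s) \<partial>\<Lambda>)"
        proof -
          have m: "(\<lambda>s. ennreal (v s) * ennreal (U s powr - p) * indicator {t<..} s) \<in> borel_measurable \<Lambda>"
            by measurable
          have "tail_int p L u v t = (\<integral>\<^sup>+s. ennreal (v s) * ennreal (U s powr - p) * indicator {t<..} s \<partial>\<Lambda>)"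
            unfolding tail_int_def nn_integral_ival[symmetric]
            by (intro nn_integral_cong) (auto simp: indicator_def ival_tail[OF t] U_epowr)
          then show ?thesis by (simp add: fund_eq[OF t] cumul_\<Lambda>[OF t] nn_integral_cmult m)
        qed
        also have "\<dots> = (\<integral>\<^sup>+s. ennreal (v s) * indicator {..<t} s + ennreal (U t powr p) * (ennreal (v s) * ennreal (U s powr - p) * indicator {t<..} s) \<partial>\<Lambda>)"
          by (intro nn_integral_add[symmetric]) measurable
        also have "\<dots> \<le> (\<integral>\<^sup>+s. ennreal (min 1 (U t / U s) powr p) * ennreal (v s) \<partial>\<Lambda>)"
        proof (intro nn_integral_mono)
          fix s assume "s \<in> space \<Lambda>"
          then have s: "s \<in> II" by simp
          consider "s < t" | "s = t" | "t < s" by linarith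
          then show "ennreal (v s) * indicator {..<t} s + ennreal (U t powr p) * (ennreal (v s) * ennreal (U s powr - p) * indicator {t<..} s) \<le> ennreal (min 1 (U t / U s) powr p) * ennreal (v s)"
          proof cases
            case 1
            then have "1 \<le> U t / U s" using U_less_iff[OF s t] U_pos[OF s] by simp
            then show ?thesis using 1 by simp
          next
            case 3
            then have "U t \<le> U s" using U_le_iff[OF t s] by simp
            from min_powr[OF U_pos[OF t] this, of p] show ?thesis using 3 by (simp add: ennreal_mult mult_ac)
          qed simp
        qed
        finally show ?thesis using assms[OF t] by (simp add: top_unique)
      qed
      \<comment> \<open>\<phi> is at least \<phi> t on (0,t), so a nonzero value at t would make the
        Gamma integral of \<phi> infinite as well.\<close>
      have "\<phi> t epowr p * top = (\<integral>\<^sup>+s. \<phi> t epowr p * (ennreal (min 1 (U t / U s) powr p) * ennreal (v s)) \<partial>\<Lambda>)"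
        unfolding fund_top[symmetric] by (intro nn_integral_cmult[symmetric]) measurable
      also have "\<dots> \<le> Gam L p u v \<phi>"
        unfolding Gam_def nn_integral_ival[where L = L]
      proof (intro nn_integral_mono)
        fix s assume "s \<in> space \<Lambda>"
        then have s: "s \<in> II" by simp
        have mint: "min s t \<in> II" using s t by (simp add: min_def)
        have mU: "min (U s) (U t) = U (min s t)" using U_le_iff[OF s t] U_le_iff[OF t s] by (auto simp: min_def)
        have "\<phi> t * ennreal (U (min s t)) = (\<integral>\<^sup>+r\<in>ival 0 (ennreal (min s t)). \<phi> t * ennreal (u r) \<partial>lebesgue)"
          unfolding U[OF mint, symmetric] cumul_\<Lambda>[OF mint]
        proof -
          have "\<phi> t * (\<integral>\<^sup>+r. ennreal (u r) * indicator {..<min s t} r \<partial>\<Lambda>) = (\<integral>\<^sup>+r. \<phi> t * (ennreal (u r) * indicator {..<min s t} r) \<partial>\<Lambda>)"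
            by (intro nn_integral_cmult[symmetric]) measurable
          also have "\<dots> = (\<integral>\<^sup>+r\<in>ival 0 (ennreal (min s t)). \<phi> t * ennreal (u r) \<partial>lebesgue)"
            unfolding nn_integral_ival[symmetric] ival_sub[OF mint]
            by (intro nn_integral_cong) (auto simp: indicator_def)
          finally show "\<phi> t * (\<integral>\<^sup>+r. ennreal (u r) * indicator {..<min s t} r \<partial>\<Lambda>) = (\<integral>\<^sup>+r\<in>ival 0 (ennreal (min s t)). \<phi> t * ennreal (u r) \<partial>lebesgue)" .
        qed
        also have "\<dots> \<le> (\<integral>\<^sup>+r\<in>ival 0 (ennreal s). \<phi> r * ennreal (u r) \<partial>lebesgue)"
          unfolding ival_sub[OF mint] ival_sub[OF s] using \<phi>
          by (intro nn_integral_mono) (auto simp: indicator_def antimono_def intro!: mult_right_mono)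
        finally have 1: "\<phi> t * ennreal (U (min s t)) \<le> (\<integral>\<^sup>+r\<in>ival 0 (ennreal s). \<phi> r * ennreal (u r) \<partial>lebesgue)" .
        have e: "ennreal (min 1 (U t / U s)) = 1 / cumul u (ennreal s) * ennreal (U (min s t))"
          using U_pos[OF s] U_pos[OF mint] U_pos[OF t]
          unfolding mU[symmetric]
          by (simp add: U[OF s] divide_ennreal_def inverse_ennreal min_def field_simps flip: ennreal_mult)
        have "\<phi> t * ennreal (min 1 (U t / U s)) \<le> 1 / cumul u (ennreal s) * (\<integral>\<^sup>+r\<in>ival 0 (ennreal s). \<phi> r * ennreal (u r) \<partial>lebesgue)"
          unfolding e using mult_left_mono[OF 1, of "1 / cumul u (ennreal s)"] by (simp add: mult_ac)
        then have "(\<phi> t * ennreal (min 1 (U t / U s))) epowr p \<le> (1 / cumul u (ennreal s) * (\<integral>\<^sup>+r\<in>ival 0 (ennreal s). \<phi> r * ennreal (u r) \<partial>lebesgue)) epowr p"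
          using p by (intro epowr_mono) auto
        moreover have "(\<phi> t * ennreal (min 1 (U t / U s))) epowr p = \<phi> t epowr p * ennreal (min 1 (U t / U s) powr p)"
          using p U_pos[OF s] U_pos[OF t] epowr_ennreal[of "min 1 (U t / U s)" p] by (simp add: epowr_mult)
        ultimately show "\<phi> t epowr p * (ennreal (min 1 (U t / U s) powr p) * ennreal (v s))
          \<le> (1 / cumul u (ennreal s) * (\<integral>\<^sup>+r\<in>ival 0 (ennreal s). \<phi> r * ennreal (u r) \<partial>lebesgue)) epowr p * ennreal (v s)"
          by (simp add: mult.assoc[symmetric] mult_right_mono)
      qed
      finally show False using G nz p by (simp add: ennreal_mult_top epowr_eq_0_iff top_unique)
    qed
    have "Lam L q w \<phi> = (\<integral>\<^sup>+t. 0 \<partial>\<Lambda>)"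
      unfolding Lam_def nn_integral_ival using z q by (intro nn_integral_cong) auto
    then show ?thesis by simp
  qed
  then have "Dfun L p q u v w \<le> 0" unfolding Dfun_def by (intro Sup_least) auto
  then show ?thesis by simp
qed

end

locale weights_fin = weights +
  assumes fund_fin: "\<exists>t\<in>II. fund p L u v t \<noteq> top"
begin

abbreviation "\<nu> \<equiv> push v"
abbreviation "\<omega> \<equiv> push w"

text \<open>Finiteness at a single point x0 spreads to all x: between x0 and x the factor (x/z)^p is
  at least 1, so the tail integral at x0 controls V; between x and x0 the factor z^(-p) is at most
  x^(-p), so V(x0) controls the tail integral.\<close>

sublocale G: gamma_data p q \<nu> \<omega>
proof
  have sp: "space \<nu> = UNIV" using sets_eq_imp_space_eq[OF sets_push] by simp
  obtain t where t: "t \<in> II" "fund p L u v t \<noteq> top" using fund_fin by blast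
  define x0 where "x0 = U t"
  have x0: "0 < x0" using U_pos[OF t(1)] by (simp add: x0_def)
  have V0: "emeasure \<nu> {..<x0} \<noteq> top" using v_fin[OF t(1)] push_lessThan[OF v_meas t(1)] by (simp add: x0_def)
  have T0: "(\<integral>\<^sup>+z\<in>{x0<..}. ennreal (z powr - p) \<partial>\<nu>) \<noteq> top"
    using t x0 by (auto simp: fund_eq tail_int_eq x0_def ennreal_mult_top)
  have mb: "f \<in> borel_measurable borel \<Longrightarrow> f \<in> borel_measurable \<nu>" for f :: "real \<Rightarrow> ennreal"
    using measurable_cong_sets[OF sets_push refl] by blast
  have ae: "AE z in \<nu>. z \<noteq> y" for y
    using push_atom[OF v_meas, of y] by (intro AE_I[where N = "{y}"]) auto
  fix x :: real assume x: "0 < x"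
  show "emeasure \<nu> {..<x} \<noteq> top"
  proof -
    have "emeasure \<nu> {..<x} = (\<integral>\<^sup>+z. indicator {..<x} z \<partial>\<nu>)" by simp
    also have "\<dots> \<le> (\<integral>\<^sup>+z. indicator {..<x0} z + ennreal (x powr p) * (ennreal (z powr - p) * indicator {x0<..} z) \<partial>\<nu>)"
    proof (rule nn_integral_mono_AE, use ae[of x0] in eventually_elim)
      case (elim z)
      have "1 \<le> x powr p * z powr - p" if "x0 < z" "z < x"
        using that x0 p by (simp add: powr_minus field_simps powr_mono2)
      then show ?case using elim by (auto simp: indicator_def simp flip: ennreal_mult)
    qed
    also have "\<dots> = emeasure \<nu> {..<x0} + ennreal (x powr p) * (\<integral>\<^sup>+z\<in>{x0<..}. ennreal (z powr - p) \<partial>\<nu>)"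
    proof -
      have "(\<integral>\<^sup>+z. indicator {..<x0} z + ennreal (x powr p) * (ennreal (z powr - p) * indicator {x0<..} z) \<partial>\<nu>)
        = (\<integral>\<^sup>+z. indicator {..<x0} z \<partial>\<nu>) + (\<integral>\<^sup>+z. ennreal (x powr p) * (ennreal (z powr - p) * indicator {x0<..} z) \<partial>\<nu>)"
        by (intro nn_integral_add mb) measurable
      also have "(\<integral>\<^sup>+z. ennreal (x powr p) * (ennreal (z powr - p) * indicator {x0<..} z) \<partial>\<nu>)
        = ennreal (x powr p) * (\<integral>\<^sup>+z. (ennreal (z powr - p) * indicator {x0<..} z) \<partial>\<nu>)"
        by (intro nn_integral_cmult mb) measurable
      finally show ?thesis by simp
    qed
    finally show ?thesis using V0 T0 by (auto simp: ennreal_mult_eq_top_iff top_unique)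
  qed
  show "(\<integral>\<^sup>+z\<in>{x<..}. ennreal (z powr - p) \<partial>\<nu>) \<noteq> top"
  proof -
    have "(\<integral>\<^sup>+z\<in>{x<..}. ennreal (z powr - p) \<partial>\<nu>)
        \<le> (\<integral>\<^sup>+z. ennreal (x powr - p) * indicator {..<x0} z + ennreal (z powr - p) * indicator {x0<..} z \<partial>\<nu>)"
    proof (rule nn_integral_mono_AE, use ae[of x0] in eventually_elim)
      case (elim z)
      have "z powr - p \<le> x powr - p" if "x < z" using that x p by (intro powr_mono2') auto
      then show ?case using elim by (auto simp: indicator_def intro: ennreal_leI)
    qed
    also have "\<dots> = ennreal (x powr - p) * emeasure \<nu> {..<x0} + (\<integral>\<^sup>+z\<in>{x0<..}. ennreal (z powr - p) \<partial>\<nu>)"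
    proof -
      have "(\<integral>\<^sup>+z. ennreal (x powr - p) * indicator {..<x0} z + ennreal (z powr - p) * indicator {x0<..} z \<partial>\<nu>)
        = (\<integral>\<^sup>+z. ennreal (x powr - p) * indicator {..<x0} z \<partial>\<nu>) + (\<integral>\<^sup>+z. ennreal (z powr - p) * indicator {x0<..} z \<partial>\<nu>)"
        by (intro nn_integral_add mb) measurable
      also have "(\<integral>\<^sup>+z. ennreal (x powr - p) * indicator {..<x0} z \<partial>\<nu>) = ennreal (x powr - p) * (\<integral>\<^sup>+z. indicator {..<x0} z \<partial>\<nu>)"
        by (intro nn_integral_cmult mb) measurable
      finally show ?thesis by simp
    qed
    finally show ?thesis using V0 T0 by (auto simp: ennreal_mult_eq_top_iff top_unique)
  qed
qed (use p q v w push_pos push_nonpos v_meas w_meas push_atom in auto)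

lemma cumul_v: "t \<in> II \<Longrightarrow> cumul v (ennreal t) = ennreal (G.V (U t))"
  using G.V[OF U_pos] push_lessThan[OF v_meas] by simp

lemma tail_v: "t \<in> II \<Longrightarrow> tail_int p L u v t = ennreal (G.T (U t))"
  using G.T[OF U_pos] tail_int_eq by simp

lemma fund_sg: "t \<in> II \<Longrightarrow> fund p L u v t = ennreal (G.sg (U t))"
  using G.V_pos[OF U_pos, of t] G.T_nonneg[of "U t"]
  by (simp add: fund_eq cumul_v tail_v G.sg_def ennreal_plus ennreal_mult)

lemma bb_fund: "t \<in> II \<Longrightarrow> cumul u (ennreal t) epowr p / fund p L u v t = ennreal (G.bb (U t))"
  using G.sg_pos[OF U_pos, of t] by (simp add: fund_sg U_epowr divide_ennreal G.bb_def)

lemma inv_fund: "t \<in> II \<Longrightarrow> 1 / fund p L u v t = ennreal (1 / G.sg (U t))"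
  using G.sg_pos[OF U_pos, of t] divide_ennreal[of 1 "G.sg (U t)"] by (simp add: fund_sg)

lemma cumul_w: "t \<in> II \<Longrightarrow> cumul w (ennreal t) = emeasure \<omega> {..<U t}"
  using push_lessThan[OF w_meas] by simp

text \<open>\<open>lift_antimono\<close> and \<open>pull_antimono\<close> match the competitors in
  both directions, and functions that correspond along U have the same functionals.\<close>

lemma Dfun_eq_Dq: "Dfun L p q u v w = G.Dq"
proof -
  have LG: "Lam L q w \<phi> = G.Lm \<psi>" "Gam L p u v \<phi> = G.Gm \<psi>"
    if \<psi>: "antimono \<psi>" and eq: "\<And>t. t \<in> II \<Longrightarrow> \<psi> (U t) = \<phi> t" for \<phi> \<psi>
  proof -
    have m: "\<psi> \<in> borel_measurable borel" by (rule antimono_ennreal_borel[OF \<psi>])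
    have "G.Lm \<psi> = (\<integral>\<^sup>+t. \<psi> (U t) epowr q * ennreal (w t) \<partial>\<Lambda>)"
      unfolding G.Lm_def using m by (intro nn_integral_push[OF w_meas]) measurable
    also have "\<dots> = Lam L q w \<phi>"
      unfolding Lam_def nn_integral_ival by (intro nn_integral_cong) (simp add: eq)
    finally show "Lam L q w \<phi> = G.Lm \<psi>" ..
    have "G.Gm \<psi> = (\<integral>\<^sup>+t. G.gg \<psi> (U t) * ennreal (v t) \<partial>\<Lambda>)"
      unfolding G.Gm_def by (intro nn_integral_push[OF v_meas]) measurable
    also have "\<dots> = Gam L p u v \<phi>"
      unfolding Gam_def nn_integral_ival[where L = L]
    proof (intro nn_integral_cong)
      fix t assume "t \<in> space \<Lambda>"
      then have t: "t \<in> II" by simp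
      have "(\<integral>\<^sup>+s\<in>ival 0 (ennreal t). \<phi> s * ennreal (u s) \<partial>lebesgue) = (\<integral>\<^sup>+s\<in>ival 0 (ennreal t). \<psi> (U s) * ennreal (u s) \<partial>lebesgue)"
        unfolding ival_sub[OF t] by (intro nn_integral_cong) (auto simp: indicator_def eq)
      also have "\<dots> = hh \<psi> (U t)" by (rule hh_U[OF m t])
      finally show "G.gg \<psi> (U t) * ennreal (v t) = (1 / cumul u (ennreal t) * (\<integral>\<^sup>+s\<in>ival 0 (ennreal t). \<phi> s * ennreal (u s) \<partial>lebesgue)) epowr p * ennreal (v t)"
        unfolding G.gg_def U[OF t] divide_ennreal_def by (simp add: mult.commute)
    qed
    finally show "Gam L p u v \<phi> = G.Gm \<psi>" ..
  qed
  have "{Lam L q w \<phi> |\<phi>. antimono \<phi> \<and> Gam L p u v \<phi> \<le> 1} = {G.Lm \<psi> |\<psi>. antimono \<psi> \<and> G.Gm \<psi> \<le> 1}"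
  proof (intro equalityI subsetI)
    fix l assume "l \<in> {Lam L q w \<phi> |\<phi>. antimono \<phi> \<and> Gam L p u v \<phi> \<le> 1}"
    then obtain \<phi> where \<phi>: "antimono \<phi>" "Gam L p u v \<phi> \<le> 1" "l = Lam L q w \<phi>" by blast
    obtain \<psi> where "antimono \<psi>" "\<And>t. t \<in> II \<Longrightarrow> \<psi> (U t) = \<phi> t" using lift_antimono[OF \<phi>(1)] by blast
    then show "l \<in> {G.Lm \<psi> |\<psi>. antimono \<psi> \<and> G.Gm \<psi> \<le> 1}" using \<phi> LG[of \<psi> \<phi>] by (intro CollectI exI[of _ \<psi>]) simp
  next
    fix l assume "l \<in> {G.Lm \<psi> |\<psi>. antimono \<psi> \<and> G.Gm \<psi> \<le> 1}"
    then obtain \<psi> where \<psi>: "antimono \<psi>" "G.Gm \<psi> \<le> 1" "l = G.Lm \<psi>" by blast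
    obtain \<phi> where "antimono \<phi>" "\<And>t. t \<in> II \<Longrightarrow> \<psi> (U t) = \<phi> t" using pull_antimono[OF \<psi>(1)] by blast
    then show "l \<in> {Lam L q w \<phi> |\<phi>. antimono \<phi> \<and> Gam L p u v \<phi> \<le> 1}" using \<psi> LG[of \<psi> \<phi>] by (intro CollectI exI[of _ \<phi>]) simp
  qed
  then show ?thesis by (simp add: Dfun_def G.Dq_def)
qed

text \<open>U(L) may be finite, and then the points of the half-line beyond the range of U have to
  be treated apart.\<close>

lemma below_M:
  assumes "0 < x"
  obtains t where "t \<in> II" "U t = x" | "cumul u L \<le> ennreal x" "\<And>t. t \<in> II \<Longrightarrow> U t < x"
proof (cases "ennreal x < cumul u L")
  case True
  then show ?thesis using U_surj assms that(1) by metis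
next
  case False
  then have "U t < x" if "t \<in> II" for t
    using U_less_M[OF that] U_pos[OF that] by (metis ennreal_less_iff less_imp_le less_le_trans not_le)
  then show ?thesis using False that(2) by auto
qed

lemma om_beyond: "cumul u L \<le> ennreal x \<Longrightarrow> emeasure \<omega> {..<x} = cumul w L"
  by (rule push_ge_M[OF w_meas])

lemma Lim_bb: "Lim (at_right 0) (\<lambda>t. cumul u (ennreal t) epowr p / fund p L u v t) = (INF x\<in>{0<..}. ennreal (G.bb x))"
proof -
  have "Lim (at_right 0) (\<lambda>t. cumul u (ennreal t) epowr p / fund p L u v t) = (INF t\<in>II. cumul u (ennreal t) epowr p / fund p L u v t)"
    by (rule Lim_right_0) (auto simp: bb_fund U_le_iff U_pos intro!: ennreal_leI G.bb_mono)
  also have "\<dots> = (INF t\<in>II. ennreal (G.bb (U t)))" by (intro INF_cong refl bb_fund)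
  also have "\<dots> = (INF x\<in>{0<..}. ennreal (G.bb x))"
  proof (rule antisym)
    show "(INF t\<in>II. ennreal (G.bb (U t))) \<le> (INF x\<in>{0<..}. ennreal (G.bb x))"
    proof (rule INF_greatest)
      fix x :: real assume "x \<in> {0<..}"
      then have x: "0 < x" by simp
      have "\<exists>t\<in>II. U t \<le> x"
        by (rule below_M[OF x]) (use II_nonempty less_imp_le in \<open>blast+\<close>)
      then obtain t where t: "t \<in> II" "U t \<le> x" by blast
      have "(INF t\<in>II. ennreal (G.bb (U t))) \<le> ennreal (G.bb (U t))" by (rule INF_lower[OF t(1)])
      also have "\<dots> \<le> ennreal (G.bb x)" using t U_pos by (intro ennreal_leI G.bb_mono) auto
      finally show "(INF t\<in>II. ennreal (G.bb (U t))) \<le> ennreal (G.bb x)" .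
    qed
    show "(INF x\<in>{0<..}. ennreal (G.bb x)) \<le> (INF t\<in>II. ennreal (G.bb (U t)))"
      by (rule INF_greatest) (use U_pos in \<open>auto intro: INF_lower\<close>)
  qed
  finally show ?thesis .
qed

text \<open>Beyond U(L) no mass of \<nu> is left, so T vanishes and \<sigma> equals V(L), the
  supremum of the values V(t) \<le> \<sigma>(U t).\<close>

lemma sg_beyond:
  assumes x: "0 < x" and ge: "cumul u L \<le> ennreal x"
  shows "ennreal (G.sg x) \<le> (SUP t\<in>II. ennreal (G.sg (U t)))" and "G.T x = 0"
proof -
  have "(\<integral>\<^sup>+z\<in>{x<..}. ennreal (z powr - p) \<partial>\<nu>) = (\<integral>\<^sup>+t. 0 \<partial>\<Lambda>)"
  proof (subst nn_integral_push[OF v_meas])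
    show "(\<integral>\<^sup>+t. ennreal (U t powr - p) * indicator {x<..} (U t) * ennreal (v t) \<partial>\<Lambda>) = (\<integral>\<^sup>+t. 0 \<partial>\<Lambda>)"
    proof (intro nn_integral_cong)
      fix t assume "t \<in> space \<Lambda>"
      then have t: "t \<in> II" by simp
      have "ennreal (U t) < ennreal x" using U_less_M[OF t] ge by (rule less_le_trans)
      then have "U t < x" using U_pos[OF t] by (simp add: ennreal_less_iff)
      then show "ennreal (U t powr - p) * indicator {x<..} (U t) * ennreal (v t) = 0" by simp
    qed
  qed simp
  then show T0: "G.T x = 0" by (simp add: G.T_def)
  have "ennreal (G.sg x) = ennreal (G.V x)" using T0 by (simp add: G.sg_def)
  also have "\<dots> = emeasure \<nu> {..<x}" using G.V[OF x] by simp
  also have "\<dots> = cumul v L" by (rule push_ge_M[OF v_meas ge])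
  also have "\<dots> = (SUP t\<in>II. cumul v (ennreal t))" by (rule cumul_SUP[OF v_meas L])
  also have "\<dots> \<le> (SUP t\<in>II. ennreal (G.sg (U t)))"
  proof (rule SUP_least)
    fix t assume t: "t \<in> II"
    have "G.V (U t) \<le> G.sg (U t)" using G.T_nonneg by (simp add: G.sg_def)
    then have "cumul v (ennreal t) \<le> ennreal (G.sg (U t))" by (simp add: cumul_v[OF t] ennreal_leI)
    also have "\<dots> \<le> (SUP t\<in>II. ennreal (G.sg (U t)))" by (rule SUP_upper[OF t])
    finally show "cumul v (ennreal t) \<le> (SUP t\<in>II. ennreal (G.sg (U t)))" .
  qed
  finally show "ennreal (G.sg x) \<le> (SUP t\<in>II. ennreal (G.sg (U t)))" .
qed

lemma Lim_sg: "Lim (at_right_end L) (\<lambda>t. 1 / fund p L u v t) = (INF x\<in>{0<..}. ennreal (1 / G.sg x))"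
proof -
  have inv: "a \<le> inverse b \<longleftrightarrow> b \<le> inverse a" for a b :: ennreal
    using inverse_antimono_ennreal[of a "inverse b"] inverse_antimono_ennreal[of b "inverse a"]
    by (auto simp: inverse_inverse_ennreal)
  have "Lim (at_right_end L) (\<lambda>t. 1 / fund p L u v t) = (INF t\<in>II. 1 / fund p L u v t)"
  proof (rule Lim_right_end)
    fix s t assume st: "s \<in> II" "t \<in> II" "s \<le> t"
    have "G.sg (U s) \<le> G.sg (U t)" using st U_le_iff U_pos by (intro G.sg_mono) auto
    then have "1 / G.sg (U t) \<le> 1 / G.sg (U s)" using G.sg_pos U_pos st by (intro divide_left_mono) auto
    then show "1 / fund p L u v t \<le> 1 / fund p L u v s" by (simp only: inv_fund[OF st(1)] inv_fund[OF st(2)] ennreal_leI)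
  qed
  also have "\<dots> = (INF t\<in>II. ennreal (1 / G.sg (U t)))" by (intro INF_cong refl inv_fund)
  also have "\<dots> = (INF x\<in>{0<..}. ennreal (1 / G.sg x))"
  proof (rule antisym)
    show "(INF t\<in>II. ennreal (1 / G.sg (U t))) \<le> (INF x\<in>{0<..}. ennreal (1 / G.sg x))"
    proof (rule INF_greatest)
      fix x :: real assume "x \<in> {0<..}"
      then have x: "0 < x" by simp
      show "(INF t\<in>II. ennreal (1 / G.sg (U t))) \<le> ennreal (1 / G.sg x)"
      proof (cases rule: below_M[OF x])
        case (1 t)
        then show ?thesis by (auto intro: INF_lower)
      next
        case 2
        define i where "i = (INF t\<in>II. ennreal (1 / G.sg (U t)))"
        \<comment> \<open>Inverses turn the infimum of 1/\<sigma> into a supremum of \<sigma>, to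
          which \<open>sg_beyond\<close> applies.\<close>
        have "ennreal (G.sg (U t)) \<le> inverse i" if t: "t \<in> II" for t
        proof -
          have "i \<le> ennreal (1 / G.sg (U t))" unfolding i_def by (rule INF_lower[OF t])
          also have "\<dots> = inverse (ennreal (G.sg (U t)))"
            using G.sg_pos[OF U_pos[OF t]] by (simp add: inverse_ennreal inverse_eq_divide)
          finally show ?thesis using inv by blast
        qed
        then have "ennreal (G.sg x) \<le> inverse i" using sg_beyond(1)[OF x 2(1)] by (meson SUP_least order_trans)
        then have "i \<le> inverse (ennreal (G.sg x))" using inv by blast
        then show ?thesis using G.sg_pos[OF x] by (simp add: i_def inverse_ennreal inverse_eq_divide)
      qed
    qed
    show "(INF x\<in>{0<..}. ennreal (1 / G.sg x)) \<le> (INF t\<in>II. ennreal (1 / G.sg (U t)))"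
      by (rule INF_greatest) (use U_pos in \<open>auto intro: INF_lower\<close>)
  qed
  finally show ?thesis .
qed

text \<open>Beyond U(L) the distribution function of \<omega> is constantly W(L), the supremum of
  W(t), while g has only decreased; such x add nothing to suprema over (0,L).\<close>

lemma sup_beyond:
  fixes g :: "real \<Rightarrow> ennreal"
  assumes t0: "t0 \<in> II" "U t0 \<le> x" and g: "\<And>y z. 0 < y \<Longrightarrow> y \<le> z \<Longrightarrow> g z \<le> g y"
  shows "emeasure \<omega> {..<x} * g x \<le> (SUP t\<in>{\<tau>. t0 \<le> \<tau> \<and> ennreal \<tau> < L}. cumul w (ennreal t) * g (U t))"
proof -
  have x: "0 < x" using t0 U_pos by fastforce
  have sub: "t \<in> II" if "t0 \<le> t" "ennreal t < L" for t using that ivalD(1)[OF t0(1)] by (auto simp: ival_def)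
  show ?thesis
  proof (cases rule: below_M[OF x])
    case (1 t)
    then have "t0 \<le> t" using t0 U_le_iff by auto
    then show ?thesis using 1 cumul_w[OF 1(1)] ivalD[OF 1(1)] by (intro SUP_upper2[of t]) auto
  next
    case 2
    have "emeasure \<omega> {..<x} * g x = (SUP t\<in>II. cumul w (ennreal t) * g x)"
      unfolding om_beyond[OF 2(1)] cumul_SUP[OF w_meas L] by (simp add: SUP_mult_right_ennreal)
    also have "\<dots> \<le> (SUP t\<in>{\<tau>. t0 \<le> \<tau> \<and> ennreal \<tau> < L}. cumul w (ennreal t) * g (U t))"
    proof (rule SUP_least)
      fix t assume t: "t \<in> II"
      have m: "max t t0 \<in> II" using t t0 by (simp add: max_def)
      have "cumul w (ennreal t) * g x \<le> cumul w (ennreal (max t t0)) * g (U (max t t0))"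
        using 2(2)[OF m] U_pos[OF m] by (intro mult_mono cumul_mono g ennreal_leI) auto
      also have "\<dots> \<le> (SUP t\<in>{\<tau>. t0 \<le> \<tau> \<and> ennreal \<tau> < L}. cumul w (ennreal t) * g (U t))"
        using ivalD[OF m] by (intro SUP_upper) auto
      finally show "cumul w (ennreal t) * g x \<le> \<dots>" .
    qed
    finally show ?thesis .
  qed
qed

end

section \<open>The integral term and the two boundary terms\<close>

context gamma_data_less
begin

definition es where "es = (p - q) / (p * q)"
text \<open>Up to the factor p, this is \<open>mm\<close> times the power of \<sigma> contained in
  R; what remains of R is the power of \<open>Nq\<close>.\<close>

definition mq where "mq x = (if x \<le> 0 then 0 else x powr (p - 1) * V x * T x * sg x powr - (q / (p - q) + 2))"
text \<open>N is a parameter because \<open>Nq\<close> is to be exchanged for explicit equivalents.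
  The boundary term \<open>B1\<close> involves only the total mass of \<omega> and has no such
  parameter.\<close>

definition Jn where "Jn N = (\<integral>\<^sup>+x\<in>{0<..}. N x epowr \<rho> * ennreal (mq x) \<partial>lborel)"
definition B0 where "B0 N = (INF x\<in>{0<..}. ennreal (bb x)) epowr (1 / p) * (SUP x\<in>{0<..}. N x * ennreal (x powr - q)) epowr (1 / q)"
definition B1 where "B1 = (INF x\<in>{0<..}. ennreal (1 / sg x)) epowr (1 / p) * emeasure \<omega> UNIV epowr (1 / q)"

lemma es: "0 < es" "\<rho> * es = 1 / q" "q / (p - q) * es = 1 / p"
  using p q qp by (auto simp: es_def \<rho>_def field_simps)

lemma Dq_es: "(Dq epowr \<rho>) epowr es = Dq epowr (1 / q)"
  using es \<rho>_pos by (simp add: epowr_epowr)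

lemma mq_measurable [measurable]: "mq \<in> borel_measurable borel"
  unfolding mq_def[abs_def] by measurable

lemma mq_nonneg: "0 \<le> mq x"
  by (cases "0 < x") (auto simp: mq_def intro!: mult_nonneg_nonneg T_nonneg less_imp_le[OF V_pos])

lemma R_mm: "0 < x \<Longrightarrow> R x * ennreal (mm x) = ennreal p * (Nq x epowr \<rho> * ennreal (mq x))"
proof -
  assume x: "0 < x"
  note s = sg_pos[OF x]
  have "ennreal (1 / sg x) epowr (q / (p - q)) = ennreal (sg x powr - (q / (p - q)))"
    using s by (simp add: epowr_ennreal powr_divide powr_minus_divide)
  then have R: "R x = Nq x epowr \<rho> * ennreal (sg x powr - (q / (p - q)))" using R_eq_sg[OF x] by simp
  have "sg x powr - (q / (p - q)) * mm x = p * mq x"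
  proof -
    have "- (q / (p - q) + 2) = - (q / (p - q)) + - 2" by simp
    then have "sg x powr - (q / (p - q) + 2) = sg x powr - (q / (p - q)) * sg x powr - 2"
      by (simp only: powr_add)
    also have "sg x powr - 2 = 1 / (sg x)\<^sup>2" using s by (simp add: powr_minus_divide powr_numeral)
    finally show ?thesis using x by (simp add: mm_def mq_def)
  qed
  then have "ennreal (sg x powr - (q / (p - q))) * ennreal (mm x) = ennreal p * ennreal (mq x)"
    using p mq_nonneg mm_nonneg by (simp flip: ennreal_mult)
  then show ?thesis by (simp add: R mult_ac) (metis mult.assoc mult.commute)
qed

lemma EE_eq: "EE = ennreal p * Jn Nq"
proof -
  have "EE = (\<integral>\<^sup>+x. ennreal p * (Nq x epowr \<rho> * ennreal (mq x) * indicator {0<..} x) \<partial>lborel)"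
    unfolding EE_def using R_mm by (intro nn_integral_cong) (auto simp: indicator_def)
  then show ?thesis by (simp add: Jn_def nn_integral_cmult)
qed

lemma Jn_le:
  assumes le: "\<And>x. 0 < x \<Longrightarrow> N x \<le> ennreal c * N' x" and c: "0 < c" and [measurable]: "N' \<in> borel_measurable borel"
  shows "Jn N \<le> ennreal (c powr \<rho>) * Jn N'"
proof -
  have "Jn N \<le> (\<integral>\<^sup>+x. ennreal (c powr \<rho>) * (N' x epowr \<rho> * ennreal (mq x) * indicator {0<..} x) \<partial>lborel)"
    unfolding Jn_def
  proof (intro nn_integral_mono)
    fix x
    have "N x epowr \<rho> \<le> ennreal (c powr \<rho>) * N' x epowr \<rho>" if "0 < x"
    proof -
      have "N x epowr \<rho> \<le> (ennreal c * N' x) epowr \<rho>" using le[OF that] \<rho>_pos by (intro epowr_mono) auto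
      then show ?thesis using c by (simp add: epowr_mult \<rho>_pos epowr_ennreal)
    qed
    then show "N x epowr \<rho> * ennreal (mq x) * indicator {0<..} x \<le> ennreal (c powr \<rho>) * (N' x epowr \<rho> * ennreal (mq x) * indicator {0<..} x)"
      by (cases "0 < x") (simp_all add: mult_right_mono mult.assoc[symmetric])
  qed
  then show ?thesis by (simp add: Jn_def nn_integral_cmult)
qed

lemma B0_le:
  assumes le: "\<And>x. 0 < x \<Longrightarrow> N x \<le> ennreal c * N' x" and c: "0 < c"
  shows "B0 N \<le> ennreal (c powr (1 / q)) * B0 N'"
proof -
  have "(SUP x\<in>{0<..}. N x * ennreal (x powr - q)) \<le> ennreal c * (SUP x\<in>{0<..}. N' x * ennreal (x powr - q))"
  proof (rule SUP_least)
    fix x :: real assume "x \<in> {0<..}"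
    then have x: "0 < x" by simp
    have "N x * ennreal (x powr - q) \<le> (ennreal c * N' x) * ennreal (x powr - q)" by (intro mult_right_mono le x) auto
    also have "\<dots> = ennreal c * (N' x * ennreal (x powr - q))" by (simp only: mult.assoc)
    also have "\<dots> \<le> ennreal c * (SUP x\<in>{0<..}. N' x * ennreal (x powr - q))"
      using x by (intro mult_left_mono SUP_upper) auto
    finally show "N x * ennreal (x powr - q) \<le> ennreal c * (SUP x\<in>{0<..}. N' x * ennreal (x powr - q))" .
  qed
  then have "(SUP x\<in>{0<..}. N x * ennreal (x powr - q)) epowr (1 / q) \<le> (ennreal c * (SUP x\<in>{0<..}. N' x * ennreal (x powr - q))) epowr (1 / q)"
    using q by (intro epowr_mono) auto
  also have "\<dots> = ennreal (c powr (1 / q)) * (SUP x\<in>{0<..}. N' x * ennreal (x powr - q)) epowr (1 / q)"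
    using q c by (simp add: epowr_mult epowr_ennreal)
  finally show ?thesis
    unfolding B0_def by (subst mult.left_commute) (rule mult_left_mono, auto)
qed

lemma E0_es: "E0 epowr es = B0 Nq"
proof -
  have "E0 = (INF x\<in>{0<..}. ennreal (bb x)) epowr (q / (p - q)) * (SUP x\<in>{0<..}. Nq x * ennreal (x powr - q)) epowr \<rho>"
    by (simp add: E0_def epowr_SUP \<rho>_pos)
  then show ?thesis using es p q qp \<rho>_pos by (simp add: B0_def epowr_mult epowr_epowr)
qed

lemma E1_es: "E1 epowr es = B1"
  unfolding E1_def B1_def using es p q qp \<rho>_pos by (simp add: epowr_mult epowr_epowr)

definition Ka where "Ka c = (c powr \<rho> / p * KE) powr es + c powr (1 / q) + 1"
definition Kb where "Kb c = (4 * Kup) powr es * ((p * c powr \<rho>) powr es + c powr (1 / q) + 1)"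

lemma KE_pos: "0 < KE" using KR_ge1 Kg_pos by (simp add: KE_def Klo_def add_nonneg_pos)
lemma Kup_pos: "0 < Kup" using KR_ge1 by (simp add: Kup_def)

lemma terms_le_Dq:
  assumes c: "1 \<le> c" and up: "\<And>x. 0 < x \<Longrightarrow> N x \<le> ennreal c * Nq x"
  shows "Jn N epowr es + B0 N + B1 \<le> ennreal (Ka c) * Dq epowr (1 / q)"
proof -
  define D where "D = Dq epowr (1 / q)"
  have "Jn N \<le> ennreal (c powr \<rho>) * Jn Nq" by (rule Jn_le[OF up]) (use c in auto)
  also have "Jn Nq = ennreal (1 / p) * EE"
    unfolding EE_eq using p by (simp add: mult.assoc[symmetric] flip: ennreal_mult)
  also have "ennreal (c powr \<rho>) * (ennreal (1 / p) * EE) \<le> ennreal (c powr \<rho>) * (ennreal (1 / p) * (ennreal KE * Dq epowr \<rho>))"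
    by (intro mult_left_mono EE_le) auto
  also have "\<dots> = ennreal (c powr \<rho> / p * KE) * Dq epowr \<rho>"
    using p KE_pos by (simp add: mult.assoc[symmetric] flip: ennreal_mult)
  finally have "Jn N epowr es \<le> (ennreal (c powr \<rho> / p * KE) * Dq epowr \<rho>) epowr es" using es by (intro epowr_mono) auto
  also have "\<dots> = ennreal ((c powr \<rho> / p * KE) powr es) * D"
    using es c p KE_pos by (simp add: epowr_mult epowr_ennreal Dq_es D_def)
  finally have 1: "Jn N epowr es \<le> ennreal ((c powr \<rho> / p * KE) powr es) * D" .
  have DD: "E0 epowr es \<le> D" "E1 epowr es \<le> D"
    unfolding D_def Dq_es[symmetric] using es by (auto intro!: epowr_mono E0_le E1_le)
  have "B0 N \<le> ennreal (c powr (1 / q)) * B0 Nq" by (rule B0_le[OF up]) (use c in auto)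
  also have "\<dots> \<le> ennreal (c powr (1 / q)) * D" using DD E0_es by (intro mult_left_mono) auto
  finally have 2: "B0 N \<le> ennreal (c powr (1 / q)) * D" .
  have 3: "B1 \<le> ennreal 1 * D" using DD E1_es by simp
  have "Jn N epowr es + B0 N + B1 \<le> ennreal ((c powr \<rho> / p * KE) powr es) * D + ennreal (c powr (1 / q)) * D + ennreal 1 * D"
    by (intro add_mono 1 2 3)
  also have "\<dots> = ennreal (Ka c) * D"
    by (simp only: distrib_right[symmetric] Ka_def ennreal_plus[symmetric] powr_ge_zero add_nonneg_nonneg zero_le_one)
  finally show ?thesis by (simp add: D_def)
qed

lemma Dq_le_terms:
  assumes c: "1 \<le> c" and lo: "\<And>x. 0 < x \<Longrightarrow> Nq x \<le> ennreal c * N x" and N [measurable]: "N \<in> borel_measurable borel"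
  shows "Dq epowr (1 / q) \<le> ennreal (Kb c) * (Jn N epowr es + B0 N + B1)"
proof -
  let ?S = "Jn N epowr es + B0 N + B1"
  have "Dq epowr (1 / q) \<le> (ennreal Kup * (EE + E0 + E1)) epowr es"
    unfolding Dq_es[symmetric] using es by (intro epowr_mono Dq_upper_bound) auto
  also have "\<dots> = ennreal (Kup powr es) * (EE + E0 + E1) epowr es"
    using es Kup_pos by (simp add: epowr_mult epowr_ennreal)
  also have "(EE + E0 + E1) epowr es \<le> ennreal (4 powr es) * (EE epowr es + E0 epowr es + E1 epowr es)"
  proof -
    have "(EE + E0 + E1) epowr es \<le> ennreal (2 powr es) * ((EE + E0) epowr es + E1 epowr es)"
      using es by (intro epowr_add_le) auto
    also have "\<dots> \<le> ennreal (2 powr es) * (ennreal (2 powr es) * (EE epowr es + E0 epowr es) + ennreal (2 powr es) * E1 epowr es)"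
    proof (intro mult_left_mono add_mono epowr_add_le)
      have "1 * E1 epowr es \<le> ennreal (2 powr es) * E1 epowr es"
        using es by (intro mult_right_mono) (auto simp: ge_one_powr_ge_zero)
      then show "E1 epowr es \<le> ennreal (2 powr es) * E1 epowr es" by simp
    qed (use es in auto)
    also have "\<dots> = (ennreal (2 powr es) * ennreal (2 powr es)) * (EE epowr es + E0 epowr es + E1 epowr es)"
      by (simp only: distrib_left mult.assoc)
    also have "ennreal (2 powr es) * ennreal (2 powr es) = ennreal (4 powr es)"
      using powr_mult[of 2 2 es] by (simp flip: ennreal_mult)
    finally show ?thesis .
  qed
  also have "EE epowr es + E0 epowr es + E1 epowr es \<le> ennreal ((p * c powr \<rho>) powr es) * ?S + ennreal (c powr (1 / q)) * ?S + ennreal 1 * ?S"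
  proof (intro add_mono)
    have "EE \<le> ennreal p * (ennreal (c powr \<rho>) * Jn N)"
      unfolding EE_eq by (intro mult_left_mono Jn_le lo N) (use c in auto)
    also have "\<dots> = ennreal (p * c powr \<rho>) * Jn N" using p by (simp add: ennreal_mult mult.assoc)
    finally have "EE epowr es \<le> (ennreal (p * c powr \<rho>) * Jn N) epowr es" using es by (intro epowr_mono) auto
    also have "\<dots> = ennreal ((p * c powr \<rho>) powr es) * Jn N epowr es"
      using es p c by (simp add: epowr_mult epowr_ennreal)
    also have "\<dots> \<le> ennreal ((p * c powr \<rho>) powr es) * ?S" by (intro mult_left_mono) (auto simp: add_increasing2 add.assoc)
    finally show "EE epowr es \<le> ennreal ((p * c powr \<rho>) powr es) * ?S" .
    have "E0 epowr es \<le> ennreal (c powr (1 / q)) * B0 N"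
      unfolding E0_es by (rule B0_le[OF lo]) (use c in auto)
    also have "\<dots> \<le> ennreal (c powr (1 / q)) * ?S" by (intro mult_left_mono) (auto simp: add_increasing add_increasing2)
    finally show "E0 epowr es \<le> ennreal (c powr (1 / q)) * ?S" .
    show "E1 epowr es \<le> ennreal 1 * ?S" unfolding E1_es by (simp add: add_increasing)
  qed
  also have "\<dots> = ennreal ((p * c powr \<rho>) powr es + c powr (1 / q) + 1) * ?S"
    by (simp only: distrib_right[symmetric] ennreal_plus[symmetric] powr_ge_zero add_nonneg_nonneg zero_le_one)
  finally have "Dq epowr (1 / q) \<le> ennreal (Kup powr es) * (ennreal (4 powr es) * (ennreal ((p * c powr \<rho>) powr es + c powr (1 / q) + 1) * ?S))"
    by (simp add: mult_left_mono)
  also have "\<dots> = ennreal (Kb c) * ?S"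
  proof -
    have "Kb c = Kup powr es * (4 powr es * ((p * c powr \<rho>) powr es + c powr (1 / q) + 1))"
      using Kup_pos by (simp add: Kb_def powr_mult)
    then have "ennreal (Kb c) = ennreal (Kup powr es) * (ennreal (4 powr es) * ennreal ((p * c powr \<rho>) powr es + c powr (1 / q) + 1))"
      by (simp only: ennreal_mult' powr_ge_zero)
    then show ?thesis by (simp only: mult.assoc)
  qed
  finally show ?thesis .
qed

lemma Kb_pos: "1 \<le> c \<Longrightarrow> 0 < Kb c" using Kup_pos by (simp add: Kb_def add_nonneg_pos)

end

context gamma_finite_lt1
begin

text \<open>Equivalent to Om x + x^q I1^(1-q), but written as the power of one sum, the form that
  the integral in \<open>A4\<close> contains.\<close>

definition Nb where "Nb x = (Om x epowr (1 + \<beta>) + ennreal (x powr \<beta>) * I1 x) epowr (1 - q)"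

lemma I1_measurable [measurable]: "I1 \<in> borel_measurable borel"
  unfolding I1_def[abs_def]
  by (intro antimono_ennreal_borel antimonoI nn_integral_mono mult_left_mono) (auto simp: indicator_def)

lemma Nb_measurable [measurable]: "Nb \<in> borel_measurable borel"
  unfolding Nb_def[abs_def] by measurable

lemma Nb_parts:
  assumes x: "0 < x"
  shows "Om x \<le> Nb x" "ennreal (x powr q) * I1 x epowr (1 - q) \<le> Nb x"
    and "Nb x \<le> ennreal 2 * (Om x + ennreal (x powr q) * I1 x epowr (1 - q))"
proof -
  have a: "(Om x epowr (1 + \<beta>)) epowr (1 - q) = Om x" using beta q1 by (simp add: epowr_epowr)
  have b: "(ennreal (x powr \<beta>) * I1 x) epowr (1 - q) = ennreal (x powr q) * I1 x epowr (1 - q)"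
    using x q1 by (simp add: epowr_mult epowr_ennreal powr_powr beta)
  have "(Om x epowr (1 + \<beta>)) epowr (1 - q) \<le> Nb x"
    unfolding Nb_def using q1 by (intro epowr_mono) auto
  then show "Om x \<le> Nb x" unfolding a .
  have "(ennreal (x powr \<beta>) * I1 x) epowr (1 - q) \<le> Nb x"
    unfolding Nb_def using q1 by (intro epowr_mono) auto
  then show "ennreal (x powr q) * I1 x epowr (1 - q) \<le> Nb x" unfolding b .
  have "Nb x \<le> ennreal (2 powr (1 - q)) * ((Om x epowr (1 + \<beta>)) epowr (1 - q) + (ennreal (x powr \<beta>) * I1 x) epowr (1 - q))"
    unfolding Nb_def using q1 by (intro epowr_add_le) auto
  then have "Nb x \<le> ennreal (2 powr (1 - q)) * (Om x + ennreal (x powr q) * I1 x epowr (1 - q))"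
    by (simp only: a b)
  also have "\<dots> \<le> ennreal 2 * (Om x + ennreal (x powr q) * I1 x epowr (1 - q))"
  proof (intro mult_right_mono ennreal_leI)
    show "2 powr (1 - q) \<le> 2" using powr_mono[of "1 - q" 1 2] q by simp
  qed auto
  finally show "Nb x \<le> ennreal 2 * (Om x + ennreal (x powr q) * I1 x epowr (1 - q))" .
qed

definition Kn where "Kn = 2 * (1 + Kv) + (1 + Ku)"

lemma K_nonneg: "0 \<le> Kv" "0 \<le> Ku" "1 \<le> Kn"
proof -
  have "0 < c1" by (simp add: c1_def)
  then show a: "0 \<le> Kv" by (simp add: Kv_def)
  show b: "0 \<le> Ku" by (simp add: Ku_def)
  show "1 \<le> Kn" using a b by (simp add: Kn_def)
qed

lemma Nb_le_Nq: "0 < x \<Longrightarrow> Nb x \<le> ennreal Kn * Nq x"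
proof -
  assume x: "0 < x"
  have "Nb x \<le> ennreal 2 * (Om x + ennreal (x powr q) * I1 x epowr (1 - q))" by (rule Nb_parts(3)[OF x])
  also have "\<dots> \<le> ennreal 2 * (ennreal 1 * Nq x + ennreal Kv * Nq x)"
    by (intro mult_left_mono add_mono Nq_ge_I1 x) (auto simp: Om_def Nq_ge x)
  also have "\<dots> = ennreal (2 * (1 + Kv)) * Nq x"
  proof -
    have "ennreal (2 * (1 + Kv)) = ennreal 2 * (ennreal 1 + ennreal Kv)"
      using K_nonneg by (simp only: ennreal_mult' ennreal_plus zero_le_numeral zero_le_one)
    then show ?thesis by (simp only: mult.assoc distrib_right)
  qed
  also have "\<dots> \<le> ennreal Kn * Nq x" using K_nonneg by (intro mult_right_mono ennreal_leI) (auto simp: Kn_def)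
  finally show ?thesis .
qed

lemma Nq_le_Nb: "0 < x \<Longrightarrow> Nq x \<le> ennreal Kn * Nb x"
proof -
  assume x: "0 < x"
  have "Nq x \<le> Om x + ennreal Ku * (ennreal (x powr q) * I1 x epowr (1 - q))" by (rule Nq_le_I1[OF x])
  also have "\<dots> \<le> ennreal 1 * Nb x + ennreal Ku * Nb x"
    using Nb_parts[OF x] by (intro add_mono mult_left_mono) auto
  also have "\<dots> = ennreal (1 + Ku) * Nb x" using K_nonneg by (simp only: ennreal_plus distrib_right zero_le_one)
  also have "\<dots> \<le> ennreal Kn * Nb x" using K_nonneg by (intro mult_right_mono ennreal_leI) (auto simp: Kn_def)
  finally show ?thesis .
qed

end

section \<open>The characterizations\<close>

context weights_fin
begin

lemma meas_push: "f \<in> borel_measurable borel \<Longrightarrow> f \<in> borel_measurable (push v')" for f :: "real \<Rightarrow> ennreal"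
  using measurable_cong_sets[OF sets_push refl] by blast

lemma om_UNIV: "emeasure \<omega> UNIV = cumul w L"
  by (rule push_UNIV[OF w_meas])

definition Wi where "Wi b = (\<integral>\<^sup>+t\<in>II. cumul w (ennreal t) epowr b * ennreal (w t) \<partial>lebesgue)"

lemma om_cdf_borel: "0 \<le> b \<Longrightarrow> (\<lambda>x. emeasure \<omega> {..<x} epowr b) \<in> borel_measurable borel"
  by (intro mono_ennreal_borel monoI epowr_mono emeasure_mono) auto

lemma Wi_eq: "0 \<le> b \<Longrightarrow> Wi b = (\<integral>\<^sup>+x. emeasure \<omega> {..<x} epowr b \<partial>\<omega>)"
  unfolding Wi_def nn_integral_ival
  by (subst nn_integral_push[OF w_meas om_cdf_borel]) (auto intro!: nn_integral_cong simp: cumul_w)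

lemma Wi_le:
  assumes b: "0 < b" shows "Wi b \<le> cumul w L epowr (1 + b)"
proof -
  have "Wi b \<le> (\<integral>\<^sup>+x. cumul w L epowr b \<partial>\<omega>)"
    unfolding Wi_eq[OF less_imp_le[OF b]] om_UNIV[symmetric] using b
    by (intro nn_integral_mono epowr_mono emeasure_mono) auto
  also have "\<dots> = cumul w L epowr b * cumul w L"
    using om_UNIV sets_eq_imp_space_eq[OF sets_push] by simp
  also have "\<dots> = cumul w L epowr (1 + b)" using b epowr_add[of b 1 "cumul w L"] by (simp add: add.commute)
  finally show ?thesis .
qed

text \<open>Since W(L) may be infinite, \<omega> is cut off at U t before \<open>cdf_powr_le\<close>
  is applied, and t is varied afterwards. With \<open>Wi_le\<close> the integral of W^b w is
  comparable to W(L)^(1+b).\<close>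

lemma Wi_ge:
  assumes b: "0 < b" shows "cumul w L epowr (1 + b) \<le> ennreal (2 powr (1 + b)) * Wi b"
proof -
  have "cumul w (ennreal t) epowr (1 + b) \<le> ennreal (2 powr (1 + b)) * Wi b" if t: "t \<in> II" for t
  proof -
    define m where "m = density \<omega> (indicator {..<U t})"
    have m: "emeasure m A = emeasure \<omega> ({..<U t} \<inter> A)" if A: "A \<in> sets borel" for A
    proof -
      have "emeasure m A = (\<integral>\<^sup>+z. indicator {..<U t} z * indicator A z \<partial>\<omega>)"
        unfolding m_def using A by (subst emeasure_density) (auto intro!: meas_push)
      also have "\<dots> = (\<integral>\<^sup>+z. indicator ({..<U t} \<inter> A) z \<partial>\<omega>)"
        by (intro nn_integral_cong) (simp add: indicator_inter_arith)
      finally show ?thesis using A by simp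
    qed
    have sets_m: "sets m = sets borel" by (simp add: m_def)
    have mle: "emeasure m {..<x} \<le> emeasure \<omega> {..<x}" for x
      by (subst m) (auto intro!: emeasure_mono)
    have eU: "emeasure m {..<U t} = cumul w (ennreal t)" using cumul_w[OF t] by (simp add: m)
    have fin: "emeasure m {..<x} \<noteq> top" for x
    proof -
      have "emeasure m {..<x} \<le> emeasure \<omega> {..<U t}" by (subst m) (auto intro!: emeasure_mono)
      then show ?thesis using w_fin(2)[OF t] cumul_w[OF t] by (auto simp: top_unique)
    qed
    have atom: "emeasure m {x} = 0" for x
    proof -
      have "emeasure m {x} \<le> emeasure \<omega> {x}" by (subst m) (auto intro!: emeasure_mono)
      then show ?thesis by (simp add: G.om_atom)
    qed
    have zero: "emeasure m {..<0} = 0"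
    proof -
      have "emeasure m {..<0} \<le> emeasure \<omega> {..0}" by (subst m) (auto intro!: emeasure_mono)
      then show ?thesis by (simp add: G.om_nonpos)
    qed
    have mb: "(\<lambda>s. emeasure m {..<s} epowr b) \<in> borel_measurable borel"
      using b by (intro mono_ennreal_borel monoI epowr_mono emeasure_mono) (auto simp: sets_m)
    have "cumul w (ennreal t) epowr (1 + b) \<le> ennreal (2 powr (1 + b)) * (\<integral>\<^sup>+s\<in>{..<U t}. emeasure m {..<s} epowr b \<partial>m)"
      unfolding eU[symmetric] by (rule cdf_powr_le[OF sets_m fin atom zero b])
    also have "(\<integral>\<^sup>+s\<in>{..<U t}. emeasure m {..<s} epowr b \<partial>m)
        = (\<integral>\<^sup>+s. indicator {..<U t} s * (emeasure m {..<s} epowr b * indicator {..<U t} s) \<partial>\<omega>)"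
      unfolding m_def[THEN arg_cong[where f = "\<lambda>m'. \<integral>\<^sup>+s\<in>{..<U t}. emeasure m {..<s} epowr b \<partial>m'"]]
      by (rule nn_integral_density) (use mb in \<open>auto intro!: meas_push\<close>)
    also have "\<dots> \<le> (\<integral>\<^sup>+s. emeasure \<omega> {..<s} epowr b \<partial>\<omega>)"
      using b mle by (intro nn_integral_mono) (auto simp: indicator_def intro: epowr_mono)
    also have "\<dots> = Wi b" using Wi_eq b by simp
    finally show ?thesis by (simp add: mult_left_mono)
  qed
  moreover have "cumul w L epowr (1 + b) = (SUP t\<in>II. cumul w (ennreal t) epowr (1 + b))"
    unfolding cumul_SUP[OF w_meas L] using b by (simp add: epowr_SUP)
  ultimately show ?thesis by (simp add: SUP_least)
qed

lemma ratio:
  assumes t: "t \<in> II"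
  shows "z epowr (1 / q) / fund p L u v t epowr (1 / p) = (z * ennreal (G.sg (U t) powr - (q / p))) epowr (1 / q)"
proof -
  note s = G.sg_pos[OF U_pos[OF t]]
  have "1 / ennreal (G.sg (U t) powr (1 / p)) = ennreal (G.sg (U t) powr - (1 / p))"
    using s divide_ennreal[of 1 "G.sg (U t) powr (1 / p)"] by (simp add: powr_minus_divide)
  moreover have "ennreal (G.sg (U t) powr - (q / p)) epowr (1 / q) = ennreal (G.sg (U t) powr - (1 / p))"
    using s q by (simp add: epowr_ennreal powr_powr)
  ultimately show ?thesis
    using s q by (simp add: fund_sg[OF t] epowr_ennreal epowr_mult divide_ennreal_def)
qed

lemma A1_le: "A1 p q L u v w \<le> G.Dq epowr (1 / q)"
  unfolding A1_def
proof (rule SUP_least)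
  fix t assume t: "t \<in> II"
  have "cumul w (ennreal t) * ennreal (G.sg (U t) powr - (q / p)) \<le> G.Q (U t)"
    unfolding G.Q_def cumul_w[OF t] by (intro mult_right_mono G.Nq_ge U_pos t) auto
  also have "\<dots> \<le> G.Dq" by (rule G.Q_le_Dq[OF U_pos[OF t]])
  finally show "cumul w (ennreal t) epowr (1 / q) / fund p L u v t epowr (1 / p) \<le> G.Dq epowr (1 / q)"
    unfolding ratio[OF t] using q by (intro epowr_mono) auto
qed

lemma sg_powr_antimono: "0 < x \<Longrightarrow> x \<le> y \<Longrightarrow> ennreal (G.sg y powr - (q / p)) \<le> ennreal (G.sg x powr - (q / p))"
  using G.sg_mono[of x y] G.sg_pos[of x] p q by (intro ennreal_leI powr_mono2') auto

text \<open>\<open>A1\<close> sees only the points U t; \<open>sup_beyond\<close> also covers the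
  points past U(L).\<close>

lemma A1_bound:
  assumes x: "0 < x"
  shows "emeasure \<omega> {..<x} * ennreal (G.sg x powr - (q / p)) \<le> A1 p q L u v w epowr q"
proof -
  have "\<exists>t\<in>II. U t \<le> x"
    by (rule below_M[OF x]) (use II_nonempty less_imp_le in \<open>blast+\<close>)
  then obtain t0 where t0: "t0 \<in> II" "U t0 \<le> x" by blast
  have "emeasure \<omega> {..<x} * ennreal (G.sg x powr - (q / p))
      \<le> (SUP t\<in>{\<tau>. t0 \<le> \<tau> \<and> ennreal \<tau> < L}. cumul w (ennreal t) * ennreal (G.sg (U t) powr - (q / p)))"
    by (rule sup_beyond[OF t0]) (rule sg_powr_antimono)
  also have "\<dots> \<le> A1 p q L u v w epowr q"
  proof (rule SUP_least)
    fix t assume "t \<in> {\<tau>. t0 \<le> \<tau> \<and> ennreal \<tau> < L}"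
    then have t: "t \<in> II" using ivalD(1)[OF t0(1)] by (auto simp: ival_def)
    have "(cumul w (ennreal t) * ennreal (G.sg (U t) powr - (q / p))) epowr (1 / q) \<le> A1 p q L u v w"
      unfolding A1_def ratio[OF t, symmetric] by (rule SUP_upper[OF t])
    then show "cumul w (ennreal t) * ennreal (G.sg (U t) powr - (q / p)) \<le> A1 p q L u v w epowr q"
      using q by (simp add: le_epowr_swap)
  qed
  finally show ?thesis .
qed

lemma A1_le_A3: "A1 p q L u v w \<le> A3 p q L u v w"
  unfolding A1_def A3_def by (intro SUP_mono' divide_right_mono_ennreal) simp

lemma Dq_le_powr:
  assumes pq: "p \<le> q" and c: "0 < c" and le: "\<And>x. 0 < x \<Longrightarrow> G.Q x \<le> ennreal c * A epowr q"
  shows "G.Dq epowr (1 / q) \<le> ennreal ((10 * 4 powr (q / p) * c) powr (1 / q)) * A"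
proof -
  have "G.Dq \<le> ennreal (10 * 4 powr (q / p)) * (ennreal c * A epowr q)" by (rule G.Dq_le_sup[OF pq le])
  also have "\<dots> = ennreal (10 * 4 powr (q / p) * c) * A epowr q" using c by (simp add: ennreal_mult' mult.assoc)
  finally have "G.Dq epowr (1 / q) \<le> (ennreal (10 * 4 powr (q / p) * c) * A epowr q) epowr (1 / q)"
    using q by (intro epowr_mono) auto
  also have "\<dots> = ennreal ((10 * 4 powr (q / p) * c) powr (1 / q)) * A"
    using q c by (simp add: epowr_mult epowr_inv epowr_ennreal)
  finally show ?thesis .
qed

lemma beyond:
  assumes "cumul u L \<noteq> top"
  obtains x0 where "0 < x0" "cumul u L \<le> ennreal x0"
proof -
  obtain m where m: "cumul u L = ennreal m" "0 \<le> m" using assms by (cases "cumul u L") auto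
  show ?thesis using m by (intro that[of "m + 1"]) (auto intro: ennreal_leI)
qed

text \<open>With U(L) finite, \<sigma> is constant from U(L) on and therefore bounded. The boundary
  term at L is then infinite as soon as W(L) is.\<close>

lemma INF_sg_pos:
  assumes M: "cumul u L \<noteq> top"
  shows "(INF x\<in>{0<..}. ennreal (1 / G.sg x)) \<noteq> 0"
proof -
  obtain x0 where x0: "0 < x0" "cumul u L \<le> ennreal x0" by (rule beyond[OF M])
  have "ennreal (1 / G.sg x0) \<le> (INF x\<in>{0<..}. ennreal (1 / G.sg x))"
  proof (rule INF_greatest)
    fix x :: real assume "x \<in> {0<..}"
    then have x: "0 < x" by simp
    have "G.sg x \<le> G.sg x0"
    proof (cases "x \<le> x0")
      case True then show ?thesis by (rule G.sg_mono[OF x])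
    next
      case False
      then have ge: "cumul u L \<le> ennreal x" using x0 by (meson ennreal_leI linear order_trans)
      have "ennreal (G.V x) = ennreal (G.V x0)"
        using push_ge_M[OF v_meas ge] push_ge_M[OF v_meas x0(2)] G.V[OF x] G.V[OF x0(1)] by simp
      then have "G.V x = G.V x0" using G.V_pos[OF x] G.V_pos[OF x0(1)] by simp
      then show ?thesis using sg_beyond(2)[OF x ge] sg_beyond(2)[OF x0] by (simp add: G.sg_def)
    qed
    then show "ennreal (1 / G.sg x0) \<le> ennreal (1 / G.sg x)"
      using G.sg_pos[OF x] by (intro ennreal_leI divide_left_mono) (auto intro!: mult_pos_pos G.sg_pos x0)
  qed
  moreover have "0 < ennreal (1 / G.sg x0)" using G.sg_pos[OF x0(1)] by simp
  ultimately have "0 < (INF x\<in>{0<..}. ennreal (1 / G.sg x))" by (rule less_le_trans[rotated])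
  then show ?thesis by simp
qed

lemma Dq_bad:
  assumes "cumul w L = top" "cumul u L \<noteq> top" shows "G.Dq = top"
proof -
  obtain x0 where x0: "0 < x0" "cumul u L \<le> ennreal x0" by (rule beyond[OF assms(2)])
  have "G.Nq x0 = top" using G.Nq_ge[OF x0(1)] om_beyond[OF x0(2)] assms(1) by (simp add: top_unique)
  then have "G.Q x0 = top" using G.sg_pos[OF x0(1)] by (simp add: G.Q_def ennreal_top_mult)
  then show ?thesis using G.Q_le_Dq[OF x0(1)] by (simp add: top_unique)
qed

lemma A1_bad:
  assumes "cumul w L = top" "cumul u L \<noteq> top" shows "A1 p q L u v w = top"
proof -
  obtain x0 where x0: "0 < x0" "cumul u L \<le> ennreal x0" by (rule beyond[OF assms(2)])
  have "emeasure \<omega> {..<x0} * ennreal (G.sg x0 powr - (q / p)) = top"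
    using om_beyond[OF x0(2)] assms(1) G.sg_pos[OF x0(1)] by (simp add: ennreal_top_mult)
  then have "A1 p q L u v w epowr q = top" using A1_bound[OF x0(1)] by (simp add: top_unique)
  then show ?thesis using q by (simp add: epowr_eq_top_iff)
qed

lemma A2_bad:
  assumes "cumul w L = top" "cumul u L \<noteq> top" shows "A2 p q L u v w = top"
  using INF_sg_pos[OF assms(2)] p q assms(1)
  by (simp add: A2_def Lim_sg ennreal_mult_top epowr_eq_0_iff)

lemma A4_bad:
  assumes "cumul w L = top" "cumul u L \<noteq> top" "q < 1" shows "A4 p q L u v w = top"
proof -
  have b: "0 < q / (1 - q)" using q assms by simp
  have "Wi (q / (1 - q)) = top"
    using Wi_ge[OF b] assms(1) b by (auto simp: top_unique ennreal_mult_eq_top_iff)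
  then show ?thesis using INF_sg_pos[OF assms(2)] p q assms
    by (simp add: A4_def Lim_sg ennreal_mult_top epowr_eq_0_iff Wi_def)
qed

end

locale weights_good = weights_fin +
  assumes good: "cumul w L \<noteq> top \<or> cumul u L = top"
begin

text \<open>If U(L) is infinite, every x > 0 is some U t, and W is finite there; if W(L) is finite,
  it bounds the whole measure.\<close>

sublocale G: gamma_finite p q \<nu> \<omega>
proof
  fix x
  show "emeasure \<omega> {..<x} \<noteq> top"
  proof (cases "0 < x")
    case True
    show ?thesis
    proof (cases rule: below_M[OF True])
      case (1 t)
      then show ?thesis using cumul_w w_fin(2) by auto
    next
      case 2
      then show ?thesis using om_beyond good by (auto simp: top_unique)
    qed
  next
    case False
    then have "emeasure \<omega> {..<x} \<le> emeasure \<omega> {..0}" by (intro emeasure_mono) auto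
    then show ?thesis by (simp add: G.om_nonpos)
  qed
qed

text \<open>The supremum over t \<ge> x in \<open>S1\<close> costs nothing: x^q \<sigma>(x)^(-q/p) =
  b(x)^(q/p) is nondecreasing, so it may be replaced by its value at t, where cancelling t^q leaves
  \<sigma>(t)^(-q/p).\<close>

lemma Dq_le_A1:
  assumes q1: "1 \<le> q" and pq: "p \<le> q"
  shows "G.Dq epowr (1 / q) \<le> ennreal ((10 * 4 powr (q / p) * (1 + 2 * q)) powr (1 / q)) * A1 p q L u v w"
proof (rule Dq_le_powr[OF pq])
  fix x :: real assume x: "0 < x"
  have e: "z powr q * G.sg z powr - (q / p) = G.bb z powr (q / p)" if "0 < z" for z
    using that G.sg_pos[OF that] p by (simp add: G.bb_def powr_divide powr_powr powr_minus_divide)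
  have "ennreal (x powr q * G.sg x powr - (q / p)) * G.S1 x \<le> A1 p q L u v w epowr q"
    unfolding G.S1_def SUP_mult_left_ennreal
  proof (rule SUP_least)
    fix t assume "t \<in> {x..}"
    then have t: "x \<le> t" "0 < t" using x by auto
    have "G.bb x powr (q / p) \<le> G.bb t powr (q / p)"
      using G.bb_mono[OF x t(1)] G.bb_pos[OF x] p q by (intro powr_mono2) auto
    then have "(x powr q * G.sg x powr - (q / p)) * t powr - q \<le> (t powr q * G.sg t powr - (q / p)) * t powr - q"
      unfolding e[OF x] e[OF t(2)] by (intro mult_right_mono) auto
    also have "\<dots> = G.sg t powr - (q / p)" using t by (simp add: powr_minus_divide)
    finally have le: "ennreal (x powr q * G.sg x powr - (q / p)) * ennreal (t powr - q) \<le> ennreal (G.sg t powr - (q / p))"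
      by (simp add: ennreal_leI flip: ennreal_mult)
    have "ennreal (x powr q * G.sg x powr - (q / p)) * (emeasure \<omega> {..<t} * ennreal (t powr - q))
        = emeasure \<omega> {..<t} * (ennreal (x powr q * G.sg x powr - (q / p)) * ennreal (t powr - q))"
      by (simp only: mult_ac)
    also have "\<dots> \<le> emeasure \<omega> {..<t} * ennreal (G.sg t powr - (q / p))" by (intro mult_left_mono le) auto
    also have "\<dots> \<le> A1 p q L u v w epowr q" by (rule A1_bound[OF t(2)])
    finally show "ennreal (x powr q * G.sg x powr - (q / p)) * (emeasure \<omega> {..<t} * ennreal (t powr - q)) \<le> A1 p q L u v w epowr q" .
  qed
  then have 1: "ennreal (1 + 2 * q) * (ennreal (x powr q * G.sg x powr - (q / p)) * G.S1 x) \<le> ennreal (1 + 2 * q) * A1 p q L u v w epowr q"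
    by (intro mult_left_mono) auto
  have "G.Q x \<le> ennreal (1 + 2 * q) * (ennreal (x powr q) * G.S1 x) * ennreal (G.sg x powr - (q / p))"
    unfolding G.Q_def by (intro mult_right_mono G.Nq_le_S1[OF q1 x]) auto
  also have "\<dots> = ennreal (1 + 2 * q) * (ennreal (x powr q * G.sg x powr - (q / p)) * G.S1 x)"
    by (subst ennreal_mult) (auto simp: mult_ac)
  finally show "G.Q x \<le> ennreal (1 + 2 * q) * A1 p q L u v w epowr q" using 1 by simp
qed (use q in auto)

end

section \<open>The supremum characterization for exponents q below 1\<close>

locale weights_lt1 = weights_good +
  assumes q1: "q < 1"
begin

sublocale G: gamma_finite_lt1 p q \<nu> \<omega>
  by unfold_locales (rule q1)

lemma Om_U: "t \<in> II \<Longrightarrow> cumul w (ennreal t) = G.Om (U t)"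
  by (simp add: G.Om_def cumul_w)

lemma tail_W_eq: "t \<in> II \<Longrightarrow> tail_W q L u w t = G.I1 (U t)"
proof -
  assume t: "t \<in> II"
  have "tail_W q L u w t = (\<integral>\<^sup>+s\<in>ival t L. (G.Om (U s) epowr G.\<beta> * ennreal (U s powr - G.\<beta>)) * ennreal (w s) \<partial>lebesgue)"
    unfolding tail_W_def G.\<beta>_def[symmetric]
    by (intro nn_integral_cong) (auto simp: indicator_def ival_tail[OF t] U_epowr Om_U mult_ac)
  also have "\<dots> = G.I1 (U t)"
    unfolding G.I1_def by (rule nn_integral_tail[OF t w_meas]) measurable
  finally show ?thesis .
qed

lemma tail_W_0: "tail_W q L u w 0 = (\<integral>\<^sup>+x\<in>{0<..}. G.Om x epowr G.\<beta> * ennreal (x powr - G.\<beta>) \<partial>\<omega>)"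
proof -
  have "tail_W q L u w 0 = (\<integral>\<^sup>+s\<in>II. (G.Om (U s) epowr G.\<beta> * ennreal (U s powr - G.\<beta>) * indicator {0<..} (U s)) * ennreal (w s) \<partial>lebesgue)"
    unfolding tail_W_def G.\<beta>_def[symmetric]
    by (intro nn_integral_cong) (auto simp: indicator_def U_pos U_epowr Om_U mult_ac)
  also have "\<dots> = (\<integral>\<^sup>+x\<in>{0<..}. G.Om x epowr G.\<beta> * ennreal (x powr - G.\<beta>) \<partial>\<omega>)"
    unfolding nn_integral_ival by (rule nn_integral_push[OF w_meas, symmetric]) measurable
  finally show ?thesis .
qed

definition num3 where "num3 t = cumul w (ennreal t) epowr (1 / q) + cumul u (ennreal t) * tail_W q L u w t epowr ((1 - q) / q)"

lemma num3_parts: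
  assumes t: "t \<in> II"
  shows "cumul w (ennreal t) epowr (1 / q) = G.Om (U t) epowr (1 / q)"
    and "cumul u (ennreal t) * tail_W q L u w t epowr ((1 - q) / q) = (ennreal (U t powr q) * G.I1 (U t) epowr (1 - q)) epowr (1 / q)"
  using q q1 U_pos[OF t]
  by (simp_all add: Om_U[OF t] tail_W_eq[OF t] U[OF t] epowr_mult epowr_epowr epowr_ennreal powr_powr)

lemma A3_le: "A3 p q L u v w \<le> ennreal (1 + G.Kv powr (1 / q)) * G.Dq epowr (1 / q)"
  unfolding A3_def
proof (rule SUP_least)
  fix t assume t: "t \<in> II"
  note x = U_pos[OF t]
  have Kv0: "0 < G.Kv" by (simp add: G.Kv_def G.c1_def add_pos_nonneg)
  have "num3 t \<le> G.Nq (U t) epowr (1 / q) + (ennreal G.Kv * G.Nq (U t)) epowr (1 / q)"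
    unfolding num3_def num3_parts[OF t] using q
    by (intro add_mono epowr_mono G.Nq_ge_I1 x) (auto simp: G.Om_def G.Nq_ge x)
  also have "\<dots> = ennreal (1 + G.Kv powr (1 / q)) * G.Nq (U t) epowr (1 / q)"
    using q Kv0 by (simp add: epowr_mult epowr_ennreal ennreal_plus distrib_right)
  finally have "num3 t / fund p L u v t epowr (1 / p) \<le> ennreal (1 + G.Kv powr (1 / q)) * G.Nq (U t) epowr (1 / q) / fund p L u v t epowr (1 / p)"
    by (rule divide_right_mono_ennreal)
  also have "\<dots> = ennreal (1 + G.Kv powr (1 / q)) * (G.Nq (U t) epowr (1 / q) / fund p L u v t epowr (1 / p))"
    by (simp add: ennreal_times_divide)
  also have "\<dots> \<le> ennreal (1 + G.Kv powr (1 / q)) * G.Dq epowr (1 / q)"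
    unfolding ratio[OF t] G.Q_def[symmetric] using q
    by (intro mult_left_mono epowr_mono G.Q_le_Dq x) auto
  finally show "(cumul w (ennreal t) epowr (1 / q) + cumul u (ennreal t) * tail_W q L u w t epowr ((1 - q) / q)) / fund p L u v t epowr (1 / p)
      \<le> ennreal (1 + G.Kv powr (1 / q)) * G.Dq epowr (1 / q)"
    unfolding num3_def .
qed

lemma Dq_le_A3:
  assumes pq: "p \<le> q"
  shows "G.Dq epowr (1 / q) \<le> ennreal ((10 * 4 powr (q / p) * (4 * G.Kn)) powr (1 / q)) * A3 p q L u v w"
proof (rule Dq_le_powr[OF pq])
  show "0 < 4 * G.Kn" using G.K_nonneg by simp
  fix x :: real assume x: "0 < x"
  show "G.Q x \<le> ennreal (4 * G.Kn) * A3 p q L u v w epowr q"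
  proof (cases rule: below_M[OF x])
    case (1 t)
    note t = 1(1)
    have "G.Nq x \<le> ennreal G.Kn * (ennreal 2 * (G.Om x + ennreal (x powr q) * G.I1 x epowr (1 - q)))"
      using G.Nq_le_Nb[OF x] G.Nb_parts(3)[OF x] by (meson mult_left_mono order_trans zero_le)
    also have "\<dots> \<le> ennreal G.Kn * (ennreal 2 * (num3 t epowr q + num3 t epowr q))"
    proof (intro mult_left_mono add_mono)
      have "G.Om x epowr (1 / q) \<le> num3 t" unfolding num3_def num3_parts[OF t] 1(2) by simp
      then show "G.Om x \<le> num3 t epowr q" using q by (simp add: le_epowr_swap)
      have "(ennreal (x powr q) * G.I1 x epowr (1 - q)) epowr (1 / q) \<le> num3 t" unfolding num3_def num3_parts[OF t] 1(2) by simp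
      then show "ennreal (x powr q) * G.I1 x epowr (1 - q) \<le> num3 t epowr q" using q by (simp add: le_epowr_swap)
    qed auto
    also have "\<dots> = ennreal (4 * G.Kn) * num3 t epowr q"
    proof -
      have "ennreal (4 * G.Kn) = ennreal G.Kn * (ennreal 2 * 2)"
        using G.K_nonneg by (simp add: ennreal_mult' mult.commute)
      then show ?thesis by (simp only: mult_2[symmetric] mult.assoc)
    qed
    finally have "G.Q x \<le> ennreal (4 * G.Kn) * num3 t epowr q * ennreal (G.sg x powr - (q / p))"
      unfolding G.Q_def by (intro mult_right_mono) auto
    also have "\<dots> = ennreal (4 * G.Kn) * (num3 t epowr q * ennreal (G.sg (U t) powr - (q / p)))" by (simp only: mult.assoc 1(2))
    also have "\<dots> \<le> ennreal (4 * G.Kn) * A3 p q L u v w epowr q"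
    proof (intro mult_left_mono)
      have "((num3 t epowr q) * ennreal (G.sg (U t) powr - (q / p))) epowr (1 / q) = num3 t / fund p L u v t epowr (1 / p)"
        unfolding ratio[OF t, symmetric] using q by (simp add: epowr_inv)
      also have "\<dots> \<le> A3 p q L u v w" unfolding A3_def num3_def by (rule SUP_upper[OF t])
      finally show "num3 t epowr q * ennreal (G.sg (U t) powr - (q / p)) \<le> A3 p q L u v w epowr q"
        using q by (simp add: le_epowr_swap)
    qed simp
    finally show ?thesis .
  next
    case 2
    \<comment> \<open>Beyond U(L) the distribution function of \<omega> has reached its total mass,
      which bounds \<open>Nq\<close>, so the simpler quantity \<open>A1\<close> suffices.\<close>
    have "G.Q x \<le> emeasure \<omega> {..<x} * ennreal (G.sg x powr - (q / p))"
      unfolding G.Q_def om_beyond[OF 2(1)] om_UNIV[symmetric] by (intro mult_right_mono G.Nq_le) auto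
    also have "\<dots> \<le> A1 p q L u v w epowr q" by (rule A1_bound[OF x])
    also have "\<dots> \<le> 1 * A3 p q L u v w epowr q" using q A1_le_A3 by (simp add: epowr_mono)
    also have "\<dots> \<le> ennreal (4 * G.Kn) * A3 p q L u v w epowr q"
      using G.K_nonneg by (intro mult_right_mono) auto
    finally show ?thesis .
  qed
qed

end

section \<open>Integral characterizations for q < p\<close>

locale weights_less = weights_good +
  assumes qp: "q < p"
begin

sublocale G: gamma_data_less p q \<nu> \<omega>
  by unfold_locales (rule qp)

lemma mq_beyond: "0 < x \<Longrightarrow> cumul u L \<le> ennreal x \<Longrightarrow> G.mq x = 0"
  by (simp add: G.mq_def sg_beyond(2))

text \<open>u dt becomes Lebesgue measure on (0,U(L)), and beyond U(L) the density \<open>mq\<close>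
  contains the vanishing factor T.\<close>

lemma Jn_eq:
  assumes [measurable]: "N \<in> borel_measurable borel"
  shows "G.Jn N = (\<integral>\<^sup>+t\<in>II. N (U t) epowr G.\<rho> * ennreal (G.mq (U t)) * ennreal (u t) \<partial>lebesgue)"
proof -
  have "(\<integral>\<^sup>+t\<in>II. N (U t) epowr G.\<rho> * ennreal (G.mq (U t)) * ennreal (u t) \<partial>lebesgue)
      = (\<integral>\<^sup>+x\<in>{x. 0 < x \<and> ennreal x < cumul u L}. N x epowr G.\<rho> * ennreal (G.mq x) \<partial>lborel)"
    unfolding nn_integral_ival by (rule nn_integral_u) measurable
  also have "\<dots> = G.Jn N"
    unfolding G.Jn_def by (intro nn_integral_cong) (auto simp: indicator_def mq_beyond)
  finally show ?thesis ..
qed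

lemma mq_U:
  assumes t: "t \<in> II"
  shows "ennreal (G.mq (U t)) = cumul v (ennreal t) * tail_int p L u v t * cumul u (ennreal t) epowr (p - 1)
    / fund p L u v t epowr (q / (p - q) + 2)"
proof -
  note x = U_pos[OF t] and s = G.sg_pos[OF U_pos[OF t]]
  have "1 / ennreal (G.sg (U t) powr (q / (p - q) + 2)) = ennreal (G.sg (U t) powr - (q / (p - q) + 2))"
    using s divide_ennreal[of 1 "G.sg (U t) powr (q / (p - q) + 2)"] by (simp add: powr_minus_divide del: minus_add_distrib)
  then have "fund p L u v t epowr (q / (p - q) + 2) = ennreal (G.sg (U t) powr (q / (p - q) + 2))"
    "inverse (ennreal (G.sg (U t) powr (q / (p - q) + 2))) = ennreal (G.sg (U t) powr - (q / (p - q) + 2))"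
    using s by (simp_all add: fund_sg[OF t] epowr_ennreal divide_ennreal_def del: minus_add_distrib)
  moreover have "ennreal (G.mq (U t)) = ennreal (G.V (U t)) * ennreal (G.T (U t)) * ennreal (U t powr (p - 1)) * ennreal (G.sg (U t) powr - (q / (p - q) + 2))"
    using x less_imp_le[OF G.V_pos[OF x]] G.T_nonneg[of "U t"] by (simp add: G.mq_def mult_ac flip: ennreal_mult)
  ultimately show ?thesis
    by (simp only: cumul_v[OF t] tail_v[OF t] U_epowr[OF t] divide_ennreal_def)
qed

definition N1 where "N1 x = ennreal (x powr q) * G.S1 x"

lemma N1_measurable [measurable]: "N1 \<in> borel_measurable borel"
proof -
  have "antimono G.S1" unfolding G.S1_def[abs_def] by (intro antimonoI SUP_subset_mono) auto
  then have [measurable]: "G.S1 \<in> borel_measurable borel" by (rule antimono_ennreal_borel)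
  show ?thesis unfolding N1_def[abs_def] by measurable
qed

lemma powr_q_antimono: "0 < y \<Longrightarrow> y \<le> z \<Longrightarrow> ennreal (z powr - q) \<le> ennreal (y powr - q)"
  using q by (intro ennreal_leI powr_mono2') auto

lemma S1_U:
  assumes t: "t \<in> II"
  shows "G.S1 (U t) = (SUP \<tau>\<in>{\<tau>. t \<le> \<tau> \<and> ennreal \<tau> < L}. cumul w (ennreal \<tau>) * ennreal (U \<tau> powr - q))"
    (is "_ = ?B")
proof (rule antisym)
  show "G.S1 (U t) \<le> ?B"
    unfolding G.S1_def
  proof (rule SUP_least)
    fix x assume "x \<in> {U t..}"
    then show "emeasure \<omega> {..<x} * ennreal (x powr - q) \<le> ?B"
      using powr_q_antimono by (intro sup_beyond[OF t]) auto
  qed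
  show "?B \<le> G.S1 (U t)"
  proof (rule SUP_least)
    fix s assume "s \<in> {\<tau>. t \<le> \<tau> \<and> ennreal \<tau> < L}"
    then have s: "s \<in> II" "t \<le> s" using ivalD(1)[OF t] by (auto simp: ival_def)
    then have "U s \<in> {U t..}" using U_le_iff[OF t s(1)] by simp
    then show "cumul w (ennreal s) * ennreal (U s powr - q) \<le> G.S1 (U t)"
      unfolding cumul_w[OF s(1)] G.S1_def by (rule SUP_upper)
  qed
qed

lemma SUP_N1: "(SUP x\<in>{0<..}. N1 x * ennreal (x powr - q)) = (SUP t\<in>II. cumul w (ennreal t) / cumul u (ennreal t) epowr q)"
proof -
  have N1: "N1 x * ennreal (x powr - q) = G.S1 x" if "0 < x" for x
  proof -
    have "ennreal (x powr q) * ennreal (x powr - q) = 1"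
      using that by (simp add: powr_minus flip: ennreal_mult)
    moreover have "N1 x * ennreal (x powr - q) = (ennreal (x powr q) * ennreal (x powr - q)) * G.S1 x"
      by (simp only: N1_def mult_ac)
    ultimately show ?thesis by simp
  qed
  have W: "cumul w (ennreal t) / cumul u (ennreal t) epowr q = cumul w (ennreal t) * ennreal (U t powr - q)" if t: "t \<in> II" for t
    using U_epowr[OF t, of q] U_epowr[OF t, of "- q"] by (simp add: divide_ennreal_def epowr_minus)
  show ?thesis
  proof (rule antisym)
    show "(SUP x\<in>{0<..}. N1 x * ennreal (x powr - q)) \<le> (SUP t\<in>II. cumul w (ennreal t) / cumul u (ennreal t) epowr q)"
    proof (rule SUP_least)
      fix x :: real assume "x \<in> {0<..}"
      then have x: "0 < x" by simp
      have "\<exists>t\<in>II. U t \<le> x"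
        by (rule below_M[OF x]) (use II_nonempty less_imp_le in \<open>blast+\<close>)
      then obtain t where t: "t \<in> II" "U t \<le> x" by blast
      have "N1 x * ennreal (x powr - q) \<le> G.S1 (U t)"
        unfolding N1[OF x] G.S1_def using t by (intro SUP_subset_mono) auto
      also have "\<dots> \<le> (SUP t\<in>II. cumul w (ennreal t) * ennreal (U t powr - q))"
        unfolding S1_U[OF t(1)] using ivalD(1)[OF t(1)] by (intro SUP_subset_mono) (auto simp: ival_def)
      also have "\<dots> = (SUP t\<in>II. cumul w (ennreal t) / cumul u (ennreal t) epowr q)"
        by (intro SUP_cong refl W[symmetric])
      finally show "N1 x * ennreal (x powr - q) \<le> \<dots>" .
    qed
    show "(SUP t\<in>II. cumul w (ennreal t) / cumul u (ennreal t) epowr q) \<le> (SUP x\<in>{0<..}. N1 x * ennreal (x powr - q))"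
    proof (rule SUP_least)
      fix t assume t: "t \<in> II"
      have "cumul w (ennreal t) / cumul u (ennreal t) epowr q \<le> G.S1 (U t)"
        unfolding W[OF t] unfolding cumul_w[OF t] G.S1_def by (rule SUP_upper) simp
      also have "\<dots> = N1 (U t) * ennreal (U t powr - q)" using N1[OF U_pos[OF t]] by simp
      also have "\<dots> \<le> (SUP x\<in>{0<..}. N1 x * ennreal (x powr - q))" by (rule SUP_upper) (use U_pos[OF t] in simp)
      finally show "cumul w (ennreal t) / cumul u (ennreal t) epowr q \<le> (SUP x\<in>{0<..}. N1 x * ennreal (x powr - q))" .
    qed
  qed
qed

text \<open>\<open>N1\<close> is x^q S1, the equivalent of \<open>Nq\<close> for q \<ge> 1. Its
  power \<rho> contributes the exponent pq/(p-q) of U outside the supremum and the exponents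
  -pq/(p-q) and p/(p-q) inside.\<close>

lemma A2_eq: "A2 p q L u v w = G.Jn N1 epowr G.es + G.B0 N1 + G.B1"
proof -
  have qr: "p * q / (p - q) = q * G.\<rho>" "p / (p - q) = G.\<rho>" by (simp_all add: G.\<rho>_def)
  have "G.Jn N1 = (\<integral>\<^sup>+t\<in>II.
        (cumul v (ennreal t) * tail_int p L u v t
          * cumul u (ennreal t) epowr (p * q / (p - q) + p - 1) * ennreal (u t)
          * (SUP \<tau>\<in>{\<tau>. t \<le> \<tau> \<and> ennreal \<tau> < L}.
               cumul u (ennreal \<tau>) epowr (- (p * q / (p - q))) * cumul w (ennreal \<tau>) epowr (p / (p - q))))
        / fund p L u v t epowr (q / (p - q) + 2) \<partial>lebesgue)"
    unfolding Jn_eq[OF N1_measurable]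
  proof (intro nn_integral_cong)
    fix t
    show "N1 (U t) epowr G.\<rho> * ennreal (G.mq (U t)) * ennreal (u t) * indicator II t =
        (cumul v (ennreal t) * tail_int p L u v t
          * cumul u (ennreal t) epowr (p * q / (p - q) + p - 1) * ennreal (u t)
          * (SUP \<tau>\<in>{\<tau>. t \<le> \<tau> \<and> ennreal \<tau> < L}.
               cumul u (ennreal \<tau>) epowr (- (p * q / (p - q))) * cumul w (ennreal \<tau>) epowr (p / (p - q))))
        / fund p L u v t epowr (q / (p - q) + 2) * indicator II t"
    proof (cases "t \<in> II")
      case t: True
      have "(SUP \<tau>\<in>{\<tau>. t \<le> \<tau> \<and> ennreal \<tau> < L}.
            cumul u (ennreal \<tau>) epowr (- (p * q / (p - q))) * cumul w (ennreal \<tau>) epowr (p / (p - q))) =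
          (SUP \<tau>\<in>{\<tau>. t \<le> \<tau> \<and> ennreal \<tau> < L}. (cumul w (ennreal \<tau>) * ennreal (U \<tau> powr - q)) epowr G.\<rho>)"
      proof (intro SUP_cong refl)
        fix s assume "s \<in> {\<tau>. t \<le> \<tau> \<and> ennreal \<tau> < L}"
        then have s: "s \<in> II" using ivalD(1)[OF t] by (auto simp: ival_def)
        show "cumul u (ennreal s) epowr (- (p * q / (p - q))) * cumul w (ennreal s) epowr (p / (p - q)) =
            (cumul w (ennreal s) * ennreal (U s powr - q)) epowr G.\<rho>"
          unfolding qr using U_pos[OF s] G.\<rho>_pos by (simp add: U_epowr[OF s] epowr_mult epowr_ennreal powr_powr mult.commute)
      qed
      also have "\<dots> = G.S1 (U t) epowr G.\<rho>" unfolding S1_U[OF t] using G.\<rho>_pos by (simp add: epowr_SUP)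
      finally have S: "(SUP \<tau>\<in>{\<tau>. t \<le> \<tau> \<and> ennreal \<tau> < L}.
            cumul u (ennreal \<tau>) epowr (- (p * q / (p - q))) * cumul w (ennreal \<tau>) epowr (p / (p - q))) = G.S1 (U t) epowr G.\<rho>" .
      have N: "N1 (U t) epowr G.\<rho> = ennreal (U t powr (q * G.\<rho>)) * G.S1 (U t) epowr G.\<rho>"
        using G.\<rho>_pos U_pos[OF t] by (simp add: N1_def epowr_mult epowr_ennreal powr_powr)
      have "U t powr (p * q / (p - q) + p - 1) = U t powr (q * G.\<rho>) * U t powr (p - 1)"
        unfolding qr by (simp add: add_diff_eq flip: powr_add)
      then have P: "cumul u (ennreal t) epowr (p * q / (p - q) + p - 1) = ennreal (U t powr (q * G.\<rho>)) * cumul u (ennreal t) epowr (p - 1)"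
        by (simp add: U_epowr[OF t] flip: ennreal_mult)
      show ?thesis unfolding S N P mq_U[OF t] by (simp only: divide_ennreal_def mult_ac)
    qed simp
  qed
  then show ?thesis
    by (simp add: A2_def G.es_def G.B0_def G.B1_def Lim_bb Lim_sg SUP_N1 om_UNIV)
qed

lemma A2_le: "1 \<le> q \<Longrightarrow> A2 p q L u v w \<le> ennreal (G.Ka (1 + 2 * q)) * G.Dq epowr (1 / q)"
  unfolding A2_eq
proof (rule G.terms_le_Dq)
  fix x :: real assume x: "0 < x"
  have "N1 x \<le> 1 * G.Nq x" unfolding N1_def using G.Nq_ge_S1[OF x] by simp
  also have "\<dots> \<le> ennreal (1 + 2 * q) * G.Nq x" using q by (intro mult_right_mono) (auto simp flip: ennreal_1 intro!: ennreal_leI)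
  finally show "N1 x \<le> ennreal (1 + 2 * q) * G.Nq x" .
qed (use q in simp)

lemma Dq_le_A2: "1 \<le> q \<Longrightarrow> G.Dq epowr (1 / q) \<le> ennreal (G.Kb (1 + 2 * q)) * A2 p q L u v w"
  unfolding A2_eq
proof (rule G.Dq_le_terms)
  fix x :: real assume "1 \<le> q" "0 < x"
  then show "G.Nq x \<le> ennreal (1 + 2 * q) * N1 x" unfolding N1_def by (rule G.Nq_le_S1)
qed (use q in auto)

end

section \<open>The integral characterization for q < p with q < 1\<close>

locale weights_less_lt1 = weights_less + weights_lt1
begin

lemma Nb_U:
  assumes t: "t \<in> II"
  shows "(cumul w (ennreal t) epowr (1 / (1 - q)) + cumul u (ennreal t) epowr (q / (1 - q)) * tail_W q L u w t)
      epowr (p * (1 - q) / (p - q)) = G.Nb (U t) epowr G.\<rho>"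
  using q1 G.\<rho>_pos
  by (simp add: G.Nb_def epowr_epowr Om_U[OF t] tail_W_eq[OF t] U_epowr[OF t] G.beta(2) G.\<rho>_def G.\<beta>_def[symmetric] mult.commute)

lemma I1_le: "0 < x \<Longrightarrow> G.I1 x \<le> tail_W q L u w 0"
  unfolding tail_W_0 G.I1_def by (intro nn_integral_mono mult_left_mono) (auto simp: indicator_def)

text \<open>On (0,x) the factor s^(-\<beta>) is at least x^(-\<beta>), so \<open>cdf_powr_le\<close>
  bounds x^(-\<beta>) times the power 1 + \<beta> of Om x by the full integral; the power 1 - q
  turns the constant 2^(1+\<beta>) into 2. Thus the first summand of \<open>Nb\<close> is absorbed
  into the boundary term at 0.\<close>

lemma Om_le:
  assumes x: "0 < x"
  shows "G.Om x * ennreal (x powr - q) \<le> ennreal 2 * tail_W q L u w 0 epowr (1 - q)"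
proof -
  let ?b = "G.\<beta>"
  note b = G.beta
  have mb: "(\<lambda>s. G.Om s epowr ?b) \<in> borel_measurable borel"
    using b by (intro mono_ennreal_borel monoI epowr_mono G.Om_mono) auto
  have zero: "emeasure \<omega> {..<0} = 0"
  proof -
    have "emeasure \<omega> {..<0} \<le> emeasure \<omega> {..0}" by (intro emeasure_mono) auto
    then show ?thesis by (simp add: G.om_nonpos)
  qed
  have "ennreal (x powr - ?b) * G.Om x epowr (1 + ?b)
      \<le> ennreal (x powr - ?b) * (ennreal (2 powr (1 + ?b)) * (\<integral>\<^sup>+s\<in>{..<x}. G.Om s epowr ?b \<partial>\<omega>))"
    unfolding G.Om_def using b
    by (intro mult_left_mono cdf_powr_le[OF sets_push G.om_fin G.om_atom zero]) auto
  also have "\<dots> = ennreal (2 powr (1 + ?b)) * (ennreal (x powr - ?b) * (\<integral>\<^sup>+s\<in>{..<x}. G.Om s epowr ?b \<partial>\<omega>))"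
    by (simp only: mult_ac)
  also have "ennreal (x powr - ?b) * (\<integral>\<^sup>+s\<in>{..<x}. G.Om s epowr ?b \<partial>\<omega>) \<le> tail_W q L u w 0"
  proof -
    have "ennreal (x powr - ?b) * (\<integral>\<^sup>+s\<in>{..<x}. G.Om s epowr ?b \<partial>\<omega>)
        = (\<integral>\<^sup>+s. ennreal (x powr - ?b) * (G.Om s epowr ?b * indicator {..<x} s) \<partial>\<omega>)"
      by (intro nn_integral_cmult[symmetric] meas_push borel_measurable_times_ennreal mb) auto
    also have "\<dots> \<le> tail_W q L u w 0"
      unfolding tail_W_0
    proof (rule nn_integral_mono)
      fix s
      show "ennreal (x powr - ?b) * (G.Om s epowr ?b * indicator {..<x} s)
          \<le> G.Om s epowr ?b * ennreal (s powr - ?b) * indicator {0<..} s"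
      proof (cases "0 < s \<and> s < x")
        case True
        then have "ennreal (x powr - ?b) \<le> ennreal (s powr - ?b)"
          using b by (intro ennreal_leI powr_mono2') auto
        then have "ennreal (x powr - ?b) * G.Om s epowr ?b \<le> ennreal (s powr - ?b) * G.Om s epowr ?b"
            by (rule mult_right_mono) simp
          then show ?thesis using True by (simp add: mult.commute)
      next
        case False
        have "G.Om s = 0" if "s \<le> 0"
        proof -
          have "G.Om s \<le> emeasure \<omega> {..0}" unfolding G.Om_def using that by (intro emeasure_mono) auto
          then show ?thesis by (simp add: G.om_nonpos)
        qed
        then show ?thesis using False b by (cases "s \<le> 0") auto
      qed
    qed
    finally show ?thesis .
  qed
  finally have "ennreal (x powr - ?b) * G.Om x epowr (1 + ?b) \<le> ennreal (2 powr (1 + ?b)) * tail_W q L u w 0"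
    by (simp add: mult_left_mono)
  then have "(ennreal (x powr - ?b) * G.Om x epowr (1 + ?b)) epowr (1 - q) \<le> (ennreal (2 powr (1 + ?b)) * tail_W q L u w 0) epowr (1 - q)"
    using q1 by (intro epowr_mono) auto
  then show ?thesis using x q1 b
    by (simp add: epowr_mult epowr_epowr epowr_ennreal powr_powr mult.commute)
qed

text \<open>The boundary term at 0 in \<open>A4\<close> contains an integral over all of (0,L),
  \<open>B0\<close> the supremum of Nb x / x^q; the tails I1 x exhaust the former as x tends to 0.
  The 6 is 2 (2 + 1), from \<open>Nb_parts\<close> and \<open>Om_le\<close>.\<close>

lemma SUP_Nb:
  shows "tail_W q L u w 0 epowr (1 - q) \<le> (SUP x\<in>{0<..}. G.Nb x * ennreal (x powr - q))"
    and "(SUP x\<in>{0<..}. G.Nb x * ennreal (x powr - q)) \<le> ennreal 6 * tail_W q L u w 0 epowr (1 - q)"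
proof -
  let ?I = "tail_W q L u w 0" and ?S = "SUP x\<in>{0<..}. G.Nb x * ennreal (x powr - q)"
  have c: "ennreal (x powr q) * A * ennreal (x powr - q) = A" if "0 < x" for x A
  proof -
    have "ennreal (x powr q) * ennreal (x powr - q) = 1"
      using that by (simp add: powr_minus flip: ennreal_mult)
    moreover have "ennreal (x powr q) * A * ennreal (x powr - q) = (ennreal (x powr q) * ennreal (x powr - q)) * A"
      by (simp only: mult_ac)
    ultimately show ?thesis by simp
  qed
  have mb: "(\<lambda>s. G.Om s epowr G.\<beta> * ennreal (s powr - G.\<beta>)) \<in> borel_measurable borel"
    using G.beta by (intro borel_measurable_times_ennreal mono_ennreal_borel[of "\<lambda>s. G.Om s epowr G.\<beta>"] monoI epowr_mono G.Om_mono) auto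
  have "?I \<le> ?S epowr (1 / (1 - q))"
    unfolding tail_W_0
  proof (rule nn_integral_Ioi_le[OF sets_push mb])
    fix a z :: real assume a: "0 < a" "a \<le> z"
    have "G.I1 a epowr (1 - q) = ennreal (a powr q) * G.I1 a epowr (1 - q) * ennreal (a powr - q)" using c[OF a(1)] by simp
    also have "\<dots> \<le> G.Nb a * ennreal (a powr - q)" by (intro mult_right_mono G.Nb_parts a) auto
    also have "\<dots> \<le> ?S" by (rule SUP_upper) (use a in simp)
    finally have "G.I1 a \<le> ?S epowr (1 / (1 - q))" using q1 epowr_le_swap[of "1 - q"] by simp
    moreover have "(\<integral>\<^sup>+x\<in>{a<..z}. G.Om x epowr G.\<beta> * ennreal (x powr - G.\<beta>) \<partial>\<omega>) \<le> G.I1 a"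
      unfolding G.I1_def by (intro nn_integral_mono mult_left_mono) (auto simp: indicator_def)
    ultimately show "(\<integral>\<^sup>+x\<in>{a<..z}. G.Om x epowr G.\<beta> * ennreal (x powr - G.\<beta>) \<partial>\<omega>) \<le> ?S epowr (1 / (1 - q))"
      by (rule order_trans[rotated])
  qed
  then show "?I epowr (1 - q) \<le> ?S" using q1 epowr_le_swap[of "1 - q"] by simp
  show "?S \<le> ennreal 6 * ?I epowr (1 - q)"
  proof (rule SUP_least)
    fix x :: real assume "x \<in> {0<..}"
    then have x: "0 < x" by simp
    have "G.Nb x * ennreal (x powr - q) \<le> ennreal 2 * (G.Om x + ennreal (x powr q) * G.I1 x epowr (1 - q)) * ennreal (x powr - q)"
      by (intro mult_right_mono G.Nb_parts x) auto
    also have "\<dots> = ennreal 2 * (G.Om x * ennreal (x powr - q) + G.I1 x epowr (1 - q))"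
      by (simp only: mult.assoc distrib_right c[OF x, unfolded mult.assoc])
    also have "\<dots> \<le> ennreal 2 * (ennreal 2 * ?I epowr (1 - q) + ennreal 1 * ?I epowr (1 - q))"
      using q1 I1_le[OF x] by (intro mult_left_mono add_mono Om_le x) (auto intro: epowr_mono)
    also have "\<dots> = (ennreal 2 * (ennreal 2 + ennreal 1)) * ?I epowr (1 - q)"
      by (simp only: distrib_right mult.assoc)
    also have "ennreal 2 * (ennreal 2 + ennreal 1) = ennreal 6"
      by (simp flip: ennreal_plus ennreal_mult del: ennreal_numeral ennreal_1)
    finally show "G.Nb x * ennreal (x powr - q) \<le> ennreal 6 * ?I epowr (1 - q)" .
  qed
qed

definition T1 where "T1 = (INF x\<in>{0<..}. ennreal (G.bb x)) epowr (1 / p) * tail_W q L u w 0 epowr ((1 - q) / q)"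
definition T2 where "T2 = (INF x\<in>{0<..}. ennreal (1 / G.sg x)) epowr (1 / p) * Wi (q / (1 - q)) epowr ((1 - q) / q)"

lemma A4_eq: "A4 p q L u v w = T1 + T2 + G.Jn G.Nb epowr G.es"
proof -
  have "G.Jn G.Nb = (\<integral>\<^sup>+t\<in>II.
          (cumul w (ennreal t) epowr (1 / (1 - q))
             + cumul u (ennreal t) epowr (q / (1 - q)) * tail_W q L u w t)
            epowr (p * (1 - q) / (p - q))
          / fund p L u v t epowr (q / (p - q) + 2)
          * (cumul v (ennreal t) * cumul u (ennreal t) epowr (p - 1) * ennreal (u t)
             * tail_int p L u v t) \<partial>lebesgue)"
    unfolding Jn_eq[OF G.Nb_measurable]
  proof (intro nn_integral_cong)
    fix t
    show "G.Nb (U t) epowr G.\<rho> * ennreal (G.mq (U t)) * ennreal (u t) * indicator II t =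
          (cumul w (ennreal t) epowr (1 / (1 - q))
             + cumul u (ennreal t) epowr (q / (1 - q)) * tail_W q L u w t)
            epowr (p * (1 - q) / (p - q))
          / fund p L u v t epowr (q / (p - q) + 2)
          * (cumul v (ennreal t) * cumul u (ennreal t) epowr (p - 1) * ennreal (u t)
             * tail_int p L u v t) * indicator II t"
    proof (cases "t \<in> II")
      case t: True
      show ?thesis unfolding Nb_U[OF t] mq_U[OF t] by (simp only: divide_ennreal_def mult_ac)
    qed simp
  qed
  then show ?thesis
    by (simp add: A4_def G.es_def T1_def T2_def Lim_bb Lim_sg Wi_def)
qed

lemma T1_B0: "T1 \<le> G.B0 G.Nb" "G.B0 G.Nb \<le> ennreal (6 powr (1 / q)) * T1"
proof -
  have e: "tail_W q L u w 0 epowr ((1 - q) / q) = (tail_W q L u w 0 epowr (1 - q)) epowr (1 / q)"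
    using q q1 by (simp add: epowr_epowr)
  show "T1 \<le> G.B0 G.Nb"
    unfolding T1_def G.B0_def e using q by (intro mult_left_mono epowr_mono SUP_Nb) auto
  have "(SUP x\<in>{0<..}. G.Nb x * ennreal (x powr - q)) epowr (1 / q) \<le> (ennreal 6 * tail_W q L u w 0 epowr (1 - q)) epowr (1 / q)"
    using q by (intro epowr_mono SUP_Nb) auto
  also have "\<dots> = ennreal (6 powr (1 / q)) * tail_W q L u w 0 epowr ((1 - q) / q)"
    unfolding e using q by (simp add: epowr_mult epowr_ennreal del: ennreal_numeral)
  finally show "G.B0 G.Nb \<le> ennreal (6 powr (1 / q)) * T1"
    unfolding G.B0_def T1_def by (subst mult.left_commute) (rule mult_left_mono, auto)
qed

text \<open>\<open>Wi_le\<close> and \<open>Wi_ge\<close> raised to the power (1-q)/q, since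
  (1+\<beta>)(1-q)/q = 1/q.\<close>

lemma T2_B1: "T2 \<le> G.B1" "G.B1 \<le> ennreal (2 powr (1 / q)) * T2"
proof -
  note b = G.beta
  have be: "q / (1 - q) = G.\<beta>" by (simp add: G.\<beta>_def)
  have qe: "0 < (1 - q) / q" "(1 + G.\<beta>) * ((1 - q) / q) = 1 / q" using q q1 b by (auto simp: field_simps)
  have e: "(cumul w L epowr (1 + G.\<beta>)) epowr ((1 - q) / q) = cumul w L epowr (1 / q)"
    using b qe by (simp add: epowr_epowr)
  have "Wi G.\<beta> epowr ((1 - q) / q) \<le> (cumul w L epowr (1 + G.\<beta>)) epowr ((1 - q) / q)"
    using qe b by (intro epowr_mono Wi_le) auto
  then show "T2 \<le> G.B1" unfolding T2_def G.B1_def be e om_UNIV by (intro mult_left_mono) auto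
  have "(cumul w L epowr (1 + G.\<beta>)) epowr ((1 - q) / q) \<le> (ennreal (2 powr (1 + G.\<beta>)) * Wi G.\<beta>) epowr ((1 - q) / q)"
    using qe b by (intro epowr_mono Wi_ge) auto
  also have "\<dots> = ennreal (2 powr (1 / q)) * Wi G.\<beta> epowr ((1 - q) / q)"
    using qe(1) by (subst epowr_mult) (simp_all only: qe(2) powr_powr epowr_ennreal powr_gt_zero zero_neq_numeral[symmetric] simp_thms)
  finally show "G.B1 \<le> ennreal (2 powr (1 / q)) * T2"
    unfolding G.B1_def T2_def be e om_UNIV by (subst mult.left_commute) (rule mult_left_mono, auto)
qed

lemma A4_le: "A4 p q L u v w \<le> ennreal (G.Ka G.Kn) * G.Dq epowr (1 / q)"
proof -
  have "A4 p q L u v w \<le> G.B0 G.Nb + G.B1 + G.Jn G.Nb epowr G.es"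
    unfolding A4_eq by (intro add_mono T1_B0 T2_B1) auto
  also have "\<dots> = G.Jn G.Nb epowr G.es + G.B0 G.Nb + G.B1" by (simp only: add_ac)
  also have "\<dots> \<le> ennreal (G.Ka G.Kn) * G.Dq epowr (1 / q)"
    by (intro G.terms_le_Dq G.K_nonneg G.Nb_le_Nq)
  finally show ?thesis .
qed

lemma Dq_le_A4: "G.Dq epowr (1 / q) \<le> ennreal (G.Kb G.Kn * 6 powr (1 / q)) * A4 p q L u v w"
proof -
  let ?c = "ennreal (6 powr (1 / q))"
  have "G.Dq epowr (1 / q) \<le> ennreal (G.Kb G.Kn) * (G.Jn G.Nb epowr G.es + G.B0 G.Nb + G.B1)"
    by (intro G.Dq_le_terms G.K_nonneg G.Nq_le_Nb G.Nb_measurable)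
  also have "\<dots> \<le> ennreal (G.Kb G.Kn) * (?c * G.Jn G.Nb epowr G.es + ?c * T1 + ?c * T2)"
  proof (intro mult_left_mono add_mono T1_B0)
    have "1 * G.Jn G.Nb epowr G.es \<le> ?c * G.Jn G.Nb epowr G.es"
      using q by (intro mult_right_mono) (auto simp: ge_one_powr_ge_zero)
    then show "G.Jn G.Nb epowr G.es \<le> ?c * G.Jn G.Nb epowr G.es" by simp
    have "ennreal (2 powr (1 / q)) * T2 \<le> ?c * T2"
      using q by (intro mult_right_mono ennreal_leI powr_mono2) auto
    then show "G.B1 \<le> ?c * T2" using T2_B1(2) by (rule order_trans[rotated])
  qed auto
  also have "\<dots> = ennreal (G.Kb G.Kn) * ?c * A4 p q L u v w"
    unfolding A4_eq by (simp only: distrib_left mult.assoc add_ac)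
  also have "ennreal (G.Kb G.Kn) * ?c = ennreal (G.Kb G.Kn * 6 powr (1 / q))"
    using G.Kb_pos[OF G.K_nonneg(3)] by (simp add: ennreal_mult')
  finally show ?thesis .
qed

end

context weights
begin

context
  assumes degenerate: "\<And>t. t \<in> II \<Longrightarrow> fund p L u v t = top"
begin

lemma Lim_0: "Lim (at_right 0) (\<lambda>t. cumul u (ennreal t) epowr p / fund p L u v t) = 0"
proof -
  have z: "cumul u (ennreal t) epowr p / fund p L u v t = 0" if "t \<in> II" for t
    by (simp add: degenerate[OF that])
  have "Lim (at_right 0) (\<lambda>t. cumul u (ennreal t) epowr p / fund p L u v t) = (INF t\<in>II. cumul u (ennreal t) epowr p / fund p L u v t)"
    by (rule Lim_right_0) (simp add: z)
  also have "\<dots> = (INF t\<in>II. 0)" by (intro INF_cong refl z)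
  also have "\<dots> = 0" using II_nonempty by (subst INF_const) auto
  finally show ?thesis .
qed

lemma Lim_end: "Lim (at_right_end L) (\<lambda>t. 1 / fund p L u v t) = 0"
proof -
  have z: "1 / fund p L u v t = 0" if "t \<in> II" for t
    by (simp add: degenerate[OF that])
  have "Lim (at_right_end L) (\<lambda>t. 1 / fund p L u v t) = (INF t\<in>II. 1 / fund p L u v t)"
    by (rule Lim_right_end) (simp add: z)
  also have "\<dots> = (INF t\<in>II. 0)" by (intro INF_cong refl z)
  also have "\<dots> = 0" using II_nonempty by (subst INF_const) auto
  finally show ?thesis .
qed

text \<open>Quotients by an infinite \<open>fund\<close> are 0, even for an infinite numerator, in
  agreement with the best constant, which is 0 here.\<close>

lemma A1_degenerate: "A1 p q L u v w = 0" and A3_degenerate: "A3 p q L u v w = 0"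
proof -
  have 0: "z / fund p L u v t epowr (1 / p) = 0" if "t \<in> II" for t z
    using p by (simp add: degenerate[OF that])
  show "A1 p q L u v w = 0" "A3 p q L u v w = 0"
    by (simp_all add: A1_def A3_def 0 SUP_constant bot_ennreal)
qed

lemma A2_degenerate: assumes qp: "q < p" shows "A2 p q L u v w = 0"
proof -
  have r: "0 < q / (p - q) + 2" "0 < (p - q) / (p * q)" using q p qp by (auto intro: add_pos_pos)
  have 0: "z / fund p L u v t epowr (q / (p - q) + 2) * indicator II t = 0" for t z
    using r by (cases "t \<in> II") (simp_all add: degenerate)
  show ?thesis unfolding A2_def Lim_0 Lim_end 0 using r p by simp
qed

lemma A4_degenerate: assumes qp: "q < p" shows "A4 p q L u v w = 0"
proof -
  have r: "0 < q / (p - q) + 2" "0 < (p - q) / (p * q)" using q p qp by (auto intro: add_pos_pos)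
  have 0: "z / fund p L u v t epowr (q / (p - q) + 2) * y * indicator II t = 0" for t z y
    using r by (cases "t \<in> II") (simp_all add: degenerate)
  show ?thesis unfolding A4_def Lim_0 Lim_end 0 using r p by simp
qed

end

end

section \<open>One constant for all carrier types\<close>

lemma sigma_finite_lebesgue: "sigma_finite_measure (lebesgue :: real measure)"
proof
  show "\<exists>A. countable A \<and> A \<subseteq> sets (lebesgue :: real measure) \<and> \<Union> A = space lebesgue \<and> (\<forall>a\<in>A. emeasure lebesgue a \<noteq> \<infinity>)"
  proof (intro exI[of _ "range (\<lambda>n. {- real n..real n})"] conjI ballI)
    have "\<exists>n. x \<in> {- real n..real n}" for x
      using real_arch_simple[of "\<bar>x\<bar>"] by (auto simp: abs_le_iff minus_le_iff)
    then show "(\<Union>n. {- real n..real n}) = space lebesgue" by auto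
  qed auto
qed

lemma approx_withI:
  assumes A: "A \<le> ennreal a * D" and D: "D \<le> ennreal b * A"
  shows "approx_with (max 1 (max a b)) D A"
proof -
  define c where "c = max 1 (max a b)"
  have c: "0 < c" "a \<le> c" "b \<le> c" by (auto simp: c_def)
  have "ennreal (1 / c) * D \<le> ennreal (1 / c) * (ennreal c * A)"
    by (intro mult_left_mono order_trans[OF D] mult_right_mono ennreal_leI c) auto
  also have "\<dots> = A" using c by (simp add: mult.assoc[symmetric] flip: ennreal_mult)
  finally have "ennreal (1 / c) * D \<le> A" .
  moreover have "A \<le> ennreal c * D"
    by (intro order_trans[OF A] mult_right_mono ennreal_leI c) auto
  ultimately show ?thesis using c(1) by (simp add: approx_with_def c_def[symmetric])
qed

text \<open>By \<open>best_const_eq\<close> the best constant is the same for a space of measure L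
  on any type and for (0,L) with Lebesgue measure, which is carried by the reals; so a constant
  valid for the reals is valid for every type. The regimes are kept apart because in two of them
  both sides are 0, or both infinite.\<close>

lemma uniformly_equivalentI:
  assumes p: "0 < p" and q: "0 < q"
    and degenerate: "\<And>L u v w. weights L u p q v w \<Longrightarrow> (\<And>t. t \<in> ival 0 L \<Longrightarrow> fund p L u v t = top) \<Longrightarrow> A p q L u v w = 0"
    and infinite: "\<And>L u v w. weights_fin L u p q v w \<Longrightarrow> cumul w L = top \<Longrightarrow> cumul u L \<noteq> top \<Longrightarrow> A p q L u v w = top"
    and good: "\<And>L u v w. weights_good L u p q v w \<Longrightarrow> A p q L u v w \<le> ennreal a * Dfun L p q u v w epowr (1 / q)"
      "\<And>L u v w. weights_good L u p q v w \<Longrightarrow> Dfun L p q u v w epowr (1 / q) \<le> ennreal b * A p q L u v w"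
  shows "uniformly_equivalent TYPE('a) p q A"
proof -
  have W: "weights L u p q v w"
    if "0 < L" "weight L u" "AE s in lebesgue_on (ival 0 L). 0 < u s" "weight L v" "weight L w" for L u v w
    using that p q by (simp add: weights_def weight_change_def weights_axioms_def)
  have key: "approx_with (max 1 (max a b)) (Dfun L p q u v w epowr (1 / q)) (A p q L u v w)"
    if w: "weights L u p q v w" for L u v w
  proof (cases "\<forall>t\<in>ival 0 L. fund p L u v t = top")
    case True
    then have "Dfun L p q u v w = 0" "A p q L u v w = 0"
      using weights.Dfun_degenerate[OF w] degenerate[OF w] by auto
    then show ?thesis using q by (simp add: approx_with_def)
  next
    case False
    then have w': "weights_fin L u p q v w" using w by (simp add: weights_fin_def weights_fin_axioms_def)
    show ?thesis
    proof (cases "cumul w L = top \<and> cumul u L \<noteq> top")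
      case True
      then have "Dfun L p q u v w = top" "A p q L u v w = top"
        using weights_fin.Dfun_eq_Dq[OF w'] weights_fin.Dq_bad[OF w'] infinite[OF w'] by auto
      then show ?thesis using q by (auto simp: approx_with_def ennreal_mult_top)
    next
      case False
      then have "weights_good L u p q v w" using w' by (auto simp: weights_good_def weights_good_axioms_def)
      then show ?thesis by (intro approx_withI good)
    qed
  qed
  have eq: "best_const M p q u v w = Dfun L p q u v w epowr (1 / q)"
    if "sigma_finite_measure M" "nonatomic M" "emeasure M (space M) = L" "weight L w" for M :: "'b measure" and L u v w
    using that p q by (intro best_const_eq) (auto simp: weight_def)
  \<comment> \<open>The representative of M on the reals has exactly the same best constant, so the
    equivalence constant is carried over unchanged.\<close>
  have real: "best_const M p q u v w = best_const (lebesgue_on (ival 0 L)) p q u v w"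
      "sigma_finite_measure (lebesgue_on (ival 0 L))" "nonatomic (lebesgue_on (ival 0 L))"
      "emeasure (lebesgue_on (ival 0 L)) (space (lebesgue_on (ival 0 L))) = L"
    if M: "sigma_finite_measure M" "nonatomic M" "emeasure M (space M) = L" "weight L w" for M :: "'a measure" and L u v w
  proof -
    show sf: "sigma_finite_measure (lebesgue_on (ival 0 L))"
      by (rule sigma_finite_measure_restrict_space) (auto intro: sigma_finite_lebesgue)
    show na: "nonatomic (lebesgue_on (ival 0 L))" by (rule nonatomic_lebesgue_on) simp
    show em: "emeasure (lebesgue_on (ival 0 L)) (space (lebesgue_on (ival 0 L))) = L"
      by (simp add: emeasure_restrict_space emeasure_ival)
    show "best_const M p q u v w = best_const (lebesgue_on (ival 0 L)) p q u v w"
      using M p q by (simp add: best_const_eq[OF sf na em] best_const_eq[OF M(1-3)] weight_def)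
  qed
  show ?thesis
    unfolding uniformly_equivalent_def
  proof (intro conjI allI impI)
    have "equivalence_constant TYPE(real) p q A (max 1 (max a b))"
      unfolding equivalence_constant_def using p q
      by (auto simp: best_const_eq weight_def intro!: key W)
    then show "\<exists>c. equivalence_constant TYPE(real) p q A c" ..
  next
    fix c assume "equivalence_constant TYPE(real) p q A c"
    then have "0 < c" and c: "\<And>L u v w. 0 < L \<Longrightarrow> sigma_finite_measure (lebesgue_on (ival 0 L)) \<Longrightarrow> nonatomic (lebesgue_on (ival 0 L)) \<Longrightarrow>
        emeasure (lebesgue_on (ival 0 L)) (space (lebesgue_on (ival 0 L))) = L \<Longrightarrow>
        weight L u \<Longrightarrow> AE s in lebesgue_on (ival 0 L). 0 < u s \<Longrightarrow> weight L v \<Longrightarrow> weight L w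
        \<Longrightarrow> approx_with c (best_const (lebesgue_on (ival 0 L)) p q u v w) (A p q L u v w)"
      unfolding equivalence_constant_def by blast+
    show "equivalence_constant TYPE('a) p q A c"
      unfolding equivalence_constant_def
    proof (intro conjI allI impI \<open>0 < c\<close>, elim conjE)
      fix M :: "'a measure" and L u v w
      assume *: "0 < L" "sigma_finite_measure M" "nonatomic M" "emeasure M (space M) = L"
        "weight L u" "AE s in lebesgue_on (ival 0 L). 0 < u s" "weight L v" "weight L w"
      note r = real[OF *(2-4,8)]
      show "approx_with c (best_const M p q u v w) (A p q L u v w)"
        unfolding r(1) by (rule c[OF *(1) r(2-4) *(5-8)])
    qed
  qed
qed

lemma weights_good_Dfun: "weights_good L u p q v w \<Longrightarrow> Dfun L p q u v w = gamma_data.Dq p q (weight_change.push L u v) (weight_change.push L u w)"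
  by (rule weights_fin.Dfun_eq_Dq) (simp add: weights_good_def)

theorem theorem4p1:
  fixes p q :: real
  assumes "0 < p" and "0 < q"
  shows "(1 \<le> q \<and> p \<le> q \<longrightarrow> uniformly_equivalent TYPE('a) p q A1) \<and>
         (1 \<le> q \<and> q < p \<longrightarrow> uniformly_equivalent TYPE('a) p q A2) \<and>
         (p \<le> q \<and> q < 1 \<longrightarrow> uniformly_equivalent TYPE('a) p q A3) \<and>
         (q < 1 \<and> q < p \<longrightarrow> uniformly_equivalent TYPE('a) p q A4)"
proof (intro conjI impI)
  assume pq: "1 \<le> q \<and> p \<le> q"
  show "uniformly_equivalent TYPE('a) p q A1"
  proof (rule uniformly_equivalentI[OF assms weights.A1_degenerate weights_fin.A1_bad])
    fix L u v w assume g: "weights_good L u p q v w"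
    then have f: "weights_fin L u p q v w" by (simp add: weights_good_def)
    show "A1 p q L u v w \<le> ennreal 1 * Dfun L p q u v w epowr (1 / q)"
      using weights_fin.A1_le[OF f] by (simp add: weights_good_Dfun[OF g])
    show "Dfun L p q u v w epowr (1 / q) \<le> ennreal ((10 * 4 powr (q / p) * (1 + 2 * q)) powr (1 / q)) * A1 p q L u v w"
      unfolding weights_good_Dfun[OF g] using pq by (intro weights_good.Dq_le_A1[OF g]) auto
  qed
next
  assume pq: "1 \<le> q \<and> q < p"
  show "uniformly_equivalent TYPE('a) p q A2"
  proof (rule uniformly_equivalentI[OF assms weights.A2_degenerate weights_fin.A2_bad])
    fix L u v w assume g: "weights_good L u p q v w"
    with pq have l: "weights_less L u p q v w" by (simp add: weights_less_def weights_less_axioms_def)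
    show "A2 p q L u v w \<le> ennreal (gamma_data_less.Ka p q (1 + 2 * q)) * Dfun L p q u v w epowr (1 / q)"
      unfolding weights_good_Dfun[OF g] using pq by (intro weights_less.A2_le[OF l]) auto
    show "Dfun L p q u v w epowr (1 / q) \<le> ennreal (gamma_data_less.Kb p q (1 + 2 * q)) * A2 p q L u v w"
      unfolding weights_good_Dfun[OF g] using pq by (intro weights_less.Dq_le_A2[OF l]) auto
  qed (use pq in auto)
next
  assume pq: "p \<le> q \<and> q < 1"
  show "uniformly_equivalent TYPE('a) p q A3"
  proof (rule uniformly_equivalentI[OF assms weights.A3_degenerate])
    show "A3 p q L u v w = top" if "weights_fin L u p q v w" "cumul w L = top" "cumul u L \<noteq> top" for L u v w
      using weights_fin.A1_bad[OF that] weights_fin.A1_le_A3[OF that(1)] by (simp add: top_unique)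
    fix L u v w assume g: "weights_good L u p q v w"
    with pq have l: "weights_lt1 L u p q v w" by (simp add: weights_lt1_def weights_lt1_axioms_def)
    show "A3 p q L u v w \<le> ennreal (1 + gamma_finite_lt1.Kv q powr (1 / q)) * Dfun L p q u v w epowr (1 / q)"
      unfolding weights_good_Dfun[OF g] by (rule weights_lt1.A3_le[OF l])
    show "Dfun L p q u v w epowr (1 / q) \<le> ennreal ((10 * 4 powr (q / p) * (4 * gamma_finite_lt1.Kn q)) powr (1 / q)) * A3 p q L u v w"
      unfolding weights_good_Dfun[OF g] using pq by (intro weights_lt1.Dq_le_A3[OF l]) auto
  qed
next
  assume pq: "q < 1 \<and> q < p"
  show "uniformly_equivalent TYPE('a) p q A4"
  proof (rule uniformly_equivalentI[OF assms weights.A4_degenerate weights_fin.A4_bad])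
    fix L u v w assume g: "weights_good L u p q v w"
    with pq have l: "weights_less_lt1 L u p q v w"
      by (simp add: weights_less_lt1_def weights_less_def weights_less_axioms_def weights_lt1_def weights_lt1_axioms_def)
    show "A4 p q L u v w \<le> ennreal (gamma_data_less.Ka p q (gamma_finite_lt1.Kn q)) * Dfun L p q u v w epowr (1 / q)"
      unfolding weights_good_Dfun[OF g] by (rule weights_less_lt1.A4_le[OF l])
    show "Dfun L p q u v w epowr (1 / q) \<le> ennreal (gamma_data_less.Kb p q (gamma_finite_lt1.Kn q) * 6 powr (1 / q)) * A4 p q L u v w"
      unfolding weights_good_Dfun[OF g] by (rule weights_less_lt1.Dq_le_A4[OF l])
  qed (use pq in auto)
qed

end
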